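(* Let $\mathfrak g$ be a simple Lie algebra, $(G,H)$ a symmetric pair with $H/L\to G/K$ a holomorphic immersion, and $V_\tau^G$ a holomorphic discrete series of $G$. Then every symmetry breaking operator from $V_\tau^G$ onto a holomorphic discrete series $V_\sigma^H$ of $H$ is represented by a homogeneous differential operator.
   Context: Setting. $G$ is a connected, simple, noncompact matrix Lie group with maximal compact subgroup $K$ and Cartan involution $\theta$; $G/K$ carries a $G$-invariant complex structure (bounded symmetric domain). $\iota$ is an involution of $G$ commuting with $\theta$, with $\iota\neq \mathrm{id}$ and $\iota\neq\theta$; $H=(G^{\iota})_0$, $L=K\cap H$. Write $\mathfrak g=\mathfrak k+\mathfrak p$ (Cartan decomposition) and $\mathfrak p_{\mathbb C}=\mathfrak p^+\oplus\mathfrak p^-$ for the $Ad(K)$-invariant decomposition given by the complex structure ($\mathfrak p^\pm$ abelian). The inclusion $H/L\to G/K$ is holomorphic; as a consequence the center of $\mathfrak k$ is contained in $\mathfrak l$. $V_\tau^G$ is the holomorphic discrete series with lowest $K$-type $(\tau,W)$, realized as a Hilbert space of square integrable smooth sections of $G\times_\tau W\to G/K$; its restriction to $H$ is admissible with irreducible factors holomorphic discrete series $V_\sigma^H$ of lowest $L$-type $(\sigma,Z)$, realized likewise as sections of $H\times_\sigma Z\to H/L$. A symmetry breaking operator is a continuous $H$-intertwining linear map $S:V_\tau^G\to V_\sigma^H$. $S$ is represented by a homogeneous differential operator (of degree $k$) if there are finitely many $c_\alpha\in\mathrm{Hom}_{\mathbb C}(W,Z)$ and $X_\alpha\in S^k(\mathfrak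 p^+)\subset\mathcal U(\mathfrak g_{\mathbb C})$, all of the same degree $k$, with $\sum_\alpha c_\alpha\otimes X_\alpha$ $L$-invariant and $S(f)(h)=\sum_\alpha c_\alpha(R_{X_\alpha}f)(h)$ for all $f\in V_\tau^G$, $h\in H$, where $R$ denotes infinitesimal right derivative (elements of $\mathfrak p^+$ act as holomorphic derivatives). Equivalently, the space $Z_S=\{K_S(\cdot,e)^\star z:z\in Z\}$ of vectors defined by $(Sf(e),z)_Z=\langle f,K_S(\cdot,e)^\star z\rangle$ lies in a single homogeneous component $\mathcal V^{(k)}=\mathrm{span}\{[x_1\cdots x_k\otimes w]:x_i\in\mathfrak p^-,w\in W\}$ of $(V_\tau^G)_{K\text{-fin}}\cong\mathcal U(\mathfrak g)\otimes_{\mathcal U(\mathfrak k_{\mathbb C}+\mathfrak p^+)}W$ ($\mathfrak p^+$ acting by zero on $W$). *)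

theory Defs
  imports "HOL-Analysis.Analysis"
begin

section \<open>Matrix Lie groups and their Lie algebras\<close>

type_synonym 'n cmat = "complex ^ 'n ^ 'n"

(* The multiplication of the type class on vectors is componentwise, so the library's exp does
   not give the matrix exponential. *)
definition matrix_exp :: "'n::finite cmat \<Rightarrow> 'n cmat" where
  "matrix_exp X = (\<Sum>k. (1 / fact k) *\<^sub>R (((**) X ^^ k) (mat 1)))"

definition matrix_subgroup :: "'n::finite cmat set \<Rightarrow> bool" where
  "matrix_subgroup G \<longleftrightarrow> (\<forall>g\<in>G. invertible g) \<and> mat 1 \<in> G \<and>
     (\<forall>g\<in>G. \<forall>h\<in>G. g ** h \<in> G) \<and> (\<forall>g\<in>G. matrix_inv g \<in> G)"

definition matrix_lie_group :: "'n::finite cmat set \<Rightarrow> bool" where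
  "matrix_lie_group G \<longleftrightarrow> matrix_subgroup G \<and>
     closedin (top_of_set {g. invertible g}) G"

definition lie_algebra :: "'n::finite cmat set \<Rightarrow> 'n cmat set" where
  "lie_algebra G = {X. \<forall>t::real. matrix_exp (t *\<^sub>R X) \<in> G}"

definition bracket :: "'n::finite cmat \<Rightarrow> 'n cmat \<Rightarrow> 'n cmat" where
  "bracket X Y = X ** Y - Y ** X"

definition Ad :: "'n::finite cmat \<Rightarrow> 'n cmat \<Rightarrow> 'n cmat" where
  "Ad g X = g ** X ** matrix_inv g"

definition lie_ideal :: "'n::finite cmat set \<Rightarrow> 'n cmat set \<Rightarrow> bool" where
  "lie_ideal I \<gg> \<longleftrightarrow> I \<subseteq> \<gg> \<and> subspace I \<and> (\<forall>X\<in>\<gg>. \<forall>Y\<in>I. bracket X Y \<in> I)"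

definition simple_lie_algebra :: "'n::finite cmat set \<Rightarrow> bool" where
  "simple_lie_algebra \<gg> \<longleftrightarrow> (\<exists>X\<in>\<gg>. \<exists>Y\<in>\<gg>. bracket X Y \<noteq> 0) \<and>
     (\<forall>I. lie_ideal I \<gg> \<longrightarrow> I = {0} \<or> I = \<gg>)"

(* The trace of a linear endomorphism T of the real subspace V; it does not depend on the basis. *)
definition trace_on :: "'a::euclidean_space set \<Rightarrow> ('a \<Rightarrow> 'a) \<Rightarrow> real" where
  "trace_on V T = (let B = (SOME B. independent B \<and> span B = V)
                   in \<Sum>b\<in>B. real_vector.representation B (T b) b)"

definition killing_form :: "'n::finite cmat set \<Rightarrow> 'n cmat \<Rightarrow> 'n cmat \<Rightarrow> real" where
  "killing_form \<gg> X Y = trace_on \<gg> (\<lambda>Z. bracket X (bracket Y Z))"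

section \<open>Involutions and the Cartan decomposition\<close>

(* A continuous homomorphism between matrix Lie groups is automatically smooth. *)
definition group_involution :: "'n::finite cmat set \<Rightarrow> ('n cmat \<Rightarrow> 'n cmat) \<Rightarrow> bool" where
  "group_involution G \<phi> \<longleftrightarrow> (\<forall>g\<in>G. \<phi> g \<in> G) \<and> (\<forall>g\<in>G. \<forall>h\<in>G. \<phi> (g ** h) = \<phi> g ** \<phi> h) \<and>
     continuous_on G \<phi> \<and> (\<forall>g\<in>G. \<phi> (\<phi> g) = g)"

definition fixed_group :: "'n::finite cmat set \<Rightarrow> ('n cmat \<Rightarrow> 'n cmat) \<Rightarrow> 'n cmat set" where
  "fixed_group G \<phi> = {g \<in> G. \<phi> g = g}"

definition identity_component :: "'n::finite cmat set \<Rightarrow> 'n cmat set" where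
  "identity_component G = connected_component_set G (mat 1)"

definition lie_differential :: "('n::finite cmat \<Rightarrow> 'n cmat) \<Rightarrow> 'n cmat \<Rightarrow> 'n cmat" where
  "lie_differential \<phi> X = vector_derivative (\<lambda>t. \<phi> (matrix_exp (t *\<^sub>R X))) (at 0)"

definition cartan_involution :: "'n::finite cmat set \<Rightarrow> ('n cmat \<Rightarrow> 'n cmat) \<Rightarrow> bool" where
  "cartan_involution G \<theta> \<longleftrightarrow> group_involution G \<theta> \<and>
     (\<forall>X\<in>lie_algebra G. X \<noteq> 0 \<longrightarrow> - killing_form (lie_algebra G) X (lie_differential \<theta> X) > 0)"

definition maximal_compact_subgroup :: "'n::finite cmat set \<Rightarrow> 'n cmat set \<Rightarrow> bool" where
  "maximal_compact_subgroup G K \<longleftrightarrow> matrix_subgroup K \<and> compact K \<and> K \<subseteq> G \<and>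
     (\<forall>K'. matrix_subgroup K' \<and> compact K' \<and> K \<subseteq> K' \<and> K' \<subseteq> G \<longrightarrow> K' = K)"

definition cartan_p :: "'n::finite cmat set \<Rightarrow> ('n cmat \<Rightarrow> 'n cmat) \<Rightarrow> 'n cmat set" where
  "cartan_p G \<theta> = {X \<in> lie_algebra G. lie_differential \<theta> X = - X}"

section \<open>Invariant complex structures\<close>

(* A G-invariant almost complex structure on the symmetric space G/K is the same as an
   Ad(K)-invariant one on the tangent space \<pp> at the base point; it is always integrable, because
   [\<pp>,\<pp>] is contained in the Lie algebra of K. *)
definition invariant_complex_structure ::
    "'n::finite cmat set \<Rightarrow> 'n cmat set \<Rightarrow> ('n cmat \<Rightarrow> 'n cmat) \<Rightarrow> bool" where
  "invariant_complex_structure K \<pp> J \<longleftrightarrow>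
     (\<forall>X\<in>\<pp>. J X \<in> \<pp>) \<and>
     (\<forall>X\<in>\<pp>. \<forall>Y\<in>\<pp>. J (X + Y) = J X + J Y) \<and>
     (\<forall>X\<in>\<pp>. \<forall>c::real. J (c *\<^sub>R X) = c *\<^sub>R J X) \<and>
     (\<forall>X\<in>\<pp>. J (J X) = - X) \<and>
     (\<forall>k\<in>K. \<forall>X\<in>\<pp>. J (Ad k X) = Ad k (J X))"

(* For L = K \<inter> H the inclusion H/L \<rightarrow> G/K is an immersion whose differential at the base point is
   the inclusion of \<pp>_H in \<pp>. By H-equivariance it is holomorphic iff this differential intertwines
   the two complex structures. *)
definition holomorphic_inclusion ::
    "'n::finite cmat set \<Rightarrow> ('n cmat \<Rightarrow> 'n cmat) \<Rightarrow> 'n cmat set \<Rightarrow> ('n cmat \<Rightarrow> 'n cmat) \<Rightarrow> bool" where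
  "holomorphic_inclusion \<pp>\<^sub>H J\<^sub>H \<pp> J \<longleftrightarrow> \<pp>\<^sub>H \<subseteq> \<pp> \<and> (\<forall>X\<in>\<pp>\<^sub>H. J X = J\<^sub>H X)"

section \<open>The complexified Lie algebra\<close>

(* The pair (X, Y) stands for X + iY in the abstract complexification. The imaginary unit here is
   not the one in the matrix entries: \<gg> consists of complex matrices but is a real Lie algebra. *)
type_synonym 'n cmatC = "'n cmat \<times> 'n cmat"

definition scaleI :: "'n::finite cmatC \<Rightarrow> 'n cmatC" where
  "scaleI x = (- snd x, fst x)"

definition bracketC :: "'n::finite cmatC \<Rightarrow> 'n cmatC \<Rightarrow> 'n cmatC" where
  "bracketC x y = (bracket (fst x) (fst y) - bracket (snd x) (snd y),
                   bracket (fst x) (snd y) + bracket (snd x) (fst y))"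

definition AdC :: "'n::finite cmat \<Rightarrow> 'n cmatC \<Rightarrow> 'n cmatC" where
  "AdC g x = (Ad g (fst x), Ad g (snd x))"

(* The eigenspaces of the complexification of J for the eigenvalues i and -i. *)
definition p_plus :: "'n::finite cmat set \<Rightarrow> ('n cmat \<Rightarrow> 'n cmat) \<Rightarrow> 'n cmatC set" where
  "p_plus \<pp> J = {x \<in> \<pp> \<times> \<pp>. (J (fst x), J (snd x)) = scaleI x}"

definition p_minus :: "'n::finite cmat set \<Rightarrow> ('n cmat \<Rightarrow> 'n cmat) \<Rightarrow> 'n cmatC set" where
  "p_minus \<pp> J = {x \<in> \<pp> \<times> \<pp>. (J (fst x), J (snd x)) = - scaleI x}"

definition abelian_subset :: "'n::finite cmatC set \<Rightarrow> bool" where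
  "abelian_subset A \<longleftrightarrow> (\<forall>x\<in>A. \<forall>y\<in>A. bracketC x y = 0)"

section \<open>Right derivatives and smooth functions on a matrix Lie group\<close>

definition right_deriv ::
    "'n::finite cmat \<Rightarrow> ('n cmat \<Rightarrow> complex^'w::finite) \<Rightarrow> 'n cmat \<Rightarrow> complex^'w" where
  "right_deriv X f g = vector_derivative (\<lambda>t. f (g ** matrix_exp (t *\<^sub>R X))) (at 0)"

definition right_derivC ::
    "'n::finite cmatC \<Rightarrow> ('n cmat \<Rightarrow> complex^'w::finite) \<Rightarrow> 'n cmat \<Rightarrow> complex^'w" where
  "right_derivC x f g = right_deriv (fst x) f g + \<i> *s right_deriv (snd x) f g"

(* The action of the product x1 ... xk in the enveloping algebra. *)
definition right_deriv_word ::
    "'n::finite cmatC list \<Rightarrow> ('n cmat \<Rightarrow> complex^'w::finite) \<Rightarrow> 'n cmat \<Rightarrow> complex^'w" where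
  "right_deriv_word xs f = foldr right_derivC xs f"

(* C^k via left-invariant vector fields, which trivialize the tangent bundle of G. *)
fun Ck_on_group :: "'n::finite cmat set \<Rightarrow> nat \<Rightarrow> ('n cmat \<Rightarrow> complex^'w::finite) \<Rightarrow> bool" where
  "Ck_on_group G 0 f \<longleftrightarrow> continuous_on G f"
| "Ck_on_group G (Suc k) f \<longleftrightarrow> continuous_on G f \<and>
     (\<forall>X\<in>lie_algebra G.
        (\<forall>g\<in>G. (\<lambda>t. f (g ** matrix_exp (t *\<^sub>R X))) differentiable (at 0)) \<and>
        Ck_on_group G k (right_deriv X f))"

definition smooth_on_group ::
    "'n::finite cmat set \<Rightarrow> ('n cmat \<Rightarrow> complex^'w::finite) \<Rightarrow> bool" where
  "smooth_on_group G f \<longleftrightarrow> (\<forall>k. Ck_on_group G k f)"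

section \<open>Holomorphic discrete series\<close>

(* A finite-dimensional complex Hilbert space is modelled as C^w with its standard inner product. *)
definition unitary_rep ::
    "'n::finite cmat set \<Rightarrow> ('n cmat \<Rightarrow> complex^'w::finite^'w) \<Rightarrow> bool" where
  "unitary_rep K \<tau> \<longleftrightarrow> continuous_on K \<tau> \<and> \<tau> (mat 1) = mat 1 \<and>
     (\<forall>k\<in>K. \<forall>l\<in>K. \<tau> (k ** l) = \<tau> k ** \<tau> l) \<and>
     (\<forall>k\<in>K. \<forall>w. norm (\<tau> k *v w) = norm w)"

definition irreducible_rep ::
    "'n::finite cmat set \<Rightarrow> ('n cmat \<Rightarrow> complex^'w::finite^'w) \<Rightarrow> bool" where
  "irreducible_rep K \<tau> \<longleftrightarrow>
     (\<forall>U. vec.subspace U \<and> (\<forall>k\<in>K. \<forall>w\<in>U. \<tau> k *v w \<in> U) \<longrightarrow> U = {0} \<or> U = UNIV)"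

definition haar_measure :: "'n::finite cmat set \<Rightarrow> 'n cmat measure \<Rightarrow> bool" where
  "haar_measure G \<mu> \<longleftrightarrow> sets \<mu> = sets (restrict_space borel G) \<and>
     (\<forall>g\<in>G. \<forall>A\<in>sets \<mu>. emeasure \<mu> ((\<lambda>x. g ** x) ` A) = emeasure \<mu> A) \<and>
     (\<forall>C. compact C \<and> C \<subseteq> G \<longrightarrow> emeasure \<mu> C < \<infinity>) \<and>
     (\<forall>U. openin (top_of_set G) U \<and> U \<noteq> {} \<longrightarrow> emeasure \<mu> U > 0)"

(* The square integrable holomorphic sections of the bundle over G/K associated with \<tau>, as
   K-equivariant functions on G, set to 0 off G so that equality of sections is equality of
   functions. A section is holomorphic iff it is killed by the antiholomorphic derivatives \<pp>^-.
   As \<tau> is unitary, |f|^2 is right K-invariant, so integrating it over G instead of G/K only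
   changes the inner product by the volume of K. *)
definition hol_sections ::
    "'n::finite cmat set \<Rightarrow> 'n cmat set \<Rightarrow> 'n cmat set \<Rightarrow> ('n cmat \<Rightarrow> 'n cmat) \<Rightarrow> 'n cmat measure \<Rightarrow>
     ('n cmat \<Rightarrow> complex^'w::finite^'w) \<Rightarrow> ('n cmat \<Rightarrow> complex^'w) set" where
  "hol_sections G K \<pp> J \<mu> \<tau> = {f.
     (\<forall>x. x \<notin> G \<longrightarrow> f x = 0) \<and>
     smooth_on_group G f \<and>
     (\<forall>g\<in>G. \<forall>k\<in>K. f (g ** k) = matrix_inv (\<tau> k) *v f g) \<and>
     (\<forall>y\<in>p_minus \<pp> J. \<forall>g\<in>G. right_derivC y f g = 0) \<and>
     integrable \<mu> (\<lambda>x. (norm (f x))\<^sup>2)}"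

definition L2_norm :: "'n::finite cmat measure \<Rightarrow> ('n cmat \<Rightarrow> complex^'w::finite) \<Rightarrow> real" where
  "L2_norm \<mu> f = sqrt (\<integral>x. (norm (f x))\<^sup>2 \<partial>\<mu>)"

(* \<tau> is the lowest K-type of a holomorphic discrete series iff it is irreducible and the space of
   square integrable holomorphic sections, which then carries the representation, is nonzero. *)
definition holomorphic_discrete_series ::
    "'n::finite cmat set \<Rightarrow> 'n cmat set \<Rightarrow> 'n cmat set \<Rightarrow> ('n cmat \<Rightarrow> 'n cmat) \<Rightarrow> 'n cmat measure \<Rightarrow>
     ('n cmat \<Rightarrow> complex^'w::finite^'w) \<Rightarrow> bool" where
  "holomorphic_discrete_series G K \<pp> J \<mu> \<tau> \<longleftrightarrow>
     unitary_rep K \<tau> \<and> irreducible_rep K \<tau> \<and> hol_sections G K \<pp> J \<mu> \<tau> \<noteq> {\<lambda>_. 0}"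

definition left_translate ::
    "'n::finite cmat \<Rightarrow> ('n cmat \<Rightarrow> complex^'w::finite) \<Rightarrow> 'n cmat \<Rightarrow> complex^'w" where
  "left_translate g f x = f (matrix_inv g ** x)"

section \<open>Symmetry breaking operators\<close>

definition symmetry_breaking_operator ::
    "'n::finite cmat set \<Rightarrow>
     'n cmat measure \<Rightarrow> ('n cmat \<Rightarrow> complex^'w::finite) set \<Rightarrow>
     'n cmat measure \<Rightarrow> ('n cmat \<Rightarrow> complex^'z::finite) set \<Rightarrow>
     (('n cmat \<Rightarrow> complex^'w) \<Rightarrow> ('n cmat \<Rightarrow> complex^'z)) \<Rightarrow> bool" where
  "symmetry_breaking_operator H \<mu> V \<nu> V' S \<longleftrightarrow>
     (\<forall>f\<in>V. S f \<in> V') \<and>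
     (\<forall>f\<in>V. \<forall>f'\<in>V. S (\<lambda>x. f x + f' x) = (\<lambda>x. S f x + S f' x)) \<and>
     (\<forall>f\<in>V. \<forall>c. S (\<lambda>x. c *s f x) = (\<lambda>x. c *s S f x)) \<and>
     (\<exists>C. \<forall>f\<in>V. L2_norm \<nu> (S f) \<le> C * L2_norm \<mu> f) \<and>
     (\<forall>h\<in>H. \<forall>f\<in>V. S (left_translate h f) = left_translate h (S f))"

section \<open>Homogeneous differential operators\<close>

(* An element of the tensor product of Hom(W,Z) and S(\<pp>^+) is written as a finite sum, given by a
   list, of terms c \<otimes> x1 ... xk with c a matrix and xi in \<pp>^+; the monomials of a general element
   of S^k(\<pp>^+) are listed separately. *)
type_synonym ('n, 'w, 'z) diff_op = "((complex^'w^'z) \<times> 'n cmatC list) list"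

definition complex_functional :: "('n::finite cmatC \<Rightarrow> complex) \<Rightarrow> bool" where
  "complex_functional \<xi> \<longleftrightarrow> linear \<xi> \<and> (\<forall>x. \<xi> (scaleI x) = \<i> * \<xi> x)"

(* Different lists can denote the same tensor. S(\<pp>^+) is the algebra of polynomial functions on the
   dual of \<pp>^+, so two lists denote the same tensor iff their values, as Hom(W,Z)-valued polynomials
   in \<xi>, agree. Every functional on \<pp>^+ extends to the ambient complexification. *)
definition symbol ::
    "('n::finite, 'w::finite, 'z::finite) diff_op \<Rightarrow> ('n cmatC \<Rightarrow> complex) \<Rightarrow> complex^'w \<Rightarrow> complex^'z"
  where "symbol D \<xi> w = (\<Sum>(c, xs)\<leftarrow>D. (\<Prod>x\<leftarrow>xs. \<xi> x) *s (c *v w))"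

definition same_tensor ::
    "('n::finite, 'w::finite, 'z::finite) diff_op \<Rightarrow> ('n, 'w, 'z) diff_op \<Rightarrow> bool" where
  "same_tensor D D' \<longleftrightarrow> (\<forall>\<xi>. complex_functional \<xi> \<longrightarrow> (\<forall>w. symbol D \<xi> w = symbol D' \<xi> w))"

definition transform_op ::
    "('n::finite cmat \<Rightarrow> complex^'w::finite^'w) \<Rightarrow> ('n cmat \<Rightarrow> complex^'z::finite^'z) \<Rightarrow> 'n cmat \<Rightarrow>
     ('n, 'w, 'z) diff_op \<Rightarrow> ('n, 'w, 'z) diff_op" where
  "transform_op \<tau> \<sigma> l D = map (\<lambda>(c, xs). (\<sigma> l ** c ** matrix_inv (\<tau> l), map (AdC l) xs)) D"

definition represented_homogeneous ::
    "'n::finite cmat set \<Rightarrow> 'n cmat set \<Rightarrow> 'n cmatC set \<Rightarrow>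
     ('n cmat \<Rightarrow> complex^'w::finite^'w) \<Rightarrow> ('n cmat \<Rightarrow> complex^'z::finite^'z) \<Rightarrow>
     ('n cmat \<Rightarrow> complex^'w) set \<Rightarrow> nat \<Rightarrow>
     (('n cmat \<Rightarrow> complex^'w) \<Rightarrow> ('n cmat \<Rightarrow> complex^'z)) \<Rightarrow> bool" where
  "represented_homogeneous H L P \<tau> \<sigma> V k S \<longleftrightarrow>
     (\<exists>D :: ('n, 'w, 'z) diff_op.
        (\<forall>(c, xs)\<in>set D. length xs = k \<and> set xs \<subseteq> P) \<and>
        (\<forall>l\<in>L. same_tensor (transform_op \<tau> \<sigma> l D) D) \<and>
        (\<forall>f\<in>V. \<forall>h\<in>H. S f h = (\<Sum>(c, xs)\<leftarrow>D. c *v right_deriv_word xs f h)))"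

end

theory Submission
  imports Defs
begin

text \<open>
  The centre of the isotropy algebra forces homogeneity. Since \<open>\<pp>\<^sup>+\<close> is abelian and \<open>\<gg>\<close> is simple, the
  complex structure \<open>J\<close> on \<open>\<pp>\<close> is \<open>ad Z\<close> for a central \<open>Z\<close> in \<open>\<kk>\<close>, and \<open>Z\<close> generates a circle of
  rotations in \<open>K\<close>. As the inclusion of \<open>H/L\<close> is holomorphic, the differential of \<open>\<iota>\<close> fixes \<open>Z\<close>
  (\<open>complex_structure_fixed\<close>), so the rotations lie in \<open>L\<close>. By Schur's lemma they act through \<open>\<tau>\<close> and
  \<open>\<sigma>\<close> by characters of weights \<open>\<alpha>\<close> and \<open>\<beta>\<close>.

  Let \<open>S\<close> be a symmetry breaking operator and \<open>\<Phi> f = S f 1\<close>. By equivariance under \<open>H\<close>, \<open>\<Phi>\<close> determines \<open>S\<close>.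
  The rotations multiply the derivatives of degree \<open>k\<close> of a section at the base point by the
  character of weight \<open>k - \<alpha>\<close>, and \<open>\<Phi>\<close> by that of weight \<open>- \<beta>\<close>. Hence \<open>\<Phi> f\<close> only depends on the derivatives
  of \<open>f\<close> of degree \<open>k = \<alpha> - \<beta>\<close>. To see this, suppose that these derivatives vanish. The average of
  \<open>f\<close> over the circle against the character of weight \<open>\<beta>\<close> is then a holomorphic section all of whose
  derivatives at the base point vanish, and it is zero (\<open>circle_average_vanishes\<close>). The averages
  over finite cyclic subsets of the circle are orthogonal projections which tend to this
  average pointwise, hence tend to zero in \<open>L\<^sup>2\<close> (\<open>mean_vanishes_in_L2\<close>). As \<open>S\<close> is bounded and
  commutes with them, the averages of \<open>S f\<close> tend to zero in \<open>L\<^sup>2\<close> as well. They all have the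
  value \<open>\<Phi> f\<close> at the identity and are equicontinuous there, so that \<open>\<Phi> f = 0\<close>.

  The unique continuation used here (\<open>unique_continuation\<close>) is proved without analyticity of the group.
  By Fourier decomposition under the rotations one may assume that the section is homogeneous:
  \<open>f (rot s g) = cis (\<beta> s) f g\<close>. Differentiation at \<open>s = 0\<close> is the right derivative along \<open>Ad (g\<^sup>-\<^sup>1) Z\<close>, and
  by the Cauchy-Riemann equations it bounds the derivative of \<open>f\<close> along a radial direction by \<open>f\<close>. In this
  direction the squared distance to \<open>K\<close> decays exponentially, but \<open>f\<close> at a bounded rate only, which
  excludes that \<open>f\<close> vanishes to infinite order (\<open>flat_homogeneous_vanishes\<close>).

  A functional on the sections that only depends on finitely many derivatives is a combination of
  them, which represents \<open>S\<close> by a homogeneous differential operator. For the \<open>L\<close>-invariance of its symbol, the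
  coefficients are taken to be the Riesz vectors of \<open>\<Phi>\<close> for the Hermitian form that the derivatives in the
  directions of a Killing-orthonormal basis of \<open>\<pp>\<close> define. These vectors are unique and
  the form is \<open>K\<close>-invariant (\<open>equivariant_symbol\<close>).
\<close>

abbreviation mexp where "mexp \<equiv> matrix_exp"

section \<open>The matrix exponential\<close>

lemma bounded_bilinear_matrix_mult:
 "bounded_bilinear ((**) :: complex^'n^'m => complex^'p^'n => complex^'p^'m)" unfolding bilinear_conv_bounded_bilinear[symmetric] bilinear_def
 by (auto intro!: linearI simp: matrix_matrix_mult_def vec_eq_iff sum.distrib algebra_simps
   scaleR_sum_right)

lemma bounded_bilinear_matrix_vector_mult:
 "bounded_bilinear ((*v) :: complex^'n^'m => complex^'n => complex^'m)" unfolding bilinear_conv_bounded_bilinear[symmetric] bilinear_def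
 by (auto intro!: linearI simp: matrix_vector_mult_def vec_eq_iff sum.distrib algebra_simps
   scaleR_sum_right)

lemmas matrix_mult_simps =
 bounded_bilinear.add_left[OF bounded_bilinear_matrix_mult]
 bounded_bilinear.add_right[OF bounded_bilinear_matrix_mult]
 bounded_bilinear.diff_left[OF bounded_bilinear_matrix_mult]
 bounded_bilinear.diff_right[OF bounded_bilinear_matrix_mult]
 bounded_bilinear.minus_left[OF bounded_bilinear_matrix_mult]
 bounded_bilinear.minus_right[OF bounded_bilinear_matrix_mult]
 bounded_bilinear.scaleR_left[OF bounded_bilinear_matrix_mult]
 bounded_bilinear.scaleR_right[OF bounded_bilinear_matrix_mult]
 bounded_bilinear.zero_left[OF bounded_bilinear_matrix_mult]
 bounded_bilinear.zero_right[OF bounded_bilinear_matrix_mult]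

lemmas matrix_vector_simps =
 bounded_bilinear.add_left[OF bounded_bilinear_matrix_vector_mult]
 bounded_bilinear.add_right[OF bounded_bilinear_matrix_vector_mult]
 bounded_bilinear.diff_left[OF bounded_bilinear_matrix_vector_mult]
 bounded_bilinear.diff_right[OF bounded_bilinear_matrix_vector_mult]
 bounded_bilinear.minus_left[OF bounded_bilinear_matrix_vector_mult]
 bounded_bilinear.minus_right[OF bounded_bilinear_matrix_vector_mult]
 bounded_bilinear.scaleR_left[OF bounded_bilinear_matrix_vector_mult]
 bounded_bilinear.scaleR_right[OF bounded_bilinear_matrix_vector_mult]
 bounded_bilinear.zero_left[OF bounded_bilinear_matrix_vector_mult]
 bounded_bilinear.zero_right[OF bounded_bilinear_matrix_vector_mult]

lemmas continuous_on_matrix_mult [continuous_intros] =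
 bounded_bilinear.continuous_on[OF bounded_bilinear_matrix_mult]
lemmas continuous_on_matrix_vector_mult [continuous_intros] =
 bounded_bilinear.continuous_on[OF bounded_bilinear_matrix_vector_mult]
lemmas tendsto_matrix_mult [tendsto_intros] =
 bounded_bilinear.tendsto[OF bounded_bilinear_matrix_mult]
lemmas has_vector_derivative_matrix_mult =
 bounded_bilinear.has_vector_derivative[OF bounded_bilinear_matrix_mult]

text \<open>The library has the exponential on Banach algebras, and its power there is an iterated
 product. A copy of the matrix type that multiplies by the matrix product and carries the operator
 norm is such an algebra; facts about exponentials are proved there and transferred back.\<close>

typedef 'n mat_alg = "UNIV :: (complex^'n^'n) set"
 morphisms mat_of of_mat by auto

setup_lifting type_definition_mat_alg

definition op_norm :: "complex^'n^'n => real" where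
 "op_norm A = onorm ((*v) A)"

lemma bounded_linear_matrix_vector_mult: "bounded_linear ((*v) (A :: complex^'n^'m))"
 by (rule bounded_bilinear.bounded_linear_right[OF bounded_bilinear_matrix_vector_mult])

lemma op_norm_equiv:
 obtains C where "C > 0" "!!A :: complex^'n^'n. op_norm A <= C * norm A"
  "!!A :: complex^'n^'n. norm A <= C * op_norm A" proof -
 obtain K where K: "K > 0" "!!(A :: complex^'n^'n) x. norm (A *v x) <= norm A * norm x * K"
  using bounded_bilinear.pos_bounded[OF bounded_bilinear_matrix_vector_mult] by blast
 have 1: "op_norm A <= K * norm A" for A :: "complex^'n^'n" unfolding op_norm_def by (rule onorm_le) (use K in \<open>simp add: mult_ac\<close>)
 have entry: "norm (A $ i $ j) <= op_norm A" for A :: "complex^'n^'n" and i j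
 proof -
  have "norm (A $ i $ j) = norm ((A *v axis j 1) $ i)" by (simp add: matrix_vector_mult_def axis_def if_distrib cong: if_cong)
  also have "\<dots> <= norm (A *v axis j 1)" by (rule Finite_Cartesian_Product.norm_nth_le)
  also have "\<dots> <= op_norm A * norm (axis j (1::complex) :: complex^'n)" unfolding op_norm_def by (rule onorm[OF bounded_linear_matrix_vector_mult])
  finally show ?thesis by simp
 qed
 have 2: "norm A <= (real CARD('n) * real CARD('n)) * op_norm A" for A :: "complex^'n^'n" proof -
  have "norm A <= (\<Sum>i\<in>UNIV. norm (A $ i))" unfolding norm_vec_def by (rule L2_set_le_sum) simp
  also have "\<dots> <= (\<Sum>i\<in>(UNIV::'n set). \<Sum>j\<in>(UNIV::'n set). norm (A $ i $ j))" unfolding norm_vec_def by (intro sum_mono L2_set_le_sum) simp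
  also have "\<dots> <= (\<Sum>i\<in>(UNIV::'n set). \<Sum>j\<in>(UNIV::'n set). op_norm A)" by (intro sum_mono entry)
  finally show ?thesis by simp
 qed
 have pos: "op_norm A \<ge> 0" for A :: "complex^'n^'n" unfolding op_norm_def by (rule onorm_pos_le[OF bounded_linear_matrix_vector_mult])
 show ?thesis
 proof
  show "K + real CARD('n) * real CARD('n) > 0" using K by (simp add: add_pos_nonneg)
  show "op_norm A <= (K + real CARD('n) * real CARD('n)) * norm A" for A :: "complex^'n^'n" using 1[of A] by (simp add: algebra_simps add_increasing2)
  show "norm A <= (K + real CARD('n) * real CARD('n)) * op_norm A" for A :: "complex^'n^'n" using 2[of A] K pos[of A] by (simp add: distrib_right add_increasing)
 qed
qed

instantiation mat_alg :: (finite) real_normed_algebra_1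
begin

lift_definition zero_mat_alg :: "'a mat_alg" is 0 .
lift_definition one_mat_alg :: "'a mat_alg" is "mat 1" .
lift_definition plus_mat_alg :: "'a mat_alg => 'a mat_alg => 'a mat_alg" is "(+)" .
lift_definition minus_mat_alg :: "'a mat_alg => 'a mat_alg => 'a mat_alg" is "(-)" .
lift_definition uminus_mat_alg :: "'a mat_alg => 'a mat_alg" is uminus .
lift_definition times_mat_alg :: "'a mat_alg => 'a mat_alg => 'a mat_alg" is "(**)" .
lift_definition scaleR_mat_alg :: "real => 'a mat_alg => 'a mat_alg" is scaleR .
lift_definition norm_mat_alg :: "'a mat_alg => real" is op_norm .
definition "dist_mat_alg (A :: 'a mat_alg) B = norm (A - B)"
definition "sgn_mat_alg (A :: 'a mat_alg) = scaleR (inverse (norm A)) A"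
definition [code del]:
 "(uniformity :: ('a mat_alg \<times> 'a mat_alg) filter) = (INF e\<in>{0 <..}. principal {(x, y). dist x y < e})"
definition [code del]:
 "open_mat_alg (S :: 'a mat_alg set) =
  (\<forall>x\<in>S. \<forall>\<^sub>F (x', y) in uniformity. x' = x --> y : S)"

instance
proof
 fix a b c :: "'a mat_alg" and r s :: real
 show "a + b + c = a + (b + c)" "a + b = b + a" "0 + a = a" "- a + a = 0" "a - b = a + - b" by (transfer, simp)+
 show "r *\<^sub>R (a + b) = r *\<^sub>R a + r *\<^sub>R b" "(r + s) *\<^sub>R a = r *\<^sub>R a + s *\<^sub>R a"
  "r *\<^sub>R s *\<^sub>R a = (r * s) *\<^sub>R a" "1 *\<^sub>R a = a" by (transfer, simp add: scaleR_add_right scaleR_add_left)+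
 show "a * b * c = a * (b * c)" by transfer (simp add: matrix_mul_assoc)
 show "1 * a = a" "a * 1 = a" by (transfer, simp)+
 show "(a + b) * c = a * c + b * c" "a * (b + c) = a * b + a * c"
  "r *\<^sub>R a * b = r *\<^sub>R (a * b)" "a * r *\<^sub>R b = r *\<^sub>R (a * b)" by (transfer, simp add: matrix_mult_simps)+
 show "(0::'a mat_alg) ~= 1" proof transfer
  have "(mat 1 :: complex^'a^'a) $ undefined $ undefined = 1" by (simp add: mat_def)
  then show "(0 :: complex^'a^'a) ~= mat 1" by auto
 qed
 show "dist a b = norm (a - b)" by (rule dist_mat_alg_def)
 show "sgn a = scaleR (inverse (norm a)) a" by (rule sgn_mat_alg_def)
 show "(uniformity :: ('a mat_alg \<times> 'a mat_alg) filter) = (INF e\<in>{0 <..}. principal {(x, y). dist x y < e})" by (rule uniformity_mat_alg_def)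
 show "open S = (\<forall>x\<in>S. \<forall>\<^sub>F (x', y) in uniformity. x' = x --> y : S)" for S :: "'a mat_alg set" by (rule open_mat_alg_def)
 show "norm (1::'a mat_alg) = 1" proof (transfer, unfold op_norm_def)
  show "onorm ((*v) (mat 1 :: complex^'a^'a)) = 1" proof -
   have "(*v) (mat 1 :: complex^'a^'a) = (%x. x)" by (simp add: fun_eq_iff)
   then show ?thesis using onorm_id[where 'a="complex^'a"] by simp
  qed
 qed
 show "(norm a = 0) = (a = 0)" proof transfer
  fix A :: "complex^'a^'a"
  obtain C where "norm A <= C * op_norm A" using op_norm_equiv[where 'n='a] by metis
  moreover have "op_norm (0 :: complex^'a^'a) = 0" proof -
   have "(*v) (0 :: complex^'a^'a) = (%x. 0)" by (simp add: fun_eq_iff)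
   then show ?thesis by (simp add: op_norm_def onorm_zero)
  qed
  ultimately show "(op_norm A = 0) = (A = 0)" by auto
 qed
 show "norm (a + b) <= norm a + norm b" proof transfer
  fix A B :: "complex^'a^'a"
  have "(*v) (A + B) = (%x. A *v x + B *v x)" by (simp add: fun_eq_iff matrix_vector_simps)
  then show "op_norm (A + B) <= op_norm A + op_norm B" unfolding op_norm_def
   by (simp add: onorm_triangle bounded_linear_matrix_vector_mult)
 qed
 show "norm (r *\<^sub>R a) = \<bar>r\<bar> * norm a" proof transfer
  fix r and A :: "complex^'a^'a"
  have "(*v) (r *\<^sub>R A) = (%x. r *\<^sub>R (A *v x))" by (simp add: fun_eq_iff matrix_vector_simps)
  then show "op_norm (r *\<^sub>R A) = \<bar>r\<bar> * op_norm A" unfolding op_norm_def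
   by (simp add: onorm_scaleR bounded_linear_matrix_vector_mult)
 qed
 show "norm (a * b) <= norm a * norm b" proof transfer
  fix A B :: "complex^'a^'a"
  show "op_norm (A ** B) <= op_norm A * op_norm B" using onorm_compose[OF bounded_linear_matrix_vector_mult bounded_linear_matrix_vector_mult, of A B]
   by (simp add: op_norm_def o_def matrix_vector_mul_assoc)
 qed
qed

end

lemma bounded_linear_mat_of: "bounded_linear (mat_of :: 'n::finite mat_alg => _)" proof -
 obtain C where C: "!!A :: complex^'n^'n. norm A <= C * op_norm A" using op_norm_equiv[where 'n='n] by metis
 show ?thesis
  by (rule bounded_linear_intro[where K=C])
    (use C in \<open>auto simp: plus_mat_alg.rep_eq scaleR_mat_alg.rep_eq norm_mat_alg.rep_eq mult.commute\<close>)
qed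

lemma bounded_linear_of_mat: "bounded_linear (of_mat :: _ => 'n::finite mat_alg)" proof -
 obtain C where C: "!!A :: complex^'n^'n. op_norm A <= C * norm A" using op_norm_equiv[where 'n='n] by metis
 show ?thesis
  by (rule bounded_linear_intro[where K=C])
    (use C in \<open>auto simp: plus_mat_alg.abs_eq scaleR_mat_alg.abs_eq norm_mat_alg.abs_eq mult.commute\<close>)
qed

instance mat_alg :: (finite) banach
proof
 fix X :: "nat => 'a mat_alg" assume "Cauchy X"
 then have "Cauchy (%n. mat_of (X n))" by (rule bounded_linear.Cauchy[OF bounded_linear_mat_of])
 then obtain L where "(%n. mat_of (X n)) \<longlonglongrightarrow> L" using Cauchy_convergent_iff convergent_def by blast
 then have "(%n. of_mat (mat_of (X n))) \<longlonglongrightarrow> of_mat L" by (rule bounded_linear.tendsto[OF bounded_linear_of_mat])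
 then show "convergent X" by (auto simp: mat_of_inverse convergent_def)
qed

lemma of_mat_mult: "of_mat (A ** B) = of_mat A * of_mat B" by (simp add: times_mat_alg.abs_eq)

lemma of_mat_one: "of_mat (mat 1) = 1" by (simp add: one_mat_alg_def)

lemmas of_mat_scaleR = linear_scale[OF bounded_linear.linear[OF bounded_linear_of_mat]]
lemmas mat_of_scaleR = linear_scale[OF bounded_linear.linear[OF bounded_linear_mat_of]]

lemma mat_of_mult: "mat_of (a * b) = mat_of a ** mat_of b" by (simp add: times_mat_alg.rep_eq)

lemma mat_of_of_mat [simp]: "mat_of (of_mat A) = A" by (simp add: of_mat_inverse)

lemma matrix_exp_eq: "mexp X = mat_of (exp (of_mat X))" proof -
 have pow: "of_mat (((**) X ^^ k) (mat 1)) = of_mat X ^ k" for k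
  by (induction k) (simp_all add: of_mat_one of_mat_mult)
 have "(%k. mat_of (of_mat X ^ k /\<^sub>R fact k)) sums mat_of (exp (of_mat X))" by (rule bounded_linear.sums[OF bounded_linear_mat_of exp_converges])
 moreover have "mat_of (of_mat X ^ k /\<^sub>R fact k) = (1 / fact k) *\<^sub>R ((**) X ^^ k) (mat 1)" for k
  by (simp add: pow[symmetric] mat_of_scaleR divide_inverse)
 ultimately show ?thesis
  unfolding matrix_exp_def by (simp add: sums_iff)
qed

lemma matrix_exp_0 [simp]: "mexp 0 = mat 1" by (simp add: matrix_exp_eq zero_mat_alg_def[symmetric] one_mat_alg.rep_eq)

lemma matrix_exp_add:
 assumes "X ** Y = Y ** X"
 shows "mexp (X + Y) = mexp X ** mexp Y" proof -
 have "of_mat X * of_mat Y = of_mat Y * of_mat X" using assms by (metis of_mat_mult)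
 then have "exp (of_mat X + of_mat Y) = exp (of_mat X) * exp (of_mat Y)" by (rule exp_add_commuting)
 then show ?thesis
  unfolding matrix_exp_eq linear_add[OF bounded_linear.linear[OF bounded_linear_of_mat]] by (simp only: mat_of_mult)
qed

lemma matrix_exp_scaleR_add: "mexp ((s + t) *\<^sub>R X) = mexp (s *\<^sub>R X) ** mexp (t *\<^sub>R X)"
 unfolding scaleR_left_distrib by (rule matrix_exp_add) (simp add: matrix_mult_simps)

lemma matrix_exp_minus [simp]:
 "mexp X ** mexp (- X) = mat 1" "mexp (- X) ** mexp X = mat 1" using matrix_exp_scaleR_add[of 1 "- 1" X] matrix_exp_scaleR_add[of "- 1" 1 X] by simp_all

lemma matrix_inv_cancel:
 assumes "invertible A"
 shows "A ** matrix_inv A = mat 1" "matrix_inv A ** A = mat 1" using someI_ex[OF assms[unfolded invertible_def]] by (auto simp: matrix_inv_def)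

lemma matrix_inv_eqI:
 assumes "A ** B = mat 1" "B ** A = mat 1"
 shows "matrix_inv A = B" proof -
 have "invertible A" using assms by (auto simp: invertible_def)
 then have "A ** matrix_inv A = mat 1" by (rule matrix_inv_cancel)
 then have "B ** (A ** matrix_inv A) = B" by simp
 then show ?thesis using assms by (simp add: matrix_mul_assoc)
qed

lemma matrix_inv_exp [simp]: "matrix_inv (mexp X) = mexp (- X)" by (rule matrix_inv_eqI) auto

lemma invertible_matrix_exp [simp]: "invertible (mexp X)" unfolding invertible_def using matrix_exp_minus by blast

lemma matrix_exp_has_vector_derivative:
 "((%t. mexp (t *\<^sub>R X)) has_vector_derivative mexp (t *\<^sub>R X) ** X) (at t within T)" using bounded_linear.has_vector_derivative[OF bounded_linear_mat_of
   exp_scaleR_has_vector_derivative_right[of "of_mat X" t T]] by (simp add: matrix_exp_eq of_mat_scaleR mat_of_mult)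

lemma matrix_exp_commute: "X ** mexp (t *\<^sub>R X) = mexp (t *\<^sub>R X) ** X" proof -
 have "of_mat X * exp (t *\<^sub>R of_mat X) = exp (t *\<^sub>R of_mat X) * of_mat X" by (rule exp_times_scaleR_commute[symmetric])
 then have "mat_of (of_mat X * exp (t *\<^sub>R of_mat X)) = mat_of (exp (t *\<^sub>R of_mat X) * of_mat X)" by simp
 then show ?thesis by (simp add: matrix_exp_eq of_mat_scaleR mat_of_mult)
qed

lemma matrix_exp_conj:
 fixes g :: "complex^'n^'n"
 assumes "invertible g"
 shows "mexp (g ** X ** matrix_inv g) = g ** mexp X ** matrix_inv g" proof -
 have inv: "matrix_inv g ** g = mat 1" "g ** matrix_inv g = mat 1" using assms by (auto simp: matrix_inv_cancel)
 let ?c = "%a. of_mat g * a * of_mat (matrix_inv g)"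
 have g: "of_mat (matrix_inv g) * of_mat g = 1" "of_mat g * of_mat (matrix_inv g) = 1" using inv by (simp_all add: of_mat_mult[symmetric] of_mat_one)
 have pow: "?c (of_mat X ^ k) = (?c (of_mat X)) ^ k" for k
 proof (induction k)
  case 0
  then show ?case by (simp add: g)
 next
  case (Suc k)
  have "(?c (of_mat X)) ^ Suc k = ?c (of_mat X) * ?c (of_mat X ^ k)" using Suc by simp
  also have "\<dots> =
    of_mat g * of_mat X * (of_mat (matrix_inv g) * of_mat g) * of_mat X ^ k * of_mat (matrix_inv g)" by (simp only: mult.assoc)
  also have "\<dots> = ?c (of_mat X ^ Suc k)" unfolding g by (simp add: mult.assoc)
  finally show ?case by (rule sym)
 qed
 have bl: "bounded_linear ?c" by (rule bounded_linear_mult_const[OF bounded_linear_const_mult[OF bounded_linear_ident]])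
 have "(%k. ?c (of_mat X ^ k /\<^sub>R fact k)) sums ?c (exp (of_mat X))" by (rule bounded_linear.sums[OF bl exp_converges])
 moreover have "?c (of_mat X ^ k /\<^sub>R fact k) = (?c (of_mat X)) ^ k /\<^sub>R fact k" for k
  unfolding pow[symmetric] by simp
 ultimately have "exp (?c (of_mat X)) = ?c (exp (of_mat X))" using exp_converges[of "?c (of_mat X)"] by (simp only: sums_iff)
 then have "mat_of (exp (?c (of_mat X))) = mat_of (?c (exp (of_mat X)))" by (rule arg_cong)
 then show ?thesis by (simp only: matrix_exp_eq of_mat_mult mat_of_mult mat_of_of_mat)
qed

lemma norm_exp_minus_linear_le:
 fixes x :: "'a::{real_normed_algebra_1,banach}"
 assumes "norm x <= 1"
 shows "norm (exp x - 1 - x) <= 3 * norm x ^ 2" proof -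
 have sm: "summable (%n. norm (inverse (fact (n + 2)) *\<^sub>R x ^ (n + 2)))" using summable_ignore_initial_segment[OF summable_norm_exp[of x], of 2] by simp
 have "exp x - 1 - x = (\<Sum>n. inverse (fact (n + 2)) *\<^sub>R (x ^ (n + 2)))" using exp_first_two_terms[of x] by simp
 also have "norm \<dots> <= (\<Sum>n. norm (inverse (fact (n + 2)) *\<^sub>R (x ^ (n + 2))))" by (rule summable_norm[OF sm])
 also have "\<dots> <= (\<Sum>n. norm x ^ 2 * (inverse (fact n) *\<^sub>R 1 ^ n))" proof (rule suminf_le[OF _ sm])
  show "summable (%n. norm x ^ 2 * (inverse (fact n) *\<^sub>R 1 ^ n) :: real)" by (intro summable_mult summable_exp_generic)
  show "norm (inverse (fact (n + 2)) *\<^sub>R x ^ (n + 2)) <= norm x ^ 2 * (inverse (fact n) *\<^sub>R 1 ^ n)" for n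
  proof -
   have "norm (x ^ (n + 2)) <= norm x ^ (n + 2)" by (rule norm_power_ineq)
   also have "\<dots> <= norm x ^ 2" using assms by (intro power_decreasing) auto
   finally have a: "norm (x ^ (n + 2)) <= norm x ^ 2" .
   have b: "inverse (fact (n + 2)) <= (inverse (fact n) :: real)" by (intro le_imp_inverse_le fact_mono) auto
   show ?thesis using mult_mono[OF b a] by (simp add: mult.commute)
  qed
 qed
 also have "\<dots> = norm x ^ 2 * exp 1" using summable_exp_generic[of "1::real"] by (subst suminf_mult) (auto simp: exp_def)
 also have "\<dots> <= norm x ^ 2 * 3" by (intro mult_left_mono exp_le) auto
 finally show ?thesis by simp
qed

lemma matrix_exp_minus_linear_le:
 obtains C r where "C > 0" "r > 0"
  "!!X :: complex^'n^'n. norm X <= r ==> norm (mexp X - mat 1 - X) <= C * norm X ^ 2" proof -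
 obtain c where c: "c > 0" "!!A :: complex^'n^'n. op_norm A <= c * norm A"
  "!!A :: complex^'n^'n. norm A <= c * op_norm A" using op_norm_equiv[where 'n='n] by metis
 show ?thesis
 proof
  show "c * (3 * c^2) > 0" "1 / c > 0" using c by auto
  fix X :: "complex^'n^'n" assume X: "norm X <= 1 / c"
  have nx: "norm (of_mat X) = op_norm X" by (simp add: norm_mat_alg.abs_eq)
  have le1: "op_norm X <= 1" using c(2)[of X] X c(1) by (simp add: field_simps)
  have eq: "mexp X - mat 1 - X = mat_of (exp (of_mat X) - 1 - of_mat X)" by (simp add: matrix_exp_eq minus_mat_alg.rep_eq one_mat_alg.rep_eq)
  have "norm (mexp X - mat 1 - X) <= c * norm (exp (of_mat X) - 1 - of_mat X)" unfolding eq norm_mat_alg.rep_eq by (rule c(3))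
  also have "\<dots> <= c * (3 * op_norm X ^ 2)" using norm_exp_minus_linear_le[of "of_mat X"] le1 c(1) nx by (simp add: mult_left_mono)
  also have "\<dots> <= c * (3 * (c * norm X) ^ 2)" proof -
   have "0 <= op_norm X" using nx norm_ge_zero by metis
   then have "op_norm X ^ 2 <= (c * norm X) ^ 2" using c(2) by (intro power_mono) auto
   then show ?thesis using c(1) by simp
  qed
  finally show "norm (mexp X - mat 1 - X) <= c * (3 * c^2) * norm X ^ 2" by (simp add: power_mult_distrib mult_ac)
 qed
qed

lemma continuous_on_exp_banach_algebra:
 "continuous_on UNIV (exp :: 'a::{real_normed_algebra_1,banach} => 'a)" proof -
 have "continuous_on (ball 0 r) (exp :: 'a => 'a)" if "r > 0" for r
 proof -
  have "uniform_limit (ball 0 r) (%n x. \<Sum>k<n. x ^ k /\<^sub>R fact k) (%x::'a. \<Sum>k. x ^ k /\<^sub>R fact k) sequentially" proof (rule Weierstrass_m_test)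
   show "norm (x ^ n /\<^sub>R fact n) <= r ^ n /\<^sub>R fact n" if "x : ball 0 r" for n and x :: 'a
   proof -
    have "norm (x ^ n) <= norm x ^ n" by (rule norm_power_ineq)
    also have "\<dots> <= r ^ n" using that by (intro power_mono) auto
    finally show ?thesis by (simp add: mult_left_mono)
   qed
   show "summable (%n. r ^ n /\<^sub>R fact n)" by (rule summable_exp_generic)
  qed
  then show ?thesis
   unfolding exp_def
   by (rule uniform_limit_theorem[rotated]) (auto intro!: always_eventually continuous_intros)
 qed
 then have "isCont exp x" for x :: 'a
  by (rule continuous_on_interior[where S="ball 0 (norm x + 1)"])
    (auto simp: add_nonneg_pos)
 then show ?thesis by (simp add: continuous_at_imp_continuous_on)
qed

lemma continuous_on_matrix_exp [continuous_intros]: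
 assumes "continuous_on S f"
 shows "continuous_on S (%x. mexp (f x))" proof -
 have "continuous_on S (%x. of_mat (f x))" using assms by (rule bounded_linear.continuous_on[OF bounded_linear_of_mat])
 then have "continuous_on S (%x. exp (of_mat (f x)))" by (rule continuous_on_compose2[OF continuous_on_exp_banach_algebra]) auto
 then show ?thesis
  unfolding matrix_exp_eq by (rule bounded_linear.continuous_on[OF bounded_linear_mat_of])
qed

section \<open>One-parameter groups\<close>

lemma has_vector_derivative_sequence:
 assumes "(f has_vector_derivative D) (at 0)"
 shows "(%n. real n *\<^sub>R (f (1 / real n) - f 0)) \<longlonglongrightarrow> D" proof (rule metric_LIMSEQ_I)
 fix e :: real assume "e > 0"
 then obtain d where d: "d > 0"
  "!!y. norm y < d ==> norm (f y - f 0 - y *\<^sub>R D) <= (e/2) * norm y"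
  using assms[unfolded has_vector_derivative_def has_derivative_at_alt, THEN conjunct2, rule_format, of "e/2"] by auto
 obtain N :: nat where N: "N > 0" "1 / real N < d" using d(1) reals_Archimedean by (metis inverse_eq_divide zero_less_Suc)
 show "\<exists>no. \<forall>n\<ge>no. dist (real n *\<^sub>R (f (1 / real n) - f 0)) D < e" proof (intro exI allI impI)
  fix n assume n: "N <= n"
  then have n0: "real n > 0" using N by simp
  have "1 / real n <= 1 / real N" using N n by (simp add: frac_le)
  then have "norm (1 / real n) < d" using N n0 by simp
  then have *: "norm (f (1 / real n) - f 0 - (1 / real n) *\<^sub>R D) <= (e/2) * norm (1 / real n)" by (rule d)
  have "real n *\<^sub>R (f (1 / real n) - f 0) - D = real n *\<^sub>R (f (1 / real n) - f 0 - (1 / real n) *\<^sub>R D)" using n0 by (simp add: algebra_simps)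
  then have "dist (real n *\<^sub>R (f (1 / real n) - f 0)) D =
    real n * norm (f (1 / real n) - f 0 - (1 / real n) *\<^sub>R D)" using n0 by (simp add: dist_norm)
  also have "\<dots> <= real n * ((e/2) * norm (1 / real n))" using * n0 by (simp only: mult_le_cancel_left_pos)
  also have "\<dots> = e/2" using n0 by simp
  finally show "dist (real n *\<^sub>R (f (1 / real n) - f 0)) D < e" using \<open>e > 0\<close> by simp
 qed
qed

lemma has_vector_derivative_in_subspace:
 fixes f :: "real => 'a::euclidean_space"
 assumes "(f has_vector_derivative D) (at 0)" "subspace V" "!!s. f s : V"
 shows "D : V" proof (rule closed_sequentially[OF closed_subspace[OF assms(2)]])
 show "(%n. real n *\<^sub>R (f (1 / real n) - f 0)) \<longlonglongrightarrow> D" by (rule has_vector_derivative_sequence[OF assms(1)])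
 show "real n *\<^sub>R (f (1 / real n) - f 0) : V" for n
  using assms by (simp add: subspace_diff subspace_scale)
qed

lemma has_vector_derivative_unique_at:
 "(f has_vector_derivative D) (at x) ==> (f has_vector_derivative D') (at x) ==> D = D'"
 for f :: "real => 'a::real_normed_vector" by (metis vector_derivative_at)

lemma has_vector_derivative_scaled:
 assumes "(f has_vector_derivative D) (at 0)"
 shows "((%s. f (c * s)) has_vector_derivative c *\<^sub>R D) (at 0)" proof -
 have 1: "((%s. c * s) has_vector_derivative c) (at 0)" by (auto intro!: derivative_eq_intros)
 have 2: "(f has_vector_derivative D) (at ((%s. c * s) 0))" using assms by simp
 show ?thesis using vector_diff_chain_at[OF 1 2] by (simp add: o_def)
qed

lemma has_vector_derivative_shift:
 assumes "((%h. f (t + h)) has_vector_derivative D) (at 0)"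
 shows "(f has_vector_derivative D) (at t)" proof -
 have 1: "((%s. s - t) has_vector_derivative 1) (at t)" by (auto intro!: derivative_eq_intros)
 have 2: "((%h. f (t + h)) has_vector_derivative D) (at ((%s. s - t) t))" using assms by simp
 show ?thesis using vector_diff_chain_at[OF 1 2] by (simp add: o_def)
qed

lemmas has_vector_derivative_matrix_mult_const =
 bounded_linear.has_vector_derivative[OF bounded_bilinear.bounded_linear_left[OF bounded_bilinear_matrix_mult]]
lemmas has_vector_derivative_const_matrix_mult =
 bounded_linear.has_vector_derivative[OF bounded_bilinear.bounded_linear_right[OF bounded_bilinear_matrix_mult]]

lemma matrix_exp_derivative_at_0: "((%t. mexp (t *\<^sub>R X)) has_vector_derivative X) (at 0)" using matrix_exp_has_vector_derivative[of X 0 UNIV] by simp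

lemma matrix_exp_scaleR_inject:
 assumes "!!t. mexp (t *\<^sub>R X) = mexp (t *\<^sub>R Y)"
 shows "X = Y" using matrix_exp_derivative_at_0[of X] matrix_exp_derivative_at_0[of Y] assms
 by (simp add: has_vector_derivative_unique_at)

lemma norm_power_diff_le:
 fixes a b :: "'a::real_normed_algebra_1"
 assumes "norm a <= M" "norm b <= M" "M \<ge> 1"
 shows "norm (a ^ n - b ^ n) <= real n * M ^ n * norm (a - b)" proof (induction n)
 case (Suc n)
 have b: "norm (b ^ n) <= M ^ n" using norm_power_ineq[of b n] power_mono[OF assms(2), of n] by simp
 have "a ^ Suc n - b ^ Suc n = a * (a ^ n - b ^ n) + (a - b) * b ^ n" by (simp add: algebra_simps)
 also have "norm \<dots> <= norm a * norm (a ^ n - b ^ n) + norm (a - b) * norm (b ^ n)" by (intro norm_triangle_le add_mono norm_mult_ineq)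
 also have "\<dots> <= M * (real n * M ^ n * norm (a - b)) + norm (a - b) * M ^ n" using assms b Suc by (intro add_mono mult_mono) auto
 also have "\<dots> <= M * (real n * M ^ n * norm (a - b)) + norm (a - b) * M ^ Suc n" using assms by (intro add_left_mono mult_left_mono power_increasing) auto
 also have "\<dots> = real (Suc n) * M ^ Suc n * norm (a - b)" by (simp add: algebra_simps)
 finally show ?case .
qed simp

lemma exp_divide_power: "n > 0 ==> exp ((1 / real n) *\<^sub>R x) ^ n = exp (x :: 'a::{real_normed_algebra_1,banach})" proof -
 assume n: "n > 0"
 have "exp ((1 / real n) *\<^sub>R x) ^ k = exp ((real k / real n) *\<^sub>R x)" for k
 proof (induction k)
  case (Suc k)
  have "exp ((real (Suc k) / real n) *\<^sub>R x) = exp ((1 / real n) *\<^sub>R x + (real k / real n) *\<^sub>R x)"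
   by (simp add: scaleR_left_distrib[symmetric] add_divide_distrib)
  also have "\<dots> = exp ((1 / real n) *\<^sub>R x) * exp ((real k / real n) *\<^sub>R x)" by (rule exp_add_commuting) simp
  finally show ?case using Suc by simp
 qed simp
 from this[of n] n show ?thesis by simp
qed

text \<open>Both \<open>a\<^sub>n\<close> and \<open>exp (x/n)\<close> are \<open>1 + x/n + o(1/n)\<close>, and taking \<open>n\<close>-th powers multiplies the
 difference by at most a constant times \<open>n\<close>.\<close>

lemma power_tendsto_exp:
 fixes x :: "'a::{real_normed_algebra_1,banach}"
 assumes lim: "(%n. real n *\<^sub>R (a n - 1)) \<longlonglongrightarrow> x"
 shows "(%n. a n ^ n) \<longlonglongrightarrow> exp x" proof -
 define b where "b n = exp ((1 / real n) *\<^sub>R x)" for n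
 have "((%t. exp (t *\<^sub>R x)) has_vector_derivative x) (at 0)" using exp_scaleR_has_vector_derivative_right[of x 0 UNIV] by simp
 then have limb: "(%n. real n *\<^sub>R (b n - 1)) \<longlonglongrightarrow> x" using has_vector_derivative_sequence[of "%t. exp (t *\<^sub>R x)" x] by (simp add: b_def)
 have "Bseq (%n. real n *\<^sub>R (a n - 1))" "Bseq (%n. real n *\<^sub>R (b n - 1))" using lim limb by (auto intro: convergent_imp_Bseq convergentI)
 then obtain K1 K2 where K1: "!!n. norm (real n *\<^sub>R (a n - 1)) <= K1" "K1 > 0"
  and K2: "!!n. norm (real n *\<^sub>R (b n - 1)) <= K2" "K2 > 0" by (meson BseqE)
 define K where "K = K1 + K2"
 have bnd: "norm c <= exp (K / real n)" if "norm (real n *\<^sub>R (c - 1)) <= K" "n > 0" for c :: 'a and n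
 proof -
  have "norm (c - 1) <= K / real n" using that by (simp add: pos_le_divide_eq mult.commute)
  then have "norm c <= 1 + K / real n" using norm_triangle_ineq[of 1 "c - 1"] by simp
  also have "\<dots> <= exp (K / real n)" by (rule exp_ge_add_one_self)
  finally show ?thesis .
 qed
 have ev: "norm (a n ^ n - exp x) <= exp K * norm (real n *\<^sub>R (a n - 1) - real n *\<^sub>R (b n - 1))"
  if "n > 0" for n
 proof -
  have "norm (a n) <= exp (K / real n)" "norm (b n) <= exp (K / real n)" using K1(1)[of n] K2(1)[of n] K1(2) K2(2) that by (intro bnd; simp add: K_def)+
  moreover have "exp (K / real n) \<ge> 1" using K1(2) K2(2) by (simp add: K_def)
  ultimately have "norm (a n ^ n - b n ^ n) <= real n * exp (K / real n) ^ n * norm (a n - b n)" by (rule norm_power_diff_le)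
  also have "exp (K / real n) ^ n = exp K" using exp_divide_power[OF that, of K] by simp
  also have "b n ^ n = exp x" unfolding b_def by (rule exp_divide_power[OF that])
  also have "real n * exp K * norm (a n - b n) = exp K * norm (real n *\<^sub>R (a n - 1) - real n *\<^sub>R (b n - 1))" unfolding scaleR_diff_right[symmetric] by simp
  finally show ?thesis .
 qed
 have "(%n. exp K * norm (real n *\<^sub>R (a n - 1) - real n *\<^sub>R (b n - 1))) \<longlonglongrightarrow> exp K * norm (x - x)" by (intro tendsto_intros lim limb)
 then have "(%n. exp K * norm (real n *\<^sub>R (a n - 1) - real n *\<^sub>R (b n - 1))) \<longlonglongrightarrow> 0" by simp
 then have "(%n. a n ^ n - exp x) \<longlonglongrightarrow> 0" by (rule Lim_null_comparison[rotated])
    (use ev in \<open>auto intro!: eventually_sequentiallyI[of 1]\<close>)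
 then show ?thesis by (simp add: LIM_zero_iff)
qed

definition matrix_power :: "complex^'n^'n => nat => complex^'n^'n" where
 "matrix_power A n = ((**) A ^^ n) (mat 1)"

lemma matrix_power_simps [simp]:
 "matrix_power A 0 = mat 1" "matrix_power A (Suc n) = A ** matrix_power A n" by (simp_all add: matrix_power_def)

lemma matrix_power_tendsto_exp:
 fixes X :: "complex^'n^'n"
 assumes lim: "(%n. real n *\<^sub>R (A n - mat 1)) \<longlonglongrightarrow> X"
 shows "(%n. matrix_power (A n) n) \<longlonglongrightarrow> mexp X" proof -
 have eq: "of_mat (real n *\<^sub>R (A n - mat 1)) = real n *\<^sub>R (of_mat (A n) - 1)" for n
  by (simp add: of_mat_scaleR linear_diff[OF bounded_linear.linear[OF bounded_linear_of_mat]] of_mat_one)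
 have "(%n. real n *\<^sub>R (of_mat (A n) - 1)) \<longlonglongrightarrow> of_mat X" using bounded_linear.tendsto[OF bounded_linear_of_mat lim] unfolding eq .
 then have "(%n. of_mat (A n) ^ n) \<longlonglongrightarrow> exp (of_mat X)" by (rule power_tendsto_exp)
 then have "(%n. mat_of (of_mat (A n) ^ n)) \<longlonglongrightarrow> mat_of (exp (of_mat X))" by (rule bounded_linear.tendsto[OF bounded_linear_mat_of])
 moreover have "mat_of (of_mat B ^ k) = matrix_power B k" for B :: "complex^'n^'n" and k
  by (induction k) (simp_all add: one_mat_alg.rep_eq mat_of_mult)
 ultimately show ?thesis by (simp add: matrix_exp_eq)
qed

lemma near_identity_invertible:
 obtains r where "r > 0" "!!A :: complex^'n^'n. norm (A - mat 1) < r ==> invertible A" proof -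
 obtain C where C: "C > 0" "!!A :: complex^'n^'n. op_norm A <= C * norm A" using op_norm_equiv[where 'n='n] by metis
 show ?thesis
 proof
  show "1 / C > 0" using C by simp
  fix A :: "complex^'n^'n" assume A: "norm (A - mat 1) < 1 / C"
  have op: "op_norm (A - mat 1) < 1" using C(2)[of "A - mat 1"] A C(1) by (simp add: field_simps)
  have "inj ((*v) A)" proof (rule injI)
   fix x y assume "A *v x = A *v y"
   then have "(A - mat 1) *v (x - y) = - (x - y)" by (simp add: matrix_vector_simps)
   then have "norm (x - y) = norm ((A - mat 1) *v (x - y))" by (simp only: norm_minus_cancel)
   also have "\<dots> <= op_norm (A - mat 1) * norm (x - y)" unfolding op_norm_def by (rule onorm[OF bounded_linear_matrix_vector_mult])
   finally have "(1 - op_norm (A - mat 1)) * norm (x - y) <= 0" by (simp add: algebra_simps)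
   then have "norm (x - y) <= 0" using op by (simp add: mult_le_0_iff)
   then show "x = y" by simp
  qed
  then show "invertible A" by (simp add: invertible_left_inverse matrix_left_invertible_injective)
 qed
qed

text \<open>Integrating over a short interval of length \<open>c\<close> gives an invertible matrix \<open>C\<close>, and
 \<open>\<phi> t ** C\<close> is the integral of \<open>\<phi>\<close> from \<open>t\<close> to \<open>t + c\<close>, hence differentiable in \<open>t\<close>.\<close>

lemma continuous_one_parameter_group:
 fixes \<phi> :: "real => complex^'n^'n"
 assumes cont: "continuous_on UNIV \<phi>" and one: "\<phi> 0 = mat 1"
  and hom: "!!s t. \<phi> (s + t) = \<phi> s ** \<phi> t"
 obtains X where "!!t. \<phi> t = mexp (t *\<^sub>R X)" proof -
 obtain r where r: "r > 0" "!!A :: complex^'n^'n. norm (A - mat 1) < r ==> invertible A" using near_identity_invertible by blast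
 define F where "F u = integral {-2..u} \<phi>" for u
 have cont': "continuous_on S \<phi>" for S by (rule continuous_on_subset[OF cont]) simp
 have F: "(F has_vector_derivative \<phi> u) (at u)" if "u : {-2<..<2}" for u
 proof -
  have "(F has_vector_derivative \<phi> u) (at u within {-2..2})" unfolding F_def using that by (intro integral_has_vector_derivative cont') auto
  then have "(F has_vector_derivative \<phi> u) (at u within {-2<..<2})" by (rule has_vector_derivative_within_subset) auto
  then show ?thesis using at_within_open[of u "{-2<..<2}"] that by simp
 qed
 have "(%n. real n *\<^sub>R (F (1 / real n) - F 0)) \<longlonglongrightarrow> mat 1" using has_vector_derivative_sequence[OF F[of 0]] by (simp add: one)
 then have "\<forall>\<^sub>F n in sequentially. dist (real n *\<^sub>R (F (1 / real n) - F 0)) (mat 1) < r" using r(1) by (rule tendstoD)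
 then obtain N where N: "!!n. n \<ge> N ==> norm (real n *\<^sub>R (F (1 / real n) - F 0) - mat 1) < r" by (auto simp: eventually_sequentially dist_norm)
 define n where "n = Suc N"
 define c where "c = 1 / real n"
 have c: "0 < c" "c <= 1" by (auto simp: c_def n_def)
 define C where "C = F c - F 0"
 have "invertible (real n *\<^sub>R C)" using N[of n] r(2) unfolding C_def c_def n_def by simp
 then obtain B where "real n *\<^sub>R C ** B = mat 1" by (auto simp: invertible_def)
 then have CB: "C ** (real n *\<^sub>R B) = mat 1" by (simp add: matrix_mult_simps)
 define D where "D = real n *\<^sub>R B"
 have split: "F v - F u = integral {u..v} \<phi>" if "-2 <= u" "u <= v" for u v
  using Henstock_Kurzweil_Integration.integral_combine[of "-2" u v \<phi>] that
   integrable_continuous_real[OF cont'] unfolding F_def by (simp add: algebra_simps)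
 have shift: "\<phi> t ** C = F (t + c) - F t" if "t : {-1<..<1}" for t
 proof -
  have bl: "bounded_linear ((**) (\<phi> t))" by (rule bounded_bilinear.bounded_linear_right[OF bounded_bilinear_matrix_mult])
  have "\<phi> t ** C = \<phi> t ** integral {0..c} \<phi>" unfolding C_def using split[of 0 c] c by simp
  also have "\<dots> = integral {0..c} ((**) (\<phi> t) \<circ> \<phi>)" by (rule integral_linear[symmetric, OF integrable_continuous_real[OF cont'] bl])
  also have "(**) (\<phi> t) \<circ> \<phi> = \<phi> \<circ> (%s. s + t)" by (simp add: fun_eq_iff hom[symmetric] add.commute)
  also have "integral {0..c} (\<phi> \<circ> (%s. s + t)) = integral {0 + t..c + t} \<phi>" by (rule integral_shift[OF cont'])
  also have "\<dots> = F (t + c) - F t" using split[of t "t + c"] that c by (simp add: add.commute)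
  finally show ?thesis .
 qed
 have der0: "(\<phi> has_vector_derivative (\<phi> c - \<phi> 0) ** D) (at 0)" proof -
  have "((%t. F (t + c)) has_vector_derivative \<phi> c) (at 0)" proof -
   have 1: "((%t. t + c) has_vector_derivative 1) (at 0)" by (auto intro!: derivative_eq_intros)
   have 2: "(F has_vector_derivative \<phi> c) (at ((%t. t + c) 0))" using F[of c] c by simp
   show ?thesis using vector_diff_chain_at[OF 1 2] by (simp add: o_def)
  qed
  then have "((%t. F (t + c) - F t) has_vector_derivative \<phi> c - \<phi> 0) (at 0)" using F[of 0] by (intro has_vector_derivative_diff) auto
  then have "((%t. (F (t + c) - F t) ** D) has_vector_derivative (\<phi> c - \<phi> 0) ** D) (at 0)" by (rule has_vector_derivative_matrix_mult_const)
  then show ?thesis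
  proof (rule has_vector_derivative_transform_within_open)
   show "open {-1<..<1::real}" "0 : {-1<..<1::real}" by auto
   fix t :: real assume t: "t : {-1<..<1}"
   have "(F (t + c) - F t) ** D = \<phi> t ** (C ** D)" unfolding shift[OF t, symmetric] by (simp add: matrix_mul_assoc)
   then show "(F (t + c) - F t) ** D = \<phi> t" using CB by (simp add: D_def)
  qed
 qed
 define X where "X = (\<phi> c - \<phi> 0) ** D"
 have der: "(\<phi> has_vector_derivative \<phi> t ** X) (at t)" for t
 proof (rule has_vector_derivative_shift)
  show "((%h. \<phi> (t + h)) has_vector_derivative \<phi> t ** X) (at 0)"
   using has_vector_derivative_matrix_mult[OF has_vector_derivative_const der0[folded X_def], of "\<phi> t"] by (simp add: hom matrix_mult_simps)
 qed
 have neg: "((%t. mexp (- (t *\<^sub>R X))) has_vector_derivative - X ** mexp (- (t *\<^sub>R X))) (at t)" for t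
  using matrix_exp_has_vector_derivative[of "- X" t UNIV] matrix_exp_commute[of "- X" t] by simp
 have z: "((%t. \<phi> t ** mexp (- (t *\<^sub>R X))) has_vector_derivative 0) (at t within UNIV)" for t
  using has_vector_derivative_matrix_mult[OF der neg] by (simp add: matrix_mult_simps matrix_mul_assoc)
 obtain k where k: "!!t. \<phi> t ** mexp (- (t *\<^sub>R X)) = k" using has_vector_derivative_zero_constant[OF convex_UNIV z] by auto
 have k1: "k = mat 1" using k[of 0] one by simp
 have "\<phi> t = mexp (t *\<^sub>R X)" for t
 proof -
  have "\<phi> t = \<phi> t ** (mexp (- (t *\<^sub>R X)) ** mexp (t *\<^sub>R X))" by simp
  also have "\<dots> = k ** mexp (t *\<^sub>R X)" by (simp only: matrix_mul_assoc k)
  finally show ?thesis by (simp add: k1)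
 qed
 then show ?thesis by (rule that)
qed

section \<open>Closed matrix groups\<close>

lemma continuous_on_matrix_inv: "continuous_on {A :: complex^'n^'n. invertible A} matrix_inv" proof (rule continuous_onI)
 fix A :: "complex^'n^'n" and e :: real
 assume A: "A : {A. invertible A}" and e: "e > 0"
 obtain K where K: "K > 0" "!!(A :: complex^'n^'n) (B :: complex^'n^'n). norm (A ** B) <= norm A * norm B * K"
  using bounded_bilinear.pos_bounded[OF bounded_bilinear_matrix_mult] by blast
 define m where "m = norm (matrix_inv A) + 1"
 have m: "m > 0" "norm (matrix_inv A) <= m" by (auto simp: m_def add_nonneg_pos)
 define d where "d = min (1 / (2 * K^2 * m)) (e / (4 * K^2 * m^2))"
 have d: "d > 0" using K m e by (simp add: d_def)
 show "\<exists>d>0. \<forall>B\<in>{A. invertible A}. dist B A < d --> dist (matrix_inv B) (matrix_inv A) <= e" proof (intro exI conjI ballI impI)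
  fix B :: "complex^'n^'n" assume B: "B : {A. invertible A}" and BA: "dist B A < d"
  define b where "b = norm (matrix_inv B)"
  have eq: "matrix_inv B - matrix_inv A = matrix_inv B ** (A - B) ** matrix_inv A" proof -
   have "matrix_inv B ** (A - B) ** matrix_inv A
     = matrix_inv B ** (A ** matrix_inv A) - (matrix_inv B ** B) ** matrix_inv A" by (simp add: matrix_mult_simps matrix_mul_assoc)
   then show ?thesis using A B by (simp add: matrix_inv_cancel)
  qed
  have le: "norm (matrix_inv B - matrix_inv A) <= K^2 * b * d * m" proof -
   have "norm (matrix_inv B - matrix_inv A) <= norm (matrix_inv B ** (A - B)) * norm (matrix_inv A) * K"
    unfolding eq using K(2)[of "matrix_inv B ** (A - B)" "matrix_inv A"] by simp
   also have "\<dots> <= (b * norm (A - B) * K) * norm (matrix_inv A) * K" using K unfolding b_def by (intro mult_right_mono K(2)) auto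
   also have "\<dots> <= (b * d * K) * m * K" using BA K m d by (intro mult_right_mono mult_mono) (auto simp: b_def dist_norm norm_minus_commute)
   finally show ?thesis by (simp add: power2_eq_square mult_ac)
  qed
  have "d <= 1 / (2 * K^2 * m)" by (simp add: d_def)
  then have "K^2 * d * m <= 1/2" using K m by (simp add: field_simps)
  then have "b * (K^2 * d * m) <= b * (1/2)" by (intro mult_left_mono) (auto simp: b_def)
  then have "norm (matrix_inv B - matrix_inv A) <= b / 2" using le by (simp add: mult_ac)
  moreover have "b <= norm (matrix_inv A) + norm (matrix_inv B - matrix_inv A)"
   unfolding b_def using norm_triangle_ineq[of "matrix_inv A" "matrix_inv B - matrix_inv A"] by simp
  ultimately have b2: "b <= 2 * m" using m by linarith
  have "d <= e / (4 * K^2 * m^2)" by (simp add: d_def)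
  then have dd: "d * (4 * K^2 * m^2) <= e" using K m by (simp add: pos_le_divide_eq)
  have "K^2 * b * d * m <= K^2 * (2 * m) * d * m" using b2 d K m by (intro mult_right_mono mult_left_mono) auto
  also have "\<dots> <= d * (4 * K^2 * m^2)" using d K m by (simp add: power2_eq_square mult_ac)
  finally show "dist (matrix_inv B) (matrix_inv A) <= e" using le dd by (simp add: dist_norm)
 qed (rule d)
qed

lemma matrix_inv_mult:
 "invertible A ==> invertible B ==> matrix_inv (A ** B) = matrix_inv B ** matrix_inv A"
 for A B :: "complex^'n^'n" proof -
 assume a: "invertible A" "invertible B"
 show ?thesis
 proof (rule matrix_inv_eqI)
  have "A ** B ** (matrix_inv B ** matrix_inv A) = A ** (B ** matrix_inv B) ** matrix_inv A" by (simp only: matrix_mul_assoc)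
  then show "A ** B ** (matrix_inv B ** matrix_inv A) = mat 1" using a by (simp add: matrix_inv_cancel)
  have "matrix_inv B ** matrix_inv A ** (A ** B) = matrix_inv B ** (matrix_inv A ** A) ** B" by (simp only: matrix_mul_assoc)
  then show "matrix_inv B ** matrix_inv A ** (A ** B) = mat 1" using a by (simp add: matrix_inv_cancel)
 qed
qed

lemma matrix_inv_inv: "invertible A ==> matrix_inv (matrix_inv A) = A"
 for A :: "complex^'n^'n" by (rule matrix_inv_eqI) (simp_all add: matrix_inv_cancel)

lemma invertible_matrix_inv: "invertible A ==> invertible (matrix_inv A)"
 for A :: "complex^'n^'n" unfolding invertible_def[of "matrix_inv A"] using matrix_inv_cancel by blast

lemma matrix_inv_one [simp]: "matrix_inv (mat 1 :: complex^'n^'n) = mat 1" by (rule matrix_inv_eqI) simp_all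

lemma Ad_mult: "invertible g ==> invertible h ==> Ad (g ** h) X = Ad g (Ad h X)" by (simp add: Ad_def matrix_inv_mult matrix_mul_assoc)

lemma Ad_one [simp]: "Ad (mat 1) X = X" by (simp add: Ad_def)

lemma Ad_exp: "invertible g ==> mexp (Ad g X) = g ** mexp X ** matrix_inv g" by (simp add: Ad_def matrix_exp_conj)

lemma linear_Ad: "linear (Ad g)" by (auto intro!: linearI simp: Ad_def matrix_mult_simps)

lemmas Ad_simps = linear_add[OF linear_Ad] linear_diff[OF linear_Ad] linear_scale[OF linear_Ad]
 linear_neg[OF linear_Ad] linear_0[OF linear_Ad]

lemma Ad_bracket: "invertible g ==> Ad g (bracket X Y) = bracket (Ad g X) (Ad g Y)" proof -
 assume g: "invertible g"
 have *: "Ad g X ** Ad g Y = g ** (X ** Y) ** matrix_inv g" for X Y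
 proof -
  have "Ad g X ** Ad g Y = g ** X ** (matrix_inv g ** g) ** Y ** matrix_inv g" unfolding Ad_def by (simp only: matrix_mul_assoc)
  also have "\<dots> = g ** (X ** Y) ** matrix_inv g" using g by (simp add: matrix_inv_cancel matrix_mul_assoc)
  finally show ?thesis .
 qed
 show ?thesis unfolding bracket_def * by (simp add: Ad_def matrix_mult_simps)
qed

lemma bounded_bilinear_bracket: "bounded_bilinear (bracket :: 'n::finite cmat => _)" unfolding bilinear_conv_bounded_bilinear[symmetric] bilinear_def bracket_def
 by (auto intro!: linearI simp: matrix_mult_simps algebra_simps)

lemmas bracket_simps =
 bounded_bilinear.add_left[OF bounded_bilinear_bracket]
 bounded_bilinear.add_right[OF bounded_bilinear_bracket]
 bounded_bilinear.diff_left[OF bounded_bilinear_bracket]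
 bounded_bilinear.diff_right[OF bounded_bilinear_bracket]
 bounded_bilinear.minus_left[OF bounded_bilinear_bracket]
 bounded_bilinear.minus_right[OF bounded_bilinear_bracket]
 bounded_bilinear.scaleR_left[OF bounded_bilinear_bracket]
 bounded_bilinear.scaleR_right[OF bounded_bilinear_bracket]
 bounded_bilinear.zero_left[OF bounded_bilinear_bracket]
 bounded_bilinear.zero_right[OF bounded_bilinear_bracket]

lemma bracket_swap: "bracket X Y = - bracket Y X" by (simp add: bracket_def)

lemma bracket_jacobi: "bracket X (bracket Y Z) = bracket (bracket X Y) Z + bracket Y (bracket X Z)" by (simp add: bracket_def matrix_mult_simps matrix_mul_assoc)

lemma Ad_exp_derivative:
 "((%s. Ad (mexp (s *\<^sub>R X)) Y) has_vector_derivative Ad (mexp (s *\<^sub>R X)) (bracket X Y)) (at s)" proof -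
 have neg: "((%t. mexp (- (t *\<^sub>R X))) has_vector_derivative - X ** mexp (- (t *\<^sub>R X))) (at t)" for t
  using matrix_exp_has_vector_derivative[of "- X" t UNIV] matrix_exp_commute[of "- X" t] by simp
 have "((%s. mexp (s *\<^sub>R X) ** Y ** mexp (- (s *\<^sub>R X))) has_vector_derivative
   mexp (s *\<^sub>R X) ** Y ** (- X ** mexp (- (s *\<^sub>R X))) +
   mexp (s *\<^sub>R X) ** X ** Y ** mexp (- (s *\<^sub>R X))) (at s)" by (intro has_vector_derivative_matrix_mult has_vector_derivative_matrix_mult_const neg
    matrix_exp_has_vector_derivative)
 then show ?thesis
  by (simp add: Ad_def bracket_def matrix_mult_simps matrix_mul_assoc)
qed

lemma Ad_exp_derivative_at_0:
 "((%s. Ad (mexp (s *\<^sub>R X)) Y) has_vector_derivative bracket X Y) (at 0)" using Ad_exp_derivative[of X Y 0] by simp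

lemma matrix_exp_has_derivative_at_0: "(mexp has_derivative (%v. v)) (at 0)" proof -
 obtain C r where C: "C > 0" "r > 0"
  "!!X :: 'n::finite cmat. norm X <= r ==> norm (mexp X - mat 1 - X) <= C * norm X ^ 2" using matrix_exp_minus_linear_le[where 'n='n] by metis
 show "((mexp :: 'n cmat => _) has_derivative (%v. v)) (at 0)" unfolding has_derivative_at_alt
 proof (intro conjI allI impI)
  fix e :: real assume e: "e > 0"
  show "\<exists>d>0. \<forall>y :: 'n cmat. norm (y - 0) < d -->
    norm (mexp y - mexp 0 - (y - 0)) <= e * norm (y - 0)" proof (intro exI conjI allI impI)
   show "min r (e / C) > 0" using C e by simp
   fix y :: "'n cmat" assume y: "norm (y - 0) < min r (e / C)"
   have "norm (mexp y - mat 1 - y) <= C * norm y ^ 2" using C(3)[of y] y by simp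
   also have "\<dots> = (C * norm y) * norm y" by (simp add: power2_eq_square)
   also have "\<dots> <= e * norm y" using y C by (intro mult_right_mono) (auto simp: field_simps)
   finally show "norm (mexp y - mexp 0 - (y - 0)) <= e * norm (y - 0)" by simp
  qed
 qed (rule bounded_linear_ident)
qed

definition exp_prod :: "('n::finite cmat => 'n cmat) list => 'n cmat => 'n cmat" where
 "exp_prod \<pi>s v = foldr (%\<pi> A. mexp (\<pi> v) ** A) \<pi>s (mat 1)"

lemma exp_prod_simps [simp]:
 "exp_prod [] v = mat 1" "exp_prod (\<pi> # \<pi>s) v = mexp (\<pi> v) ** exp_prod \<pi>s v" by (simp_all add: exp_prod_def)

lemma exp_prod_append: "exp_prod (\<pi>s @ \<rho>s) v = exp_prod \<pi>s v ** exp_prod \<rho>s v" by (induction \<pi>s) (simp_all add: matrix_mul_assoc)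

lemma exp_prod_0:
 assumes "\<forall>\<pi>\<in>set \<pi>s. linear \<pi>" shows "exp_prod \<pi>s 0 = mat 1" using assms by (induction \<pi>s) (auto simp: linear_0)

lemma exp_prod_has_derivative:
 assumes "\<forall>\<pi>\<in>set \<pi>s. linear \<pi>"
 shows "(exp_prod \<pi>s has_derivative (%v. \<Sum>\<pi>\<leftarrow>\<pi>s. \<pi> v)) (at 0)" using assms
proof (induction \<pi>s)
 case Nil
 have "exp_prod [] = (%v. mat 1)" by (simp add: fun_eq_iff)
 then show ?case by simp
next
 case (Cons \<pi> \<pi>s)
 have lin: "linear \<pi>" "\<forall>\<pi>\<in>set \<pi>s. linear \<pi>" using Cons.prems by auto
 have bl: "bounded_linear \<pi>" using lin(1) linear_conv_bounded_linear by blast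
 have "(mexp has_derivative (%v. v)) (at (\<pi> 0))" using matrix_exp_has_derivative_at_0 lin(1) by (simp add: linear_0)
 then have "((%v. mexp (\<pi> v)) has_derivative \<pi>) (at 0)" using has_derivative_compose[OF bounded_linear_imp_has_derivative[OF bl]] by blast
 then have "((%v. mexp (\<pi> v) ** exp_prod \<pi>s v) has_derivative
   (%v. mexp (\<pi> 0) ** (\<Sum>\<pi>\<leftarrow>\<pi>s. \<pi> v) + \<pi> v ** exp_prod \<pi>s 0)) (at 0)"
  by (rule bounded_bilinear.FDERIV[OF bounded_bilinear_matrix_mult _ Cons.IH[OF lin(2)]])
 moreover have "(%v. mexp (\<pi> v) ** exp_prod \<pi>s v) = exp_prod (\<pi> # \<pi>s)" by (simp add: fun_eq_iff)
 ultimately show ?case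
  using lin by (simp add: linear_0 exp_prod_0 add.commute)
qed

lemma continuous_on_exp_prod:
 assumes "\<forall>\<pi>\<in>set \<pi>s. linear \<pi>"
 shows "continuous_on S (exp_prod \<pi>s)" using assms
proof (induction \<pi>s)
 case Nil
 have "exp_prod [] = (%v. mat 1)" by (simp add: fun_eq_iff)
 then show ?case by simp
next
 case (Cons \<pi> \<pi>s)
 have "(%v. mexp (\<pi> v) ** exp_prod \<pi>s v) = exp_prod (\<pi> # \<pi>s)" by (simp add: fun_eq_iff)
 moreover have "continuous_on S (%v. mexp (\<pi> v) ** exp_prod \<pi>s v)"
  using Cons by (intro continuous_intros) (auto intro: linear_continuous_on simp: linear_conv_bounded_linear)
 ultimately show ?case by simp
qed

text \<open>The derivative at \<open>0\<close> is the identity, so the product of exponentials is open there and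
 close to the identity map.\<close>

lemma exp_prod_coordinates:
 fixes \<pi>s :: "('n::finite cmat => 'n cmat) list"
 assumes lin: "\<forall>\<pi>\<in>set \<pi>s. linear \<pi>" and sum: "!!v. (\<Sum>\<pi>\<leftarrow>\<pi>s. \<pi> v) = v"
 obtains eps where "eps > 0"
  "!!g. norm (g - mat 1) < eps ==> \<exists>v. norm v <= 2 * norm (g - mat 1) \<and> g = exp_prod \<pi>s v" proof -
 have der: "(exp_prod \<pi>s has_derivative (%v. v)) (at 0)" using exp_prod_has_derivative[OF lin] sum by simp
 then obtain d where d: "d > 0"
  "!!v. norm v < d ==> norm (exp_prod \<pi>s v - mat 1 - v) <= 1/2 * norm v"
  unfolding has_derivative_at_alt by (metis diff_zero exp_prod_0[OF lin] half_gt_zero_iff zero_less_one)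
 have "exp_prod \<pi>s 0 : interior (exp_prod \<pi>s ` ball 0 d)" by (rule sussmann_open_mapping[where S=UNIV and g'="%v. v", OF _ _ _ der])
    (use d(1) in \<open>auto intro: continuous_on_exp_prod[OF lin] bounded_linear_ident simp: fun_eq_iff interior_open\<close>)
 then obtain eps where eps: "eps > 0" "ball (mat 1) eps <= exp_prod \<pi>s ` ball 0 d" by (auto simp: mem_interior exp_prod_0[OF lin])
 show ?thesis
 proof
  fix g :: "'n cmat" assume "norm (g - mat 1) < eps"
  then have "g : ball (mat 1) eps" by (simp add: dist_norm norm_minus_commute)
  then obtain v where v: "norm v < d" "g = exp_prod \<pi>s v" using eps(2) by auto
  have "norm v - norm (g - mat 1) <= norm (g - mat 1 - v)" by (metis norm_minus_commute norm_triangle_ineq2)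
  also have "\<dots> <= 1/2 * norm v" using d(2)[OF v(1)] v(2) by simp
  finally show "\<exists>v. norm v <= 2 * norm (g - mat 1) \<and> g = exp_prod \<pi>s v" using v(2) by (intro exI[of _ v]) simp
 qed (rule eps(1))
qed

locale closed_matrix_group =
 fixes G :: "'n::finite cmat set"
 assumes lie_group: "matrix_lie_group G"
begin

abbreviation \<gg> where "\<gg> \<equiv> lie_algebra G"

lemma one_mem [simp]: "mat 1 : G"
 and mult_mem [intro]: "g : G ==> h : G ==> g ** h : G"
 and inv_mem [intro]: "g : G ==> matrix_inv g : G"
 and invertible_mem [intro]: "g : G ==> invertible g" using lie_group by (auto simp: matrix_lie_group_def matrix_subgroup_def)

lemma inv_cancel [simp]:
 assumes "g : G"
 shows "g ** matrix_inv g = mat 1" "matrix_inv g ** g = mat 1" "g ** (matrix_inv g ** A) = A"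
  "matrix_inv g ** (g ** A) = A" "A ** g ** matrix_inv g = A" "A ** matrix_inv g ** g = A"
  "matrix_inv (matrix_inv g) = g" proof -
 have g: "invertible g" using assms by auto
 show "g ** matrix_inv g = mat 1" "matrix_inv g ** g = mat 1" "matrix_inv (matrix_inv g) = g" using g by (auto simp: matrix_inv_cancel matrix_inv_inv)
 then show "g ** (matrix_inv g ** A) = A" "matrix_inv g ** (g ** A) = A" by (auto simp: matrix_mul_assoc)
 show "A ** g ** matrix_inv g = A" "A ** matrix_inv g ** g = A" using g by (auto simp: matrix_mul_assoc[symmetric] matrix_inv_cancel)
qed

lemma mult_mem_iff: "g : G ==> g ** h : G \<longleftrightarrow> h : G" using mult_mem[of "matrix_inv g" "g ** h"] by auto

lemma exp_mem: "X : \<gg> ==> mexp X : G" proof -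
 assume "X : \<gg>"
 then have "mexp (1 *\<^sub>R X) : G" unfolding lie_algebra_def by blast
 then show ?thesis by simp
qed

lemma matrix_power_mem: "A : G ==> matrix_power A n : G" by (induction n) auto

lemma limit_mem:
 assumes "!!n. A n : G" "A \<longlonglongrightarrow> L" "invertible L"
 shows "L : G" proof -
 obtain T where T: "closed T" "G = {g. invertible g} \<inter> T" using lie_group unfolding matrix_lie_group_def closedin_closed by blast
 have "L : T" using closed_sequentially[OF T(1), of A L] assms T(2) by auto
 then show ?thesis using T(2) assms(3) by auto
qed

lemma lie_algebra_curve:
 assumes mem: "!!s. \<gamma> s : G" and 0: "\<gamma> 0 = mat 1" and der: "(\<gamma> has_vector_derivative D) (at 0)"
 shows "D : \<gg>" unfolding lie_algebra_def
proof (intro CollectI allI)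
 fix t :: real
 have "(%n. real n *\<^sub>R (\<gamma> (t * (1 / real n)) - \<gamma> (t * 0))) \<longlonglongrightarrow> t *\<^sub>R D"
  by (rule has_vector_derivative_sequence[OF has_vector_derivative_scaled[OF der]])
 then have "(%n. real n *\<^sub>R (\<gamma> (t * (1 / real n)) - mat 1)) \<longlonglongrightarrow> t *\<^sub>R D" by (simp add: 0)
 then have "(%n. matrix_power (\<gamma> (t * (1 / real n))) n) \<longlonglongrightarrow> mexp (t *\<^sub>R D)" by (rule matrix_power_tendsto_exp)
 then show "mexp (t *\<^sub>R D) : G" by (rule limit_mem[rotated]) (auto intro: matrix_power_mem mem)
qed

lemma lie_algebra_scaleR: "X : \<gg> ==> c *\<^sub>R X : \<gg>" by (simp add: lie_algebra_def)

lemma exp_prod_curve_derivative: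
 "((%s. mexp (s *\<^sub>R X) ** mexp (s *\<^sub>R Y)) has_vector_derivative X + Y) (at 0)"
 using has_vector_derivative_matrix_mult[OF matrix_exp_derivative_at_0[of X] matrix_exp_derivative_at_0[of Y]] by (simp add: add.commute)

lemma subspace_lie_algebra: "subspace \<gg>" proof (rule subspaceI)
 show "0 : \<gg>" by (simp add: lie_algebra_def)
 show "c *\<^sub>R X : \<gg>" if "X : \<gg>" for c X using that by (rule lie_algebra_scaleR)
 show "X + Y : \<gg>" if "X : \<gg>" "Y : \<gg>" for X Y
  by (rule lie_algebra_curve[OF _ _ exp_prod_curve_derivative])
    (use that in \<open>auto intro: exp_mem lie_algebra_scaleR\<close>)
qed

lemma lie_algebra_Ad: "g : G ==> X : \<gg> ==> Ad g X : \<gg>" proof -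
 assume g: "g : G" and X: "X : \<gg>"
 have "mexp (t *\<^sub>R Ad g X) = g ** mexp (t *\<^sub>R X) ** matrix_inv g" for t
  using Ad_exp[of g "t *\<^sub>R X"] g by (auto simp: Ad_simps)
 then show ?thesis using g X unfolding lie_algebra_def by auto
qed

lemma lie_algebra_bracket: "X : \<gg> ==> Y : \<gg> ==> bracket X Y : \<gg>" by (rule has_vector_derivative_in_subspace[OF Ad_exp_derivative_at_0 subspace_lie_algebra])
   (auto intro: lie_algebra_Ad exp_mem lie_algebra_scaleR)

lemma linear_projection:
 obtains P :: "'n cmat => 'n cmat" where "linear P" "!!v. P v : \<gg>" "!!v. v : \<gg> ==> P v = v"
 using linear_exists_left_inverse_on[OF linear_id subspace_lie_algebra] by auto

text \<open>Elements \<open>W\<^sub>n\<close> of a complement of the Lie algebra with \<open>exp W\<^sub>n \<in> G\<close> and \<open>W\<^sub>n \<rightarrow> 0\<close> would have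
 directions that accumulate at a unit vector \<open>u\<close> of the complement, and integer multiples of \<open>W\<^sub>n\<close>
 approximate every multiple of \<open>u\<close>, so that \<open>u\<close> would lie in the Lie algebra.\<close>

lemma exp_complement_discrete:
 assumes Q: "subspace Q" "Q \<inter> \<gg> <= {0}"
 obtains r where "r > 0" "!!W. W : Q ==> norm W < r ==> mexp W : G ==> W = 0" proof (rule ccontr)
 assume neg: "\<not> thesis"
 have "\<exists>W. W : Q \<and> norm W < 1 / real (Suc n) \<and> mexp W : G \<and> W ~= 0" for n
  using neg that[of "1 / real (Suc n)"] by auto
 then obtain W where W: "!!n. W n : Q" "!!n. norm (W n) < 1 / real (Suc n)"
  "!!n. mexp (W n) : G" "!!n. W n ~= 0" by metis
 define u where "u n = W n /\<^sub>R norm (W n)" for n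
 have u: "u n : sphere 0 1" for n using W(4) by (simp add: u_def)
 obtain l r where l: "l : sphere 0 1" and r: "strict_mono r" and lim: "(u \<circ> r) \<longlonglongrightarrow> l"
  using compact_sphere[of "0::'n cmat" 1] u unfolding compact_def by metis
 have "l : Q" by (rule closed_sequentially[OF closed_subspace[OF Q(1)] _ lim])
    (simp add: u_def subspace_scale[OF Q(1)] W)
 moreover have "l : \<gg>" unfolding lie_algebra_def
 proof (intro CollectI allI)
  fix t :: real
  define k where "k n = \<lfloor>t / norm (W (r n))\<rfloor>" for n
  have W0: "(%n. norm (W (r n))) \<longlonglongrightarrow> 0" proof (rule Lim_null_comparison[OF _ lim_1_over_n[THEN LIMSEQ_Suc]])
   have "norm (norm (W (r n))) <= 1 / real (Suc n)" for n
   proof -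
    have "norm (W (r n)) <= 1 / real (Suc (r n))" using W(2) less_imp_le by blast
    also have "\<dots> <= 1 / real (Suc n)" using seq_suble[OF r, of n] by (intro divide_left_mono) auto
    finally show ?thesis by simp
   qed
   then show "\<forall>\<^sub>F n in sequentially. norm (norm (W (r n))) <= 1 / of_nat (Suc n)" by simp
  qed
  have "(%n. of_int (k n) * norm (W (r n)) - t) \<longlonglongrightarrow> 0" proof (rule Lim_null_comparison[OF _ W0])
   have "norm (of_int (k n) * norm (W (r n)) - t) <= norm (W (r n))" for n
   proof -
    have p: "norm (W (r n)) > 0" using W(4) by simp
    have "of_int (k n) <= t / norm (W (r n))" "t / norm (W (r n)) < of_int (k n) + 1" unfolding k_def by linarith+
    then have "of_int (k n) * norm (W (r n)) <= t" "t < (of_int (k n) + 1) * norm (W (r n))" using p by (simp_all add: pos_le_divide_eq pos_divide_less_eq)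
    then show ?thesis by (simp add: distrib_right)
   qed
   then show "\<forall>\<^sub>F n in sequentially. norm (of_int (k n) * norm (W (r n)) - t) <= norm (W (r n))" by simp
  qed
  then have kl: "(%n. of_int (k n) * norm (W (r n))) \<longlonglongrightarrow> t" by (simp add: LIM_zero_iff)
  have "(%n. (of_int (k n) * norm (W (r n))) *\<^sub>R (u \<circ> r) n) \<longlonglongrightarrow> t *\<^sub>R l" by (intro tendsto_scaleR kl lim)
  moreover have "(of_int (k n) * norm (W (r n))) *\<^sub>R (u \<circ> r) n = of_int (k n) *\<^sub>R W (r n)" for n
   using W(4) by (simp add: u_def)
  ultimately have conv: "(%n. of_int (k n) *\<^sub>R W (r n)) \<longlonglongrightarrow> t *\<^sub>R l" by simp
  have "isCont mexp (t *\<^sub>R l)" using continuous_on_matrix_exp[OF continuous_on_id, of "UNIV :: 'n cmat set"] by (simp add: continuous_on_eq_continuous_at)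
  then have lim': "(%n. mexp (of_int (k n) *\<^sub>R W (r n))) \<longlonglongrightarrow> mexp (t *\<^sub>R l)" by (rule isCont_tendsto_compose[OF _ conv])
  have nat: "mexp (real m *\<^sub>R W n) : G" for m n
  proof (induction m)
   case (Suc m)
   have "mexp (real (Suc m) *\<^sub>R W n) = mexp (1 *\<^sub>R W n) ** mexp (real m *\<^sub>R W n)" unfolding matrix_exp_scaleR_add[symmetric] by simp
   then show ?case using Suc W(3) by auto
  qed simp
  have "mexp (of_int j *\<^sub>R W n) : G" for j n
  proof (cases "j \<ge> 0")
   case True then show ?thesis using nat[of "nat j" n] by simp
  next
   case False
   then have "mexp (of_int j *\<^sub>R W n) = matrix_inv (mexp (real (nat (- j)) *\<^sub>R W n))" by simp
   then show ?thesis using nat[of "nat (- j)" n] by (metis inv_mem)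
  qed
  then show "mexp (t *\<^sub>R l) : G" using lim' by (rule limit_mem) simp
 qed
 ultimately show False using Q(2) l by auto
qed

text \<open>Cartan's theorem on closed subgroups: near the identity the group is parametrised by its Lie
 algebra, with the freedom to split the exponential into factors.\<close>

theorem group_exp_coordinates:
 assumes lin: "\<forall>\<pi>\<in>set \<pi>s. linear \<pi>" and mem: "\<forall>\<pi>\<in>set \<pi>s. \<forall>v\<in>\<gg>. \<pi> v : \<gg>"
  and sum: "!!v. v : \<gg> ==> (\<Sum>\<pi>\<leftarrow>\<pi>s. \<pi> v) = v"
 obtains eps C where "eps > 0" "C > 0"
  "!!g. g : G ==> norm (g - mat 1) < eps ==>
    \<exists>v\<in>\<gg>. norm v <= C * norm (g - mat 1) \<and> g = exp_prod \<pi>s v" proof -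
 obtain P where P: "linear P" "!!v. P v : \<gg>" "!!v. v : \<gg> ==> P v = v" using linear_projection by blast
 define Q where "Q v = v - P v" for v
 have linQ: "linear Q" unfolding Q_def using P(1) by (intro linear_compose_sub linear_ident)
 have subQ: "subspace (range Q)" using linQ by (intro linear_subspace_image subspace_UNIV)
 have "Q v = 0" if "Q v : \<gg>" for v
 proof -
  have "Q v = P (Q v)" using P(3)[OF that] by simp
  also have "\<dots> = 0" using P by (simp add: Q_def linear_diff[OF P(1)])
  finally show ?thesis .
 qed
 then have "range Q \<inter> \<gg> <= {0}" by auto
 then obtain r where r: "r > 0" "!!W. W : range Q ==> norm W < r ==> mexp W : G ==> W = 0" using exp_complement_discrete[OF subQ] by metis
 define \<rho>s where "\<rho>s = map (%\<pi>. \<pi> \<circ> P) \<pi>s @ [Q]"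
 have lin\<rho>: "\<forall>\<pi>\<in>set \<rho>s. linear \<pi>" using lin linQ P(1) by (auto simp: \<rho>s_def intro: linear_compose)
 have sum\<rho>: "(\<Sum>\<pi>\<leftarrow>\<rho>s. \<pi> v) = v" for v
  using sum[OF P(2)[of v]] by (simp add: \<rho>s_def Q_def o_def)
 obtain eps where eps: "eps > 0" "!!g. norm (g - mat 1) < eps ==>
   \<exists>v. norm v <= 2 * norm (g - mat 1) \<and> g = exp_prod \<rho>s v" using exp_prod_coordinates[OF lin\<rho> sum\<rho>] by metis
 obtain c where c: "c > 0" "!!v. norm (P v) <= c * norm v" using linear_bounded_pos[OF P(1)] by blast
 obtain q where q: "q > 0" "!!v. norm (Q v) <= q * norm v" using linear_bounded_pos[OF linQ] by blast
 have expP: "exp_prod (map (%\<pi>. \<pi> \<circ> P) \<pi>s) v = exp_prod \<pi>s (P v)" for v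
  by (induction \<pi>s) auto
 have exp_mem': "exp_prod \<pi>s v : G" if "v : \<gg>" for v
  using mem that by (induction \<pi>s) (auto intro: exp_mem)
 show ?thesis
 proof
  show "min eps (r / (2 * q)) > 0" "2 * c > 0" using eps r q c by auto
  fix g assume g: "g : G" and n: "norm (g - mat 1) < min eps (r / (2 * q))"
  obtain v where v: "norm v <= 2 * norm (g - mat 1)" "g = exp_prod \<rho>s v" using eps(2) n by auto
  have gv: "g = exp_prod \<pi>s (P v) ** mexp (Q v)" using v(2) by (simp add: \<rho>s_def exp_prod_append expP)
  have "matrix_inv (exp_prod \<pi>s (P v)) ** g = mexp (Q v)" using exp_mem'[OF P(2)] by (simp add: gv)
  then have "mexp (Q v) : G" using g exp_mem'[OF P(2)] by (metis mult_mem inv_mem)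
  moreover have "norm (Q v) < r" proof -
   have "norm (Q v) <= q * (2 * norm (g - mat 1))" using q v(1) by (meson mult_left_mono order_trans less_imp_le)
   also have "\<dots> < r" using n q by (simp add: field_simps)
   finally show ?thesis .
  qed
  ultimately have "Q v = 0" using r(2) by blast
  then have "g = exp_prod \<pi>s (P v)" using gv by simp
  moreover have "norm (P v) <= 2 * c * norm (g - mat 1)" proof -
   have "norm (P v) <= c * (2 * norm (g - mat 1))" using c v(1) by (meson mult_left_mono order_trans less_imp_le)
   then show ?thesis by simp
  qed
  ultimately show "\<exists>v\<in>\<gg>. norm v <= 2 * c * norm (g - mat 1) \<and> g = exp_prod \<pi>s v" using P(2) by blast
 qed
qed

lemma connected_group_induct:
 assumes conn: "connected G" and A: "A <= G" "mat 1 : A" and eps: "eps > 0"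
  and step: "!!a u. a : A ==> u : G ==> norm (u - mat 1) < eps ==> a ** u : A"
 shows "A = G" proof -
 have cont: "continuous_on G (%g. matrix_inv b ** g)" for b by (intro continuous_intros)
 have open1: "openin (top_of_set G) {g : G. matrix_inv b ** g : ball (mat 1) eps}" for b
  using continuous_openin_preimage_gen[OF cont open_ball] by (simp add: vimage_def Int_def)
 have continv: "continuous_on G matrix_inv" by (rule continuous_on_subset[OF continuous_on_matrix_inv]) auto
 have open2: "openin (top_of_set G) {g : G. matrix_inv g ** b : ball (mat 1) eps}" for b
  using continuous_openin_preimage_gen[OF continuous_on_matrix_mult[OF continv continuous_on_const] open_ball] by (simp add: vimage_def Int_def)
 have oA: "openin (top_of_set G) A" proof (subst openin_subopen, intro ballI)
  fix a assume a: "a : A"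
  then have aG: "a : G" using A by auto
  have "{g : G. matrix_inv a ** g : ball (mat 1) eps} <= A" proof (intro subsetI)
   fix g assume g: "g : {g : G. matrix_inv a ** g : ball (mat 1) eps}"
   then have "a ** (matrix_inv a ** g) : A" using aG by (intro step a) (auto simp: dist_norm norm_minus_commute)
   then show "g : A" using aG by simp
  qed
  then show "\<exists>T. openin (top_of_set G) T \<and> a : T \<and> T <= A"
   using open1[of a] aG eps by (intro exI[of _ "{g : G. matrix_inv a ** g : ball (mat 1) eps}"]) auto
 qed
 have oC: "openin (top_of_set G) (G - A)" proof (subst openin_subopen, intro ballI)
  fix b assume b: "b : G - A"
  have "{g : G. matrix_inv g ** b : ball (mat 1) eps} <= G - A" proof (intro subsetI)
   fix g assume g: "g : {g : G. matrix_inv g ** b : ball (mat 1) eps}"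
   have "g \<notin> A" proof
    assume "g : A"
    then have "g ** (matrix_inv g ** b) : A" using g b by (intro step) (auto simp: dist_norm norm_minus_commute)
    then show False using g b by simp
   qed
   then show "g : G - A" using g by auto
  qed
  then show "\<exists>T. openin (top_of_set G) T \<and> b : T \<and> T <= G - A"
   using open2[of b] b eps by (intro exI[of _ "{g : G. matrix_inv g ** b : ball (mat 1) eps}"]) auto
 qed
 have "closedin (top_of_set G) A" using oC A by (simp add: closedin_def)
 then show ?thesis using conn oA A(2) unfolding connected_clopen by auto
qed

lemma connected_group_generated:
 assumes conn: "connected G" and A: "A <= G" "mat 1 : A"
  and step: "!!a X. a : A ==> X : \<gg> ==> a ** mexp X : A"
 shows "A = G" proof -
 show ?thesis
 proof (rule group_exp_coordinates[of "[id]"])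
  fix eps C assume eps: "eps > 0" "!!g. g : G ==> norm (g - mat 1) < eps ==>
    \<exists>v\<in>\<gg>. norm v <= C * norm (g - mat 1) \<and> g = exp_prod [id] v"
  show ?thesis
  proof (rule connected_group_induct[OF conn A eps(1)])
   fix a u assume "a : A" "u : G" "norm (u - mat 1) < eps"
   with eps(2)[of u] step show "a ** u : A" by auto
  qed
 qed (auto simp: linear_id)
qed

end

section \<open>Differentials of homomorphisms\<close>

definition hom_differential :: "('n::finite cmat => 'm::finite cmat) => 'n cmat => 'm cmat" where
 "hom_differential \<phi> X = vector_derivative (%t. \<phi> (mexp (t *\<^sub>R X))) (at 0)"

lemma lie_differential_eq: "lie_differential \<phi> = hom_differential \<phi>" by (simp add: fun_eq_iff lie_differential_def hom_differential_def)

locale continuous_hom = closed_matrix_group G for G :: "'n::finite cmat set" +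
 fixes \<phi> :: "'n cmat => 'm::finite cmat"
 assumes hom_mult: "g : G ==> h : G ==> \<phi> (g ** h) = \<phi> g ** \<phi> h"
  and hom_one: "\<phi> (mat 1) = mat 1"
  and hom_continuous: "continuous_on G \<phi>"
begin

abbreviation d\<phi> where "d\<phi> \<equiv> hom_differential \<phi>"

lemma hom_inv: "g : G ==> \<phi> (matrix_inv g) = matrix_inv (\<phi> g)" proof -
 assume g: "g : G"
 have "\<phi> g ** \<phi> (matrix_inv g) = mat 1" "\<phi> (matrix_inv g) ** \<phi> g = mat 1" using g by (simp_all add: hom_mult[symmetric] inv_mem hom_one)
 then show ?thesis by (metis matrix_inv_eqI)
qed

lemma hom_invertible: "g : G ==> invertible (\<phi> g)" unfolding invertible_def by (metis hom_mult hom_one inv_cancel(1,2) inv_mem)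

lemma hom_exp_curve:
 assumes X: "X : \<gg>"
 shows "\<phi> (mexp (t *\<^sub>R X)) = mexp (t *\<^sub>R d\<phi> X)" proof -
 have mem: "mexp (t *\<^sub>R X) : G" for t using X by (auto intro: exp_mem lie_algebra_scaleR)
 have "continuous_on UNIV (%t. \<phi> (mexp (t *\<^sub>R X)))" by (rule continuous_on_compose2[OF hom_continuous]) (auto intro!: continuous_intros mem)
 then obtain Y where Y: "!!t. \<phi> (mexp (t *\<^sub>R X)) = mexp (t *\<^sub>R Y)" using continuous_one_parameter_group[of "%t. \<phi> (mexp (t *\<^sub>R X))"]
  by (auto simp: hom_one matrix_exp_scaleR_add hom_mult mem)
 have "d\<phi> X = Y" unfolding hom_differential_def Y by (rule vector_derivative_at[OF matrix_exp_derivative_at_0])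
 then show ?thesis using Y by simp
qed

lemma hom_exp: "X : \<gg> ==> \<phi> (mexp X) = mexp (d\<phi> X)" using hom_exp_curve[of X 1] by simp

lemma differential_eqI:
 assumes "!!t. \<phi> (mexp (t *\<^sub>R X)) = mexp (t *\<^sub>R Y)" shows "d\<phi> X = Y"
 unfolding hom_differential_def assms by (rule vector_derivative_at[OF matrix_exp_derivative_at_0])

lemma differential_scaleR: "X : \<gg> ==> d\<phi> (c *\<^sub>R X) = c *\<^sub>R d\<phi> X" by (rule differential_eqI) (simp add: hom_exp_curve)

lemma hom_power: "A : G ==> \<phi> (matrix_power A n) = matrix_power (\<phi> A) n" by (induction n) (auto simp: hom_one hom_mult matrix_power_mem)

lemma differential_add:
 assumes X: "X : \<gg>" and Y: "Y : \<gg>"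
 shows "d\<phi> (X + Y) = d\<phi> X + d\<phi> Y" proof (rule differential_eqI)
 fix t :: real
 define c where "c s = mexp (s *\<^sub>R (t *\<^sub>R X)) ** mexp (s *\<^sub>R (t *\<^sub>R Y))" for s
 have mem: "c s : G" for s
  using X Y unfolding c_def by (auto intro!: exp_mem lie_algebra_scaleR simp del: scaleR_scaleR)
 have pow: "(%n. matrix_power (c (1 / real n)) n) \<longlonglongrightarrow> mexp (t *\<^sub>R X + t *\<^sub>R Y)" proof (rule matrix_power_tendsto_exp)
  show "(%n. real n *\<^sub>R (c (1 / real n) - mat 1)) \<longlonglongrightarrow> t *\<^sub>R X + t *\<^sub>R Y"
   using has_vector_derivative_sequence[OF exp_prod_curve_derivative[of "t *\<^sub>R X" "t *\<^sub>R Y"]] by (simp add: c_def)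
 qed
 define c' where "c' s = mexp (s *\<^sub>R (t *\<^sub>R d\<phi> X)) ** mexp (s *\<^sub>R (t *\<^sub>R d\<phi> Y))" for s
 have \<phi>c: "\<phi> (c s) = c' s" for s
  using X Y hom_exp_curve[of X "s * t"] hom_exp_curve[of Y "s * t"] by (simp add: c_def c'_def hom_mult exp_mem lie_algebra_scaleR)
 have pow': "(%n. matrix_power (c' (1 / real n)) n) \<longlonglongrightarrow> mexp (t *\<^sub>R d\<phi> X + t *\<^sub>R d\<phi> Y)" proof (rule matrix_power_tendsto_exp)
  show "(%n. real n *\<^sub>R (c' (1 / real n) - mat 1)) \<longlonglongrightarrow> t *\<^sub>R d\<phi> X + t *\<^sub>R d\<phi> Y"
   using has_vector_derivative_sequence[OF exp_prod_curve_derivative[of "t *\<^sub>R d\<phi> X" "t *\<^sub>R d\<phi> Y"]] by (simp add: c'_def)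
 qed
 have XY: "t *\<^sub>R X + t *\<^sub>R Y : \<gg>" using X Y subspace_lie_algebra by (simp add: subspace_add subspace_scale)
 have "(%n. \<phi> (matrix_power (c (1 / real n)) n)) \<longlonglongrightarrow> \<phi> (mexp (t *\<^sub>R X + t *\<^sub>R Y))"
  by (rule continuous_on_tendsto_compose[OF hom_continuous pow exp_mem[OF XY]])
    (auto intro!: always_eventually matrix_power_mem mem)
 then have "(%n. matrix_power (c' (1 / real n)) n) \<longlonglongrightarrow> \<phi> (mexp (t *\<^sub>R X + t *\<^sub>R Y))" by (simp add: hom_power mem \<phi>c)
 then have "\<phi> (mexp (t *\<^sub>R X + t *\<^sub>R Y)) = mexp (t *\<^sub>R d\<phi> X + t *\<^sub>R d\<phi> Y)" using pow' LIMSEQ_unique by blast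
 then show "\<phi> (mexp (t *\<^sub>R (X + Y))) = mexp (t *\<^sub>R (d\<phi> X + d\<phi> Y))" by (simp add: scaleR_right_distrib)
qed

lemma differential_Ad:
 assumes g: "g : G" and X: "X : \<gg>"
 shows "d\<phi> (Ad g X) = Ad (\<phi> g) (d\<phi> X)" proof (rule differential_eqI)
 fix t :: real
 have e: "mexp (t *\<^sub>R X) : G" using X by (auto intro: exp_mem lie_algebra_scaleR)
 have "\<phi> (mexp (t *\<^sub>R Ad g X)) = \<phi> (g ** mexp (t *\<^sub>R X) ** matrix_inv g)"
  using Ad_exp[OF invertible_mem[OF g], of "t *\<^sub>R X"] by (simp add: Ad_simps)
 also have "\<dots> = \<phi> g ** mexp (t *\<^sub>R d\<phi> X) ** matrix_inv (\<phi> g)" using g e X by (simp add: hom_mult mult_mem inv_mem hom_inv hom_exp_curve)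
 also have "\<dots> = mexp (t *\<^sub>R Ad (\<phi> g) (d\<phi> X))" using Ad_exp[OF hom_invertible[OF g], of "t *\<^sub>R d\<phi> X"] by (simp add: Ad_simps)
 finally show "\<phi> (mexp (t *\<^sub>R Ad g X)) = mexp (t *\<^sub>R Ad (\<phi> g) (d\<phi> X))" .
qed

lemma linear_extension:
 obtains l where "linear l" "!!X. X : \<gg> ==> l X = d\<phi> X" proof -
 obtain P where P: "linear P" "!!v. P v : \<gg>" "!!v. v : \<gg> ==> P v = v" using linear_projection by blast
 have "linear (%v. d\<phi> (P v))" by (rule linearI) (simp_all add: linear_add[OF P(1)] linear_scale[OF P(1)] differential_add differential_scaleR P(2))
 then show ?thesis using that[of "%v. d\<phi> (P v)"] P(3) by simp
qed

lemma differential_bracket: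
 assumes X: "X : \<gg>" and Y: "Y : \<gg>"
 shows "d\<phi> (bracket X Y) = bracket (d\<phi> X) (d\<phi> Y)" proof -
 obtain l where l: "linear l" "!!X. X : \<gg> ==> l X = d\<phi> X" using linear_extension by blast
 have "bounded_linear l" using l(1) by (simp add: linear_conv_bounded_linear)
 then have "((%s. l (Ad (mexp (s *\<^sub>R X)) Y)) has_vector_derivative l (bracket X Y)) (at 0)"
  by (rule bounded_linear.has_vector_derivative) (rule Ad_exp_derivative_at_0)
 moreover have "l (Ad (mexp (s *\<^sub>R X)) Y) = Ad (mexp (s *\<^sub>R d\<phi> X)) (d\<phi> Y)" for s
 proof -
  have e: "mexp (s *\<^sub>R X) : G" using X by (auto intro: exp_mem lie_algebra_scaleR)
  show ?thesis
   using l(2)[OF lie_algebra_Ad[OF e Y]] differential_Ad[OF e Y] hom_exp_curve[OF X] by simp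
 qed
 ultimately have "((%s. Ad (mexp (s *\<^sub>R d\<phi> X)) (d\<phi> Y)) has_vector_derivative l (bracket X Y)) (at 0)" by simp
 then have "l (bracket X Y) = bracket (d\<phi> X) (d\<phi> Y)" by (rule has_vector_derivative_unique_at[OF _ Ad_exp_derivative_at_0])
 then show ?thesis using l(2)[OF lie_algebra_bracket[OF X Y]] by simp
qed

end

section \<open>Left-invariant vector fields\<close>

lemma bounded_bilinear_vector_smult: "bounded_bilinear ((*s) :: complex => complex^'w => complex^'w)" unfolding bilinear_conv_bounded_bilinear[symmetric] bilinear_def
 by (auto intro!: linearI simp: vec_eq_iff algebra_simps)

lemmas continuous_on_vector_smult [continuous_intros] =
 bounded_bilinear.continuous_on[OF bounded_bilinear_vector_smult]
lemmas bounded_linear_vector_smult = bounded_bilinear.bounded_linear_right[OF bounded_bilinear_vector_smult]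

lemma vector_smult_matrix_vector: "A *v (c *s v) = c *s (A *v v)" for A :: "complex^'w^'v" by (simp add: vec_eq_iff matrix_vector_mult_def sum_distrib_left mult_ac)

lemma mean_value_inequality:
 fixes f :: "real => 'a::real_normed_vector"
 assumes der: "!!s. \<bar>s\<bar> <= \<bar>t\<bar> ==> (f has_vector_derivative f' s) (at s)"
  and bnd: "!!s. \<bar>s\<bar> <= \<bar>t\<bar> ==> norm (f' s) <= M"
 shows "norm (f t - f 0) <= M * \<bar>t\<bar>" proof -
 have M: "M \<ge> 0" using bnd[of 0] norm_ge_zero[of "f' 0"] by linarith
 have "norm (f t - f 0) <= M * norm (t - 0)" proof (rule differentiable_bound)
  show "convex {- \<bar>t\<bar>..\<bar>t\<bar>}" "t : {- \<bar>t\<bar>..\<bar>t\<bar>}" "0 : {- \<bar>t\<bar>..\<bar>t\<bar>}" by auto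
  fix s assume s: "s : {- \<bar>t\<bar>..\<bar>t\<bar>}"
  show "(f has_derivative (%h. h *\<^sub>R f' s)) (at s within {- \<bar>t\<bar>..\<bar>t\<bar>})"
   using der[of s] s unfolding has_vector_derivative_def by (auto intro: has_derivative_at_withinI)
  show "onorm (%h. h *\<^sub>R f' s) <= M" proof (rule onorm_le)
   fix h :: real
   have "norm (f' s) <= M" using bnd[of s] s by auto
   then show "norm (h *\<^sub>R f' s) <= M * norm h" by (simp add: mult.commute[of M] mult_left_mono)
  qed
 qed
 then show ?thesis by simp
qed

lemma mean_value_linearization:
 fixes f :: "real => 'a::real_normed_vector"
 assumes der: "!!s. \<bar>s\<bar> <= \<bar>t\<bar> ==> (f has_vector_derivative f' s) (at s)"
  and bnd: "!!s. \<bar>s\<bar> <= \<bar>t\<bar> ==> norm (f' s - D) <= M"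
 shows "norm (f t - f 0 - t *\<^sub>R D) <= M * \<bar>t\<bar>" proof -
 have "norm ((%s. f s - s *\<^sub>R D) t - (%s. f s - s *\<^sub>R D) 0) <= M * \<bar>t\<bar>" proof (rule mean_value_inequality)
  show "((%s. f s - s *\<^sub>R D) has_vector_derivative f' s - D) (at s)" if "\<bar>s\<bar> <= \<bar>t\<bar>" for s
   using der[OF that] by (auto intro!: derivative_eq_intros has_vector_derivative_diff)
 qed (rule bnd)
 then show ?thesis by (simp add: algebra_simps)
qed

lemma Ck_on_group_continuous: "Ck_on_group G k f ==> continuous_on G f" by (cases k) auto

definition smooth_functions :: "'n::finite cmat set => ('n cmat => complex^'w::finite) set" where
 "smooth_functions G = {f. smooth_on_group G f \<and> (\<forall>x. x \<notin> G --> f x = 0)}"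

context closed_matrix_group
begin

lemma exp_scaleR_mem [intro]: "X : \<gg> ==> mexp (t *\<^sub>R X) : G" by (auto intro: exp_mem lie_algebra_scaleR)

lemma Ck_cong:
 "(!!g. g : G ==> f g = f' g) ==> Ck_on_group G k f = Ck_on_group G k f'" proof (induction k arbitrary: f f')
 case 0
 then show ?case by (simp cong: continuous_on_cong)
next
 case (Suc k)
 have c: "continuous_on G f = continuous_on G f'" using Suc.prems by (simp cong: continuous_on_cong)
 have e: "(%t. f (g ** mexp (t *\<^sub>R X))) = (%t. f' (g ** mexp (t *\<^sub>R X)))"
  if "X : \<gg>" "g : G" for X g
  using that Suc.prems by (auto simp: fun_eq_iff)
 then have "Ck_on_group G k (right_deriv X f) = Ck_on_group G k (right_deriv X f')" if "X : \<gg>" for X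
  using that by (intro Suc.IH) (simp add: right_deriv_def)
 then show ?case using c e by (auto cong: ball_cong)
qed

lemma smooth_right_deriv: "smooth_on_group G f ==> X : \<gg> ==> smooth_on_group G (right_deriv X f)" unfolding smooth_on_group_def by (metis Ck_on_group.simps(2))

lemma smooth_continuous: "smooth_on_group G f ==> continuous_on G f" unfolding smooth_on_group_def using Ck_on_group_continuous by blast

lemma smooth_differentiable:
 "smooth_on_group G f ==> X : \<gg> ==> g : G ==> (%t. f (g ** mexp (t *\<^sub>R X))) differentiable (at 0)" unfolding smooth_on_group_def by (metis Ck_on_group.simps(2))

lemma right_deriv_at_0:
 assumes "smooth_on_group G f" "X : \<gg>" "g : G"
 shows "((%t. f (g ** mexp (t *\<^sub>R X))) has_vector_derivative right_deriv X f g) (at 0)"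
 using smooth_differentiable[OF assms] unfolding right_deriv_def by (simp add: vector_derivative_works)

lemma right_deriv_at:
 assumes "smooth_on_group G f" "X : \<gg>" "g : G"
 shows "((%t. f (g ** mexp (t *\<^sub>R X))) has_vector_derivative
  right_deriv X f (g ** mexp (t *\<^sub>R X))) (at t)" proof (rule has_vector_derivative_shift)
 show "((%h. f (g ** mexp ((t + h) *\<^sub>R X))) has_vector_derivative
   right_deriv X f (g ** mexp (t *\<^sub>R X))) (at 0)" using right_deriv_at_0[OF assms(1,2), of "g ** mexp (t *\<^sub>R X)"] assms
  by (auto simp: matrix_exp_scaleR_add matrix_mul_assoc)
qed

lemma right_deriv_eqI:
 "((%t. f (g ** mexp (t *\<^sub>R X))) has_vector_derivative D) (at 0) ==> right_deriv X f g = D" unfolding right_deriv_def by (rule vector_derivative_at)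

lemma Ck_left_translate: "a : G ==> Ck_on_group G k f ==> Ck_on_group G k (%x. f (a ** x))" proof (induction k arbitrary: f)
 case 0
 then show ?case
  by (auto intro!: continuous_on_compose2[of G f] continuous_intros)
next
 case (Suc k)
 have "continuous_on G (%x. f (a ** x))" using Suc.prems Ck_on_group_continuous[OF Suc.prems(2)] by (auto intro!: continuous_on_compose2[of G f] continuous_intros)
 moreover have "right_deriv X (%x. f (a ** x)) = (%x. right_deriv X f (a ** x))" for X
  by (simp add: right_deriv_def fun_eq_iff matrix_mul_assoc)
 moreover have "(%t. f (a ** (g ** mexp (t *\<^sub>R X)))) = (%t. f (a ** g ** mexp (t *\<^sub>R X)))" for g X
  by (simp add: matrix_mul_assoc)
 ultimately show ?case using Suc by (auto simp: mult_mem)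
qed

lemma right_deriv_left_translate: "right_deriv X (%x. f (a ** x)) = (%x. right_deriv X f (a ** x))" by (simp add: right_deriv_def fun_eq_iff matrix_mul_assoc)

lemma right_translate_curve:
 assumes "h : G"
 shows "f (g ** mexp (t *\<^sub>R X) ** h) = f (g ** h ** mexp (t *\<^sub>R Ad (matrix_inv h) X))" proof -
 have "h ** mexp (t *\<^sub>R Ad (matrix_inv h) X) = mexp (t *\<^sub>R X) ** h" using Ad_exp[OF invertible_mem[OF inv_mem[OF assms]], of "t *\<^sub>R X"] assms
  by (simp add: Ad_simps matrix_mul_assoc)
 then show ?thesis by (metis matrix_mul_assoc)
qed

lemma right_deriv_right_translate:
 assumes "h : G"
 shows "right_deriv X (%x. f (x ** h)) g = right_deriv (Ad (matrix_inv h) X) f (g ** h)" unfolding right_deriv_def right_translate_curve[OF assms] ..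

lemma Ck_right_translate: "h : G ==> Ck_on_group G k f ==> Ck_on_group G k (%x. f (x ** h))" proof (induction k arbitrary: f)
 case 0
 then show ?case
  by (auto intro!: continuous_on_compose2[of G f] continuous_intros)
next
 case (Suc k)
 have "continuous_on G (%x. f (x ** h))" using Suc.prems Ck_on_group_continuous[OF Suc.prems(2)] by (auto intro!: continuous_on_compose2[of G f] continuous_intros)
 moreover have "right_deriv X (%x. f (x ** h)) = (%x. right_deriv (Ad (matrix_inv h) X) f (x ** h))" for X
  by (rule ext, rule right_deriv_right_translate[OF Suc.prems(1)])
 moreover have "(%t. f (g ** mexp (t *\<^sub>R X) ** h)) = (%t. f (g ** h ** mexp (t *\<^sub>R Ad (matrix_inv h) X)))" for g X
  by (rule ext, rule right_translate_curve[OF Suc.prems(1)])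
 ultimately show ?case
  using Suc by (simp add: lie_algebra_Ad inv_mem mult_mem)
qed

lemma smooth_left_translate: "a : G ==> smooth_on_group G f ==> smooth_on_group G (%x. f (a ** x))"
 and smooth_right_translate: "h : G ==> smooth_on_group G f ==> smooth_on_group G (%x. f (x ** h))"
 unfolding smooth_on_group_def using Ck_left_translate Ck_right_translate by blast+

lemma right_deriv_bounded_linear:
 assumes "bounded_linear T" "smooth_on_group G f" "X : \<gg>" "g : G"
 shows "right_deriv X (%x. T (f x)) g = T (right_deriv X f g)" by (rule right_deriv_eqI, rule bounded_linear.has_vector_derivative[OF assms(1)])
   (rule right_deriv_at_0[OF assms(2-4)])

lemma right_deriv_fun_add:
 assumes "smooth_on_group G f" "smooth_on_group G f'" "X : \<gg>" "g : G"
 shows "right_deriv X (%x. f x + f' x) g = right_deriv X f g + right_deriv X f' g" by (rule right_deriv_eqI, rule has_vector_derivative_add)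
   (use assms in \<open>auto intro: right_deriv_at_0\<close>)

lemma Ck_bounded_linear:
 "bounded_linear T ==> smooth_on_group G f ==> Ck_on_group G k (%x. T (f x))" proof (induction k arbitrary: f)
 case 0
 then show ?case by (auto intro: bounded_linear.continuous_on smooth_continuous)
next
 case (Suc k)
 have "Ck_on_group G k (right_deriv X (%x. T (f x)))" if X: "X : \<gg>" for X
  using Suc.IH[OF Suc.prems(1) smooth_right_deriv[OF Suc.prems(2) X]]
   right_deriv_bounded_linear[OF Suc.prems X] Ck_cong[of "right_deriv X (%x. T (f x))" "%x. T (right_deriv X f x)"] by simp
 moreover have "(%t. T (f (g ** mexp (t *\<^sub>R X)))) differentiable (at 0)" if "X : \<gg>" "g : G" for X g
  using bounded_linear.has_vector_derivative[OF Suc.prems(1) right_deriv_at_0[OF Suc.prems(2) that]] by (rule differentiableI_vector)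
 ultimately show ?case
  using Suc.prems by (auto intro: bounded_linear.continuous_on smooth_continuous)
qed

lemma Ck_fun_add:
 "smooth_on_group G f ==> smooth_on_group G f' ==> Ck_on_group G k (%x. f x + f' x)" proof (induction k arbitrary: f f')
 case 0
 then show ?case by (auto intro: continuous_on_add smooth_continuous)
next
 case (Suc k)
 have "Ck_on_group G k (right_deriv X (%x. f x + f' x))" if X: "X : \<gg>" for X
  using Suc.IH[OF smooth_right_deriv[OF Suc.prems(1) X] smooth_right_deriv[OF Suc.prems(2) X]]
   right_deriv_fun_add[OF Suc.prems X]
   Ck_cong[of "right_deriv X (%x. f x + f' x)" "%x. right_deriv X f x + right_deriv X f' x"] by simp
 moreover have "(%t. f (g ** mexp (t *\<^sub>R X)) + f' (g ** mexp (t *\<^sub>R X))) differentiable (at 0)"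
  if "X : \<gg>" "g : G" for X g
  using has_vector_derivative_add[OF right_deriv_at_0[OF Suc.prems(1) that] right_deriv_at_0[OF Suc.prems(2) that]] by (rule differentiableI_vector)
 ultimately show ?case
  using Suc.prems by (auto intro: continuous_on_add smooth_continuous)
qed

lemma smooth_bounded_linear: "bounded_linear T ==> smooth_on_group G f ==> smooth_on_group G (%x. T (f x))"
 and smooth_add: "smooth_on_group G f ==> smooth_on_group G f' ==> smooth_on_group G (%x. f x + f' x)"
 using Ck_bounded_linear Ck_fun_add by (auto simp: smooth_on_group_def)

lemma right_deriv_scaleR:
 assumes "smooth_on_group G f" "X : \<gg>" "g : G"
 shows "right_deriv (c *\<^sub>R X) f g = c *\<^sub>R right_deriv X f g" proof (rule right_deriv_eqI)
 show "((%t. f (g ** mexp (t *\<^sub>R c *\<^sub>R X))) has_vector_derivative c *\<^sub>R right_deriv X f g) (at 0)"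
  using has_vector_derivative_scaled[OF right_deriv_at_0[OF assms], of c] by (simp add: mult.commute)
qed

lemma curve_near:
 assumes "\<rho> > 0"
 obtains \<delta> where "\<delta> > 0" "!!p s. norm (p - g) < \<delta> ==> \<bar>s\<bar> < \<delta> ==> norm (p ** mexp (s *\<^sub>R X) - g) < \<rho>" proof -
 have "continuous_on UNIV (%(p, s). p ** mexp (s *\<^sub>R X))" unfolding split_beta by (intro continuous_intros)
 from this[unfolded continuous_on_iff, rule_format, of "(g, 0::real)" \<rho>] obtain d where d: "d > 0"
  "!!z. dist z (g, 0::real) < d ==> dist ((%(p, s). p ** mexp (s *\<^sub>R X)) z) g < \<rho>" using assms by auto
 show ?thesis
 proof
  show "d / 2 > 0" using d by simp
  fix p s assume ps: "norm (p - g) < d / 2" "\<bar>s\<bar> < d / 2"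
  have "dist (p, s) (g, 0::real) <= dist p g + dist s 0" unfolding dist_prod_def fst_conv snd_conv by (rule sqrt_sum_squares_le_sum) auto
  also have "\<dots> < d" using ps by (simp add: dist_norm)
  finally show "norm (p ** mexp (s *\<^sub>R X) - g) < \<rho>" using d(2)[of "(p, s)"] by (simp add: dist_norm)
 qed
qed

lemma continuous_locally:
 fixes f :: "'n cmat => complex^'w"
 assumes "continuous_on G f" "g : G" "e > 0"
 obtains \<rho> where "\<rho> > 0" "!!x. x : G ==> norm (x - g) < \<rho> ==> norm (f x - f g) < e" using assms unfolding continuous_on_iff dist_norm by metis

text \<open>A derivative along a fixed direction controls increments in that direction only, so increments
 in general are split into steps along finitely many fixed directions.\<close>

lemma local_lipschitz_directions:
 fixes f :: "'n cmat => complex^'w"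
 assumes f: "smooth_on_group G f" and g: "g : G" and X: "!!i. X i : \<gg>"
 shows "\<exists>\<delta>>0. \<exists>M\<ge>0. \<forall>p\<in>G. \<forall>v. norm (p - g) < \<delta> --> norm v < \<delta> -->
  set bs <= Basis -->
  norm (f (p ** exp_prod (map (%i v. (v \<bullet> i) *\<^sub>R X i) bs) v) - f p) <= M * norm v" proof (induction bs)
 case Nil
 show ?case by (intro exI[of _ 1] exI[of _ 0]) auto
next
 case (Cons i bs)
 from Cons.IH obtain \<delta>1 M1 where \<delta>1: "\<delta>1 > 0" and M1: "M1 \<ge> 0"
  and bound: "\<forall>p\<in>G. \<forall>v. norm (p - g) < \<delta>1 --> norm v < \<delta>1 --> set bs <= Basis -->
   norm (f (p ** exp_prod (map (%i v. (v \<bullet> i) *\<^sub>R X i) bs) v) - f p) <= M1 * norm v" by (elim exE conjE)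
 note IH = \<delta>1 M1 bound[rule_format]
 obtain \<rho> where \<rho>: "\<rho> > 0"
  "!!x. x : G ==> norm (x - g) < \<rho> ==> norm (right_deriv (X i) f x - right_deriv (X i) f g) < 1"
  by (rule continuous_locally[OF smooth_continuous[OF smooth_right_deriv[OF f X[of i]]] g zero_less_one]) (rule that)
 define M2 where "M2 = norm (right_deriv (X i) f g) + 1"
 have M2: "norm (right_deriv (X i) f x) <= M2" if "x : G" "norm (x - g) < \<rho>" for x
  using \<rho>(2)[OF that] norm_triangle_ineq2[of "right_deriv (X i) f x" "right_deriv (X i) f g"] by (simp add: M2_def)
 obtain \<delta>2 where \<delta>2: "\<delta>2 > 0" "!!p s. norm (p - g) < \<delta>2 ==> \<bar>s\<bar> < \<delta>2 ==>
   norm (p ** mexp (s *\<^sub>R X i) - g) < min \<delta>1 \<rho>" by (rule curve_near[of "min \<delta>1 \<rho>" g "X i"]) (use IH(1) \<rho>(1) in auto)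
 show ?case
 proof (rule exI[of _ "min \<delta>1 \<delta>2"], rule conjI, goal_cases)
  case 1
  show ?case using IH(1) \<delta>2(1) by simp
 next
  case 2
  show ?case
 proof (rule exI[of _ "M1 + M2"], intro conjI ballI allI impI)
  show "M1 + M2 \<ge> 0" using IH(2) by (simp add: M2_def)
  fix p v :: "'n cmat" assume p: "p : G" "norm (p - g) < min \<delta>1 \<delta>2" and v: "norm v < min \<delta>1 \<delta>2"
   and sub: "set (i # bs) <= Basis"
  define t where "t = v \<bullet> i"
  have t: "\<bar>t\<bar> <= norm v" using sub by (simp add: t_def Basis_le_norm)
  define p' where "p' = p ** mexp (t *\<^sub>R X i)"
  have p': "p' : G" "norm (p' - g) < \<delta>1" proof -
   show "p' : G" using p(1) X by (auto simp: p'_def)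
   have "norm (p ** mexp (t *\<^sub>R X i) - g) < min \<delta>1 \<rho>" using p t v by (intro \<delta>2(2)) auto
   then show "norm (p' - g) < \<delta>1" by (simp add: p'_def)
  qed
  have 1: "norm (f (p' ** exp_prod (map (%i v. (v \<bullet> i) *\<^sub>R X i) bs) v) - f p') <= M1 * norm v" using IH(3)[OF p'] v sub by simp
  have "norm (f (p ** mexp (t *\<^sub>R X i)) - f (p ** mexp (0 *\<^sub>R X i))) <= M2 * \<bar>t\<bar>" proof (rule mean_value_inequality)
   fix s assume s: "\<bar>s\<bar> <= \<bar>t\<bar>"
   show "((%t. f (p ** mexp (t *\<^sub>R X i))) has_vector_derivative
     right_deriv (X i) f (p ** mexp (s *\<^sub>R X i))) (at s)" by (rule right_deriv_at[OF f X p(1)])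
   show "norm (right_deriv (X i) f (p ** mexp (s *\<^sub>R X i))) <= M2" proof (rule M2)
    show "p ** mexp (s *\<^sub>R X i) : G" using p(1) X by auto
    have "norm (p ** mexp (s *\<^sub>R X i) - g) < min \<delta>1 \<rho>" using p s t v by (intro \<delta>2(2)) auto
    then show "norm (p ** mexp (s *\<^sub>R X i) - g) < \<rho>" by simp
   qed
  qed
  then have 2: "norm (f p' - f p) <= M2 * norm v" proof -
   have "M2 * \<bar>t\<bar> <= M2 * norm v" using t by (intro mult_left_mono) (auto simp: M2_def)
   then show ?thesis using \<open>norm (f (p ** mexp (t *\<^sub>R X i)) - f (p ** mexp (0 *\<^sub>R X i))) <= M2 * \<bar>t\<bar>\<close> by (simp add: p'_def)
  qed
  have "f (p ** exp_prod (map (%i v. (v \<bullet> i) *\<^sub>R X i) (i # bs)) v) - f p =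
    (f (p' ** exp_prod (map (%i v. (v \<bullet> i) *\<^sub>R X i) bs) v) - f p') + (f p' - f p)" by (simp add: p'_def t_def matrix_mul_assoc)
  then show "norm (f (p ** exp_prod (map (%i v. (v \<bullet> i) *\<^sub>R X i) (i # bs)) v) - f p) <= (M1 + M2) * norm v"
   using norm_triangle_mono[OF 1 2] by (simp add: distrib_right)
 qed
 qed
qed

lemma projection_basis:
 obtains E :: "'n cmat => 'n cmat" where "!!i. E i : \<gg>" "!!v. v : \<gg> ==> (\<Sum>i\<in>Basis. (v \<bullet> i) *\<^sub>R E i) = v" proof -
 obtain P where P: "linear P" "!!v. P v : \<gg>" "!!v. v : \<gg> ==> P v = v" using linear_projection by blast
 have "(\<Sum>i\<in>Basis. (v \<bullet> i) *\<^sub>R P i) = v" if "v : \<gg>" for v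
 proof -
  have "P v = P (\<Sum>i\<in>Basis. (v \<bullet> i) *\<^sub>R i)" by (simp add: euclidean_representation)
  also have "\<dots> = (\<Sum>i\<in>Basis. (v \<bullet> i) *\<^sub>R P i)" by (simp add: linear_sum[OF P(1)] linear_scale[OF P(1)])
  finally show ?thesis using P(3)[OF that] by simp
 qed
 then show ?thesis using that P(2) by blast
qed

lemma second_kind_coordinates:
 obtains E :: "'n cmat => 'n cmat" and bs eps C where "!!i. E i : \<gg>" "set bs = Basis" "eps > 0" "C > 0"
  "!!g. g : G ==> norm (g - mat 1) < eps ==>
    \<exists>v\<in>\<gg>. norm v <= C * norm (g - mat 1) \<and> g = exp_prod (map (%i v. (v \<bullet> i) *\<^sub>R E i) bs) v" proof -
 obtain E where E: "!!i. E i : \<gg>" "!!v. v : \<gg> ==> (\<Sum>i\<in>Basis. (v \<bullet> i) *\<^sub>R E i) = v" by (rule projection_basis) (rule that)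
 obtain bs :: "'n cmat list" where ds: "set bs = Basis" "distinct bs" using finite_distinct_list[OF finite_Basis] by blast
 show ?thesis
 proof (rule group_exp_coordinates[of "map (%i v. (v \<bullet> i) *\<^sub>R E i) bs"])
  show "\<forall>\<pi>\<in>set (map (%i v. (v \<bullet> i) *\<^sub>R E i) bs). linear \<pi>" by (auto intro!: linearI simp: inner_add_left scaleR_left_distrib)
  show "\<forall>\<pi>\<in>set (map (%i v. (v \<bullet> i) *\<^sub>R E i) bs). \<forall>v\<in>\<gg>. \<pi> v : \<gg>" using E(1) by (auto intro: lie_algebra_scaleR)
  show "(\<Sum>\<pi>\<leftarrow>map (%i v. (v \<bullet> i) *\<^sub>R E i) bs. \<pi> v) = v" if "v : \<gg>" for v
   using E(2)[OF that] ds by (simp add: sum_list_distinct_conv_sum_set o_def)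
 next
  fix eps C :: real assume "eps > 0" "C > 0"
   "!!g. g : G ==> norm (g - mat 1) < eps ==>
    \<exists>v\<in>\<gg>. norm v <= C * norm (g - mat 1) \<and> g = exp_prod (map (%i v. (v \<bullet> i) *\<^sub>R E i) bs) v"
  then show thesis by (rule that[OF E(1) ds(1)])
 qed
qed

lemma local_lipschitz:
 fixes f :: "'n cmat => complex^'w"
 assumes f: "smooth_on_group G f" and g: "g : G"
 obtains \<delta> M where "\<delta> > 0" "M \<ge> 0" "!!p u. p : G ==> u : G ==> norm (p - g) < \<delta> ==> norm (u - mat 1) < \<delta> ==>
  norm (f (p ** u) - f p) <= M * norm (u - mat 1)" proof -
 obtain E bs eps C where E: "!!i. E i : \<gg>" "set bs = Basis" and eps: "eps > 0" "C > 0"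
  "!!g. g : G ==> norm (g - mat 1) < eps ==>
    \<exists>v\<in>\<gg>. norm v <= C * norm (g - mat 1) \<and> g = exp_prod (map (%i v. (v \<bullet> i) *\<^sub>R E i) bs) v"
  by (rule second_kind_coordinates) (rule that)
 from local_lipschitz_directions[where X=E and bs=bs, OF f g E(1)]
 obtain \<delta> M where \<delta>pos: "\<delta> > 0" and Mpos: "M \<ge> 0"
  and bound: "\<forall>p\<in>G. \<forall>v. norm (p - g) < \<delta> --> norm v < \<delta> --> set bs <= Basis -->
   norm (f (p ** exp_prod (map (%i v. (v \<bullet> i) *\<^sub>R E i) bs) v) - f p) <= M * norm v" by (elim exE conjE)
 note \<delta> = \<delta>pos Mpos bound[rule_format]
 show ?thesis
 proof
  show "min \<delta> (min eps (\<delta> / C)) > 0" "M * C \<ge> 0" using \<delta>(1,2) eps(1,2) by auto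
  fix p u assume p: "p : G" "norm (p - g) < min \<delta> (min eps (\<delta> / C))"
   and u: "u : G" "norm (u - mat 1) < min \<delta> (min eps (\<delta> / C))"
  obtain v where v: "norm v <= C * norm (u - mat 1)" "u = exp_prod (map (%i v. (v \<bullet> i) *\<^sub>R E i) bs) v" using eps(3)[OF u(1)] u(2) by auto
  have "C * norm (u - mat 1) < \<delta>" using u(2) eps(2) by (simp add: field_simps)
  then have "norm (f (p ** u) - f p) <= M * norm v" using \<delta>(3)[of p v] p v E(2) by simp
  also have "\<dots> <= M * (C * norm (u - mat 1))" using \<delta>(2) v(1) by (rule mult_left_mono[rotated])
  finally show "norm (f (p ** u) - f p) <= M * C * norm (u - mat 1)" by (simp add: mult.assoc)
 qed
qed

text \<open>A curve \<open>\<gamma>\<close> with initial velocity \<open>g ** X\<close> differs from \<open>g ** exp (t X)\<close> by right factors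
 \<open>1 + o(t)\<close>.\<close>

lemma right_deriv_chain:
 assumes f: "smooth_on_group G f" and X: "X : \<gg>"
  and mem: "!!t. \<gamma> t : G" and der: "(\<gamma> has_vector_derivative \<gamma> 0 ** X) (at 0)"
 shows "((%t. f (\<gamma> t)) has_vector_derivative right_deriv X f (\<gamma> 0)) (at 0)" proof -
 define g where "g = \<gamma> 0"
 have g: "g : G" using mem by (simp add: g_def)
 define p where "p t = g ** mexp (t *\<^sub>R X)" for t
 define u where "u t = mexp (- (t *\<^sub>R X)) ** (matrix_inv g ** \<gamma> t)" for t
 have p: "p t : G" for t using g X by (auto simp: p_def)
 have u: "u t : G" for t using g X mem exp_scaleR_mem[OF X, of "- t"] by (auto simp: u_def)
 have pu: "p t ** u t = \<gamma> t" for t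
 proof -
  have "p t ** u t = g ** ((mexp (t *\<^sub>R X) ** mexp (- (t *\<^sub>R X))) ** (matrix_inv g ** \<gamma> t))" unfolding p_def u_def by (simp only: matrix_mul_assoc)
  then show ?thesis using g by simp
 qed
 have neg: "((%t. mexp (- (t *\<^sub>R X))) has_vector_derivative - X) (at 0)" using matrix_exp_derivative_at_0[of "- X"] by simp
 have "((%t. matrix_inv g ** \<gamma> t) has_vector_derivative matrix_inv g ** (g ** X)) (at 0)"
  using der unfolding g_def by (rule has_vector_derivative_const_matrix_mult)
 then have "((%t. matrix_inv g ** \<gamma> t) has_vector_derivative X) (at 0)" using g by simp
 then have "(u has_vector_derivative
   mexp (- (0 *\<^sub>R X)) ** X + (- X) ** (matrix_inv g ** \<gamma> 0)) (at 0)" unfolding u_def by (rule has_vector_derivative_matrix_mult[OF neg])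
 moreover have "matrix_inv g ** \<gamma> 0 = mat 1" using g unfolding g_def[symmetric] by simp
 ultimately have du: "(u has_vector_derivative 0) (at 0)" by (simp add: matrix_mult_simps)
 have u0: "u 0 = mat 1" using \<open>matrix_inv g ** \<gamma> 0 = mat 1\<close> by (simp add: u_def)
 obtain \<delta> M where \<delta>: "\<delta> > 0" "M \<ge> 0" "!!p u. p : G ==> u : G ==> norm (p - g) < \<delta> ==>
   norm (u - mat 1) < \<delta> ==> norm (f (p ** u) - f p) <= M * norm (u - mat 1)" by (rule local_lipschitz[OF f g]) (rule that)
 have diff0: "((%t. f (p t ** u t) - f (p t)) has_vector_derivative 0) (at 0)" unfolding has_vector_derivative_def has_derivative_at_alt
 proof (intro conjI allI impI)
  show "bounded_linear (%h::real. h *\<^sub>R (0::complex^'a))" by simp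
  fix e :: real assume e: "e > 0"
  define e' where "e' = min 1 (e / (M + 1))"
  have e': "e' > 0" "M * e' <= e" "e' <= 1" proof -
   show "e' > 0" "e' <= 1" using e \<delta>(2) by (auto simp: e'_def)
   have "M * e' <= M * (e / (M + 1))" using \<delta>(2) by (intro mult_left_mono) (auto simp: e'_def)
   also have "\<dots> = e * (M / (M + 1))" by simp
   also have "\<dots> <= e * 1" using e \<delta>(2) by (intro mult_left_mono) (auto simp: field_simps)
   finally show "M * e' <= e" by simp
  qed
  obtain d1 where d1: "d1 > 0" "!!t. norm t < d1 ==> norm (u t - mat 1) <= e' * norm t"
   using du[unfolded has_vector_derivative_def has_derivative_at_alt, THEN conjunct2, rule_format, OF e'(1)] by (auto simp: u0)
  obtain d2 where d2: "d2 > 0" "!!q s. norm (q - g) < d2 ==> \<bar>s\<bar> < d2 ==> norm (q ** mexp (s *\<^sub>R X) - g) < \<delta>"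
   by (rule curve_near[OF \<delta>(1)]) (rule that)
  show "\<exists>d>0. \<forall>y::real. norm (y - 0) < d -->
    norm (f (p y ** u y) - f (p y) - (f (p 0 ** u 0) - f (p 0)) - (y - 0) *\<^sub>R 0) <= e * norm (y - 0)"
  proof (intro exI[of _ "min d1 (min d2 \<delta>)"] conjI allI impI)
   show "min d1 (min d2 \<delta>) > 0" using d1 d2 \<delta> by simp
   fix y :: real assume y: "norm (y - 0) < min d1 (min d2 \<delta>)"
   have a: "norm (u y - mat 1) <= e' * norm y" using d1 y by simp
   also have "\<dots> <= 1 * norm y" using e' by (intro mult_right_mono) auto
   also have "\<dots> < \<delta>" using y by simp
   finally have b: "norm (u y - mat 1) < \<delta>" .
   have c: "norm (p y - g) < \<delta>" using d2(2)[of g y] d2(1) y by (simp add: p_def)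
   have "norm (f (p y ** u y) - f (p y)) <= M * norm (u y - mat 1)" by (rule \<delta>(3)[OF p u c b])
   also have "\<dots> <= M * (e' * norm y)" using a \<delta>(2) by (rule mult_left_mono)
   also have "\<dots> <= e * norm y" using e'(2) by (simp add: mult.assoc[symmetric] mult_right_mono)
   finally show "norm (f (p y ** u y) - f (p y) - (f (p 0 ** u 0) - f (p 0)) - (y - 0) *\<^sub>R 0) <= e * norm (y - 0)" by (simp add: u0)
  qed
 qed
 have "((%t. (f (p t ** u t) - f (p t)) + f (p t)) has_vector_derivative 0 + right_deriv X f g) (at 0)"
  unfolding p_def by (intro has_vector_derivative_add right_deriv_at_0[OF f X g] diff0[unfolded p_def])
 then show ?thesis by (simp add: pu g_def)
qed

lemma right_deriv_add:
 assumes f: "smooth_on_group G f" and X: "X : \<gg>" and Y: "Y : \<gg>" and g: "g : G"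
 shows "right_deriv (X + Y) f g = right_deriv X f g + right_deriv Y f g" proof -
 define q where "q t = g ** mexp (t *\<^sub>R X)" for t
 have q: "q t : G" for t using g X by (auto simp: q_def)
 have XY: "X + Y : \<gg>" using X Y subspace_lie_algebra by (simp add: subspace_add)
 define \<gamma> where "\<gamma> t = g ** (mexp (t *\<^sub>R X) ** mexp (t *\<^sub>R Y))" for t
 have \<gamma>q: "\<gamma> t = q t ** mexp (t *\<^sub>R Y)" for t by (simp add: \<gamma>_def q_def matrix_mul_assoc)
 have \<gamma>0: "\<gamma> 0 = g" by (simp add: \<gamma>_def)
 have "(\<gamma> has_vector_derivative g ** (X + Y)) (at 0)" unfolding \<gamma>_def by (rule has_vector_derivative_const_matrix_mult[OF exp_prod_curve_derivative])
 then have 1: "((%t. f (\<gamma> t)) has_vector_derivative right_deriv (X + Y) f g) (at 0)"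
  using right_deriv_chain[OF f XY, of \<gamma>] g X Y by (auto simp: \<gamma>0 \<gamma>_def)
 have 2: "((%t. f (\<gamma> t) - f (q t)) has_vector_derivative right_deriv Y f g) (at 0)" unfolding has_vector_derivative_def has_derivative_at_alt
 proof (intro conjI allI impI)
  show "bounded_linear (%h. h *\<^sub>R right_deriv Y f g)" by (rule bounded_linear_scaleR_left)
  fix e :: real assume e: "e > 0"
  obtain \<rho> where \<rho>: "\<rho> > 0" "!!x. x : G ==> norm (x - g) < \<rho> ==> norm (right_deriv Y f x - right_deriv Y f g) < e"
   by (rule continuous_locally[OF smooth_continuous[OF smooth_right_deriv[OF f Y]] g e]) (rule that)
  obtain d1 where d1: "d1 > 0" "!!p s. norm (p - g) < d1 ==> \<bar>s\<bar> < d1 ==> norm (p ** mexp (s *\<^sub>R Y) - g) < \<rho>"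
   by (rule curve_near[OF \<rho>(1)]) (rule that)
  obtain d2 where d2: "d2 > 0" "!!p s. norm (p - g) < d2 ==> \<bar>s\<bar> < d2 ==> norm (p ** mexp (s *\<^sub>R X) - g) < d1" by (rule curve_near[OF d1(1)]) (rule that)
  show "\<exists>d>0. \<forall>y::real. norm (y - 0) < d -->
    norm (f (\<gamma> y) - f (q y) - (f (\<gamma> 0) - f (q 0)) - (y - 0) *\<^sub>R right_deriv Y f g) <= e * norm (y - 0)"
  proof (intro exI[of _ "min d1 d2"] conjI allI impI)
   show "min d1 d2 > 0" using d1 d2 by simp
   fix y :: real assume y: "norm (y - 0) < min d1 d2"
   have qy: "norm (q y - g) < d1" using d2(2)[of g y] d2(1) y by (simp add: q_def)
   have "norm (f (q y ** mexp (y *\<^sub>R Y)) - f (q y ** mexp (0 *\<^sub>R Y)) - y *\<^sub>R right_deriv Y f g) <= e * \<bar>y\<bar>"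
   proof (rule mean_value_linearization)
    fix s assume s: "\<bar>s\<bar> <= \<bar>y\<bar>"
    show "((%t. f (q y ** mexp (t *\<^sub>R Y))) has_vector_derivative
      right_deriv Y f (q y ** mexp (s *\<^sub>R Y))) (at s)" by (rule right_deriv_at[OF f Y q])
    show "norm (right_deriv Y f (q y ** mexp (s *\<^sub>R Y)) - right_deriv Y f g) <= e"
     using \<rho>(2)[of "q y ** mexp (s *\<^sub>R Y)"] d1(2)[OF qy, of s] s y q Y by (simp add: mult_mem exp_scaleR_mem)
   qed
   then show "norm (f (\<gamma> y) - f (q y) - (f (\<gamma> 0) - f (q 0)) - (y - 0) *\<^sub>R right_deriv Y f g) <= e * norm (y - 0)" by (simp add: \<gamma>q q_def)
  qed
 qed
 have "((%t. (f (\<gamma> t) - f (q t)) + f (q t)) has_vector_derivative right_deriv Y f g + right_deriv X f g) (at 0)"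
  by (rule has_vector_derivative_add[OF 2]) (unfold q_def, rule right_deriv_at_0[OF f X g])
 then have "((%t. f (\<gamma> t)) has_vector_derivative right_deriv Y f g + right_deriv X f g) (at 0)" by simp
 then show ?thesis using has_vector_derivative_unique_at[OF 1] by (simp add: add.commute)
qed

lemma right_deriv_sum:
 assumes f: "smooth_on_group G f" and g: "g : G" and "finite I" and E: "!!i. E i : \<gg>"
 shows "right_deriv (\<Sum>i\<in>I. c i *\<^sub>R E i) f g = (\<Sum>i\<in>I. c i *\<^sub>R right_deriv (E i) f g)" using \<open>finite I\<close> proof (induction I)
 case empty
 have "right_deriv (0 *\<^sub>R 0) f g = 0 *\<^sub>R right_deriv 0 f g" by (rule right_deriv_scaleR[OF f _ g]) (simp add: subspace_0[OF subspace_lie_algebra])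
 then show ?case by simp
next
 case (insert i I)
 have "(\<Sum>i\<in>I. c i *\<^sub>R E i) : \<gg>" using E by (intro subspace_sum[OF subspace_lie_algebra] lie_algebra_scaleR)
 then show ?case
  using insert E by (simp add: right_deriv_add[OF f _ _ g] right_deriv_scaleR[OF f _ g] lie_algebra_scaleR)
qed

text \<open>Exchange of the two partial derivatives of \<open>f (g ** exp (s Y) ** exp (t X))\<close> at the origin.\<close>

lemma mixed_derivative:
 assumes f: "smooth_on_group G f" and X: "X : \<gg>" and Y: "Y : \<gg>" and g: "g : G"
 shows "((%t. right_deriv Y (%x. f (x ** mexp (t *\<^sub>R X))) g) has_vector_derivative
  right_deriv Y (right_deriv X f) g) (at 0)" proof -
 define F where "F = right_deriv X f"
 have F: "smooth_on_group G F" unfolding F_def by (rule smooth_right_deriv[OF f X])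
 obtain E where E: "!!i. E i : \<gg>" "!!v. v : \<gg> ==> (\<Sum>i\<in>Basis. (v \<bullet> i) *\<^sub>R E i) = v" by (rule projection_basis) (rule that)
 have expX: "mexp (t *\<^sub>R X) : G" "mexp (t *\<^sub>R Y) : G" for t using X Y by auto
 define V where "V s t = right_deriv Y (%x. F (x ** mexp (t *\<^sub>R X))) (g ** mexp (s *\<^sub>R Y))" for s t
 have V_eq: "V s t = (\<Sum>i\<in>Basis. (Ad (mexp (- (t *\<^sub>R X))) Y \<bullet> i) *\<^sub>R
   right_deriv (E i) F (g ** mexp (s *\<^sub>R Y) ** mexp (t *\<^sub>R X)))" for s t
 proof -
  have m: "Ad (mexp (- (t *\<^sub>R X))) Y : \<gg>" using lie_algebra_Ad[OF _ Y] expX(1)[of "- t"] by simp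
  have "V s t = right_deriv (Ad (mexp (- (t *\<^sub>R X))) Y) F (g ** mexp (s *\<^sub>R Y) ** mexp (t *\<^sub>R X))"
   unfolding V_def right_deriv_right_translate[OF expX(1)] by simp
  also have "\<dots> = right_deriv (\<Sum>i\<in>Basis. (Ad (mexp (- (t *\<^sub>R X))) Y \<bullet> i) *\<^sub>R E i) F
    (g ** mexp (s *\<^sub>R Y) ** mexp (t *\<^sub>R X))" by (simp add: E(2)[OF m])
  also have "\<dots> = (\<Sum>i\<in>Basis. (Ad (mexp (- (t *\<^sub>R X))) Y \<bullet> i) *\<^sub>R
    right_deriv (E i) F (g ** mexp (s *\<^sub>R Y) ** mexp (t *\<^sub>R X)))" by (rule right_deriv_sum[OF F _ _ E(1)]) (use g expX in auto)
  finally show ?thesis .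
 qed
 have contV: "continuous_on UNIV (%(s, t). V s t)" proof -
  have contAd: "continuous_on UNIV (%z::real \<times> real. Ad (mexp (- (snd z *\<^sub>R X))) Y)" unfolding Ad_def matrix_inv_exp by (intro continuous_intros)
  have "continuous_on UNIV (%z::real \<times> real. right_deriv (E i) F (g ** mexp (fst z *\<^sub>R Y) ** mexp (snd z *\<^sub>R X)))" for i
   by (rule continuous_on_compose2[OF smooth_continuous[OF smooth_right_deriv[OF F E(1)]]])
     (use g expX in \<open>auto intro!: continuous_intros\<close>)
  then show ?thesis unfolding V_eq split_beta by (intro continuous_intros contAd)
 qed
 define w where "w t = right_deriv Y (%x. f (x ** mexp (t *\<^sub>R X))) g" for t
 have contVs: "continuous_on S (V 0)" for S
  using continuous_on_compose2[OF contV continuous_on_Pair[OF continuous_on_const continuous_on_id], of 0 S] by simp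
 have cF: "continuous_on S (%t. F (g ** mexp (s *\<^sub>R Y) ** mexp (t *\<^sub>R X)))" for S s
  by (rule continuous_on_compose2[OF smooth_continuous[OF F]])
    (use g expX in \<open>auto intro!: continuous_intros\<close>)
 have w_eq: "w t = integral {-1..t} (V 0) + w (-1)" if t: "t : {-1..1}" for t
 proof -
  have "((%s. integral (cbox (-1) t) (%t. F (g ** mexp (s *\<^sub>R Y) ** mexp (t *\<^sub>R X))))
    has_vector_derivative integral (cbox (-1) t) (V 0)) (at 0 within UNIV)" proof (rule leibniz_rule_vector_derivative)
   show "((%s. F (g ** mexp (s *\<^sub>R Y) ** mexp (t *\<^sub>R X))) has_vector_derivative V s t) (at s within UNIV)"
    for s t
    unfolding V_def by (rule right_deriv_at[OF smooth_right_translate[OF expX(1) F] Y g])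
   show "(%t. F (g ** mexp (s *\<^sub>R Y) ** mexp (t *\<^sub>R X))) integrable_on cbox (-1) t" for s
    by (simp add: integrable_continuous_interval cF)
   show "continuous_on (UNIV \<times> cbox (-1) t) (%(x, t). V x t)" by (rule continuous_on_subset[OF contV]) simp
  qed auto
  moreover have "integral (cbox (-1) t) (%t. F (g ** mexp (s *\<^sub>R Y) ** mexp (t *\<^sub>R X))) =
    f (g ** mexp (s *\<^sub>R Y) ** mexp (t *\<^sub>R X)) - f (g ** mexp (s *\<^sub>R Y) ** mexp ((-1) *\<^sub>R X))" for s
  proof -
   have "((%t. F (g ** mexp (s *\<^sub>R Y) ** mexp (t *\<^sub>R X))) has_integral
    (f (g ** mexp (s *\<^sub>R Y) ** mexp (t *\<^sub>R X)) - f (g ** mexp (s *\<^sub>R Y) ** mexp ((-1) *\<^sub>R X)))) {-1..t}" using t g expX(2)[of s] unfolding F_def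
    by (intro fundamental_theorem_of_calculus has_vector_derivative_at_within[OF right_deriv_at[OF f X]]) auto
   then show ?thesis by (simp add: integral_unique)
  qed
  ultimately have "((%s. f (g ** mexp (s *\<^sub>R Y) ** mexp (t *\<^sub>R X)) -
    f (g ** mexp (s *\<^sub>R Y) ** mexp ((-1) *\<^sub>R X))) has_vector_derivative integral {-1..t} (V 0)) (at 0)" by simp
  moreover have "((%s. f (g ** mexp (s *\<^sub>R Y) ** mexp (t *\<^sub>R X)) -
    f (g ** mexp (s *\<^sub>R Y) ** mexp ((-1) *\<^sub>R X))) has_vector_derivative w t - w (-1)) (at 0)" unfolding w_def
   by (intro has_vector_derivative_diff right_deriv_at_0[OF smooth_right_translate[OF expX(1) f] Y g])
  ultimately have "integral {-1..t} (V 0) = w t - w (-1)" by (rule has_vector_derivative_unique_at)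
  then show ?thesis by simp
 qed
 have "((%t. integral {-1..t} (V 0)) has_vector_derivative V 0 0) (at 0 within {-1..1})" by (rule integral_has_vector_derivative[OF contVs]) auto
 then have "((%t. integral {-1..t} (V 0) + w (-1)) has_vector_derivative V 0 0) (at 0 within {-1..1})" by (auto intro!: derivative_eq_intros)
 then have "(w has_vector_derivative V 0 0) (at 0 within {-1..1})" by (rule has_vector_derivative_transform[rotated 2]) (simp, rule w_eq)
 then have "(w has_vector_derivative V 0 0) (at 0 within {-1<..<1})" by (rule has_vector_derivative_within_subset) auto
 then have "(w has_vector_derivative V 0 0) (at 0)" using at_within_open[of "0::real" "{-1<..<1}"] by simp
 moreover have "w = (%t. right_deriv Y (%x. f (x ** mexp (t *\<^sub>R X))) g)" by (simp add: fun_eq_iff w_def)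
 ultimately show ?thesis by (simp add: V_def F_def)
qed

theorem right_deriv_commutator:
 assumes f: "smooth_on_group G f" and X: "X : \<gg>" and Y: "Y : \<gg>" and g: "g : G"
 shows "right_deriv X (right_deriv Y f) g - right_deriv Y (right_deriv X f) g = right_deriv (bracket X Y) f g" proof -
 obtain E where E: "!!i. E i : \<gg>" "!!v. v : \<gg> ==> (\<Sum>i\<in>Basis. (v \<bullet> i) *\<^sub>R E i) = v" by (rule projection_basis) (rule that)
 define Yt where "Yt t = Ad (mexp (t *\<^sub>R X)) Y" for t
 have expX: "mexp (t *\<^sub>R X) : G" for t using X by auto
 have Yt: "Yt t : \<gg>" for t unfolding Yt_def by (rule lie_algebra_Ad[OF expX Y])
 define w where "w i t = right_deriv (E i) (%x. f (x ** mexp (t *\<^sub>R X))) g" for i t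
 have eq: "right_deriv Y f (g ** mexp (t *\<^sub>R X)) = (\<Sum>i\<in>Basis. (Yt t \<bullet> i) *\<^sub>R w i t)" for t
 proof -
  have "right_deriv Y f (g ** mexp (t *\<^sub>R X)) = right_deriv (Yt t) (%x. f (x ** mexp (t *\<^sub>R X))) g" unfolding right_deriv_right_translate[OF expX] Yt_def
   by (simp add: Ad_mult[symmetric])
  also have "\<dots> = right_deriv (\<Sum>i\<in>Basis. (Yt t \<bullet> i) *\<^sub>R E i) (%x. f (x ** mexp (t *\<^sub>R X))) g" by (simp add: E(2)[OF Yt])
  also have "\<dots> = (\<Sum>i\<in>Basis. (Yt t \<bullet> i) *\<^sub>R w i t)"
   unfolding w_def by (rule right_deriv_sum[OF smooth_right_translate[OF expX f] g _ E(1)]) simp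
  finally show ?thesis .
 qed
 have dw: "(w i has_vector_derivative right_deriv (E i) (right_deriv X f) g) (at 0)" for i
  unfolding w_def by (rule mixed_derivative[OF f X E(1) g])
 have dY: "((%t. Yt t \<bullet> i) has_vector_derivative bracket X Y \<bullet> i) (at 0)" for i
  unfolding Yt_def
  by (rule bounded_linear.has_vector_derivative[OF bounded_linear_inner_left Ad_exp_derivative_at_0])
 have "((%t. \<Sum>i\<in>Basis. (Yt t \<bullet> i) *\<^sub>R w i t) has_vector_derivative
   (\<Sum>i\<in>Basis. (Yt 0 \<bullet> i) *\<^sub>R right_deriv (E i) (right_deriv X f) g + (bracket X Y \<bullet> i) *\<^sub>R w i 0)) (at 0)"
  by (intro has_vector_derivative_sum bounded_bilinear.has_vector_derivative[OF bounded_bilinear_scaleR] dw dY)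
 then have "right_deriv X (right_deriv Y f) g =
   (\<Sum>i\<in>Basis. (Yt 0 \<bullet> i) *\<^sub>R right_deriv (E i) (right_deriv X f) g) + (\<Sum>i\<in>Basis. (bracket X Y \<bullet> i) *\<^sub>R w i 0)"
  unfolding eq[symmetric] by (subst right_deriv_eqI) (auto simp: sum.distrib)
 also have "(\<Sum>i\<in>Basis. (Yt 0 \<bullet> i) *\<^sub>R right_deriv (E i) (right_deriv X f) g) = right_deriv Y (right_deriv X f) g"
  unfolding right_deriv_sum[OF smooth_right_deriv[OF f X] g finite_Basis E(1), symmetric] using E(2)[OF Y] by (simp add: Yt_def)
 also have "(\<Sum>i\<in>Basis. (bracket X Y \<bullet> i) *\<^sub>R w i 0) = right_deriv (bracket X Y) f g"
  using right_deriv_sum[where E=E and c="%i. bracket X Y \<bullet> i", OF f g finite_Basis E(1)] E(2)[OF lie_algebra_bracket[OF X Y]] by (simp add: w_def)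
 finally show ?thesis by simp
qed

end

section \<open>Complex derivatives and words\<close>

lemma bounded_linear_imaginary: "bounded_linear (%v :: complex^'w. \<i> *s v)" by (rule bounded_linear_vector_smult)

lemma matrix_vector_bounded_linear: "bounded_linear (%v. A *v v)" for A :: "complex^'w^'v"
 by (rule bounded_bilinear.bounded_linear_right[OF bounded_bilinear_matrix_vector_mult])

lemma right_deriv_word_simps [simp]:
 "right_deriv_word [] f = f" "right_deriv_word (x # xs) f = right_derivC x (right_deriv_word xs f)" by (simp_all add: right_deriv_word_def)

lemma right_deriv_word_append: "right_deriv_word (xs @ ys) f = right_deriv_word xs (right_deriv_word ys f)" by (simp add: right_deriv_word_def)

context closed_matrix_group
begin

abbreviation \<gg>\<^sub>C where "\<gg>\<^sub>C \<equiv> \<gg> \<times> \<gg>"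

lemma zero_lie_algebra [simp]: "0 : \<gg>" by (rule subspace_0[OF subspace_lie_algebra])

lemma smooth_functionsD:
 "f : smooth_functions G ==> smooth_on_group G f"
 "f : smooth_functions G ==> x \<notin> G ==> f x = 0" by (auto simp: smooth_functions_def)

lemma smooth_functions_eqI:
 assumes "f : smooth_functions G" "f' : smooth_functions G" "!!g. g : G ==> f g = f' g"
 shows "f = f'" proof
 show "f x = f' x" for x
  using assms(3)[of x] smooth_functionsD(2)[OF assms(1), of x] smooth_functionsD(2)[OF assms(2), of x] by (cases "x : G") auto
qed

lemma right_deriv_cong:
 assumes "!!g. g : G ==> f g = f' g" "X : \<gg>" "g : G"
 shows "right_deriv X f g = right_deriv X f' g" proof -
 have "(%t. f (g ** mexp (t *\<^sub>R X))) = (%t. f' (g ** mexp (t *\<^sub>R X)))" by (rule ext, rule assms(1)) (use assms(2,3) in auto)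
 then show ?thesis by (simp add: right_deriv_def)
qed

lemma right_deriv_mem:
 assumes f: "f : smooth_functions G" and X: "X : \<gg>"
 shows "right_deriv X f : smooth_functions G" proof -
 have "right_deriv X f x = 0" if x: "x \<notin> G" for x
 proof -
  have "x ** mexp (t *\<^sub>R X) \<notin> G" for t
  proof
   assume "x ** mexp (t *\<^sub>R X) : G"
   then have "x ** mexp (t *\<^sub>R X) ** matrix_inv (mexp (t *\<^sub>R X)) : G" by (rule mult_mem[OF _ inv_mem[OF exp_scaleR_mem[OF X]]])
   then have "x : G" unfolding inv_cancel(5)[OF exp_scaleR_mem[OF X]] .
   then show False using x by simp
  qed
  then have "(%t. f (x ** mexp (t *\<^sub>R X))) = (%t. 0)" using smooth_functionsD(2)[OF f] by (simp add: fun_eq_iff)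
  then show ?thesis by (simp add: right_deriv_def)
 qed
 then show ?thesis using smooth_right_deriv[OF smooth_functionsD(1)[OF f] X] by (simp add: smooth_functions_def)
qed

lemma bounded_linear_mem:
 "f : smooth_functions G ==> bounded_linear T ==> (%x. T (f x)) : smooth_functions G"
 by (simp add: smooth_functions_def smooth_bounded_linear linear_0[OF bounded_linear.linear])

lemma add_mem: "f : smooth_functions G ==> f' : smooth_functions G ==> (%x. f x + f' x) : smooth_functions G" by (simp add: smooth_functions_def smooth_add)

lemma left_translate_mem:
 "f : smooth_functions G ==> a : G ==> (%x. f (a ** x)) : smooth_functions G" by (simp add: smooth_functions_def smooth_left_translate mult_mem_iff)

lemma right_derivC_mem:
 assumes f: "f : smooth_functions G" and x: "x : \<gg>\<^sub>C"
 shows "right_derivC x f : smooth_functions G" proof -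
 have "right_derivC x f = (%g. right_deriv (fst x) f g + \<i> *s right_deriv (snd x) f g)" by (simp add: fun_eq_iff right_derivC_def)
 then show ?thesis
  using x by (simp add: mem_Times_iff add_mem bounded_linear_mem[OF _ bounded_linear_imaginary] right_deriv_mem[OF f])
qed

lemma right_deriv_word_mem:
 "f : smooth_functions G ==> set xs <= \<gg>\<^sub>C ==> right_deriv_word xs f : smooth_functions G" by (induction xs) (auto intro: right_derivC_mem)

lemma right_derivC_add:
 assumes f: "f : smooth_functions G" and x: "x : \<gg>\<^sub>C" and y: "y : \<gg>\<^sub>C"
 shows "right_derivC (x + y) f = (%g. right_derivC x f g + right_derivC y f g)" proof (rule smooth_functions_eqI)
 have "x + y : \<gg>\<^sub>C" using x y by (auto simp: mem_Times_iff subspace_add[OF subspace_lie_algebra])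
 then show "right_derivC (x + y) f : smooth_functions G" by (rule right_derivC_mem[OF f])
 show "(%g. right_derivC x f g + right_derivC y f g) : smooth_functions G" by (rule add_mem[OF right_derivC_mem[OF f x] right_derivC_mem[OF f y]])
 show "right_derivC (x + y) f g = right_derivC x f g + right_derivC y f g" if "g : G" for g
  using x y right_deriv_add[OF smooth_functionsD(1)[OF f] _ _ that] by (simp add: right_derivC_def mem_Times_iff vector_add_ldistrib)
qed

lemma right_derivC_scaleR:
 assumes f: "f : smooth_functions G" and x: "x : \<gg>\<^sub>C"
 shows "right_derivC (c *\<^sub>R x) f = (%g. c *\<^sub>R right_derivC x f g)" proof (rule smooth_functions_eqI)
 have "c *\<^sub>R x : \<gg>\<^sub>C" using x by (auto simp: mem_Times_iff lie_algebra_scaleR)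
 then show "right_derivC (c *\<^sub>R x) f : smooth_functions G" by (rule right_derivC_mem[OF f])
 show "(%g. c *\<^sub>R right_derivC x f g) : smooth_functions G" by (rule bounded_linear_mem[OF right_derivC_mem[OF f x] bounded_linear_scaleR_right])
 show "right_derivC (c *\<^sub>R x) f g = c *\<^sub>R right_derivC x f g" if "g : G" for g
  using x right_deriv_scaleR[OF smooth_functionsD(1)[OF f] _ that] by (simp add: right_derivC_def mem_Times_iff scaleR_right_distrib
    linear_scale[OF bounded_linear.linear[OF bounded_linear_imaginary]])
qed

lemma right_deriv_uminus:
 assumes "smooth_on_group G f" "X : \<gg>" "g : G"
 shows "right_deriv (- X) f g = - right_deriv X f g" using right_deriv_scaleR[OF assms, of "-1"] by simp

lemma right_derivC_scaleI:
 assumes f: "f : smooth_functions G" and x: "x : \<gg>\<^sub>C"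
 shows "right_derivC (scaleI x) f = (%g. \<i> *s right_derivC x f g)" proof (rule smooth_functions_eqI)
 have "scaleI x : \<gg>\<^sub>C" using x by (auto simp: mem_Times_iff scaleI_def subspace_neg[OF subspace_lie_algebra])
 then show "right_derivC (scaleI x) f : smooth_functions G" by (rule right_derivC_mem[OF f])
 show "(%g. \<i> *s right_derivC x f g) : smooth_functions G" by (rule bounded_linear_mem[OF right_derivC_mem[OF f x] bounded_linear_imaginary])
 show "right_derivC (scaleI x) f g = \<i> *s right_derivC x f g" if "g : G" for g
  using x right_deriv_uminus[OF smooth_functionsD(1)[OF f] _ that] by (simp add: right_derivC_def mem_Times_iff scaleI_def vec_eq_iff algebra_simps)
qed

lemma right_derivC_linear:
 assumes f: "f : smooth_functions G" and x: "x : \<gg>\<^sub>C" and T: "bounded_linear T" "!!v. T (\<i> *s v) = \<i> *s T v"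
 shows "right_derivC x (%g. T (f g)) = (%g. T (right_derivC x f g))" proof (rule smooth_functions_eqI)
 show "right_derivC x (%g. T (f g)) : smooth_functions G" by (rule right_derivC_mem[OF bounded_linear_mem[OF f T(1)] x])
 show "(%g. T (right_derivC x f g)) : smooth_functions G" by (rule bounded_linear_mem[OF right_derivC_mem[OF f x] T(1)])
 show "right_derivC x (%g. T (f g)) g = T (right_derivC x f g)" if "g : G" for g
  using x right_deriv_bounded_linear[OF T(1) smooth_functionsD(1)[OF f] _ that]
  by (simp add: right_derivC_def mem_Times_iff linear_add[OF bounded_linear.linear[OF T(1)]] T(2))
qed

lemma right_derivC_fun_add:
 assumes f: "f : smooth_functions G" and f': "f' : smooth_functions G" and x: "x : \<gg>\<^sub>C"
 shows "right_derivC x (%g. f g + f' g) = (%g. right_derivC x f g + right_derivC x f' g)" proof (rule smooth_functions_eqI)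
 show "right_derivC x (%g. f g + f' g) : smooth_functions G" by (rule right_derivC_mem[OF add_mem[OF f f'] x])
 show "(%g. right_derivC x f g + right_derivC x f' g) : smooth_functions G" by (rule add_mem[OF right_derivC_mem[OF f x] right_derivC_mem[OF f' x]])
 show "right_derivC x (%g. f g + f' g) g = right_derivC x f g + right_derivC x f' g" if "g : G" for g
  using x right_deriv_fun_add[OF smooth_functionsD(1)[OF f] smooth_functionsD(1)[OF f'] _ that] by (simp add: right_derivC_def mem_Times_iff vector_add_ldistrib)
qed

lemma right_derivC_commutator:
 assumes f: "f : smooth_functions G" and x: "x : \<gg>\<^sub>C" and y: "y : \<gg>\<^sub>C" and g: "g : G"
 shows "right_derivC x (right_derivC y f) g = right_derivC y (right_derivC x f) g + right_derivC (bracketC x y) f g" proof -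
 let ?R = "%X f. right_deriv X f"
 have xy: "fst x : \<gg>" "snd x : \<gg>" "fst y : \<gg>" "snd y : \<gg>" using x y by (auto simp: mem_Times_iff)
 note sm = smooth_functionsD(1)[OF f]
 have expand: "right_derivC u (right_derivC v f) g =
   (?R (fst u) (?R (fst v) f) g - ?R (snd u) (?R (snd v) f) g)
   + \<i> *s (?R (fst u) (?R (snd v) f) g + ?R (snd u) (?R (fst v) f) g)" if u: "u : \<gg>\<^sub>C" and v: "v : \<gg>\<^sub>C" for u v
 proof -
  have uv: "fst u : \<gg>" "snd u : \<gg>" "fst v : \<gg>" "snd v : \<gg>" using u v by (auto simp: mem_Times_iff)
  have s: "smooth_on_group G (?R (fst v) f)" "smooth_on_group G (?R (snd v) f)" using uv by (auto intro: smooth_right_deriv[OF sm])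
  have eq: "right_derivC v f = (%g. ?R (fst v) f g + \<i> *s ?R (snd v) f g)" by (simp add: fun_eq_iff right_derivC_def)
  have "?R U (right_derivC v f) g = ?R U (?R (fst v) f) g + \<i> *s ?R U (?R (snd v) f) g" if "U : \<gg>" for U
   unfolding eq
   using right_deriv_fun_add[OF s(1) smooth_bounded_linear[OF bounded_linear_imaginary s(2)] that g]
    right_deriv_bounded_linear[OF bounded_linear_imaginary s(2) that g] by simp
  then show ?thesis
   using uv by (simp add: right_derivC_def[of u] vec_eq_iff algebra_simps)
 qed
 have br: "bracket (fst x) (fst y) : \<gg>" "bracket (snd x) (snd y) : \<gg>" "bracket (fst x) (snd y) : \<gg>"
   "bracket (snd x) (fst y) : \<gg>" using xy by (auto intro: lie_algebra_bracket)
 have mbr: "- bracket (snd x) (snd y) : \<gg>" using br(2) by (rule subspace_neg[OF subspace_lie_algebra])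
 have 1: "?R (fst (bracketC x y)) f g = ?R (bracket (fst x) (fst y)) f g - ?R (bracket (snd x) (snd y)) f g"
  using right_deriv_add[OF sm br(1) mbr g] right_deriv_uminus[OF sm br(2) g] by (simp add: bracketC_def)
 have 2: "?R (snd (bracketC x y)) f g = ?R (bracket (fst x) (snd y)) f g + ?R (bracket (snd x) (fst y)) f g"
  using right_deriv_add[OF sm br(3) br(4) g] by (simp add: bracketC_def)
 have "right_derivC (bracketC x y) f g =
   (?R (bracket (fst x) (fst y)) f g - ?R (bracket (snd x) (snd y)) f g)
   + \<i> *s (?R (bracket (fst x) (snd y)) f g + ?R (bracket (snd x) (fst y)) f g)" by (simp add: right_derivC_def[of "bracketC x y"] 1 2)
 then show ?thesis
  unfolding expand[OF x y] expand[OF y x]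
   right_deriv_commutator[OF sm xy(1) xy(3) g, symmetric] right_deriv_commutator[OF sm xy(2) xy(4) g, symmetric]
   right_deriv_commutator[OF sm xy(1) xy(4) g, symmetric] right_deriv_commutator[OF sm xy(2) xy(3) g, symmetric] by (simp add: vec_eq_iff algebra_simps)
qed

lemma right_deriv_word_linear:
 assumes f: "f : smooth_functions G" and T: "bounded_linear T" "!!v. T (\<i> *s v) = \<i> *s T v"
 shows "set xs <= \<gg>\<^sub>C ==> right_deriv_word xs (%g. T (f g)) = (%g. T (right_deriv_word xs f g))" proof (induction xs)
 case (Cons x xs)
 then show ?case
  using right_derivC_linear[OF right_deriv_word_mem[OF f, of xs] _ T, of x] by simp
qed simp

lemma right_deriv_word_fun_add:
 assumes f: "f : smooth_functions G" and f': "f' : smooth_functions G"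
 shows "set xs <= \<gg>\<^sub>C ==>
  right_deriv_word xs (%g. f g + f' g) = (%g. right_deriv_word xs f g + right_deriv_word xs f' g)" proof (induction xs)
 case (Cons x xs)
 then show ?case
  using right_derivC_fun_add[OF right_deriv_word_mem[OF f, of xs] right_deriv_word_mem[OF f', of xs], of x] by simp
qed simp

lemma right_deriv_word_zero: "set xs <= \<gg>\<^sub>C ==> right_deriv_word xs (%g. 0 :: complex^'w) = (%g. 0)" proof -
 assume xs: "set xs <= \<gg>\<^sub>C"
 have bl: "bounded_linear (%v :: complex^'w. 0 :: complex^'w)" by (rule bounded_linear_zero)
 have "smooth_on_group G (%g. 0 :: complex^'w)" proof -
  have "Ck_on_group G k (%g. 0 :: complex^'w)" for k
  proof (induction k)
   case (Suc k)
   have "right_deriv X (%g. 0 :: complex^'w) = (%g. 0)" for X :: "'n cmat" by (simp add: right_deriv_def fun_eq_iff)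
   then show ?case using Suc by simp
  qed simp
  then show ?thesis by (simp add: smooth_on_group_def)
 qed
 then have "(%g. 0 :: complex^'w) : smooth_functions G" by (simp add: smooth_functions_def)
 from right_deriv_word_linear[OF this bl _ xs] show ?thesis by simp
qed

lemma right_derivC_left_translate: "right_derivC x (%x. f (a ** x)) = (%y. right_derivC x f (a ** y))"
 by (simp add: fun_eq_iff right_derivC_def right_deriv_left_translate)

lemma right_deriv_word_left_translate:
 "right_deriv_word xs (%x. f (a ** x)) = (%y. right_deriv_word xs f (a ** y))" by (induction xs) (simp_all add: right_derivC_left_translate)

lemma AdC_mem: "k : G ==> x : \<gg>\<^sub>C ==> AdC k x : \<gg>\<^sub>C" by (auto simp: AdC_def mem_Times_iff lie_algebra_Ad)

lemma right_deriv_word_right_translate: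
 fixes f :: "'n cmat => complex^'w"
 assumes f: "f : smooth_functions G" and k: "k : G" and eqv: "!!g. g : G ==> f (g ** k) = M *v f g"
 shows "set xs <= \<gg>\<^sub>C ==> g : G ==>
  right_deriv_word xs f (g ** k) = M *v right_deriv_word (map (AdC k) xs) f g" proof (induction xs arbitrary: g)
 case Nil
 then show ?case by (simp add: eqv)
next
 case (Cons x xs)
 have x: "x : \<gg>\<^sub>C" and xs: "set xs <= \<gg>\<^sub>C" using Cons.prems by auto
 have xs': "set (map (AdC k) xs) <= \<gg>\<^sub>C" unfolding set_map using xs by (intro image_subsetI AdC_mem[OF k]) blast
 define F where "F = right_deriv_word xs f"
 define F' where "F' = right_deriv_word (map (AdC k) xs) f"
 have F': "smooth_on_group G F'" unfolding F'_def by (rule smooth_functionsD(1)[OF right_deriv_word_mem[OF f xs']])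
 have FF': "F (h ** k) = M *v F' h" if "h : G" for h
  unfolding F_def F'_def by (rule Cons.IH[OF xs that])
 have R: "right_deriv X F (g ** k) = M *v right_deriv (Ad k X) F' g" if X: "X : \<gg>" for X
 proof -
  have kX: "Ad k X : \<gg>" using lie_algebra_Ad[OF k X] .
  have "right_deriv X F (g ** k) = right_deriv (Ad (matrix_inv k) (Ad k X)) F (g ** k)" using k by (simp add: Ad_mult[symmetric] invertible_mem inv_mem)
  also have "\<dots> = right_deriv (Ad k X) (%x. F (x ** k)) g" by (rule right_deriv_right_translate[OF k, symmetric])
  also have "\<dots> = right_deriv (Ad k X) (%x. M *v F' x) g" by (rule right_deriv_cong[OF FF' kX Cons.prems(2)])
  also have "\<dots> = M *v right_deriv (Ad k X) F' g" by (rule right_deriv_bounded_linear[OF matrix_vector_bounded_linear F' kX Cons.prems(2)])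
  finally show ?thesis .
 qed
 have "right_derivC x F (g ** k) = M *v right_derivC (AdC k x) F' g"
  using x by (simp add: right_derivC_def AdC_def mem_Times_iff R matrix_vector_simps vector_smult_matrix_vector)
 then show ?case by (simp add: F_def F'_def)
qed

lemma right_deriv_word_local:
 assumes f: "f : smooth_functions G" and U: "open U" and z: "!!g. g : G ==> g : U ==> f g = 0"
 shows "set xs <= \<gg>\<^sub>C ==> g : G ==> g : U ==> right_deriv_word xs f g = 0" proof (induction xs arbitrary: g)
 case Nil
 then show ?case by (simp add: z)
next
 case (Cons x xs)
 define F where "F = right_deriv_word xs f"
 have F0: "F h = 0" if "h : G" "h : U" for h
  unfolding F_def using Cons.IH[of h] Cons.prems(1) that by simp
 have R: "right_deriv X F g = 0" if X: "X : \<gg>" for X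
 proof (rule right_deriv_eqI, rule has_vector_derivative_transform_within_open)
  have "continuous_on UNIV (%t. g ** mexp (t *\<^sub>R X))" by (intro continuous_intros)
  then show "open ((%t. g ** mexp (t *\<^sub>R X)) -` U)" by (rule open_vimage[OF U])
  show "0 : (%t. g ** mexp (t *\<^sub>R X)) -` U" using Cons.prems by simp
  show "((%t. 0) has_vector_derivative 0) (at 0)" by (rule has_vector_derivative_const)
  show "0 = F (g ** mexp (t *\<^sub>R X))" if "t : (%t. g ** mexp (t *\<^sub>R X)) -` U" for t
   using F0[of "g ** mexp (t *\<^sub>R X)"] that X Cons.prems(2) by auto
 qed
 show ?case using Cons.prems(1) R by (simp add: F_def[symmetric] right_derivC_def mem_Times_iff)
qed

section \<open>Averages over curves\<close>

definition average :: "real => real => (real => complex) => (real => 'n cmat) => ('n cmat => complex^'w) => 'n cmat => complex^'w"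
 where "average a b c \<gamma> f x = integral {a..b} (%t. c t *s f (\<gamma> t ** x))"

context
 fixes a b :: real and c :: "real => complex" and \<gamma> :: "real => 'n cmat"
 assumes c: "continuous_on UNIV c" and \<gamma>: "continuous_on UNIV \<gamma>" "!!t. \<gamma> t : G"
begin

lemma continuous_on_averaged:
 assumes "continuous_on G f"
 shows "continuous_on (G \<times> UNIV) (%(x, t). c t *s f (\<gamma> t ** x))" proof -
 have "continuous_on (G \<times> (UNIV :: real set)) (%z. f (\<gamma> (snd z) ** fst z))" by (rule continuous_on_compose2[OF assms])
    (auto intro!: continuous_intros continuous_on_compose2[OF \<gamma>(1)] simp: \<gamma>(2) mult_mem)
 then show ?thesis unfolding split_beta
  by (intro continuous_intros) (auto intro!: continuous_on_compose2[OF c] continuous_intros)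
qed

lemma continuous_on_averaged_fixed:
 assumes "continuous_on G f" "x : G"
 shows "continuous_on S (%t. c t *s f (\<gamma> t ** x))" using continuous_on_compose2[OF continuous_on_averaged[OF assms(1)]
   continuous_on_Pair[OF continuous_on_const[of S x] continuous_on_id]] assms(2) by auto

lemma average_deriv_at_0:
 assumes f: "smooth_on_group G f" and X: "X : \<gg>" and g: "g : G"
 shows "((%s. average a b c \<gamma> f (g ** mexp (s *\<^sub>R X))) has_vector_derivative
  average a b c \<gamma> (right_deriv X f) g) (at 0)" proof -
 let ?h = "%s t. c t *s f (\<gamma> t ** (g ** mexp (s *\<^sub>R X)))"
 let ?h' = "%s t. c t *s right_deriv X f (\<gamma> t ** (g ** mexp (s *\<^sub>R X)))"
 have mem: "g ** mexp (s *\<^sub>R X) : G" for s using g X by auto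
 have "((%s. integral (cbox a b) (?h s)) has_vector_derivative integral (cbox a b) (?h' 0)) (at 0 within UNIV)" proof (rule leibniz_rule_vector_derivative)
  fix s t
  have "((%s. f (\<gamma> t ** g ** mexp (s *\<^sub>R X))) has_vector_derivative
    right_deriv X f (\<gamma> t ** g ** mexp (s *\<^sub>R X))) (at s)" by (rule right_deriv_at[OF f X]) (use g \<gamma>(2) in auto)
  then show "((%s. ?h s t) has_vector_derivative ?h' s t) (at s within UNIV)"
   using bounded_linear.has_vector_derivative[OF bounded_linear_vector_smult] by (simp add: matrix_mul_assoc)
 next
  show "?h s integrable_on cbox a b" for s
   by (simp add: integrable_continuous_interval continuous_on_averaged_fixed[OF smooth_continuous[OF f] mem])
  have "continuous_on (UNIV \<times> cbox a b) (%z. (%(x, t). c t *s right_deriv X f (\<gamma> t ** x)) (g ** mexp (fst z *\<^sub>R X), snd z))"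
   by (rule continuous_on_compose2[OF continuous_on_averaged[OF smooth_continuous[OF smooth_right_deriv[OF f X]]]])
     (auto intro!: continuous_intros simp: mem)
  then show "continuous_on (UNIV \<times> cbox a b) (%(s, t). ?h' s t)" by (simp add: split_beta)
 qed auto
 then show ?thesis unfolding average_def by simp
qed

lemma right_deriv_average:
 "smooth_on_group G f ==> X : \<gg> ==> g : G ==>
  right_deriv X (average a b c \<gamma> f) g = average a b c \<gamma> (right_deriv X f) g" by (rule right_deriv_eqI) (rule average_deriv_at_0)

lemma Ck_average: "smooth_on_group G f ==> Ck_on_group G k (average a b c \<gamma> f)" proof (induction k arbitrary: f)
 have cont: "continuous_on G (average a b c \<gamma> f)" if "smooth_on_group G f" for f :: "'n cmat => complex^'b" proof -
  have "continuous_on (G \<times> cbox a b) (%(x, t). c t *s f (\<gamma> t ** x))"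
   by (rule continuous_on_subset[OF continuous_on_averaged[OF smooth_continuous[OF that]]]) auto
  from integral_continuous_on_param[OF this] show ?thesis unfolding average_def[abs_def] by simp
 qed
 {
  case 0
  then show ?case by (simp add: cont)
 next
  case (Suc k)
  have "Ck_on_group G k (right_deriv X (average a b c \<gamma> f))" if X: "X : \<gg>" for X
   by (rule Ck_cong[OF right_deriv_average[OF Suc.prems X], THEN iffD2])
     (assumption, rule Suc.IH[OF smooth_right_deriv[OF Suc.prems X]])
  moreover have "(%t. average a b c \<gamma> f (g ** mexp (t *\<^sub>R X))) differentiable (at 0)"
   if "X : \<gg>" "g : G" for X g
   by (rule differentiableI_vector[OF average_deriv_at_0[OF Suc.prems that]])
  ultimately show ?case using cont[OF Suc.prems] by auto
 }
qed

lemma average_mem: "f : smooth_functions G ==> average a b c \<gamma> f : smooth_functions G"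
 using Ck_average \<gamma>(2) unfolding smooth_functions_def smooth_on_group_def
 by (auto simp: average_def mult_mem_iff)

lemma right_derivC_average:
 assumes f: "f : smooth_functions G" and x: "x : \<gg>\<^sub>C"
 shows "right_derivC x (average a b c \<gamma> f) = average a b c \<gamma> (right_derivC x f)" proof (rule smooth_functions_eqI)
 show "right_derivC x (average a b c \<gamma> f) : smooth_functions G" "average a b c \<gamma> (right_derivC x f) : smooth_functions G"
  by (rule right_derivC_mem[OF average_mem[OF f] x], rule average_mem[OF right_derivC_mem[OF f x]])
 fix g assume g: "g : G"
 have xx: "fst x : \<gg>" "snd x : \<gg>" using x by (auto simp: mem_Times_iff)
 note sm = smooth_functionsD(1)[OF f]
 have int: "(%t. c t *s right_deriv X f (\<gamma> t ** g)) integrable_on {a..b}" if "X : \<gg>" for X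
  by (simp add: integrable_continuous_interval continuous_on_averaged_fixed[OF smooth_continuous[OF smooth_right_deriv[OF sm that]] g])
 have "\<i> *s integral {a..b} (%t. c t *s right_deriv (snd x) f (\<gamma> t ** g)) =
   integral {a..b} (%t. \<i> *s (c t *s right_deriv (snd x) f (\<gamma> t ** g)))" using integral_linear[OF int[OF xx(2)] bounded_linear_imaginary] by (simp add: o_def)
 moreover have "(%t. \<i> *s (c t *s right_deriv (snd x) f (\<gamma> t ** g))) integrable_on {a..b}"
  using integrable_linear[OF int[OF xx(2)] bounded_linear_imaginary] by (simp add: o_def)
 ultimately have "right_derivC x (average a b c \<gamma> f) g =
   integral {a..b} (%t. c t *s right_deriv (fst x) f (\<gamma> t ** g) + \<i> *s (c t *s right_deriv (snd x) f (\<gamma> t ** g)))"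
  unfolding right_derivC_def right_deriv_average[OF sm xx(1) g] right_deriv_average[OF sm xx(2) g] average_def
  by (simp add: Henstock_Kurzweil_Integration.integral_add int[OF xx(1)])
 also have "\<dots> = average a b c \<gamma> (right_derivC x f) g"
  unfolding average_def right_derivC_def by (rule arg_cong[where f="integral {a..b}"]) (simp add: fun_eq_iff vec_eq_iff algebra_simps)
 finally show "right_derivC x (average a b c \<gamma> f) g = average a b c \<gamma> (right_derivC x f) g" .
qed

lemma right_deriv_word_average:
 assumes f: "f : smooth_functions G"
 shows "set xs <= \<gg>\<^sub>C ==> right_deriv_word xs (average a b c \<gamma> f) = average a b c \<gamma> (right_deriv_word xs f)"
 by (induction xs) (simp_all add: right_derivC_average right_deriv_word_mem[OF f])

end

section \<open>Vanishing to infinite order\<close>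

definition flat_at_one :: "('n cmat => complex^'w) => bool" where
 "flat_at_one f \<longleftrightarrow> f : smooth_functions G \<and> (\<forall>xs. set xs <= \<gg>\<^sub>C --> right_deriv_word xs f (mat 1) = 0)"

lemma flat_at_one_right_deriv:
 assumes f: "flat_at_one f" and X: "X : \<gg>"
 shows "flat_at_one (right_deriv X f)" proof -
 have fS: "f : smooth_functions G" using f by (simp add: flat_at_one_def)
 have "right_derivC (X, 0) f = right_deriv X f" proof (rule smooth_functions_eqI)
  show "right_derivC (X, 0) f : smooth_functions G" using X by (intro right_derivC_mem fS) auto
  show "right_deriv X f : smooth_functions G" by (rule right_deriv_mem[OF fS X])
  show "right_derivC (X, 0) f g = right_deriv X f g" if "g : G" for g
   using right_deriv_scaleR[OF smooth_functionsD(1)[OF fS] zero_lie_algebra that, of 0] by (simp add: right_derivC_def)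
 qed
 then have "right_deriv_word xs (right_deriv X f) = right_deriv_word (xs @ [(X, 0)]) f" for xs
  by (simp add: right_deriv_word_append)
 then show ?thesis
  using f X right_deriv_mem[OF fS X] unfolding flat_at_one_def by auto
qed

lemma norm_matrix_exp_minus_one:
 obtains r where "r > 0" "!!X :: 'n cmat. norm X < r ==> norm (mexp X - mat 1) <= 2 * norm X" proof -
 from matrix_exp_has_derivative_at_0[unfolded has_derivative_at_alt, THEN conjunct2, rule_format, OF zero_less_one]
 obtain r where r: "r > 0" "!!X :: 'n cmat. norm X < r ==> norm (mexp X - mat 1 - X) <= norm X" by auto
 show ?thesis
 proof (rule that[OF r(1)])
  fix X :: "'n cmat" assume "norm X < r"
  then show "norm (mexp X - mat 1) <= 2 * norm X" using r(2)[of X] norm_triangle_ineq2[of "mexp X - mat 1" X] by simp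
 qed
qed

text \<open>Along \<open>t \<mapsto> exp (t v)\<close> the derivative of \<open>f\<close> is a combination of derivatives in fixed
 directions, with coefficients of size \<open>norm v\<close>; each of them vanishes to one order less.\<close>

lemma flat_at_one_bound:
 "flat_at_one f ==> \<exists>\<delta>>0. \<exists>C\<ge>0. \<forall>v\<in>\<gg>. norm v < \<delta> --> norm (f (mexp v)) <= C * norm v ^ N"
proof (induction N arbitrary: f)
 case 0
 have fS: "f : smooth_functions G" and f1: "f (mat 1) = 0" using 0 unfolding flat_at_one_def by (auto dest: spec[of _ "[]"])
 obtain \<rho> where \<rho>: "\<rho> > 0" "!!x. x : G ==> norm (x - mat 1) < \<rho> ==> norm (f x - f (mat 1)) < 1"
  by (rule continuous_locally[OF smooth_continuous[OF smooth_functionsD(1)[OF fS]] one_mem zero_less_one]) (rule that)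
 obtain r where r: "r > 0" "!!X :: 'n cmat. norm X < r ==> norm (mexp X - mat 1) <= 2 * norm X" by (rule norm_matrix_exp_minus_one) (rule that)
 have "norm (f (mexp v)) <= 1 * norm v ^ 0" if "v : \<gg>" "norm v < min r (\<rho> / 2)" for v
 proof -
  have "norm (mexp v - mat 1) < \<rho>" using r(2)[of v] that(2) by simp
  then show ?thesis using \<rho>(2)[OF exp_mem[OF that(1)]] f1 by simp
 qed
 then show ?case using \<rho>(1) r(1) by (intro exI[of _ "min r (\<rho> / 2)"] conjI exI[of _ 1]) auto
next
 case (Suc N)
 obtain E where E: "!!i. E i : \<gg>" "!!v. v : \<gg> ==> (\<Sum>i\<in>Basis. (v \<bullet> i) *\<^sub>R E i) = v" by (rule projection_basis) (rule that)
 have fS: "f : smooth_functions G" and f1: "f (mat 1) = 0" using Suc.prems unfolding flat_at_one_def by (auto dest: spec[of _ "[]"])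
 have "\<forall>i. \<exists>\<delta>C. fst \<delta>C > 0 \<and> snd \<delta>C \<ge> 0 \<and> (\<forall>v\<in>\<gg>. norm v < fst \<delta>C -->
   norm (right_deriv (E i) f (mexp v)) <= snd \<delta>C * norm v ^ N)" proof
  fix i
  from Suc.IH[OF flat_at_one_right_deriv[OF Suc.prems E(1)[of i]]]
  obtain \<delta> C where "\<delta> > 0" "C \<ge> 0" "\<forall>v\<in>\<gg>. norm v < \<delta> -->
    norm (right_deriv (E i) f (mexp v)) <= C * norm v ^ N" by (elim exE conjE)
  then show "\<exists>\<delta>C. fst \<delta>C > 0 \<and> snd \<delta>C \<ge> 0 \<and> (\<forall>v\<in>\<gg>. norm v < fst \<delta>C -->
   norm (right_deriv (E i) f (mexp v)) <= snd \<delta>C * norm v ^ N)" by (intro exI[of _ "(\<delta>, C)"]) simp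
 qed
 from choice[OF this] obtain \<delta>C where \<delta>C: "!!i. fst (\<delta>C i) > 0" "!!i. snd (\<delta>C i) \<ge> 0"
  "!!i v. v : \<gg> ==> norm v < fst (\<delta>C i) ==>
   norm (right_deriv (E i) f (mexp v)) <= snd (\<delta>C i) * norm v ^ N" by blast
 define \<delta> where "\<delta> = Min ((%i. fst (\<delta>C i)) ` Basis)"
 define C where "C = (\<Sum>i\<in>Basis. snd (\<delta>C i))"
 have \<delta>: "\<delta> > 0" "!!i. i : Basis ==> \<delta> <= fst (\<delta>C i)" unfolding \<delta>_def using \<delta>C(1) by auto
 have C: "C \<ge> 0" unfolding C_def using \<delta>C(2) by (simp add: sum_nonneg)
 have "norm (f (mexp v)) <= C * norm v ^ Suc N" if v: "v : \<gg>" and vn: "norm v < \<delta>" for v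
 proof -
  have "norm (f (mat 1 ** mexp (1 *\<^sub>R v)) - f (mat 1 ** mexp (0 *\<^sub>R v))) <= (C * norm v ^ Suc N) * \<bar>1\<bar>" proof (rule mean_value_inequality)
   fix s :: real assume s: "\<bar>s\<bar> <= \<bar>1\<bar>"
   show "((%t. f (mat 1 ** mexp (t *\<^sub>R v))) has_vector_derivative
     right_deriv v f (mat 1 ** mexp (s *\<^sub>R v))) (at s)" by (rule right_deriv_at[OF smooth_functionsD(1)[OF fS] v one_mem])
   have sv: "s *\<^sub>R v : \<gg>" "norm (s *\<^sub>R v) <= norm v" using v s by (auto intro: lie_algebra_scaleR simp: mult_left_le_one_le)
   have "right_deriv v f (mexp (s *\<^sub>R v)) = (\<Sum>i\<in>Basis. (v \<bullet> i) *\<^sub>R right_deriv (E i) f (mexp (s *\<^sub>R v)))"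
    using right_deriv_sum[where E=E and c="%i. v \<bullet> i", OF smooth_functionsD(1)[OF fS] exp_mem[OF sv(1)] finite_Basis E(1)] E(2)[OF v] by simp
   also have "norm \<dots> <= (\<Sum>i\<in>Basis. norm v * (snd (\<delta>C i) * norm v ^ N))" proof (rule sum_norm_le)
    fix i :: "'n cmat" assume i: "i : Basis"
    have "norm (right_deriv (E i) f (mexp (s *\<^sub>R v))) <= snd (\<delta>C i) * norm (s *\<^sub>R v) ^ N"
     using \<delta>C(3)[OF sv(1), of i] sv(2) vn \<delta>(2)[OF i] by simp
    also have "\<dots> <= snd (\<delta>C i) * norm v ^ N" using sv(2) \<delta>C(2) by (intro mult_left_mono power_mono) auto
    finally show "norm ((v \<bullet> i) *\<^sub>R right_deriv (E i) f (mexp (s *\<^sub>R v))) <= norm v * (snd (\<delta>C i) * norm v ^ N)"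
     using Basis_le_norm[OF i, of v] by (simp add: mult_mono)
   qed
   also have "\<dots> = C * norm v ^ Suc N" by (simp add: C_def sum_distrib_left sum_distrib_right mult_ac)
   finally show "norm (right_deriv v f (mat 1 ** mexp (s *\<^sub>R v))) <= C * norm v ^ Suc N" by simp
  qed
  then show ?thesis by (simp add: f1)
 qed
 then show ?case using \<delta>(1) C by (intro exI[of _ \<delta>] conjI exI[of _ C]) auto
qed

end

section \<open>The Killing form\<close>

definition endo_on :: "'a::real_vector set => ('a => 'a) => bool" where
 "endo_on V T \<longleftrightarrow> (\<forall>x\<in>V. T x : V) \<and> (\<forall>x\<in>V. \<forall>y\<in>V. T (x + y) = T x + T y) \<and>
   (\<forall>c. \<forall>x\<in>V. T (c *\<^sub>R x) = c *\<^sub>R T x)"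

lemma endo_onD:
 assumes "endo_on V T"
 shows "x : V ==> T x : V" "x : V ==> y : V ==> T (x + y) = T x + T y"
  "x : V ==> T (c *\<^sub>R x) = c *\<^sub>R T x" using assms by (auto simp: endo_on_def)

lemma endo_on_add:
 "subspace V ==> endo_on V T ==> endo_on V S ==> endo_on V (%x. T x + S x)" by (simp add: endo_on_def subspace_add scaleR_right_distrib)

context
 fixes V :: "'a::euclidean_space set"
 assumes V: "subspace V"
begin

abbreviation (input) trace_basis where
 "trace_basis \<equiv> (SOME B. independent B \<and> span B = V)"
abbreviation (input) coord where
 "coord \<equiv> real_vector.representation trace_basis"

lemma trace_basis: "independent trace_basis" "span trace_basis = V" "finite trace_basis" proof -
 obtain B where B: "B <= V" "independent B" "V <= span B" using basis_exists[of V] by metis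
 have "span B = V" using B span_minimal[OF B(1) V] by auto
 then have "\<exists>B. independent B \<and> span B = V" using B by blast
 from someI_ex[OF this] show "independent trace_basis" "span trace_basis = V" by auto
 then show "finite trace_basis" using independent_imp_finite by blast
qed

lemma trace_basis_mem: "b : trace_basis ==> b : V" using trace_basis(2) span_base by blast

lemma coord_add: "x : V ==> y : V ==> coord (x + y) b = coord x b + coord y b"
 using real_vector.representation_add[OF trace_basis(1)] trace_basis(2) by (auto simp: fun_eq_iff)

lemma coord_scale: "x : V ==> coord (c *\<^sub>R x) b = c * coord x b" using real_vector.representation_scale[OF trace_basis(1)] trace_basis(2) by (auto simp: fun_eq_iff)

lemma coord_sum: "(!!i. i : I ==> x i : V) ==> coord (\<Sum>i\<in>I. x i) b = (\<Sum>i\<in>I. coord (x i) b)"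
 using real_vector.representation_sum[OF trace_basis(1), of I x] trace_basis(2) by (auto simp: fun_eq_iff)

lemma coord_expansion: "x : V ==> (\<Sum>b\<in>trace_basis. coord x b *\<^sub>R b) = x"
 using real_vector.sum_representation_eq[OF trace_basis(1) _ trace_basis(3) order_refl] trace_basis(2) by simp

lemma endo_on_sum:
 assumes T: "endo_on V T"
 shows "finite I ==> (!!i. i : I ==> x i : V) ==> T (\<Sum>i\<in>I. x i) = (\<Sum>i\<in>I. T (x i))" proof (induction I rule: finite_induct)
 case empty
 show ?case using endo_onD(3)[OF T subspace_0[OF V], of 0] by simp
next
 case (insert i I)
 have "(\<Sum>i\<in>I. x i) : V" using insert.prems by (intro subspace_sum[OF V]) auto
 then show ?case using insert endo_onD(2)[OF T] by simp
qed

lemma trace_on_eq: "trace_on V T = (\<Sum>b\<in>trace_basis. coord (T b) b)" by (simp add: trace_on_def Let_def)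

lemma trace_on_cong: "(!!x. x : V ==> T x = S x) ==> trace_on V T = trace_on V S" unfolding trace_on_eq by (rule sum.cong) (auto simp: trace_basis_mem)

lemma trace_on_add:
 "endo_on V T ==> endo_on V S ==> trace_on V (%x. T x + S x) = trace_on V T + trace_on V S" unfolding trace_on_eq sum.distrib[symmetric]
 by (rule sum.cong) (auto simp: coord_add endo_onD(1) trace_basis_mem)

lemma trace_on_scale: "endo_on V T ==> trace_on V (%x. c *\<^sub>R T x) = c * trace_on V T" unfolding trace_on_eq sum_distrib_left
 by (rule sum.cong) (auto simp: coord_scale endo_onD(1) trace_basis_mem)

lemma trace_on_commute:
 assumes T: "endo_on V T" and S: "endo_on V S"
 shows "trace_on V (%x. T (S x)) = trace_on V (%x. S (T x))" proof -
 have expand: "coord (T (S b)) b = (\<Sum>c\<in>trace_basis. coord (S b) c * coord (T c) b)"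
  if T: "endo_on V T" and S: "endo_on V S" and b: "b : V" for T S b
 proof -
  have m: "!!c. c : trace_basis ==> coord (S b) c *\<^sub>R c : V" by (rule subspace_scale[OF V trace_basis_mem])
  have "T (S b) = T (\<Sum>c\<in>trace_basis. coord (S b) c *\<^sub>R c)" using coord_expansion[OF endo_onD(1)[OF S b]] by simp
  also have "\<dots> = (\<Sum>c\<in>trace_basis. T (coord (S b) c *\<^sub>R c))" by (rule endo_on_sum[OF T trace_basis(3) m])
  also have "\<dots> = (\<Sum>c\<in>trace_basis. coord (S b) c *\<^sub>R T c)" by (rule sum.cong) (auto simp: endo_onD(3)[OF T] trace_basis_mem)
  finally show ?thesis
   using endo_onD(1)[OF T] by (simp add: coord_sum coord_scale subspace_scale[OF V] trace_basis_mem)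
 qed
 have "trace_on V (%x. T (S x)) = (\<Sum>b\<in>trace_basis. \<Sum>c\<in>trace_basis. coord (S b) c * coord (T c) b)"
  unfolding trace_on_eq by (rule sum.cong[OF refl]) (rule expand[OF T S trace_basis_mem])
 also have "\<dots> = (\<Sum>c\<in>trace_basis. \<Sum>b\<in>trace_basis. coord (T c) b * coord (S b) c)" by (subst sum.swap) (simp add: mult.commute)
 also have "\<dots> = trace_on V (%x. S (T x))" unfolding trace_on_eq by (rule sum.cong[OF refl]) (rule expand[OF S T trace_basis_mem, symmetric])
 finally show ?thesis .
qed

end

context closed_matrix_group
begin

lemma ad_endo: "X : \<gg> ==> endo_on \<gg> (bracket X)" by (auto simp: endo_on_def lie_algebra_bracket bracket_simps)

lemma endo_on_compose: "endo_on V T ==> endo_on V S ==> endo_on V (%x. T (S x))" by (simp add: endo_on_def)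

abbreviation \<kappa> where "\<kappa> \<equiv> killing_form \<gg>"

lemma killing_sym: "X : \<gg> ==> Y : \<gg> ==> \<kappa> X Y = \<kappa> Y X"
 unfolding killing_form_def by (rule trace_on_commute[OF subspace_lie_algebra ad_endo ad_endo])

lemma killing_add_left:
 assumes "X : \<gg>" "X' : \<gg>" "Y : \<gg>" shows "\<kappa> (X + X') Y = \<kappa> X Y + \<kappa> X' Y" unfolding killing_form_def bracket_simps
 by (rule trace_on_add[OF subspace_lie_algebra endo_on_compose[OF ad_endo[OF assms(1)] ad_endo[OF assms(3)]]
   endo_on_compose[OF ad_endo[OF assms(2)] ad_endo[OF assms(3)]]])

lemma killing_scale_left:
 assumes "X : \<gg>" "Y : \<gg>" shows "\<kappa> (c *\<^sub>R X) Y = c * \<kappa> X Y" unfolding killing_form_def bracket_simps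
 by (rule trace_on_scale[OF subspace_lie_algebra endo_on_compose[OF ad_endo[OF assms(1)] ad_endo[OF assms(2)]]])

lemma killing_add_right:
 assumes "X : \<gg>" "Y : \<gg>" "Y' : \<gg>" shows "\<kappa> X (Y + Y') = \<kappa> X Y + \<kappa> X Y'"
 using killing_add_left[OF assms(2,3,1)] killing_sym assms subspace_add[OF subspace_lie_algebra] by metis

lemma killing_scale_right:
 assumes "X : \<gg>" "Y : \<gg>" shows "\<kappa> X (c *\<^sub>R Y) = c * \<kappa> X Y"
 using killing_scale_left[OF assms(2,1)] killing_sym assms lie_algebra_scaleR by metis

lemma killing_minus:
 assumes "X : \<gg>" "Y : \<gg>" shows "\<kappa> (- X) Y = - \<kappa> X Y" "\<kappa> X (- Y) = - \<kappa> X Y"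
 using killing_scale_left[OF assms, of "-1"] killing_scale_right[OF assms, of "-1"] by simp_all

lemma endo_on_minus_ad: "X : \<gg> ==> endo_on \<gg> T ==> endo_on \<gg> (%x. (-1) *\<^sub>R T x)" by (auto simp: endo_on_def subspace_neg[OF subspace_lie_algebra])

lemma killing_automorphism:
 assumes \<phi>: "endo_on \<gg> \<phi>" and \<psi>: "endo_on \<gg> \<psi>" and inv: "!!X. X : \<gg> ==> \<psi> (\<phi> X) = X" "!!X. X : \<gg> ==> \<phi> (\<psi> X) = X"
  and br: "!!X Y. X : \<gg> ==> Y : \<gg> ==> \<phi> (bracket X Y) = bracket (\<phi> X) (\<phi> Y)"
  and X: "X : \<gg>" and Y: "Y : \<gg>"
 shows "\<kappa> (\<phi> X) (\<phi> Y) = \<kappa> X Y" proof -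
 have e: "endo_on \<gg> (%Z. bracket X (bracket Y (\<psi> Z)))" by (rule endo_on_compose[OF ad_endo[OF X] endo_on_compose[OF ad_endo[OF Y] \<psi>]])
 have "\<kappa> (\<phi> X) (\<phi> Y) = trace_on \<gg> (%Z. \<phi> (bracket X (bracket Y (\<psi> Z))))" unfolding killing_form_def
  by (rule trace_on_cong[OF subspace_lie_algebra])
    (simp add: br inv X Y lie_algebra_bracket endo_onD(1)[OF \<psi>])
 also have "\<dots> = trace_on \<gg> (%Z. bracket X (bracket Y (\<psi> (\<phi> Z))))" by (rule trace_on_commute[OF subspace_lie_algebra \<phi> e])
 also have "\<dots> = \<kappa> X Y" unfolding killing_form_def by (rule trace_on_cong[OF subspace_lie_algebra]) (simp add: inv)
 finally show ?thesis .
qed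

lemma killing_Ad:
 assumes g: "g : G" and X: "X : \<gg>" and Y: "Y : \<gg>"
 shows "\<kappa> (Ad g X) (Ad g Y) = \<kappa> X Y" proof (rule killing_automorphism[OF _ _ _ _ _ X Y])
 show "endo_on \<gg> (Ad g)" "endo_on \<gg> (Ad (matrix_inv g))" using g by (auto simp: endo_on_def lie_algebra_Ad inv_mem Ad_simps)
 show "Ad (matrix_inv g) (Ad g X) = X" "Ad g (Ad (matrix_inv g) X) = X" for X
  using g by (simp_all add: Ad_mult[symmetric] invertible_mem inv_mem)
 show "Ad g (bracket X Y) = bracket (Ad g X) (Ad g Y)" for X Y
  using g by (simp add: Ad_bracket invertible_mem)
qed

text \<open>A derivation \<open>D\<close> of a Lie algebra with nondegenerate Killing form is \<open>ad Z\<close>, for the \<open>Z\<close> that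
 represents the functional \<open>X \<mapsto> tr (D ad X)\<close>: the difference \<open>E\<close> of \<open>D\<close> and \<open>ad Z\<close> satisfies
 \<open>\<kappa> (E X) Y = tr (E ad [X, Y]) = 0\<close>.\<close>

lemma derivation_inner:
 assumes nondeg: "!!X. X : \<gg> ==> (!!Y. Y : \<gg> ==> \<kappa> X Y = 0) ==> X = 0"
  and D: "endo_on \<gg> D"
  and der: "!!X Y. X : \<gg> ==> Y : \<gg> ==> D (bracket X Y) = bracket (D X) Y + bracket X (D Y)"
 obtains Z where "Z : \<gg>" "!!X. X : \<gg> ==> bracket Z X = D X" proof -
 obtain B where B: "B <= \<gg>" "independent B" "\<gg> <= span B" using basis_exists[of \<gg>] by metis
 have span: "span B = \<gg>" using B span_minimal[OF B(1) subspace_lie_algebra] by auto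
 have fin: "finite B" using B(2) independent_imp_finite by blast
 obtain P where P: "linear P" "!!v. P v : \<gg>" "!!v. v : \<gg> ==> P v = v" by (rule linear_projection) (rule that)
 define l where "l X = (\<Sum>b\<in>B. \<kappa> (P X) b *\<^sub>R b)" for X
 have mem: "b : B ==> b : \<gg>" for b using B(1) by blast
 have lin: "linear l" proof (rule linearI)
  show "l (X + Y) = l X + l Y" for X Y
   unfolding l_def linear_add[OF P(1)] sum.distrib[symmetric] by (rule sum.cong[OF refl]) (simp add: killing_add_left P(2) mem scaleR_left_distrib)
  show "l (c *\<^sub>R X) = c *\<^sub>R l X" for c X
   unfolding l_def linear_scale[OF P(1)] scaleR_sum_right
   by (rule sum.cong[OF refl]) (simp add: killing_scale_left P(2) mem)
 qed
 have ext: "l1 X = l2 X" if X: "X : \<gg>" and eq: "!!b. b : B ==> l1 b = l2 b"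
  and add: "!!X Y. X : \<gg> ==> Y : \<gg> ==> l1 (X + Y) = l1 X + l1 Y" "!!X Y. X : \<gg> ==> Y : \<gg> ==> l2 (X + Y) = l2 X + l2 Y"
  and sc: "!!X c. X : \<gg> ==> l1 (c *\<^sub>R X) = c * l1 X" "!!X c. X : \<gg> ==> l2 (c *\<^sub>R X) = c * l2 X"
  for l1 l2 :: "'n cmat => real" and X
 proof -
  have "subspace {X : \<gg>. l1 X = l2 X}" using subspace_lie_algebra sc(1)[of 0 0] sc(2)[of 0 0] unfolding subspace_def by (auto simp: add sc)
  moreover have "B <= {X : \<gg>. l1 X = l2 X}" using B(1) eq by auto
  ultimately have "span B <= {X : \<gg>. l1 X = l2 X}" by (rule span_minimal[rotated])
  then show ?thesis using X span by auto
 qed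
 have inj: "X = 0" if X: "X : \<gg>" and lX: "l X = 0" for X
 proof (rule nondeg[OF X])
  fix Y assume Y: "Y : \<gg>"
  have "\<kappa> X b = 0" if b: "b : B" for b
  proof -
   have "(\<Sum>b\<in>B. \<kappa> X b *\<^sub>R b) = 0" using lX P(3)[OF X] by (simp add: l_def)
   then show ?thesis by (rule B(2)[unfolded independent_explicit, THEN conjunct2, rule_format, OF _ b])
  qed
  then show "\<kappa> X Y = 0" by (intro ext[OF Y, of "\<kappa> X" "%_. 0"]) (auto simp: killing_add_right[OF X] killing_scale_right[OF X])
 qed
 have "l ` \<gg> = \<gg>" proof (rule subspace_dim_equal)
  show "subspace (l ` \<gg>)" by (rule linear_subspace_image[OF lin subspace_lie_algebra])
  show "subspace \<gg>" by (rule subspace_lie_algebra)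
  show "l ` \<gg> <= \<gg>" unfolding l_def using B(1) by (auto intro!: subspace_sum[OF subspace_lie_algebra] lie_algebra_scaleR)
  have "inj_on l (span \<gg>)" unfolding span_eq_iff[THEN iffD2, OF subspace_lie_algebra] using linear_inj_on_iff_eq_0[OF lin subspace_lie_algebra] inj by blast
  then show "dim \<gg> <= dim (l ` \<gg>)" using dim_image_eq[OF lin] by simp
 qed
 define \<Lambda> where "\<Lambda> X = trace_on \<gg> (%Y. D (bracket X Y))" for X
 have e: "endo_on \<gg> (%Y. D (bracket X Y))" if "X : \<gg>" for X by (rule endo_on_compose[OF D ad_endo[OF that]])
 have \<Lambda>add: "\<Lambda> (X + Y) = \<Lambda> X + \<Lambda> Y" if X: "X : \<gg>" and Y: "Y : \<gg>" for X Y
 proof -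
  have "\<Lambda> (X + Y) = trace_on \<gg> (%W. D (bracket X W) + D (bracket Y W))" unfolding \<Lambda>_def by (rule trace_on_cong[OF subspace_lie_algebra])
    (simp add: bracket_simps endo_onD(2)[OF D] lie_algebra_bracket X Y)
  then show ?thesis using trace_on_add[OF subspace_lie_algebra e[OF X] e[OF Y]] by (simp add: \<Lambda>_def)
 qed
 have \<Lambda>scale: "\<Lambda> (c *\<^sub>R X) = c * \<Lambda> X" if X: "X : \<gg>" for X c
 proof -
  have "\<Lambda> (c *\<^sub>R X) = trace_on \<gg> (%W. c *\<^sub>R D (bracket X W))" unfolding \<Lambda>_def by (rule trace_on_cong[OF subspace_lie_algebra])
    (simp add: bracket_simps endo_onD(3)[OF D] lie_algebra_bracket X)
  then show ?thesis using trace_on_scale[OF subspace_lie_algebra e[OF X]] by (simp add: \<Lambda>_def)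
 qed
 have "(\<Sum>b\<in>B. \<Lambda> b *\<^sub>R b) : \<gg>" using B(1) by (auto intro!: subspace_sum[OF subspace_lie_algebra] lie_algebra_scaleR)
 then have "(\<Sum>b\<in>B. \<Lambda> b *\<^sub>R b) : l ` \<gg>" using \<open>l ` \<gg> = \<gg>\<close> by simp
 then obtain Z where Z: "Z : \<gg>" "l Z = (\<Sum>b\<in>B. \<Lambda> b *\<^sub>R b)" unfolding image_iff by metis
 have "\<kappa> Z b = \<Lambda> b" if b: "b : B" for b
 proof -
  have "(\<Sum>b\<in>B. (\<kappa> Z b - \<Lambda> b) *\<^sub>R b) = 0" using Z(2) P(3)[OF Z(1)] by (simp add: l_def scaleR_left_diff_distrib sum_subtractf)
  then have "\<kappa> Z b - \<Lambda> b = 0" by (rule B(2)[unfolded independent_explicit, THEN conjunct2, rule_format, OF _ b])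
  then show ?thesis by simp
 qed
 note onB = this
 have rep: "\<kappa> Z X = \<Lambda> X" if X: "X : \<gg>" for X
 proof (rule ext[OF X, of "\<kappa> Z" \<Lambda>])
  show "\<kappa> Z b = \<Lambda> b" if "b : B" for b by (rule onB[OF that])
 qed (simp_all only: killing_add_right[OF Z(1)] killing_scale_right[OF Z(1)] \<Lambda>add \<Lambda>scale)
 define E where "E X = D X + (-1) *\<^sub>R bracket Z X" for X
 have adZ: "endo_on \<gg> (%X. (-1) *\<^sub>R bracket Z X)" by (rule endo_on_minus_ad[OF Z(1) ad_endo[OF Z(1)]])
 have endoE: "endo_on \<gg> E" unfolding E_def by (rule endo_on_add[OF subspace_lie_algebra D adZ])
 have trE: "trace_on \<gg> (%Y. E (bracket X Y)) = 0" if X: "X : \<gg>" for X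
 proof -
  have "trace_on \<gg> (%Y. E (bracket X Y)) = \<Lambda> X + trace_on \<gg> (%Y. (-1) *\<^sub>R bracket Z (bracket X Y))"
   unfolding E_def \<Lambda>_def by (rule trace_on_add[OF subspace_lie_algebra e[OF X] endo_on_compose[OF adZ ad_endo[OF X]]])
  also have "trace_on \<gg> (%Y. (-1) *\<^sub>R bracket Z (bracket X Y)) = - \<kappa> Z X"
   using trace_on_scale[OF subspace_lie_algebra endo_on_compose[OF ad_endo[OF Z(1)] ad_endo[OF X]], of "-1"] by (simp add: killing_form_def)
  finally show ?thesis using rep[OF X] by simp
 qed
 have derE: "E (bracket X Y) = bracket (E X) Y + bracket X (E Y)" if "X : \<gg>" "Y : \<gg>" for X Y
  unfolding E_def der[OF that] by (simp add: bracket_jacobi[of Z X Y] bracket_simps algebra_simps)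
 have "E X = 0" if X: "X : \<gg>" for X
 proof (rule nondeg[OF endo_onD(1)[OF endoE X]])
  fix Y assume Y: "Y : \<gg>"
  have XY: "bracket X Y : \<gg>" by (rule lie_algebra_bracket[OF X Y])
  have e1: "endo_on \<gg> (%W. E (bracket X (bracket Y W)))" by (rule endo_on_compose[OF endoE endo_on_compose[OF ad_endo[OF X] ad_endo[OF Y]]])
  have e2: "endo_on \<gg> (%W. (-1) *\<^sub>R bracket X (E (bracket Y W)))"
   by (rule endo_on_minus_ad[OF X endo_on_compose[OF ad_endo[OF X] endo_on_compose[OF endoE ad_endo[OF Y]]]])
  have e3: "endo_on \<gg> (%W. (-1) *\<^sub>R E (bracket Y (bracket X W)))"
   by (rule endo_on_minus_ad[OF X endo_on_compose[OF endoE endo_on_compose[OF ad_endo[OF Y] ad_endo[OF X]]]])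
  have "\<kappa> (E X) Y = trace_on \<gg> (%W. E (bracket X (bracket Y W)) + (-1) *\<^sub>R bracket X (E (bracket Y W)))" unfolding killing_form_def
   by (rule trace_on_cong[OF subspace_lie_algebra]) (simp add: derE X Y lie_algebra_bracket)
  also have "\<dots> = trace_on \<gg> (%W. E (bracket X (bracket Y W))) + trace_on \<gg> (%W. (-1) *\<^sub>R bracket X (E (bracket Y W)))"
   by (rule trace_on_add[OF subspace_lie_algebra e1 e2])
  also have "trace_on \<gg> (%W. (-1) *\<^sub>R bracket X (E (bracket Y W))) = - trace_on \<gg> (%W. bracket X (E (bracket Y W)))"
   using trace_on_scale[OF subspace_lie_algebra endo_on_compose[OF ad_endo[OF X] endo_on_compose[OF endoE ad_endo[OF Y]]], of "-1"] by simp
  also have "trace_on \<gg> (%W. bracket X (E (bracket Y W))) = trace_on \<gg> (%W. E (bracket Y (bracket X W)))"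
   by (rule trace_on_commute[OF subspace_lie_algebra ad_endo[OF X] endo_on_compose[OF endoE ad_endo[OF Y]]])
  also have "- trace_on \<gg> (%W. E (bracket Y (bracket X W))) = trace_on \<gg> (%W. (-1) *\<^sub>R E (bracket Y (bracket X W)))"
   using trace_on_scale[OF subspace_lie_algebra endo_on_compose[OF endoE endo_on_compose[OF ad_endo[OF Y] ad_endo[OF X]]], of "-1"] by simp
  also have "trace_on \<gg> (%W. E (bracket X (bracket Y W))) + trace_on \<gg> (%W. (-1) *\<^sub>R E (bracket Y (bracket X W)))
    = trace_on \<gg> (%W. E (bracket X (bracket Y W)) + (-1) *\<^sub>R E (bracket Y (bracket X W)))" by (rule trace_on_add[OF subspace_lie_algebra e1 e3, symmetric])
  also have "\<dots> = trace_on \<gg> (%W. E (bracket (bracket X Y) W))" proof (rule trace_on_cong[OF subspace_lie_algebra])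
   fix W assume W: "W : \<gg>"
   have "E (bracket X (bracket Y W)) = E (bracket (bracket X Y) W) + E (bracket Y (bracket X W))" unfolding bracket_jacobi[of X Y W]
    by (rule endo_onD(2)[OF endoE]) (auto intro!: lie_algebra_bracket X Y W)
   then show "E (bracket X (bracket Y W)) + (-1) *\<^sub>R E (bracket Y (bracket X W)) = E (bracket (bracket X Y) W)" by simp
  qed
  also have "\<dots> = 0" by (rule trE[OF XY])
  finally show "\<kappa> (E X) Y = 0" .
 qed
 then have "bracket Z X = D X" if "X : \<gg>" for X using that by (simp add: E_def)
 then show ?thesis using that Z(1) by blast
qed

end

section \<open>The complex structure as an element of the Lie algebra\<close>

locale involutive_group = continuous_hom G \<phi> for G :: "'n::finite cmat set" and \<phi> :: "'n cmat => 'n cmat" +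
 assumes maps: "g : G ==> \<phi> g : G" and involutive: "g : G ==> \<phi> (\<phi> g) = g"
begin

lemma differential_mem: "X : \<gg> ==> d\<phi> X : \<gg>" using maps[OF exp_scaleR_mem] by (auto simp: lie_algebra_def hom_exp_curve)

lemma differential_involutive: "X : \<gg> ==> d\<phi> (d\<phi> X) = X" by (rule differential_eqI) (simp add: hom_exp_curve[symmetric] involutive exp_scaleR_mem)

lemma differential_minus: "X : \<gg> ==> d\<phi> (- X) = - d\<phi> X" using differential_scaleR[of X "-1"] by simp

lemma differential_0 [simp]: "d\<phi> 0 = 0" using differential_scaleR[of 0 0] by simp

lemma differential_endo: "endo_on \<gg> d\<phi>" by (simp add: endo_on_def differential_mem differential_add differential_scaleR)

end

lemma group_involution_imp_involutive_group:
 assumes "matrix_lie_group G" "group_involution G \<phi>"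
 shows "involutive_group G \<phi>" proof -
 interpret closed_matrix_group G by unfold_locales (rule assms)
 have m: "\<phi> (mat 1) : G" "\<phi> (mat 1) = \<phi> (mat 1) ** \<phi> (mat 1)"
  using assms(2) one_mem matrix_mul_lid[of "mat 1"] unfolding group_involution_def by metis+
 have "matrix_inv (\<phi> (mat 1)) ** \<phi> (mat 1) = matrix_inv (\<phi> (mat 1)) ** (\<phi> (mat 1) ** \<phi> (mat 1))" using m(2) by simp
 then have "\<phi> (mat 1) = mat 1" using m(1) by simp
 then show ?thesis using assms(2) by unfold_locales (auto simp: group_involution_def)
qed

text \<open>The pieces of the data of a bounded symmetric domain that determine its complex structure.\<close>

locale hermitian_group = involutive_group G \<theta> for G :: "'n::finite cmat set" and \<theta> :: "'n cmat => 'n cmat" +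
 fixes J :: "'n cmat => 'n cmat"
 assumes conn: "connected G" and noncompact: "\<not> compact G"
  and simple: "simple_lie_algebra (lie_algebra G)"
  and positive: "!!X. X : lie_algebra G ==> X ~= 0 ==>
   - killing_form (lie_algebra G) X (hom_differential \<theta> X) > 0"
  and compactK: "compact (fixed_group G \<theta>)"
  and complex: "invariant_complex_structure (fixed_group G \<theta>) (cartan_p G \<theta>) J"
  and abelian: "abelian_subset (p_plus (cartan_p G \<theta>) J)"
begin

abbreviation d\<theta> where "d\<theta> \<equiv> hom_differential \<theta>"
abbreviation K where "K \<equiv> fixed_group G \<theta>"
abbreviation \<pp> where "\<pp> \<equiv> cartan_p G \<theta>"
definition \<kk> where "\<kk> = {X : \<gg>. d\<theta> X = X}"

lemma p_iff: "X : \<pp> \<longleftrightarrow> X : \<gg> \<and> d\<theta> X = - X" by (simp add: cartan_p_def lie_differential_eq)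

lemma p_mem: "X : \<pp> ==> X : \<gg>" and k_mem: "X : \<kk> ==> X : \<gg>" by (auto simp: p_iff \<kk>_def)

lemma subspace_p: "subspace \<pp>" unfolding subspace_def using subspace_lie_algebra
 by (auto simp: p_iff differential_add differential_scaleR subspace_add lie_algebra_scaleR
   dest: differential_scaleR[of 0 0])

lemma subspace_k: "subspace \<kk>" unfolding subspace_def \<kk>_def using subspace_lie_algebra differential_scaleR[of 0 0]
 by (auto simp: differential_add differential_scaleR subspace_add lie_algebra_scaleR)

definition k_part where "k_part X = (1/2) *\<^sub>R (X + d\<theta> X)"
definition p_part where "p_part X = (1/2) *\<^sub>R (X - d\<theta> X)"

lemma parts:
 assumes X: "X : \<gg>"
 shows "k_part X : \<kk>" "p_part X : \<pp>" "k_part X + p_part X = X" proof -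
 have d: "d\<theta> X : \<gg>" "d\<theta> (d\<theta> X) = X" using X by (auto intro: differential_mem differential_involutive)
 have m: "- d\<theta> X : \<gg>" "d\<theta> (- d\<theta> X) = - X" using d differential_minus[OF d(1)] subspace_neg[OF subspace_lie_algebra] by auto
 show "k_part X : \<kk>" using X d subspace_lie_algebra
  by (simp add: k_part_def \<kk>_def lie_algebra_scaleR subspace_add differential_scaleR differential_add add.commute)
 have "X + - d\<theta> X : \<gg>" using X m subspace_lie_algebra by (simp only: subspace_add)
 moreover have "d\<theta> (X + - d\<theta> X) = - (X + - d\<theta> X)" using differential_add[OF X m(1)] m(2) by simp
 ultimately show "p_part X : \<pp>" unfolding p_part_def by (intro subspace_scale[OF subspace_p]) (simp add: p_iff)
 show "k_part X + p_part X = X" by (simp add: k_part_def p_part_def scaleR_right_distrib scaleR_right_diff_distrib scaleR_left_distrib[symmetric])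
qed

lemma p_part_p: "X : \<pp> ==> p_part X = X" and p_part_k: "X : \<kk> ==> p_part X = 0"
 and k_part_p: "X : \<pp> ==> k_part X = 0" and k_part_k: "X : \<kk> ==> k_part X = X"
 by (simp_all add: p_part_def k_part_def p_iff \<kk>_def scaleR_left_distrib[symmetric] flip: scaleR_2)

lemma parts_add:
 assumes "X : \<gg>" "Y : \<gg>"
 shows "p_part (X + Y) = p_part X + p_part Y" "k_part (X + Y) = k_part X + k_part Y" using assms by (simp_all add: p_part_def k_part_def differential_add algebra_simps)

lemma parts_scaleR:
 assumes "X : \<gg>"
 shows "p_part (c *\<^sub>R X) = c *\<^sub>R p_part X" "k_part (c *\<^sub>R X) = c *\<^sub>R k_part X"
 using assms by (simp_all add: p_part_def k_part_def differential_scaleR algebra_simps)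

lemma bracket_kk: "X : \<kk> ==> Y : \<kk> ==> bracket X Y : \<kk>"
 and bracket_kp: "X : \<kk> ==> Y : \<pp> ==> bracket X Y : \<pp>"
 and bracket_pk: "Y : \<pp> ==> X : \<kk> ==> bracket Y X : \<pp>"
 and bracket_pp: "Y : \<pp> ==> Z : \<pp> ==> bracket Y Z : \<kk>" by (simp_all add: \<kk>_def p_iff lie_algebra_bracket differential_bracket bracket_simps)

lemma K_group:
 "mat 1 : K" "k : K ==> l : K ==> k ** l : K" "k : K ==> matrix_inv k : K" "k : K ==> k : G" by (auto simp: fixed_group_def hom_one hom_mult hom_inv)

lemma exp_k_mem: "X : \<kk> ==> mexp (t *\<^sub>R X) : K" by (auto simp: fixed_group_def \<kk>_def hom_exp_curve)

lemma Ad_K: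
 assumes k: "k : K"
 shows "X : \<kk> ==> Ad k X : \<kk>" "X : \<pp> ==> Ad k X : \<pp>" using k by (auto simp: \<kk>_def p_iff fixed_group_def lie_algebra_Ad differential_Ad Ad_simps)

lemma J_mem: "X : \<pp> ==> J X : \<pp>"
 and J_add: "X : \<pp> ==> Y : \<pp> ==> J (X + Y) = J X + J Y"
 and J_scaleR: "X : \<pp> ==> J (c *\<^sub>R X) = c *\<^sub>R J X"
 and J_J: "X : \<pp> ==> J (J X) = - X"
 and J_Ad: "k : K ==> X : \<pp> ==> J (Ad k X) = Ad k (J X)" using complex by (simp_all add: invariant_complex_structure_def)

lemma J_minus: "X : \<pp> ==> J (- X) = - J X" using J_scaleR[of X "-1"] by simp

lemma J_0: "J 0 = 0" using J_scaleR[of 0 0] subspace_0[OF subspace_p] by simp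

lemma linear_J_extension:
 obtains l where "linear l" "!!X. X : \<gg> ==> l X = J (p_part X)" proof -
 obtain P where P: "linear P" "!!v. P v : \<gg>" "!!v. v : \<gg> ==> P v = v" by (rule linear_projection) (rule that)
 have "linear (%v. J (p_part (P v)))" by (rule linearI) (simp_all add: linear_add[OF P(1)] linear_scale[OF P(1)] parts_add parts_scaleR J_add J_scaleR parts P(2))
 then show ?thesis using that[of "%v. J (p_part (P v))"] P(3) by simp
qed

lemma J_bracket_k:
 assumes Y: "Y : \<kk>" and X: "X : \<pp>"
 shows "J (bracket Y X) = bracket Y (J X)" proof -
 obtain l where l: "linear l" "!!X. X : \<gg> ==> l X = J (p_part X)" by (rule linear_J_extension) (rule that)
 have lp: "l V = J V" if "V : \<pp>" for V using l(2)[OF p_mem[OF that]] p_part_p[OF that] by simp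
 have "bounded_linear l" using l(1) by (simp add: linear_conv_bounded_linear)
 then have "((%s. l (Ad (mexp (s *\<^sub>R Y)) X)) has_vector_derivative l (bracket Y X)) (at 0)"
  by (rule bounded_linear.has_vector_derivative) (rule Ad_exp_derivative_at_0)
 moreover have "l (Ad (mexp (s *\<^sub>R Y)) X) = Ad (mexp (s *\<^sub>R Y)) (J X)" for s
  using lp[OF Ad_K(2)[OF exp_k_mem[OF Y] X]] J_Ad[OF exp_k_mem[OF Y] X] by simp
 ultimately have "((%s. Ad (mexp (s *\<^sub>R Y)) (J X)) has_vector_derivative l (bracket Y X)) (at 0)" by simp
 then have "l (bracket Y X) = bracket Y (J X)" by (rule has_vector_derivative_unique_at[OF _ Ad_exp_derivative_at_0])
 then show ?thesis using lp[OF bracket_kp[OF Y X]] by simp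
qed

lemma p_plus_mem: "X : \<pp> ==> (X, - J X) : p_plus \<pp> J" by (simp add: p_plus_def scaleI_def J_mem J_minus J_J subspace_neg[OF subspace_p])

lemma p_plusD: "x : p_plus \<pp> J ==> fst x : \<pp> \<and> snd x = - J (fst x)" by (auto simp: p_plus_def scaleI_def)

lemma p_minus_mem: "X : \<pp> ==> (X, J X) : p_minus \<pp> J" by (simp add: p_minus_def scaleI_def J_mem J_J)

lemma bracket_J_J:
 assumes "X : \<pp>" "Y : \<pp>"
 shows "bracket (J X) (J Y) = bracket X Y" "bracket (J X) Y + bracket X (J Y) = 0" proof -
 have "bracketC (X, - J X) (Y, - J Y) = 0" using abelian p_plus_mem assms by (simp add: abelian_subset_def)
 then show "bracket (J X) (J Y) = bracket X Y" "bracket (J X) Y + bracket X (J Y) = 0"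
  by (auto simp: bracketC_def bracket_simps zero_prod_def neg_eq_iff_add_eq_0 add_eq_0_iff add.commute)
qed

lemma killing_nondegenerate: "X : \<gg> ==> (!!Y. Y : \<gg> ==> \<kappa> X Y = 0) ==> X = 0" using positive[of X] differential_mem by fastforce

lemma center_trivial:
 assumes X: "X : \<gg>" and c: "!!Y. Y : \<gg> ==> bracket X Y = 0"
 shows "X = 0" proof (rule killing_nondegenerate[OF X])
 fix Y assume Y: "Y : \<gg>"
 have e: "endo_on \<gg> (%W. bracket X (bracket Y W))" by (rule endo_on_compose[OF ad_endo[OF X] ad_endo[OF Y]])
 have "\<kappa> X Y = trace_on \<gg> (%W. 0 *\<^sub>R bracket X (bracket Y W))"
  unfolding killing_form_def by (rule trace_on_cong[OF subspace_lie_algebra]) (simp add: c Y lie_algebra_bracket)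
 then show "\<kappa> X Y = 0" using trace_on_scale[OF subspace_lie_algebra e, of 0] by simp
qed

text \<open>Extended by zero to \<open>\<kk>\<close>, the complex structure is a derivation: on \<open>[\<pp>, \<pp>]\<close> this says that
 \<open>[J X, Y] + [X, J Y]\<close> vanishes, which is the commutativity of \<open>\<pp>\<^sup>+\<close>.\<close>

lemma complex_structure_inner:
 "\<exists>Z. Z : \<kk> \<and> (\<forall>X\<in>\<pp>. bracket Z X = J X) \<and> (\<forall>Y\<in>\<kk>. bracket Z Y = 0)" proof -
 define D where "D X = J (p_part X)" for X
 have Dp: "D X = J X" if "X : \<pp>" for X using that by (simp add: D_def p_part_p)
 have Dk: "D X = 0" if "X : \<kk>" for X using that by (simp add: D_def p_part_k J_0)
 have endo: "endo_on \<gg> D" by (simp add: endo_on_def D_def parts parts_add parts_scaleR J_add J_scaleR J_mem p_mem)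
 have der: "D (bracket X Y) = bracket (D X) Y + bracket X (D Y)" if X: "X : \<gg>" and Y: "Y : \<gg>" for X Y
 proof -
  define X1 X2 Y1 Y2 where "X1 = k_part X" and "X2 = p_part X" and "Y1 = k_part Y" and "Y2 = p_part Y"
  have m: "X1 : \<kk>" "X2 : \<pp>" "Y1 : \<kk>" "Y2 : \<pp>" and eq: "X = X1 + X2" "Y = Y1 + Y2" using parts X Y by (auto simp: X1_def X2_def Y1_def Y2_def)
  note mg = k_mem[OF m(1)] p_mem[OF m(2)] k_mem[OF m(3)] p_mem[OF m(4)]
  have DX: "D X = J X2" "D Y = J Y2" by (simp_all add: D_def X2_def Y2_def)
  have pb: "bracket X2 Y1 = - bracket Y1 X2" by (rule bracket_swap)
  have "D (bracket X Y) = D (bracket X1 Y1 + bracket X2 Y2 + (bracket X1 Y2 + bracket X2 Y1))" by (simp add: eq bracket_simps algebra_simps)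
  also have "\<dots> = D (bracket X1 Y1 + bracket X2 Y2) + D (bracket X1 Y2 + bracket X2 Y1)"
   using mg by (intro endo_onD(2)[OF endo] subspace_add[OF subspace_lie_algebra] lie_algebra_bracket)
  also have "D (bracket X1 Y1 + bracket X2 Y2) = 0" using m by (intro Dk subspace_add[OF subspace_k] bracket_kk bracket_pp)
  also have "D (bracket X1 Y2 + bracket X2 Y1) = J (bracket X1 Y2 + bracket X2 Y1)" using m by (intro Dp subspace_add[OF subspace_p] bracket_kp bracket_pk)
  also have "\<dots> = J (bracket X1 Y2) + J (bracket X2 Y1)" using m by (intro J_add bracket_kp bracket_pk)
  also have "J (bracket X1 Y2) = bracket X1 (J Y2)" by (rule J_bracket_k[OF m(1) m(4)])
  also have "J (bracket X2 Y1) = bracket (J X2) Y1" unfolding pb using J_minus[OF bracket_kp[OF m(3) m(2)]] J_bracket_k[OF m(3) m(2)] bracket_swap[of "J X2" Y1] by simp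
  finally have "D (bracket X Y) = bracket X1 (J Y2) + bracket (J X2) Y1" by simp
  moreover have "bracket (D X) Y = bracket (J X2) Y1 + bracket (J X2) Y2" unfolding DX(1) eq(2) bracket_simps ..
  moreover have "bracket X (D Y) = bracket X1 (J Y2) + bracket X2 (J Y2)" unfolding DX(2) eq(1) bracket_simps ..
  ultimately show ?thesis
   using bracket_J_J(2)[OF m(2) m(4)] by (simp add: algebra_simps)
 qed
 obtain Z where Z: "Z : \<gg>" "!!X. X : \<gg> ==> bracket Z X = D X" using derivation_inner[OF killing_nondegenerate endo der] by blast
 have "d\<theta> Z - Z = 0" proof (rule center_trivial)
  show "d\<theta> Z - Z : \<gg>" using Z(1) differential_mem by (simp add: subspace_diff[OF subspace_lie_algebra])
  fix Y assume Y: "Y : \<gg>"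
  have dY: "d\<theta> Y : \<gg>" using Y by (rule differential_mem)
  have "bracket (d\<theta> Z) Y = d\<theta> (bracket Z (d\<theta> Y))" using Z(1) Y dY by (simp add: differential_bracket differential_involutive)
  also have "\<dots> = d\<theta> (J (p_part (d\<theta> Y)))" using Z(2)[OF dY] by (simp add: D_def)
  also have "p_part (d\<theta> Y) = - p_part Y" using Y by (simp add: p_part_def differential_involutive algebra_simps)
  also have "d\<theta> (J (- p_part Y)) = J (p_part Y)" using parts(2)[OF Y] J_mem[OF parts(2)[OF Y]] J_minus p_mem differential_minus by (simp add: p_iff)
  finally have "bracket (d\<theta> Z) Y = bracket Z Y" using Z(2)[OF Y] by (simp add: D_def)
  then show "bracket (d\<theta> Z - Z) Y = 0" by (simp add: bracket_simps)
 qed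
 then have "Z : \<kk>" using Z(1) by (simp add: \<kk>_def)
 moreover have "bracket Z X = J X" if "X : \<pp>" for X
  using Z(2)[OF p_mem[OF that]] Dp[OF that] by simp
 moreover have "bracket Z Y = 0" if "Y : \<kk>" for Y
  using Z(2)[OF k_mem[OF that]] Dk[OF that] by simp
 ultimately show ?thesis by (intro exI[of _ Z] conjI ballI)
qed

definition Z where "Z = (SOME Z. Z : \<kk> \<and> (\<forall>X\<in>\<pp>. bracket Z X = J X) \<and> (\<forall>Y\<in>\<kk>. bracket Z Y = 0))"

lemma Z_mem: "Z : \<kk>" and Z_p: "X : \<pp> ==> bracket Z X = J X" and Z_k: "Y : \<kk> ==> bracket Z Y = 0"
 using someI_ex[OF complex_structure_inner] unfolding Z_def by blast+

lemma Z_g: "Z : \<gg>" by (rule k_mem[OF Z_mem])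

lemma Z_unique:
 assumes "Z' : \<gg>" "!!X. X : \<pp> ==> bracket Z' X = J X" "!!Y. Y : \<kk> ==> bracket Z' Y = 0"
 shows "Z' = Z" proof -
 have "Z' - Z = 0" proof (rule center_trivial)
  show "Z' - Z : \<gg>" using assms(1) Z_g by (simp add: subspace_diff[OF subspace_lie_algebra])
  fix Y assume Y: "Y : \<gg>"
  have "bracket (Z' - Z) (k_part Y + p_part Y) = 0" unfolding bracket_simps using parts(1,2)[OF Y] assms Z_p Z_k by simp
  then show "bracket (Z' - Z) Y = 0" using parts(3)[OF Y] by simp
 qed
 then show ?thesis by simp
qed

lemma Ad_K_Z:
 assumes k: "k : K" shows "Ad k Z = Z" proof (rule Z_unique)
 have kG: "k : G" "matrix_inv k : K" using k K_group by auto
 show "Ad k Z : \<gg>" using lie_algebra_Ad[OF kG(1) Z_g] .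
 have inv: "Ad k (Ad (matrix_inv k) X) = X" for X
  using kG(1) by (simp add: Ad_mult[symmetric] invertible_mem inv_mem)
 have b: "bracket (Ad k Z) X = Ad k (bracket Z (Ad (matrix_inv k) X))" for X
  using Ad_bracket[OF invertible_mem[OF kG(1)], of Z "Ad (matrix_inv k) X"] inv by simp
 show "bracket (Ad k Z) X = J X" if X: "X : \<pp>" for X
  using b[of X] Z_p[OF Ad_K(2)[OF kG(2) X]] J_Ad[OF k Ad_K(2)[OF kG(2) X]] inv by simp
 show "bracket (Ad k Z) Y = 0" if Y: "Y : \<kk>" for Y
  using b[of Y] Z_k[OF Ad_K(1)[OF kG(2) Y]] by (simp add: Ad_simps)
qed

abbreviation rot where "rot t \<equiv> mexp (t *\<^sub>R Z)"

lemma rot_mem: "rot t : K" "rot t : G" using exp_k_mem[OF Z_mem] K_group(4) by auto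

lemma Ad_rot_p:
 assumes X: "X : \<pp>"
 shows "Ad (rot t) X = cos t *\<^sub>R X + sin t *\<^sub>R J X" proof -
 define c where "c t = cos t *\<^sub>R Ad (mexp (t *\<^sub>R (- Z))) X + sin t *\<^sub>R Ad (mexp (t *\<^sub>R (- Z))) (J X)" for t
 have JX: "J X : \<pp>" by (rule J_mem[OF X])
 have d1: "((%s. Ad (mexp (s *\<^sub>R (- Z))) X) has_vector_derivative - Ad (mexp (s *\<^sub>R (- Z))) (J X)) (at s)" for s
  using Ad_exp_derivative[of "- Z" X s] Z_p[OF X] by (simp add: bracket_simps Ad_simps)
 have d2: "((%s. Ad (mexp (s *\<^sub>R (- Z))) (J X)) has_vector_derivative Ad (mexp (s *\<^sub>R (- Z))) X) (at s)" for s
  using Ad_exp_derivative[of "- Z" "J X" s] Z_p[OF JX] J_J[OF X] by (simp add: bracket_simps Ad_simps)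
 have dc: "(cos has_real_derivative - sin s) (at s)" "(sin has_real_derivative cos s) (at s)" for s :: real
  by (auto intro!: derivative_eq_intros)
 have "(c has_vector_derivative
   (cos s *\<^sub>R (- Ad (mexp (s *\<^sub>R (- Z))) (J X)) + (- sin s) *\<^sub>R Ad (mexp (s *\<^sub>R (- Z))) X) +
   (sin s *\<^sub>R Ad (mexp (s *\<^sub>R (- Z))) X + cos s *\<^sub>R Ad (mexp (s *\<^sub>R (- Z))) (J X))) (at s within UNIV)" for s
  unfolding c_def by (intro has_vector_derivative_add has_vector_derivative_scaleR dc d1 d2)
 then have "(c has_vector_derivative 0) (at s within UNIV)" for s by simp
 then obtain v where v: "!!s. c s = v" using has_vector_derivative_zero_constant[OF convex_UNIV, of c] by auto
 have cX: "c s = X" for s using v[of s] v[of 0] by (simp add: c_def)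
 have "c t = Ad (mexp (- (t *\<^sub>R Z))) (cos t *\<^sub>R X + sin t *\<^sub>R J X)" by (simp add: c_def Ad_simps)
 then have "Ad (rot t) X = Ad (rot t) (Ad (mexp (- (t *\<^sub>R Z))) (cos t *\<^sub>R X + sin t *\<^sub>R J X))" using cX[of t] by simp
 also have "\<dots> = cos t *\<^sub>R X + sin t *\<^sub>R J X" by (simp add: Ad_mult[symmetric])
 finally show ?thesis .
qed

lemma Ad_rot_k:
 assumes Y: "Y : \<kk>" shows "Ad (rot t) Y = Y" proof -
 have "((%s. Ad (rot s) Y) has_vector_derivative 0) (at s within UNIV)" for s
  using Ad_exp_derivative[of Z Y s] Z_k[OF Y] by (simp add: Ad_simps)
 then obtain v where v: "!!s. Ad (rot s) Y = v" using has_vector_derivative_zero_constant[OF convex_UNIV, of "%s. Ad (rot s) Y"] by auto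
 show ?thesis using v[of t] v[of 0] by simp
qed

lemma rot_period_central:
 assumes g: "g : G" shows "rot (2 * pi) ** g = g ** rot (2 * pi)" proof -
 let ?c = "rot (2 * pi)"
 have Ad: "Ad ?c X = X" if X: "X : \<gg>" for X
  using parts[OF X] linear_add[OF linear_Ad, of ?c "k_part X" "p_part X"] by (simp add: Ad_rot_k Ad_rot_p)
 have "{g : G. ?c ** g = g ** ?c} = G" proof (rule connected_group_generated[OF conn])
  fix a X assume a: "a : {g : G. ?c ** g = g ** ?c}" and X: "X : \<gg>"
  have "?c ** mexp X ** matrix_inv ?c = mexp X" using Ad_exp[of ?c X] Ad[OF X] by simp
  then have "?c ** mexp X ** matrix_inv ?c ** ?c = mexp X ** ?c" by simp
  then have e: "?c ** mexp X = mexp X ** ?c" using rot_mem(2) by (simp add: matrix_mul_assoc[symmetric])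
  have "?c ** (a ** mexp X) = a ** (?c ** mexp X)" using a by (simp add: matrix_mul_assoc)
  also have "\<dots> = a ** mexp X ** ?c" unfolding e by (simp add: matrix_mul_assoc)
  finally show "a ** mexp X : {g : G. ?c ** g = g ** ?c}" using a X exp_mem by auto
 qed auto
 then show ?thesis using g by blast
qed

lemma p_nontrivial: "\<exists>X\<in>\<pp>. X ~= 0" proof (rule ccontr)
 assume "\<not> (\<exists>X\<in>\<pp>. X ~= 0)"
 then have k: "X : \<kk>" if "X : \<gg>" for X using parts[OF that] by force
 have "{g : G. \<theta> g = g} = G" proof (rule connected_group_generated[OF conn])
  fix a X assume "a : {g : G. \<theta> g = g}" "X : \<gg>"
  then show "a ** mexp X : {g : G. \<theta> g = g}" using k[of X] exp_mem[of X] by (auto simp: hom_mult hom_exp \<kk>_def)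
 qed (auto simp: hom_one)
 then have "K = G" by (simp add: fixed_group_def)
 then show False using noncompact compactK by simp
qed

text \<open>For \<open>\<pp> = \<pp>\<^sub>1 + \<pp>\<^sub>2\<close> invariant under \<open>\<kk>\<close> with \<open>[\<pp>\<^sub>1, \<pp>\<^sub>2] = 0\<close>, the sum of \<open>\<pp>\<^sub>1\<close> and \<open>[\<pp>\<^sub>1, \<pp>\<^sub>1]\<close> is an
 ideal whose elements have \<open>\<pp>\<close>-part in \<open>\<pp>\<^sub>1\<close>.\<close>

lemma ideal_of_summand:
 assumes p1: "subspace \<pp>\<^sub>1" "\<pp>\<^sub>1 <= \<pp>" and p2: "\<pp>\<^sub>2 <= \<pp>"
  and sum: "!!X. X : \<pp> ==> \<exists>X1\<in>\<pp>\<^sub>1. \<exists>X2\<in>\<pp>\<^sub>2. X = X1 + X2"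
  and inv: "!!Y X. Y : \<kk> ==> X : \<pp>\<^sub>1 ==> bracket Y X : \<pp>\<^sub>1"
  and comm: "!!X Y. X : \<pp>\<^sub>1 ==> Y : \<pp>\<^sub>2 ==> bracket Y X = 0"
 shows "\<pp>\<^sub>1 <= {0} \<or> (\<gg> = span (\<pp>\<^sub>1 \<union> {bracket A B |A B. A : \<pp>\<^sub>1 \<and> B : \<pp>\<^sub>1}) \<and> \<pp> <= \<pp>\<^sub>1)"
proof -
 let ?S = "\<pp>\<^sub>1 \<union> {bracket A B |A B. A : \<pp>\<^sub>1 \<and> B : \<pp>\<^sub>1}"
 define I where "I = span ?S"
 have p1g: "A : \<gg>" "A : \<pp>" if "A : \<pp>\<^sub>1" for A using that p1(2) p_mem by auto
 have Sg: "?S <= \<gg>" using p1g lie_algebra_bracket by auto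
 have Ig: "I <= \<gg>" unfolding I_def by (rule span_minimal[OF Sg subspace_lie_algebra])
 have I1: "A : I" if "A : \<pp>\<^sub>1" for A unfolding I_def using that by (intro span_base) auto
 have I2: "bracket A B : I" if "A : \<pp>\<^sub>1" "B : \<pp>\<^sub>1" for A B unfolding I_def using that by (intro span_base) auto
 have subI: "subspace I" by (simp add: I_def subspace_span)
 have decomp: "\<exists>a\<in>\<pp>\<^sub>1. \<exists>Y\<in>\<kk>. bracket X A = a + Y \<and> (\<forall>B\<in>\<pp>\<^sub>1. bracket Y B : \<pp>\<^sub>1) \<and> Y : I"
  if X: "X : \<gg>" and A: "A : \<pp>\<^sub>1" for X A
 proof -
  obtain X1 X2 where X12: "X1 : \<pp>\<^sub>1" "X2 : \<pp>\<^sub>2" "p_part X = X1 + X2" using sum[OF parts(2)[OF X]] by blast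
  have "bracket X A = bracket (k_part X + (X1 + X2)) A" using parts(3)[OF X] X12(3) by simp
  also have "\<dots> = bracket (k_part X) A + bracket X1 A" using comm[OF A X12(2)] by (simp add: bracket_simps)
  finally show ?thesis
   using inv[OF parts(1)[OF X] A] bracket_pp[OF p1g(2)[OF X12(1)] p1g(2)[OF A]] inv I2[OF X12(1) A] by blast
 qed
 have "lie_ideal I \<gg>" unfolding lie_ideal_def
 proof (intro conjI ballI Ig subI)
  fix X Y assume X: "X : \<gg>" and Y: "Y : I"
  have "subspace {Y. bracket X Y : I}" unfolding subspace_def using subI by (auto simp: bracket_simps subspace_add subspace_scale subspace_0)
  moreover have "?S <= {Y. bracket X Y : I}" proof (intro subsetI CollectI)
   fix Y assume "Y : ?S"
   then consider "Y : \<pp>\<^sub>1" | A B where "Y = bracket A B" "A : \<pp>\<^sub>1" "B : \<pp>\<^sub>1" by blast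
   then show "bracket X Y : I" proof cases
    case 1
    then show ?thesis using decomp[OF X 1] I1 subspace_add[OF subI] by metis
   next
    case 2
    have half: "bracket (bracket X A) B : I" if A: "A : \<pp>\<^sub>1" and B: "B : \<pp>\<^sub>1" for A B
    proof -
     obtain a Y where aY: "a : \<pp>\<^sub>1" "bracket X A = a + Y" "bracket Y B : \<pp>\<^sub>1" using decomp[OF X A] B by blast
     then show ?thesis using I1[OF aY(3)] I2[OF aY(1) B] subspace_add[OF subI] by (simp add: bracket_simps)
    qed
    have "bracket X Y = bracket (bracket X A) B + (-1) *\<^sub>R bracket (bracket X B) A"
     unfolding 2(1) bracket_jacobi[of X A B] using bracket_swap[of A "bracket X B"] by simp
    then show ?thesis using half[OF 2(2,3)] half[OF 2(3,2)] subspace_add[OF subI] subspace_scale[OF subI] by metis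
   qed
  qed
  ultimately have "I <= {Y. bracket X Y : I}" unfolding I_def by (rule span_minimal[rotated])
  then show "bracket X Y : I" using Y by blast
 qed
 then have "I = {0} \<or> I = \<gg>" using simple unfolding simple_lie_algebra_def by blast
 moreover have "\<pp> <= \<pp>\<^sub>1" if "I = \<gg>" proof -
  have "subspace {X : \<gg>. p_part X : \<pp>\<^sub>1}" unfolding subspace_def using subspace_lie_algebra p1(1) parts_scaleR(1)[of 0 0]
   by (auto simp: parts_add parts_scaleR subspace_add subspace_scale subspace_0)
  moreover have "?S <= {X : \<gg>. p_part X : \<pp>\<^sub>1}" using p1g lie_algebra_bracket p_part_p p_part_k[OF bracket_pp] subspace_0[OF p1(1)] by auto
  ultimately have "I <= {X : \<gg>. p_part X : \<pp>\<^sub>1}" unfolding I_def by (rule span_minimal[rotated])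
  then show ?thesis using that p_mem p_part_p by force
 qed
 ultimately show ?thesis using I1 unfolding I_def by blast
qed

end

context closed_matrix_group
begin

lemma fixed_group_closed:
 assumes "involutive_group G \<iota>"
 shows "fixed_group G \<iota> <= G" "mat 1 : fixed_group G \<iota>"
  "g : fixed_group G \<iota> ==> h : fixed_group G \<iota> ==> g ** h : fixed_group G \<iota>"
  "g : fixed_group G \<iota> ==> matrix_inv g : fixed_group G \<iota>" proof -
 interpret I: involutive_group G \<iota> by (rule assms)
 show "fixed_group G \<iota> <= G" "mat 1 : fixed_group G \<iota>"
  "g : fixed_group G \<iota> ==> h : fixed_group G \<iota> ==> g ** h : fixed_group G \<iota>"
  "g : fixed_group G \<iota> ==> matrix_inv g : fixed_group G \<iota>" by (auto simp: fixed_group_def I.hom_one I.hom_mult I.hom_inv)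
qed

lemma identity_component_group:
 assumes F: "F <= G" "mat 1 : F" "!!g h. g : F ==> h : F ==> g ** h : F" "!!g. g : F ==> matrix_inv g : F"
 shows "identity_component F <= F" "mat 1 : identity_component F"
  "g : identity_component F ==> h : identity_component F ==> g ** h : identity_component F"
  "g : identity_component F ==> matrix_inv g : identity_component F" proof -
 show "identity_component F <= F" unfolding identity_component_def by (rule connected_component_subset)
 show "mat 1 : identity_component F" unfolding identity_component_def using F(2) by (simp add: connected_component_refl)
 have get: "\<exists>T. connected T \<and> T <= F \<and> mat 1 : T \<and> g : T" if "g : identity_component F" for g
  using that unfolding identity_component_def connected_component_def by auto
 have put: "g : identity_component F" if "connected T" "T <= F" "mat 1 : T" "g : T" for g T
  using that unfolding identity_component_def connected_component_def by auto
 show "g ** h : identity_component F" if g: "g : identity_component F" and h: "h : identity_component F" proof -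
  obtain S where S: "connected S" "S <= F" "mat 1 : S" "g : S" using get[OF g] by blast
  obtain T where T: "connected T" "T <= F" "mat 1 : T" "h : T" using get[OF h] by blast
  have gT: "connected ((%x. g ** x) ` T)" by (intro connected_continuous_image T(1) continuous_intros)
  have "g : (%x. g ** x) ` T" using T(3) by (intro image_eqI[of _ _ "mat 1"]) auto
  then have "connected (S \<union> (%x. g ** x) ` T)" using S gT by (intro connected_Un) auto
  then show ?thesis using S T F(3) by (elim put) auto
 qed
 show "matrix_inv g : identity_component F" if g: "g : identity_component F" proof -
  obtain S where S: "connected S" "S <= F" "mat 1 : S" "g : S" using get[OF g] by blast
  have "continuous_on S matrix_inv" by (rule continuous_on_subset[OF continuous_on_matrix_inv]) (use S(2) F(1) in auto)
  then have "connected (matrix_inv ` S)" using S(1) by (rule connected_continuous_image)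
  moreover have "mat 1 : matrix_inv ` S" using S(3) by (intro image_eqI[of _ _ "mat 1"]) auto
  ultimately show ?thesis using S F(4) by (elim put) auto
 qed
qed

lemma exp_identity_component:
 assumes "!!t. mexp (t *\<^sub>R X) : F"
 shows "mexp (t *\<^sub>R X) : identity_component F" proof -
 have "connected (range (%t. mexp (t *\<^sub>R X)))" by (intro connected_continuous_image connected_UNIV continuous_intros)
 moreover have "mat 1 : range (%t. mexp (t *\<^sub>R X))" by (intro image_eqI[of _ _ 0]) auto
 ultimately show ?thesis
  unfolding identity_component_def connected_component_def
  using assms by (intro CollectI exI[of _ "range (%t. mexp (t *\<^sub>R X))"]) auto
qed

end

context hermitian_group
begin

text \<open>The differential of \<open>\<iota>\<close> carries \<open>Z\<close> to another central element \<open>Z'\<close> of \<open>\<kk>\<close> with \<open>ad Z'\<close> a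
 complex structure on \<open>\<pp>\<close>. The subspaces where the two structures agree or are opposite commute, so
 by simplicity one of them is \<open>\<pp>\<close>. They agree on the \<open>\<iota>\<close>-fixed part of \<open>\<pp>\<close>; if that part is zero,
 then \<open>\<iota>\<close> and \<open>\<theta>\<close> have the same differential.\<close>

theorem complex_structure_fixed:
 assumes inv: "involutive_group G \<iota>" and comm: "!!g. g : G ==> \<iota> (\<theta> g) = \<theta> (\<iota> g)"
  and neq: "\<exists>g\<in>G. \<iota> g ~= \<theta> g"
  and hol: "!!X. X : \<pp> ==> hom_differential \<iota> X = X ==> hom_differential \<iota> (J X) = J X"
 shows "hom_differential \<iota> Z = Z" proof -
 interpret I: involutive_group G \<iota> by (rule inv)
 let ?d = "hom_differential \<iota>"
 have dcomm: "?d (d\<theta> X) = d\<theta> (?d X)" if X: "X : \<gg>" for X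
 proof (rule matrix_exp_scaleR_inject)
  fix t
  have "\<iota> (\<theta> (mexp (t *\<^sub>R X))) = \<theta> (\<iota> (mexp (t *\<^sub>R X)))" using X by (intro comm) auto
  then show "mexp (t *\<^sub>R ?d (d\<theta> X)) = mexp (t *\<^sub>R d\<theta> (?d X))"
   using X by (simp add: hom_exp_curve I.hom_exp_curve differential_mem I.differential_mem)
 qed
 have dk: "?d X : \<kk>" if "X : \<kk>" for X
  using that dcomm[of X] by (auto simp: \<kk>_def I.differential_mem)
 have dp: "?d X : \<pp>" if "X : \<pp>" for X
  using that dcomm[of X] by (auto simp: p_iff I.differential_mem I.differential_minus)
 define Z' where "Z' = ?d Z"
 have Z'k: "Z' : \<kk>" unfolding Z'_def by (rule dk[OF Z_mem])
 define J' where "J' X = bracket Z' X" for X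
 have Z'0: "bracket Z' Y = 0" if Y: "Y : \<kk>" for Y
 proof -
  have "bracket Z' Y = ?d (bracket Z (?d Y))" using Y by (simp add: Z'_def I.differential_bracket Z_g k_mem I.differential_mem I.differential_involutive)
  then show ?thesis using Z_k[OF dk[OF Y]] by simp
 qed
 have J'd: "J' X = ?d (J (?d X))" if X: "X : \<pp>" for X
 proof -
  have "J' X = ?d (bracket Z (?d X))" using X by (simp add: J'_def Z'_def I.differential_bracket Z_g p_mem I.differential_mem I.differential_involutive)
  then show ?thesis using Z_p[OF dp[OF X]] by simp
 qed
 have J'p: "J' X : \<pp>" if "X : \<pp>" for X unfolding J'_def by (rule bracket_kp[OF Z'k that])
 have J'J': "J' (J' X) = - X" if X: "X : \<pp>" for X
  using X dp J_mem J_J J'p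
  by (simp add: J'd I.differential_involutive p_mem I.differential_minus I.differential_mem J_minus)
 have JJ': "J' (J X) = J (J' X)" if X: "X : \<pp>" for X
  using bracket_jacobi[of Z' Z X] Z'0[OF Z_mem] Z_p[OF X] Z_p[OF J'p[OF X]] by (simp add: J'_def bracket_simps)
 have J'add: "J' (c *\<^sub>R (X + Y)) = c *\<^sub>R (J' X + J' Y)" "J' (c *\<^sub>R (X - Y)) = c *\<^sub>R (J' X - J' Y)" for c X Y
  by (simp_all add: J'_def bracket_simps)
 have Jadd: "J (c *\<^sub>R (X + Y)) = c *\<^sub>R (J X + J Y)" "J (c *\<^sub>R (X - Y)) = c *\<^sub>R (J X - J Y)" if "X : \<pp>" "Y : \<pp>" for c X Y
  using that Z_p[of "c *\<^sub>R (X + Y)"] Z_p[of "c *\<^sub>R (X - Y)"] Z_p[of X] Z_p[of Y] subspace_p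
  by (simp_all add: bracket_simps subspace_add subspace_diff subspace_scale)
 define \<pp>\<^sub>1 where "\<pp>\<^sub>1 = {X : \<pp>. J' X = J X}"
 define \<pp>\<^sub>2 where "\<pp>\<^sub>2 = {X : \<pp>. J' X = - J X}"
 have sub1: "subspace \<pp>\<^sub>1" unfolding subspace_def \<pp>\<^sub>1_def using subspace_p
  by (auto simp: J'_def bracket_simps subspace_0 subspace_add subspace_scale J_0 J_add J_scaleR)
 have br': "bracket (J' X) (J' Y) = bracket X Y" if X: "X : \<pp>" and Y: "Y : \<pp>" for X Y
 proof -
  have "bracket (J' X) (J' Y) = ?d (bracket (J (?d X)) (J (?d Y)))" using X Y by (simp add: J'd I.differential_bracket p_mem dp J_mem)
  also have "\<dots> = ?d (bracket (?d X) (?d Y))" using bracket_J_J(1)[OF dp[OF X] dp[OF Y]] by simp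
  also have "\<dots> = bracket X Y" using X Y by (simp add: I.differential_bracket p_mem I.differential_mem I.differential_involutive)
  finally show ?thesis .
 qed
 have "\<pp>\<^sub>1 <= {0} \<or> (\<gg> = span (\<pp>\<^sub>1 \<union> {bracket A B |A B. A : \<pp>\<^sub>1 \<and> B : \<pp>\<^sub>1}) \<and> \<pp> <= \<pp>\<^sub>1)"
 proof (rule ideal_of_summand[OF sub1, of \<pp>\<^sub>2])
  show "\<pp>\<^sub>1 <= \<pp>" "\<pp>\<^sub>2 <= \<pp>" by (auto simp: \<pp>\<^sub>1_def \<pp>\<^sub>2_def)
  fix X assume X: "X : \<pp>"
  have m: "J (J' X) : \<pp>" by (intro J_mem J'p X)
  have e: "J' (J (J' X)) = - J X" "J (J (J' X)) = - J' X" using JJ'[OF J'p[OF X]] J'J'[OF X] J_minus[OF X] J_J[OF J'p[OF X]] by simp_all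
  have "(1/2) *\<^sub>R (X - J (J' X)) : \<pp>\<^sub>1"
   using X m subspace_p by (simp only: \<pp>\<^sub>1_def mem_Collect_eq J'add Jadd e) (simp add: subspace_diff subspace_scale algebra_simps)
  moreover have "(1/2) *\<^sub>R (X + J (J' X)) : \<pp>\<^sub>2"
   using X m subspace_p by (simp only: \<pp>\<^sub>2_def mem_Collect_eq J'add Jadd e) (simp add: subspace_add subspace_scale algebra_simps)
  moreover have "X = (1/2) *\<^sub>R (X - J (J' X)) + (1/2) *\<^sub>R (X + J (J' X))" unfolding scaleR_right_distrib[symmetric] by (simp add: scaleR_2[symmetric])
  ultimately show "\<exists>X1\<in>\<pp>\<^sub>1. \<exists>X2\<in>\<pp>\<^sub>2. X = X1 + X2" by blast
 next
  fix Y X assume Y: "Y : \<kk>" and "X : \<pp>\<^sub>1"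
  then have X: "X : \<pp>" "J' X = J X" by (auto simp: \<pp>\<^sub>1_def)
  have "J' (bracket Y X) = bracket Y (J' X)" using bracket_jacobi[of Z' Y X] Z'0[OF Y] by (simp add: J'_def bracket_simps)
  then show "bracket Y X : \<pp>\<^sub>1" using X J_bracket_k[OF Y X(1)] bracket_kp[OF Y X(1)] by (simp add: \<pp>\<^sub>1_def)
 next
  fix X Y assume "X : \<pp>\<^sub>1" "Y : \<pp>\<^sub>2"
  then have XY: "X : \<pp>" "Y : \<pp>" "J' X = J X" "J' Y = - J Y" by (auto simp: \<pp>\<^sub>1_def \<pp>\<^sub>2_def)
  have "bracket X Y = - bracket X Y" using br'[OF XY(1,2)] bracket_J_J(1)[OF XY(1,2)] by (simp add: XY bracket_simps)
  then have "2 *\<^sub>R bracket X Y = 0" by (metis add.right_inverse scaleR_2)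
  then show "bracket Y X = 0" using bracket_swap[of Y X] by simp
 qed
 then show ?thesis
 proof
  assume "\<gg> = span (\<pp>\<^sub>1 \<union> {bracket A B |A B. A : \<pp>\<^sub>1 \<and> B : \<pp>\<^sub>1}) \<and> \<pp> <= \<pp>\<^sub>1"
  then have sub: "\<pp> <= \<pp>\<^sub>1" by blast
  have "Z' = Z" proof (rule Z_unique[OF k_mem[OF Z'k] _ Z'0])
   fix X assume "X : \<pp>"
   then have "X : \<pp>\<^sub>1" using sub by blast
   then show "bracket Z' X = J X" by (simp add: \<pp>\<^sub>1_def J'_def)
  qed
  then show ?thesis by (simp add: Z'_def)
 next
  assume p1: "\<pp>\<^sub>1 <= {0}"
  have onp: "?d X = d\<theta> X" if X: "X : \<pp>" for X
  proof -
   have m: "X + ?d X : \<pp>" using X dp subspace_p by (simp add: subspace_add)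
   have fixX: "?d (X + ?d X) = X + ?d X" using X by (simp add: I.differential_add p_mem I.differential_mem I.differential_involutive add.commute)
   have "J' (X + ?d X) = J (X + ?d X)" using J'd[OF m] fixX hol[OF m fixX] by simp
   then have "X + ?d X : \<pp>\<^sub>1" using m by (simp add: \<pp>\<^sub>1_def)
   then have "X + ?d X = 0" using p1 by blast
   then show ?thesis using X by (simp add: p_iff add_eq_0_iff)
  qed
  have "\<gg> = span (\<pp> \<union> {bracket A B |A B. A : \<pp> \<and> B : \<pp>})"
   using ideal_of_summand[OF subspace_p order_refl, of "{0}"] p_nontrivial subspace_0[OF subspace_p] bracket_kp
   by (force simp: bracket_simps)
  moreover have "span (\<pp> \<union> {bracket A B |A B. A : \<pp> \<and> B : \<pp>}) <= {X : \<gg>. ?d X = d\<theta> X}" proof (rule span_minimal)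
   show "\<pp> \<union> {bracket A B |A B. A : \<pp> \<and> B : \<pp>} <= {X : \<gg>. ?d X = d\<theta> X}"
    using onp p_mem by (auto simp: lie_algebra_bracket differential_bracket I.differential_bracket)
   show "subspace {X : \<gg>. ?d X = d\<theta> X}" unfolding subspace_def using subspace_lie_algebra
    by (auto simp: subspace_add lie_algebra_scaleR differential_add differential_scaleR I.differential_add I.differential_scaleR)
  qed
  ultimately have d: "?d X = d\<theta> X" if "X : \<gg>" for X using that by blast
  have "{g : G. \<iota> g = \<theta> g} = G" proof (rule connected_group_generated[OF conn])
   fix a X assume "a : {g : G. \<iota> g = \<theta> g}" "X : \<gg>"
   then show "a ** mexp X : {g : G. \<iota> g = \<theta> g}" using d[of X] exp_mem[of X] by (auto simp: hom_mult I.hom_mult hom_exp I.hom_exp)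
  qed (auto simp: hom_one I.hom_one)
  then show ?thesis using neq by blast
 qed
qed

section \<open>Scalar action of the centre\<close>

lemma rot_commute:
 assumes k: "k : K" shows "rot t ** k = k ** rot t" proof -
 have kG: "k : G" using K_group(4)[OF k] .
 have "k ** rot t ** matrix_inv k = rot t" using Ad_exp[OF invertible_mem[OF kG], of "t *\<^sub>R Z"] Ad_K_Z[OF k] by (simp add: Ad_simps)
 then have "k ** rot t ** matrix_inv k ** k = rot t ** k" by simp
 then show ?thesis using kG by simp
qed

end

lemma symmetric_has_eigenvector:
 fixes T :: "complex^'w => complex^'w"
 assumes T: "linear T" and sym: "!!v w. T v \<bullet> w = v \<bullet> T w"
 obtains v l where "v ~= 0" "T v = l *\<^sub>R v" proof -
 have bl: "bounded_linear T" using T by (simp add: linear_conv_bounded_linear)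
 have cont: "continuous_on (sphere 0 1) (%v. T v \<bullet> v)" by (intro continuous_intros bounded_linear.continuous_on[OF bl])
 have ne: "sphere (0 :: complex^'w) 1 ~= {}" by simp
 from continuous_attains_sup[OF compact_sphere ne cont]
 obtain v where v: "v : sphere 0 1" "!!w. w : sphere 0 1 ==> T w \<bullet> w <= T v \<bullet> v" by blast
 define l where "l = T v \<bullet> v"
 have vv: "v \<bullet> v = 1" using v(1) by (simp add: dot_square_norm)
 have le: "T w \<bullet> w <= l * (w \<bullet> w)" for w
 proof (cases "w = 0")
  case True
  then show ?thesis by (simp add: linear_0[OF T])
 next
  case False
  have "T (w /\<^sub>R norm w) \<bullet> (w /\<^sub>R norm w) <= l" unfolding l_def using False by (intro v(2)) simp
  then have "(T w \<bullet> w) / (norm w * norm w) <= l" by (simp add: linear_scale[OF T] divide_inverse mult_ac)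
  then show ?thesis using False by (simp add: divide_le_eq dot_square_norm power2_eq_square zero_less_mult_iff split: if_splits)
 qed
 define u where "u = T v - l *\<^sub>R v"
 have "u \<bullet> u = 0" proof (rule ccontr)
  assume "u \<bullet> u ~= 0"
  then have b: "u \<bullet> u > 0" by (simp add: less_le)
  define c where "c = l * (u \<bullet> u) - T u \<bullet> u"
  have uv: "T v \<bullet> u - l * (v \<bullet> u) = u \<bullet> u" by (simp add: u_def inner_diff_left)
  have q: "2 * t * (u \<bullet> u) <= t^2 * c" for t
  proof -
   have "T (v + t *\<^sub>R u) \<bullet> (v + t *\<^sub>R u) = l + 2 * t * (T v \<bullet> u) + t^2 * (T u \<bullet> u)"
    using sym[of u v] by (simp add: linear_add[OF T] linear_scale[OF T] inner_add_left inner_add_right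
      l_def power2_eq_square inner_commute algebra_simps)
   moreover have "(v + t *\<^sub>R u) \<bullet> (v + t *\<^sub>R u) = 1 + 2 * t * (v \<bullet> u) + t^2 * (u \<bullet> u)"
    by (simp add: inner_add_left inner_add_right vv inner_commute power2_eq_square algebra_simps)
   ultimately have "l + 2 * t * (T v \<bullet> u) + t^2 * (T u \<bullet> u) <= l * (1 + 2 * t * (v \<bullet> u) + t^2 * (u \<bullet> u))"
    using le[of "v + t *\<^sub>R u"] by simp
   then have "2 * t * (T v \<bullet> u - l * (v \<bullet> u)) <= t^2 * c" by (simp add: c_def algebra_simps)
   then show ?thesis unfolding uv .
  qed
  define t where "t = (u \<bullet> u) / (\<bar>c\<bar> + 1)"
  have t: "t > 0" using b by (simp add: t_def)
  have "2 * t * (u \<bullet> u) <= t * (t * c)" using q[of t] by (simp add: power2_eq_square mult_ac)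
  then have "2 * (u \<bullet> u) <= t * c" using t by simp
  also have "\<dots> <= t * (\<bar>c\<bar> + 1)" using t by (intro mult_left_mono) auto
  also have "\<dots> = u \<bullet> u" by (simp add: t_def)
  finally show False using b by simp
 qed
 then have "T v = l *\<^sub>R v" by (simp add: u_def)
 moreover have "v ~= 0" using v(1) by auto
 ultimately show ?thesis using that by blast
qed

lemma inner_imaginary: "(\<i> *s v) \<bullet> w = - (v \<bullet> (\<i> *s w))" for v w :: "complex^'w"
 by (simp add: inner_vec_def inner_complex_def sum_negf[symmetric] algebra_simps)

text \<open>Schur's lemma for a one-parameter group: its generator is skew, so \<open>\<i>\<close> times it is symmetric and
 has an eigenvector; the eigenspace is invariant under the commutant.\<close>

lemma central_one_parameter_scalar:
 fixes \<tau> :: "'n::finite cmat => complex^'w^'w"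
 assumes \<tau>: "unitary_rep K \<tau>" and irr: "irreducible_rep K \<tau>"
  and c: "continuous_on UNIV c" "!!t. c t : K" "c 0 = mat 1" "!!s t. c (s + t) = c s ** c t"
  and comm: "!!t k. k : K ==> c t ** k = k ** c t"
 obtains a where "!!t v. \<tau> (c t) *v v = cis (a * t) *s v" proof -
 have hom: "!!k l. k : K ==> l : K ==> \<tau> (k ** l) = \<tau> k ** \<tau> l" and contK: "continuous_on K \<tau>"
  and one: "\<tau> (mat 1) = mat 1" and nrm: "!!k w. k : K ==> norm (\<tau> k *v w) = norm w" using \<tau> by (auto simp: unitary_rep_def)
 have "continuous_on UNIV (%t. \<tau> (c t))" by (rule continuous_on_compose2[OF contK c(1)]) (use c(2) in auto)
 moreover have "\<tau> (c 0) = mat 1" by (simp add: c(3) one)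
 moreover have "\<tau> (c (s + t)) = \<tau> (c s) ** \<tau> (c t)" for s t by (simp add: c hom)
 ultimately obtain A where A: "!!t. \<tau> (c t) = mexp (t *\<^sub>R A)" using continuous_one_parameter_group[of "%t. \<tau> (c t)"] by blast
 have bl: "bounded_linear (%M. M *v v)" for v :: "complex^'w" by (rule bounded_bilinear.bounded_linear_left[OF bounded_bilinear_matrix_vector_mult])
 have der: "((%t. mexp (t *\<^sub>R A) *v v) has_vector_derivative mexp (t *\<^sub>R A) *v (A *v v)) (at t)" for t v
  using bounded_linear.has_vector_derivative[OF bl matrix_exp_has_vector_derivative[of A t UNIV]] by (simp add: matrix_vector_mul_assoc)
 have der0: "((%t. mexp (t *\<^sub>R A) *v v) has_vector_derivative A *v v) (at 0)" for v
  using der[of v 0] by simp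
 have skew: "(A *v v) \<bullet> w = - (v \<bullet> (A *v w))" for v w
 proof -
  have z: "(A *v v) \<bullet> v = 0" for v
  proof -
   have "((%t. (mexp (t *\<^sub>R A) *v v) \<bullet> (mexp (t *\<^sub>R A) *v v)) has_vector_derivative
     (mexp (0 *\<^sub>R A) *v v) \<bullet> (A *v v) + (A *v v) \<bullet> (mexp (0 *\<^sub>R A) *v v)) (at 0)"
    by (rule bounded_bilinear.has_vector_derivative[OF bounded_bilinear_inner der0 der0])
   moreover have "(mexp (t *\<^sub>R A) *v v) \<bullet> (mexp (t *\<^sub>R A) *v v) = v \<bullet> v" for t
    using nrm[OF c(2), of t v] by (simp add: A dot_square_norm)
   ultimately have "((%t::real. v \<bullet> v) has_vector_derivative v \<bullet> (A *v v) + (A *v v) \<bullet> v) (at 0)" by simp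
   then have "v \<bullet> (A *v v) + (A *v v) \<bullet> v = 0" using has_vector_derivative_unique_at[OF _ has_vector_derivative_const] by blast
   then show ?thesis by (simp add: inner_commute)
  qed
  show ?thesis
   using z[of "v + w"] z[of v] z[of w] by (simp add: matrix_vector_simps inner_add_left inner_add_right inner_commute)
 qed
 define T where "T v = \<i> *s (A *v v)" for v
 have T: "linear T" unfolding T_def
  by (rule linearI) (simp_all add: matrix_vector_simps vector_add_ldistrib vec_eq_iff)
 have "T v \<bullet> w = v \<bullet> T w" for v w
  unfolding T_def inner_imaginary using skew[of v "\<i> *s w"] by (simp add: vector_smult_matrix_vector)
 then obtain v l where v: "v ~= 0" "T v = l *\<^sub>R v" using symmetric_has_eigenvector[OF T] by metis
 define U where "U = {w. T w = l *\<^sub>R w}"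
 have AK: "A *v (\<tau> k *v w) = \<tau> k *v (A *v w)" if k: "k : K" for k w
 proof -
  have e: "mexp (t *\<^sub>R A) *v (\<tau> k *v w) = \<tau> k *v (mexp (t *\<^sub>R A) *v w)" for t
   using hom[OF c(2) k, of t] hom[OF k c(2), of t] comm[OF k, of t] by (simp add: A matrix_vector_mul_assoc)
  have "((%t. \<tau> k *v (mexp (t *\<^sub>R A) *v w)) has_vector_derivative \<tau> k *v (A *v w)) (at 0)"
   by (rule bounded_linear.has_vector_derivative[OF bounded_linear_matrix_vector_mult der0])
  then show ?thesis
   using has_vector_derivative_unique_at[OF der0[of "\<tau> k *v w"]] by (simp add: e)
 qed
 have "vec.subspace U" unfolding vec.subspace_def U_def T_def
  by (auto simp: matrix_vector_simps vector_smult_matrix_vector vec_eq_iff algebra_simps)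
 moreover have "\<forall>k\<in>K. \<forall>w\<in>U. \<tau> k *v w : U" unfolding U_def T_def
  by (auto simp: AK vector_smult_matrix_vector[symmetric] matrix_vector_simps)
 moreover have "v : U" using v by (simp add: U_def)
 ultimately have "U = UNIV" using irr v(1) unfolding irreducible_rep_def by blast
 then have Tw: "T w = l *\<^sub>R w" for w by (auto simp: U_def)
 have Aw: "A *v w = (- \<i> * of_real l) *s w" for w
 proof -
  have "A *v w = (- \<i>) *s T w" by (simp add: T_def vec_eq_iff mult.assoc[symmetric])
  also have "\<dots> = (- \<i>) *s (l *\<^sub>R w)" by (simp only: Tw)
  also have "\<dots> = (- \<i> * of_real l) *s w" unfolding vec_eq_iff vector_smult_component vector_scaleR_component
   by (simp add: scaleR_conv_of_real)
  finally show ?thesis .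
 qed
 define a where "a = - l"
 have "\<tau> (c t) *v w = cis (a * t) *s w" for t w
 proof -
  have dcis: "((%t. cis (- a * t)) has_vector_derivative (- \<i> * of_real a) * cis (- a * t)) (at t)" for t
   using exp_scaleR_has_vector_derivative_right[of "- \<i> * of_real a" t UNIV] by (simp add: cis_conv_exp scaleR_conv_of_real mult_ac)
  have "((%t. cis (- a * t) *s (mexp (t *\<^sub>R A) *v w)) has_vector_derivative
    cis (- a * t) *s (mexp (t *\<^sub>R A) *v (A *v w)) +
    ((- \<i> * of_real a) * cis (- a * t)) *s (mexp (t *\<^sub>R A) *v w)) (at t within UNIV)" for t
   by (rule bounded_bilinear.has_vector_derivative[OF bounded_bilinear_vector_smult dcis der])
  then have "((%t. cis (- a * t) *s (mexp (t *\<^sub>R A) *v w)) has_vector_derivative 0) (at t within UNIV)" for t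
   unfolding Aw vector_smult_matrix_vector by (simp add: a_def vec_eq_iff algebra_simps)
  then obtain u where u: "!!t. cis (- a * t) *s (mexp (t *\<^sub>R A) *v w) = u"
   using has_vector_derivative_zero_constant[OF convex_UNIV, of "%t. cis (- a * t) *s (mexp (t *\<^sub>R A) *v w)"] by auto
  have "cis (- a * t) *s (mexp (t *\<^sub>R A) *v w) = w" using u[of t] u[of 0] by simp
  then have "cis (a * t) *s w = cis (a * t) *s (cis (- a * t) *s (mexp (t *\<^sub>R A) *v w))" by simp
  also have "\<dots> = mexp (t *\<^sub>R A) *v w" by (simp add: vec_eq_iff mult.assoc[symmetric] cis_mult)
  finally show ?thesis by (simp add: A)
 qed
 then show ?thesis using that by blast
qed

section \<open>Holomorphic sections that vanish to infinite order\<close>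

context hermitian_group
begin

definition orb :: "'n cmat => 'n cmat" where "orb g = Ad (matrix_inv g) Z"
definition orbK :: "'n cmat => 'n cmat" where "orbK g = k_part (orb g)"
definition orbP :: "'n cmat => 'n cmat" where "orbP g = p_part (orb g)"
definition \<psi> :: "'n cmat => real" where "\<psi> g = \<kappa> (orbP g) (orbP g)"

lemma orb_mem: "g : G ==> orb g : \<gg>" unfolding orb_def by (intro lie_algebra_Ad inv_mem Z_g)

lemma orb_parts: "g : G ==> orbK g : \<kk>" "g : G ==> orbP g : \<pp>" "g : G ==> orbK g + orbP g = orb g" unfolding orbK_def orbP_def using parts[OF orb_mem] by auto

lemma killing_bounded_bilinear:
 fixes P :: "'n cmat => 'n cmat"
 assumes P: "linear P" "!!v. P v : \<gg>"
 shows "bounded_bilinear (%x y. \<kappa> (P x) (P y))" unfolding bilinear_conv_bounded_bilinear[symmetric] bilinear_def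
 by (auto intro!: linearI simp: linear_add[OF P(1)] linear_scale[OF P(1)] P(2)
   killing_add_left killing_add_right killing_scale_left killing_scale_right)

lemma killing_upper:
 obtains C where "C > 0" "!!X Y. X : \<gg> ==> Y : \<gg> ==> \<bar>\<kappa> X Y\<bar> <= C * norm X * norm Y" proof -
 obtain P where P: "linear P" "!!v. P v : \<gg>" "!!v. v : \<gg> ==> P v = v" by (rule linear_projection) (rule that)
 obtain C where C: "C > 0" "!!X Y. norm (\<kappa> (P X) (P Y)) <= norm X * norm Y * C" using bounded_bilinear.pos_bounded[OF killing_bounded_bilinear[OF P(1,2)]] by blast
 show ?thesis
 proof (rule that[OF C(1)])
  show "\<bar>\<kappa> X Y\<bar> <= C * norm X * norm Y" if "X : \<gg>" "Y : \<gg>" for X Y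
   using C(2)[of X Y] P(3)[OF that(1)] P(3)[OF that(2)] by (simp add: mult_ac)
 qed
qed

lemma killing_positive: "X : \<pp> ==> X ~= 0 ==> \<kappa> X X > 0" using positive[of X] killing_minus(2)[of X X] by (simp add: p_iff)

lemma killing_lower:
 obtains m where "m > 0" "!!X. X : \<pp> ==> m * norm X ^ 2 <= \<kappa> X X" proof -
 obtain P where P: "linear P" "!!v. P v : \<gg>" "!!v. v : \<gg> ==> P v = v" by (rule linear_projection) (rule that)
 have cont: "continuous_on (\<pp> \<inter> sphere 0 1) (%X. \<kappa> (P X) (P X))"
  by (rule bounded_bilinear.continuous_on[OF killing_bounded_bilinear[OF P(1,2)]]) (auto intro: continuous_on_id)
 have comp: "compact (\<pp> \<inter> sphere 0 1)" using closed_subspace[OF subspace_p] by (intro closed_Int_compact) auto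
 obtain X0 where X0: "X0 : \<pp>" "X0 ~= 0" using p_nontrivial by blast
 have ne: "\<pp> \<inter> sphere 0 1 ~= {}" using X0 subspace_scale[OF subspace_p X0(1), of "inverse (norm X0)"] by force
 from continuous_attains_inf[OF comp ne cont]
 obtain Y where Y: "Y : \<pp> \<inter> sphere 0 1" "!!X. X : \<pp> \<inter> sphere 0 1 ==> \<kappa> (P Y) (P Y) <= \<kappa> (P X) (P X)" by blast
 have Y': "Y : \<pp>" "Y ~= 0" using Y(1) by auto
 show ?thesis
 proof (rule that[of "\<kappa> Y Y"])
  show "\<kappa> Y Y > 0" by (rule killing_positive[OF Y'])
  fix X assume X: "X : \<pp>"
  show "\<kappa> Y Y * norm X ^ 2 <= \<kappa> X X" proof (cases "X = 0")
   case True
   then show ?thesis using killing_scale_left[of 0 0 0] by simp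
  next
   case False
   define U where "U = inverse (norm X) *\<^sub>R X"
   have U: "U : \<pp>" "norm U = 1" using X False subspace_scale[OF subspace_p X] by (auto simp: U_def)
   have XU: "X = norm X *\<^sub>R U" using False by (simp add: U_def)
   have "\<kappa> Y Y <= \<kappa> U U" using Y(2)[of U] U Y'(1) by (simp add: P(3) p_mem)
   moreover have "\<kappa> X X = norm X ^ 2 * \<kappa> U U"
    by (subst (1 2) XU) (simp add: killing_scale_left killing_scale_right lie_algebra_scaleR p_mem[OF U(1)] power2_eq_square)
   ultimately show ?thesis
    using mult_right_mono[of "\<kappa> Y Y" "\<kappa> U U" "norm X ^ 2"] by (simp add: mult.commute)
  qed
 qed
qed

lemma parts_bounded:
 obtains lk lp where "bounded_linear lk" "bounded_linear lp"
  "!!X. X : \<gg> ==> lk X = k_part X" "!!X. X : \<gg> ==> lp X = p_part X"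
  "!!X. lk X : \<kk>" "!!X. lp X : \<pp>" proof -
 obtain P where P: "linear P" "!!v. P v : \<gg>" "!!v. v : \<gg> ==> P v = v" by (rule linear_projection) (rule that)
 show ?thesis
 proof (rule that[of "%v. k_part (P v)" "%v. p_part (P v)"])
  have "linear (%v. k_part (P v))" "linear (%v. p_part (P v))" by (rule linearI; simp add: linear_add[OF P(1)] linear_scale[OF P(1)] P(2) parts_add parts_scaleR)+
  then show "bounded_linear (%v. k_part (P v))" "bounded_linear (%v. p_part (P v))" by (simp_all add: linear_conv_bounded_linear)
 qed (auto simp: P parts)
qed

lemma J_bounded:
 obtains c where "c > 0" "!!X. X : \<pp> ==> norm (J X) <= c * norm X" proof -
 obtain l where l: "linear l" "!!X. X : \<gg> ==> l X = J (p_part X)" by (rule linear_J_extension) (rule that)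
 obtain c where c: "c > 0" "!!X. norm (l X) <= c * norm X" using linear_bounded_pos[OF l(1)] by blast
 show ?thesis
 proof (rule that[OF c(1)])
  show "norm (J X) <= c * norm X" if "X : \<pp>" for X
   using c(2)[of X] l(2)[OF p_mem[OF that]] p_part_p[OF that] by simp
 qed
qed

lemma orb_exp: "orb (mexp X) = mexp (- X) ** Z ** mexp X" by (simp add: orb_def Ad_def)

lemma orb_near_one:
 assumes e: "e > 0"
 obtains r where "r > 0" "!!X. X : \<pp> ==> norm X < r ==> norm (orbP (mexp X) - J X) <= e * norm X"
  "!!X. X : \<pp> ==> norm X < r ==> norm (orbK (mexp X) - Z) <= e * norm X" proof -
 obtain lk lp where l: "bounded_linear lk" "bounded_linear lp"
  "!!X. X : \<gg> ==> lk X = k_part X" "!!X. X : \<gg> ==> lp X = p_part X" by (rule parts_bounded) (rule that)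
 obtain c1 where c1: "c1 > 0" "!!X. norm (lk X) <= norm X * c1" using bounded_linear.pos_bounded[OF l(1)] by blast
 obtain c2 where c2: "c2 > 0" "!!X. norm (lp X) <= norm X * c2" using bounded_linear.pos_bounded[OF l(2)] by blast
 define c where "c = c1 + c2"
 have c: "c > 0" using c1 c2 by (simp add: c_def)
 have d1: "((%X. mexp (- X)) has_derivative (%X. - X)) (at (0 :: 'n cmat))" proof -
  have m: "((%X::'n cmat. - X) has_derivative (%X. - X)) (at 0)" by (auto intro!: derivative_eq_intros)
  have "(mexp has_derivative (%X. X)) (at (- (0 :: 'n cmat)))" using matrix_exp_has_derivative_at_0 by simp
  from has_derivative_compose[OF m this] show ?thesis .
 qed
 have "((%X. mexp (- X) ** Z) has_derivative (%X. - X ** Z)) (at 0)"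
  by (rule bounded_linear.has_derivative[OF bounded_bilinear.bounded_linear_left[OF bounded_bilinear_matrix_mult] d1])
 from bounded_bilinear.FDERIV[OF bounded_bilinear_matrix_mult this matrix_exp_has_derivative_at_0]
 have "((%X. mexp (- X) ** Z ** mexp X) has_derivative (%X. bracket Z X)) (at 0)" by (simp add: bracket_def matrix_mult_simps)
 then have "(%X. orb (mexp X)) = (%X. mexp (- X) ** Z ** mexp X) ==>
   ((%X. orb (mexp X)) has_derivative (%X. bracket Z X)) (at 0)" by simp
 then have "((%X. orb (mexp X)) has_derivative (%X. bracket Z X)) (at 0)" by (simp add: orb_exp fun_eq_iff)
 from this[unfolded has_derivative_at_alt, THEN conjunct2, rule_format, of "e / c"]
 obtain r where r: "r > 0" "!!X. norm X < r ==> norm (orb (mexp X) - Z - bracket Z X) <= e / c * norm X" using e c by (auto simp: orb_exp orb_def[of "mat 1"])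
 have key: "norm (orbP (mexp X) - J X) <= e * norm X \<and> norm (orbK (mexp X) - Z) <= e * norm X"
  if X: "X : \<pp>" "norm X < r" for X
 proof -
  define D where "D = orb (mexp X) - Z - bracket Z X"
  have om: "orb (mexp X) : \<gg>" using X by (intro orb_mem exp_mem p_mem)
  have JX: "bracket Z X = J X" "J X : \<pp>" using Z_p[OF X(1)] J_mem[OF X(1)] by auto
  have D: "norm D <= e / c * norm X" unfolding D_def by (rule r(2)[OF X(2)])
  have "lp D = orbP (mexp X) - J X" unfolding D_def JX(1) linear_diff[OF bounded_linear.linear[OF l(2)]]
   using l(4)[OF om] l(4)[OF Z_g] l(4)[OF p_mem[OF JX(2)]] p_part_k[OF Z_mem] p_part_p[OF JX(2)] by (simp add: orbP_def)
  moreover have "lk D = orbK (mexp X) - Z" unfolding D_def JX(1) linear_diff[OF bounded_linear.linear[OF l(1)]]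
   using l(3)[OF om] l(3)[OF Z_g] l(3)[OF p_mem[OF JX(2)]] k_part_k[OF Z_mem] k_part_p[OF JX(2)] by (simp add: orbK_def)
  moreover have "norm D * c1 <= e * norm X" "norm D * c2 <= e * norm X" proof -
   have "norm D * c <= e / c * norm X * c" using D c by (intro mult_right_mono) auto
   then have a: "norm D * c <= e * norm X" using c by simp
   have p: "0 <= norm D * c1" "0 <= norm D * c2" using c1(1) c2(1) by simp_all
   have "norm D * c1 + norm D * c2 <= e * norm X" using a by (simp add: c_def distrib_left)
   then show "norm D * c1 <= e * norm X" "norm D * c2 <= e * norm X" using p by linarith+
  qed
  ultimately show ?thesis using c1(2)[of D] c2(2)[of D] by simp
 qed
 show ?thesis
  by (rule that[OF r(1)]) (use key in blast)+
qed

lemma \<psi>_derivative: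
 assumes g: "g : G"
 shows "((%t. \<psi> (g ** mexp (t *\<^sub>R J (orbP g)))) has_vector_derivative
  2 * \<kappa> (bracket (orbK g) (J (orbP g))) (orbP g)) (at 0)" proof -
 obtain P where P: "linear P" "!!v. P v : \<gg>" "!!v. v : \<gg> ==> P v = v" by (rule linear_projection) (rule that)
 obtain lk lp where l: "bounded_linear lp" "!!X. X : \<gg> ==> lp X = p_part X" by (rule parts_bounded) (rule that)
 define Y where "Y = J (orbP g)"
 have Y: "Y : \<pp>" unfolding Y_def by (rule J_mem[OF orb_parts(2)[OF g]])
 have eg: "g ** mexp (t *\<^sub>R Y) : G" for t using g p_mem[OF Y] by auto
 have orbc: "orb (g ** mexp (t *\<^sub>R Y)) = Ad (mexp (t *\<^sub>R (- Y))) (orb g)" for t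
  using g by (simp add: orb_def matrix_inv_mult invertible_mem Ad_mult invertible_matrix_inv)
 have "((%t. lp (orb (g ** mexp (t *\<^sub>R Y)))) has_vector_derivative lp (bracket (- Y) (orb g))) (at 0)"
  unfolding orbc by (rule bounded_linear.has_vector_derivative[OF l(1) Ad_exp_derivative_at_0])
 moreover have "lp (orb (g ** mexp (t *\<^sub>R Y))) = orbP (g ** mexp (t *\<^sub>R Y))" for t
  using l(2)[OF orb_mem[OF eg]] by (simp add: orbP_def)
 moreover have "lp (bracket (- Y) (orb g)) = bracket (orbK g) Y" proof -
  have mg: "bracket (- Y) (orbK g) : \<gg>" "bracket (- Y) (orbP g) : \<gg>"
   using p_mem[OF Y] orb_parts[OF g] k_mem p_mem subspace_neg[OF subspace_lie_algebra] by (auto intro!: lie_algebra_bracket)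
  have m1: "bracket (- Y) (orbK g) : \<pp>" "bracket (- Y) (orbP g) : \<kk>" using Y orb_parts[OF g] subspace_neg[OF subspace_p] by (auto intro!: bracket_pk bracket_pp)
  have "bracket (- Y) (orb g) = bracket (- Y) (orbK g) + bracket (- Y) (orbP g)"
   unfolding orb_parts(3)[OF g, symmetric] by (rule bounded_bilinear.add_right[OF bounded_bilinear_bracket])
  then have "lp (bracket (- Y) (orb g)) = p_part (bracket (- Y) (orbK g)) + p_part (bracket (- Y) (orbP g))"
   using linear_add[OF bounded_linear.linear[OF l(1)]] l(2)[OF mg(1)] l(2)[OF mg(2)] by simp
  then show ?thesis using p_part_p[OF m1(1)] p_part_k[OF m1(2)] bracket_swap[of "orbK g" Y] by (simp add: bracket_simps)
 qed
 ultimately have db: "((%t. orbP (g ** mexp (t *\<^sub>R Y))) has_vector_derivative bracket (orbK g) Y) (at 0)" by simp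
 have "((%t. \<kappa> (P (orbP (g ** mexp (t *\<^sub>R Y)))) (P (orbP (g ** mexp (t *\<^sub>R Y))))) has_vector_derivative
   \<kappa> (P (orbP (g ** mexp (0 *\<^sub>R Y)))) (P (bracket (orbK g) Y)) +
   \<kappa> (P (bracket (orbK g) Y)) (P (orbP (g ** mexp (0 *\<^sub>R Y))))) (at 0)"
  by (rule bounded_bilinear.has_vector_derivative[OF killing_bounded_bilinear[OF P(1,2)] db db])
 moreover have "P (orbP (g ** mexp (t *\<^sub>R Y))) = orbP (g ** mexp (t *\<^sub>R Y))" for t
  by (rule P(3)[OF p_mem[OF orb_parts(2)[OF eg]]])
 moreover have "P (bracket (orbK g) Y) = bracket (orbK g) Y" by (rule P(3)[OF p_mem[OF bracket_kp[OF orb_parts(1)[OF g] Y]]])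
 moreover have "P (orbP g) = orbP g" by (rule P(3)[OF p_mem[OF orb_parts(2)[OF g]]])
 moreover have "\<kappa> (orbP g) (bracket (orbK g) Y) = \<kappa> (bracket (orbK g) Y) (orbP g)"
  by (rule killing_sym[OF p_mem[OF orb_parts(2)[OF g]] p_mem[OF bracket_kp[OF orb_parts(1)[OF g] Y]]])
 ultimately show ?thesis unfolding \<psi>_def Y_def[symmetric] by simp
qed

lemma orb_K:
 assumes g: "g : G" and k: "k : K"
 shows "\<psi> (g ** k) = \<psi> g" proof -
 have k': "matrix_inv k : K" "matrix_inv k : G" "k : G" using k K_group by auto
 have "orb (g ** k) = Ad (matrix_inv k) (orb g)" using g k'(3) by (simp add: orb_def matrix_inv_mult invertible_mem Ad_mult invertible_matrix_inv)
 moreover have "d\<theta> (Ad (matrix_inv k) (orb g)) = Ad (matrix_inv k) (d\<theta> (orb g))"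
  using differential_Ad[OF k'(2) orb_mem[OF g]] k'(1) by (simp add: fixed_group_def)
 ultimately have "orbP (g ** k) = Ad (matrix_inv k) (orbP g)" by (simp add: orbP_def p_part_def Ad_simps)
 then show ?thesis
  using killing_Ad[OF k'(2) p_mem[OF orb_parts(2)[OF g]] p_mem[OF orb_parts(2)[OF g]]] by (simp add: \<psi>_def)
qed

definition hol_functions :: "('n cmat => complex^'w^'w) => ('n cmat => complex^'w) set" where
 "hol_functions \<tau> = {f : smooth_functions G.
   (\<forall>g\<in>G. \<forall>k\<in>K. f (g ** k) = matrix_inv (\<tau> k) *v f g) \<and>
   (\<forall>y\<in>p_minus \<pp> J. \<forall>g\<in>G. right_derivC y f g = 0)}"

lemma hol_functionsD:
 assumes "f : hol_functions \<tau>"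
 shows "f : smooth_functions G" "smooth_on_group G f" "g : G ==> k : K ==> f (g ** k) = matrix_inv (\<tau> k) *v f g"
  "y : p_minus \<pp> J ==> g : G ==> right_derivC y f g = 0" using assms by (auto simp: hol_functions_def smooth_functions_def)

lemma cauchy_riemann:
 assumes f: "f : hol_functions \<tau>" and X: "X : \<pp>" and g: "g : G"
 shows "right_deriv (J X) f g = \<i> *s right_deriv X f g" proof -
 have "right_deriv X f g + \<i> *s right_deriv (J X) f g = 0" using hol_functionsD(4)[OF f p_minus_mem[OF X] g] by (simp add: right_derivC_def)
 then have "\<i> *s (right_deriv X f g + \<i> *s right_deriv (J X) f g) = 0" by simp
 then show ?thesis by (simp add: vec_eq_iff algebra_simps)
qed

lemma isotropy_derivative_bound:
 assumes \<tau>: "unitary_rep K \<tau>" and f: "f : hol_functions \<tau>" and Y: "Y : \<kk>"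
 shows "\<exists>M\<ge>0. \<forall>g\<in>G. norm (right_deriv Y f g) <= M * norm (f g)" proof -
 have eK: "mexp (t *\<^sub>R Y) : K" for t by (rule exp_k_mem[OF Y])
 have "continuous_on UNIV (%t. \<tau> (mexp (t *\<^sub>R Y)))"
  by (rule continuous_on_compose2[of K \<tau>]) (use \<tau> eK in \<open>auto simp: unitary_rep_def intro!: continuous_intros\<close>)
 then obtain B where B: "!!t. \<tau> (mexp (t *\<^sub>R Y)) = mexp (t *\<^sub>R B)" using continuous_one_parameter_group[of "%t. \<tau> (mexp (t *\<^sub>R Y))"] \<tau> eK
  by (auto simp: unitary_rep_def matrix_exp_scaleR_add)
 obtain K1 where K1: "K1 > 0" "!!(A :: complex^'a^'a) x. norm (A *v x) <= norm A * norm x * K1"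
  using bounded_bilinear.pos_bounded[OF bounded_bilinear_matrix_vector_mult] by blast
 have "norm (right_deriv Y f g) <= norm B * K1 * norm (f g)" if g: "g : G" for g
 proof -
  have "f (g ** mexp (t *\<^sub>R Y)) = mexp (t *\<^sub>R (- B)) *v f g" for t
   using hol_functionsD(3)[OF f g eK] by (simp add: B)
  moreover have "((%t. mexp (t *\<^sub>R (- B)) *v f g) has_vector_derivative (- B) *v f g) (at 0)"
   by (rule bounded_linear.has_vector_derivative[OF bounded_bilinear.bounded_linear_left[OF bounded_bilinear_matrix_vector_mult] matrix_exp_derivative_at_0])
  ultimately have "right_deriv Y f g = (- B) *v f g" by (intro right_deriv_eqI) simp
  then show ?thesis using K1(2)[of "- B" "f g"] by (simp add: mult_ac)
 qed
 then show ?thesis using K1(1) by (intro exI[of _ "norm B * K1"]) auto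
qed

text \<open>Left rotations act on \<open>f\<close> by scalars, and at \<open>g\<close> they differentiate along \<open>Ad (g\<^sup>-\<^sup>1) Z\<close>. The
 \<open>\<kk>\<close>-part of this vector acts by the isotropy representation, so its \<open>\<pp>\<close>-part and, by the
 Cauchy-Riemann equations, the \<open>J\<close>-image of that also act by bounded matrices.\<close>

lemma radial_derivative_bound:
 assumes \<tau>: "unitary_rep K \<tau>" and f: "f : hol_functions \<tau>"
  and rotation: "!!s x. \<bar>s\<bar> < 1 ==> x : G ==> f (rot s ** x) = cis (\<beta> * s) *s f x"
 shows "\<exists>M\<ge>0. \<forall>g\<in>G. norm (orbK g) <= c --> norm (right_deriv (J (orbP g)) f g) <= M * norm (f g)" proof -
 note sm = hol_functionsD(2)[OF f]
 obtain E where E: "!!i. E i : \<gg>" "!!v. v : \<gg> ==> (\<Sum>i\<in>Basis. (v \<bullet> i) *\<^sub>R E i) = v" by (rule projection_basis) (rule that)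
 obtain lk lp where lk: "bounded_linear lk" "!!X. X : \<gg> ==> lk X = k_part X" "!!X. lk X : \<kk>" by (rule parts_bounded) (rule that)
 have "\<forall>i. \<exists>M\<ge>0. \<forall>g\<in>G. norm (right_deriv (lk (E i)) f g) <= M * norm (f g)" using isotropy_derivative_bound[OF \<tau> f lk(3)] by blast
 from choice[OF this] obtain M where M: "!!i. M i \<ge> 0"
  "!!i g. g : G ==> norm (right_deriv (lk (E i)) f g) <= M i * norm (f g)" by blast
 define M' where "M' = \<bar>\<beta>\<bar> + (\<Sum>i\<in>(Basis :: 'n cmat set). \<bar>c\<bar> * M i)"
 have bound: "norm (right_deriv (J (orbP g)) f g) <= M' * norm (f g)" if g: "g : G" and c: "norm (orbK g) <= c" for g
 proof -
  have A: "orbK g : \<kk>" and b: "orbP g : \<pp>" by (rule orb_parts[OF g])+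
  have "right_deriv (orb g) f g = (\<i> * of_real \<beta>) *s f g" proof (rule right_deriv_eqI, rule has_vector_derivative_transform_within_open)
   have "g ** mexp (t *\<^sub>R orb g) = rot t ** g" for t
    using Ad_exp[OF invertible_mem[OF inv_mem[OF g]], of "t *\<^sub>R Z"] g
    by (simp add: orb_def Ad_simps matrix_mul_assoc)
   then show "cis (\<beta> * t) *s f g = f (g ** mexp (t *\<^sub>R orb g))" if "t : {-1<..<1}" for t
    using rotation[of t g] that g by auto
   have d: "((%t. cis (\<beta> * t)) has_vector_derivative \<i> * of_real \<beta>) (at 0)"
    using exp_scaleR_has_vector_derivative_right[of "\<i> * of_real \<beta>" 0 UNIV] by (simp add: cis_conv_exp scaleR_conv_of_real mult_ac)
   show "((%t. cis (\<beta> * t) *s f g) has_vector_derivative (\<i> * of_real \<beta>) *s f g) (at 0)"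
    by (rule bounded_linear.has_vector_derivative[OF bounded_bilinear.bounded_linear_left[OF bounded_bilinear_vector_smult] d])
  qed auto
  moreover have "right_deriv (orb g) f g = right_deriv (orbK g) f g + right_deriv (orbP g) f g"
   using right_deriv_add[OF sm k_mem[OF A] p_mem[OF b] g] orb_parts(3)[OF g] by simp
  ultimately have eq: "right_deriv (orbP g) f g = (\<i> * of_real \<beta>) *s f g - right_deriv (orbK g) f g" by (metis add_diff_cancel_left')
  have nsm: "norm (a *s v) = norm a * norm v" for a and v :: "complex^'a" by (simp add: norm_vec_def norm_mult L2_set_right_distrib)
  have "orbK g = (\<Sum>i\<in>Basis. (orbK g \<bullet> i) *\<^sub>R lk (E i))" proof -
   have "orbK g = lk (\<Sum>i\<in>Basis. (orbK g \<bullet> i) *\<^sub>R E i)" using E(2)[OF k_mem[OF A]] lk(2)[OF k_mem[OF A]] k_part_k[OF A] by simp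
   then show ?thesis
    by (simp add: linear_sum[OF bounded_linear.linear[OF lk(1)]] linear_scale[OF bounded_linear.linear[OF lk(1)]])
  qed
  then have "right_deriv (orbK g) f g = (\<Sum>i\<in>Basis. (orbK g \<bullet> i) *\<^sub>R right_deriv (lk (E i)) f g)"
   using right_deriv_sum[where E="%i. lk (E i)" and c="%i. orbK g \<bullet> i", OF sm g finite_Basis k_mem[OF lk(3)]] by simp
  also have "norm \<dots> <= (\<Sum>i\<in>(Basis :: 'n cmat set). \<bar>c\<bar> * (M i * norm (f g)))" proof (rule sum_norm_le)
   fix i :: "'n cmat" assume i: "i : Basis"
   have "\<bar>orbK g \<bullet> i\<bar> <= \<bar>c\<bar>" using Basis_le_norm[OF i, of "orbK g"] c by simp
   then show "norm ((orbK g \<bullet> i) *\<^sub>R right_deriv (lk (E i)) f g) <= \<bar>c\<bar> * (M i * norm (f g))" using M(2)[OF g, of i] by (simp add: mult_mono)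
  qed
  finally have "norm (right_deriv (orbK g) f g) <= (\<Sum>i\<in>(Basis :: 'n cmat set). \<bar>c\<bar> * M i) * norm (f g)" by (simp add: sum_distrib_right mult.assoc)
  moreover have "norm (right_deriv (J (orbP g)) f g) <= \<bar>\<beta>\<bar> * norm (f g) + norm (right_deriv (orbK g) f g)" unfolding cauchy_riemann[OF f b g] nsm eq
   using norm_triangle_ineq4[of "(\<i> * of_real \<beta>) *s f g" "right_deriv (orbK g) f g"] by (simp add: nsm norm_mult)
  ultimately show ?thesis by (simp add: M'_def distrib_right)
 qed
 have "M' \<ge> 0" unfolding M'_def using M(1) by (intro add_nonneg_nonneg sum_nonneg mult_nonneg_nonneg) auto
 then show ?thesis using bound by blast
qed

lemma cartan_coordinates:
 obtains eps C where "eps > 0" "C > 0"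
  "!!g. g : G ==> norm (g - mat 1) < eps ==>
    \<exists>X\<in>\<pp>. \<exists>Y\<in>\<kk>. norm X <= C * norm (g - mat 1) \<and> g = mexp X ** mexp Y" proof -
 obtain lk lp where l: "bounded_linear lk" "bounded_linear lp"
  "!!X. X : \<gg> ==> lk X = k_part X" "!!X. X : \<gg> ==> lp X = p_part X"
  "!!X. lk X : \<kk>" "!!X. lp X : \<pp>" by (rule parts_bounded) (rule that)
 obtain c where c: "c > 0" "!!X. norm (lp X) <= norm X * c" using bounded_linear.pos_bounded[OF l(2)] by blast
 show ?thesis
 proof (rule group_exp_coordinates[of "[lp, lk]"])
  show "\<forall>\<pi>\<in>set [lp, lk]. linear \<pi>" using l(1,2) by (simp add: bounded_linear.linear)
  show "\<forall>\<pi>\<in>set [lp, lk]. \<forall>v\<in>\<gg>. \<pi> v : \<gg>" using l(5,6) k_mem p_mem by auto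
  show "(\<Sum>\<pi>\<leftarrow>[lp, lk]. \<pi> v) = v" if "v : \<gg>" for v
   using l(3)[OF that] l(4)[OF that] parts(3)[OF that] by (simp add: add.commute)
 next
  fix eps C :: real assume eps: "eps > 0" "C > 0" and coord: "!!g. g : G ==> norm (g - mat 1) < eps ==>
    \<exists>v\<in>\<gg>. norm v <= C * norm (g - mat 1) \<and> g = exp_prod [lp, lk] v"
  show thesis
  proof (rule that[of eps "C * c"])
   show "eps > 0" "C * c > 0" using eps c by auto
   fix g assume "g : G" "norm (g - mat 1) < eps"
   from coord[OF this] obtain v where v: "norm v <= C * norm (g - mat 1)" "g = exp_prod [lp, lk] v" by blast
   have "norm (lp v) <= C * norm (g - mat 1) * c" by (rule order_trans[OF c(2) mult_right_mono[OF v(1)]]) (use c(1) in simp)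
   then show "\<exists>X\<in>\<pp>. \<exists>Y\<in>\<kk>. norm X <= C * c * norm (g - mat 1) \<and> g = mexp X ** mexp Y"
    using l(5,6) v(2) by (intro bexI[of _ "lp v"] bexI[of _ "lk v"]) (auto simp: mult_ac)
  qed
 qed
qed

text \<open>Geometry near the base point: \<open>\<psi>\<close> is comparable to the squared distance, and it decreases along
 \<open>J (orbP g)\<close> at a rate comparable to itself.\<close>

lemma \<psi>_near_one:
 obtains r c1 c2 where "r > 0" "c1 > 0" "c2 > 0"
  "!!X. X : \<pp> ==> norm X <= r ==> c1 * norm X ^ 2 <= \<psi> (mexp X)"
  "!!X. X : \<pp> ==> norm X <= r ==> \<psi> (mexp X) <= c2 * norm X ^ 2"
  "!!X. X : \<pp> ==> norm X <= r ==> norm (orbK (mexp X)) <= norm Z + 1"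
  "!!X. X : \<pp> ==> norm X <= r ==>
    2 * \<kappa> (bracket (orbK (mexp X)) (J (orbP (mexp X)))) (orbP (mexp X)) <= - \<psi> (mexp X)" proof -
 obtain C where C: "C > 0" "!!X Y. X : \<gg> ==> Y : \<gg> ==> \<bar>\<kappa> X Y\<bar> <= C * norm X * norm Y" by (rule killing_upper) (rule that)
 obtain m where m: "m > 0" "!!X. X : \<pp> ==> m * norm X ^ 2 <= \<kappa> X X" by (rule killing_lower) (rule that)
 obtain cJ where cJ: "cJ > 0" "!!X. X : \<pp> ==> norm (J X) <= cJ * norm X" by (rule J_bounded) (rule that)
 obtain cb where cb: "cb > 0" "!!X Y. norm (bracket X Y :: 'n cmat) <= norm X * norm Y * cb" using bounded_bilinear.pos_bounded[OF bounded_bilinear_bracket] by blast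
 define e where "e = min (1 / (2 * cJ)) (min 1 (m / (2 * C * cb * cJ)))"
 have e: "e > 0" "e <= 1 / (2 * cJ)" "e <= 1" "e <= m / (2 * C * cb * cJ)" using cJ(1) C(1) cb(1) m(1) by (auto simp: e_def)
 obtain r0 where r0: "r0 > 0"
  "!!X. X : \<pp> ==> norm X < r0 ==> norm (orbP (mexp X) - J X) <= e * norm X"
  "!!X. X : \<pp> ==> norm X < r0 ==> norm (orbK (mexp X) - Z) <= e * norm X" by (rule orb_near_one[OF e(1)]) (rule that)
 define r where "r = min (r0 / 2) 1"
 have r: "r > 0" "r < r0" "r <= 1" using r0(1) by (auto simp: r_def)
 show ?thesis
 proof (rule that[of r "m * (1 / (2 * cJ))^2" "C * (cJ + 1)^2"])
  show "r > 0" "m * (1 / (2 * cJ))^2 > 0" "C * (cJ + 1)^2 > 0" using r m cJ C by auto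
  fix X assume X: "X : \<pp>" and Xr: "norm X <= r"
  let ?g = "mexp X"
  have g: "?g : G" by (rule exp_mem[OF p_mem[OF X]])
  have A: "orbK ?g : \<kk>" and b: "orbP ?g : \<pp>" by (rule orb_parts[OF g])+
  have nP: "norm (orbP ?g - J X) <= e * norm X" and nK: "norm (orbK ?g - Z) <= e * norm X" using r0(2,3)[OF X] Xr r(2) by auto
  have nK': "norm (orbK ?g - Z) <= e" proof -
   have "e * norm X <= e * 1" using Xr r(3) e(1) by (intro mult_left_mono) auto
   then show ?thesis using nK by simp
  qed
  show "norm (orbK ?g) <= norm Z + 1" using norm_triangle_ineq2[of "orbK ?g" Z] nK' e(3) by simp
  have JX: "norm X <= cJ * norm (J X)" using cJ(2)[OF J_mem[OF X]] J_J[OF X] by simp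
  have "1 / (2 * cJ) * norm X <= norm (orbP ?g)" proof -
   have "1 / cJ * norm X <= norm (J X)" using JX cJ(1) by (simp add: field_simps)
   moreover have "norm (J X) - norm (orbP ?g) <= norm (orbP ?g - J X)" by (metis norm_minus_commute norm_triangle_ineq2)
   moreover have "e * norm X <= 1 / (2 * cJ) * norm X" using e(2) by (intro mult_right_mono) auto
   ultimately show ?thesis using nP by (simp add: field_simps)
  qed
  then have "(1 / (2 * cJ) * norm X)^2 <= norm (orbP ?g)^2" using cJ(1) by (intro power_mono) auto
  then have "m * (1 / (2 * cJ) * norm X)^2 <= m * norm (orbP ?g)^2" using m(1) by simp
  also have "\<dots> <= \<psi> ?g" unfolding \<psi>_def by (rule m(2)[OF b])
  finally show "m * (1 / (2 * cJ))^2 * norm X^2 <= \<psi> ?g" by (simp only: power_mult_distrib mult.assoc)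
  have "norm (orbP ?g) <= (cJ + 1) * norm X" using norm_triangle_ineq2[of "orbP ?g" "J X"] nP cJ(2)[OF X] mult_right_mono[OF e(3), of "norm X"]
   by (simp add: distrib_right)
  then have "norm (orbP ?g)^2 <= ((cJ + 1) * norm X)^2" by (intro power_mono) auto
  then have "C * norm (orbP ?g)^2 <= C * ((cJ + 1) * norm X)^2" using C(1) by simp
  moreover have "\<psi> ?g <= C * norm (orbP ?g)^2" using C(2)[OF p_mem[OF b] p_mem[OF b]] by (simp add: \<psi>_def power2_eq_square mult.assoc)
  ultimately show "\<psi> ?g <= C * (cJ + 1)^2 * norm X^2" by (simp add: power_mult_distrib mult.assoc)
  define A' where "A' = orbK ?g - Z"
  have A': "A' : \<kk>" using A Z_mem subspace_k by (simp add: A'_def subspace_diff)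
  have Jb: "J (orbP ?g) : \<pp>" by (rule J_mem[OF b])
  have "bracket (orbK ?g) (J (orbP ?g)) = (-1) *\<^sub>R orbP ?g + bracket A' (J (orbP ?g))" using Z_p[OF Jb] J_J[OF b] by (simp add: A'_def bracket_simps)
  then have "\<kappa> (bracket (orbK ?g) (J (orbP ?g))) (orbP ?g) =
    (-1) * \<psi> ?g + \<kappa> (bracket A' (J (orbP ?g))) (orbP ?g)"
   using killing_add_left[OF lie_algebra_scaleR[OF p_mem[OF b], of "-1"] p_mem[OF bracket_kp[OF A' Jb]] p_mem[OF b]]
    killing_scale_left[OF p_mem[OF b] p_mem[OF b], of "-1"] by (simp only: \<psi>_def)
  moreover have "\<kappa> (bracket A' (J (orbP ?g))) (orbP ?g) <= 1/2 * \<psi> ?g" proof -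
   have "\<kappa> (bracket A' (J (orbP ?g))) (orbP ?g) <= C * norm (bracket A' (J (orbP ?g))) * norm (orbP ?g)"
    using C(2)[OF p_mem[OF bracket_kp[OF A' Jb]] p_mem[OF b]] by simp
   also have "\<dots> <= C * (e * (cJ * norm (orbP ?g)) * cb) * norm (orbP ?g)" proof (intro mult_right_mono mult_left_mono)
    have "norm (bracket A' (J (orbP ?g))) <= norm A' * norm (J (orbP ?g)) * cb" by (rule cb(2))
    also have "\<dots> <= e * (cJ * norm (orbP ?g)) * cb" using nK' cJ(2)[OF b] cb(1) e(1) unfolding A'_def by (intro mult_right_mono mult_mono) auto
    finally show "norm (bracket A' (J (orbP ?g))) <= e * (cJ * norm (orbP ?g)) * cb" .
   qed (use C in auto)
   also have "\<dots> = (e * (C * cb * cJ)) * norm (orbP ?g)^2" by (simp add: power2_eq_square mult_ac)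
   also have "\<dots> <= (m / 2) * norm (orbP ?g)^2" proof (rule mult_right_mono)
    have "e * (2 * C * cb * cJ) <= m" using e(4) C cb cJ by (simp add: pos_le_divide_eq)
    then show "e * (C * cb * cJ) <= m / 2" by (simp add: mult_ac)
   qed simp
   also have "\<dots> <= 1/2 * \<psi> ?g" using m(2)[OF b] by (simp add: \<psi>_def)
   finally show ?thesis .
  qed
  ultimately show "2 * \<kappa> (bracket (orbK ?g) (J (orbP ?g))) (orbP ?g) <= - \<psi> ?g" by simp
 qed
qed

end

context hermitian_group
begin

lemma norm_hol_K:
 assumes \<tau>: "unitary_rep K \<tau>" and f: "f : hol_functions \<tau>" and g: "g : G" and k: "k : K"
 shows "norm (f (g ** k)) = norm (f g)" proof -
 have k': "matrix_inv k : K" "k : G" using k K_group by auto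
 have hom: "!!k l. k : K ==> l : K ==> \<tau> (k ** l) = \<tau> k ** \<tau> l" "\<tau> (mat 1) = mat 1" using \<tau> by (auto simp: unitary_rep_def)
 have "matrix_inv (\<tau> k) = \<tau> (matrix_inv k)" proof (rule matrix_inv_eqI)
  show "\<tau> k ** \<tau> (matrix_inv k) = mat 1" using hom(1)[OF k k'(1)] hom(2) k'(2) by simp
  show "\<tau> (matrix_inv k) ** \<tau> k = mat 1" using hom(1)[OF k'(1) k] hom(2) k'(2) by simp
 qed
 then show ?thesis using hol_functionsD(3)[OF f g k] \<tau> k'(1) by (simp add: unitary_rep_def)
qed

lemma has_vector_derivative_imp_increasing:
 assumes "(q has_vector_derivative D) (at 0)" "D > (0::real)"
 obtains d where "d > 0" "!!t. 0 < t ==> t < d ==> q 0 < q t" proof -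
 have "(q has_real_derivative D) (at 0)" using assms(1) by (simp add: has_real_derivative_iff_has_vector_derivative)
 from DERIV_pos_inc_right[OF this assms(2)] show ?thesis using that by auto
qed

text \<open>Suppose \<open>f (exp X1)\<close> is nonzero for a small \<open>X1\<close>. As \<open>f\<close> vanishes to infinite order, the quotient
 of \<open>norm (f x) ^ 2\<close> by a power of \<open>\<psi>\<close> is maximal at some \<open>x = exp X0\<close> other than the base point.
 Moving from there in the direction \<open>J (orbP x)\<close> decreases \<open>\<psi>\<close> exponentially and \<open>f\<close> at a bounded
 exponential rate, so for a large power the quotient grows, although the point stays in the region
 up to a right factor in \<open>K\<close>.\<close>

lemma flat_homogeneous_vanishes:
 obtains eps where "eps > 0"
  "!!(\<tau> :: 'n cmat => complex^'w^'w) f \<beta> g. unitary_rep K \<tau> ==> f : hol_functions \<tau> ==> flat_at_one f ==>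
   (!!s x. \<bar>s\<bar> < 1 ==> x : G ==> f (rot s ** x) = cis (\<beta> * s) *s f x) ==>
   g : G ==> norm (g - mat 1) < eps ==> f g = 0" proof -
 obtain r c1 c2 where r: "r > 0" and c: "c1 > 0" "c2 > 0"
  and low: "!!X. X : \<pp> ==> norm X <= r ==> c1 * norm X ^ 2 <= \<psi> (mexp X)"
  and up: "!!X. X : \<pp> ==> norm X <= r ==> \<psi> (mexp X) <= c2 * norm X ^ 2"
  and nK: "!!X. X : \<pp> ==> norm X <= r ==> norm (orbK (mexp X)) <= norm Z + 1"
  and dec: "!!X. X : \<pp> ==> norm X <= r ==>
    2 * \<kappa> (bracket (orbK (mexp X)) (J (orbP (mexp X)))) (orbP (mexp X)) <= - \<psi> (mexp X)" by (rule \<psi>_near_one) (rule that)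
 obtain eps0 C where eps0: "eps0 > 0" "C > 0"
  and coord: "!!g. g : G ==> norm (g - mat 1) < eps0 ==>
    \<exists>X\<in>\<pp>. \<exists>Y\<in>\<kk>. norm X <= C * norm (g - mat 1) \<and> g = mexp X ** mexp Y" by (rule cartan_coordinates) (rule that)
 obtain r1 where r1: "r1 > 0" "!!X :: 'n cmat. norm X < r1 ==> norm (mexp X - mat 1) <= 2 * norm X" by (rule norm_matrix_exp_minus_one) (rule that)
 define eps1 where "eps1 = min eps0 (r / C)"
 have eps1: "eps1 > 0" "eps1 <= eps0" "eps1 <= r / C" using eps0 r by (auto simp: eps1_def)
 define r' where "r' = min r (min (r1 / 2) (eps1 / 4))"
 have r': "r' > 0" "r' <= r" "r' < r1" "2 * r' < eps1" using r r1(1) eps1(1) by (auto simp: r'_def)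
 define R where "R = c1 * r'^2"
 have R: "R > 0" using c r' by (simp add: R_def)
 have small: "norm X <= r'" if "X : \<pp>" "norm X <= r" "\<psi> (mexp X) <= R" for X
 proof -
  have "c1 * norm X^2 <= c1 * r'^2" using low[OF that(1,2)] that(3) by (simp add: R_def)
  then have "norm X^2 <= r'^2" using c(1) by simp
  then show ?thesis by (rule power2_le_imp_le) (use r'(1) in simp)
 qed
 define \<rho> where "\<rho> = min r (sqrt (R / c2))"
 have \<rho>: "\<rho> > 0" using r R c by (simp add: \<rho>_def)
 have inR: "\<psi> (mexp X) <= R" if "X : \<pp>" "norm X <= \<rho>" for X
 proof -
  have "norm X^2 <= (sqrt (R / c2))^2" using that(2) by (intro power_mono) (auto simp: \<rho>_def)
  then have "norm X^2 <= R / c2" using R c by simp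
  then have "c2 * norm X^2 <= R" using c by (simp add: pos_le_divide_eq mult.commute)
  then show ?thesis using up[OF that(1)] that(2) by (simp add: \<rho>_def)
 qed
 have main: "f (mexp X1) = 0"
  if \<tau>: "unitary_rep K \<tau>" and f: "f : hol_functions \<tau>" and flat: "flat_at_one f"
   and rotation: "!!s x. \<bar>s\<bar> < 1 ==> x : G ==> f (rot s ** x) = cis (\<beta> * s) *s f x"
   and X1: "X1 : \<pp>" "norm X1 <= r" "\<psi> (mexp X1) <= R"
  for \<tau> :: "'n cmat => complex^'w^'w" and f \<beta> X1
 proof (rule ccontr)
  assume nz: "f (mexp X1) ~= 0"
  note sm = hol_functionsD(2)[OF f]
  have "f (mat 1) = 0" using flat unfolding flat_at_one_def by (auto dest: spec[of _ "[]"])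
  then have X10: "X1 ~= 0" using nz by auto
  obtain M where M: "M \<ge> 0" "!!g. g : G ==> norm (orbK g) <= norm Z + 1 ==>
    norm (right_deriv (J (orbP g)) f g) <= M * norm (f g)" using radial_derivative_bound[OF \<tau> f rotation, of "norm Z + 1"] by blast
  obtain N :: nat where N: "real N > 2 * M" using reals_Archimedean2 by blast
  define Q where "Q g = norm (f g)^2 / \<psi> g ^ N" for g
  have \<psi>pos: "\<psi> (mexp X) > 0" if "X : \<pp>" "norm X <= r" "X ~= 0" for X
  proof -
   have "0 < c1 * norm X^2" using c that(3) by simp
   then show ?thesis using low[OF that(1,2)] by linarith
  qed
  have Q1: "Q (mexp X1) > 0" using \<psi>pos[OF X1(1,2) X10] nz by (simp add: Q_def)
  obtain \<delta> D where \<delta>: "\<delta> > 0" "D \<ge> 0"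
   and Dbound: "!!v. v : \<gg> ==> norm v < \<delta> ==> norm (f (mexp v)) <= D * norm v ^ (N + 1)" using flat_at_one_bound[OF flat, of "N + 1"] by blast
  define \<eta> where "\<eta> = min (\<delta> / 2) (min r (sqrt (Q (mexp X1) * c1 ^ N / (2 * (D^2 + 1)))))"
  have \<eta>: "\<eta> > 0" "\<eta> < \<delta>" "\<eta> <= r" using \<delta> r Q1 c by (auto simp: \<eta>_def add_nonneg_pos)
  have small_Q: "Q (mexp X) < Q (mexp X1)" if X: "X : \<pp>" "norm X <= \<eta>" for X
  proof (cases "X = 0")
   case True
   then show ?thesis using Q1 \<open>f (mat 1) = 0\<close> by (simp add: Q_def)
  next
   case False
   have n0: "norm X > 0" using False by simp
   have nr: "norm X <= r" using X(2) \<eta>(3) by simp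
   have "norm (f (mexp X)) <= D * norm X ^ (N + 1)" using Dbound[OF p_mem[OF X(1)]] X(2) \<eta>(2) by simp
   then have "norm (f (mexp X))^2 <= (D * norm X ^ (N + 1))^2" by (intro power_mono) auto
   also have "\<dots> = D^2 * norm X^2 * (norm X^2)^N"
    by (simp add: power_mult_distrib power_add power_mult[symmetric] mult.commute power2_eq_square power_even_eq mult.assoc)
   finally have a: "norm (f (mexp X))^2 <= D^2 * norm X^2 * (norm X^2)^N" .
   have "(c1 * norm X^2)^N <= \<psi> (mexp X) ^ N" using low[OF X(1) nr] c by (intro power_mono) auto
   moreover have "(c1 * norm X^2)^N > 0" using c n0 by simp
   ultimately have "Q (mexp X) <= norm (f (mexp X))^2 / (c1 * norm X^2)^N" unfolding Q_def by (intro divide_left_mono) (auto intro: mult_pos_pos less_le_trans)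
   also have "\<dots> <= (D^2 * norm X^2 * (norm X^2)^N) / (c1 * norm X^2)^N" using a \<open>(c1 * norm X^2)^N > 0\<close> by (intro divide_right_mono) auto
   also have "\<dots> = D^2 * norm X^2 / c1^N" using n0 by (simp add: power_mult_distrib)
   also have "\<dots> < Q (mexp X1)" proof -
    have "norm X^2 <= (sqrt (Q (mexp X1) * c1 ^ N / (2 * (D^2 + 1))))^2" using X(2) by (intro power_mono) (auto simp: \<eta>_def)
    also have "\<dots> = Q (mexp X1) * c1 ^ N / (2 * (D^2 + 1))" using Q1 c by (intro real_sqrt_pow2) (simp add: add_nonneg_pos)
    finally have "norm X^2 * (2 * (D^2 + 1)) <= Q (mexp X1) * c1 ^ N" by (subst (asm) pos_le_divide_eq) (simp_all add: add_nonneg_pos)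
    moreover have "D^2 * norm X^2 < norm X^2 * (2 * (D^2 + 1))" proof -
     have "norm X^2 * D^2 < norm X^2 * (2 * (D^2 + 1))" proof (rule mult_strict_left_mono)
      have "D^2 + 0 < D^2 + (D^2 + 2)" by (intro add_strict_left_mono add_nonneg_pos) simp_all
      then show "D^2 < 2 * (D^2 + 1)" by (simp add: algebra_simps)
     qed (use n0 in simp)
     then show ?thesis by (simp add: mult.commute)
    qed
    ultimately have "D^2 * norm X^2 < Q (mexp X1) * c1 ^ N" by simp
    then show ?thesis using c by (simp add: divide_less_eq)
   qed
   finally show ?thesis .
  qed
  define S where "S = {X : \<pp>. norm X : {\<eta>..r} \<and> \<psi> (mexp X) <= R}"
  obtain l0 lp where lp: "bounded_linear lp" "!!X. X : \<gg> ==> lp X = p_part X" by (rule parts_bounded) (rule that)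
  obtain P where P: "linear P" "!!v. P v : \<gg>" "!!v. v : \<gg> ==> P v = v" by (rule linear_projection) (rule that)
  have expG: "mexp X : G" if "X : \<pp>" for X by (rule exp_mem[OF p_mem[OF that]])
  have cont\<psi>: "continuous_on \<pp> (%X. \<psi> (mexp X))" proof -
   have "continuous_on \<pp> (%X. lp (mexp (- X) ** Z ** mexp X))" by (rule bounded_linear.continuous_on[OF lp(1)]) (intro continuous_intros)
   then have "continuous_on \<pp> (%X. \<kappa> (P (lp (mexp (- X) ** Z ** mexp X))) (P (lp (mexp (- X) ** Z ** mexp X))))"
    by (intro bounded_bilinear.continuous_on[OF killing_bounded_bilinear[OF P(1,2)]])
   moreover have "\<kappa> (P (lp (mexp (- X) ** Z ** mexp X))) (P (lp (mexp (- X) ** Z ** mexp X))) = \<psi> (mexp X)"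
    if "X : \<pp>" for X
    using lp(2)[OF orb_mem[OF expG[OF that]]] P(3)[OF p_mem[OF orb_parts(2)[OF expG[OF that]]]] by (simp add: orb_exp[symmetric] \<psi>_def orbP_def)
   ultimately show ?thesis by (simp cong: continuous_on_cong)
  qed
  have closedp: "closed \<pp>" by (rule closed_subspace[OF subspace_p])
  have "closed {X : \<pp>. \<psi> (mexp X) <= R}" using continuous_closed_preimage[OF cont\<psi> closedp closed_atMost[of R]] by (simp add: vimage_def Int_def)
  moreover have "compact (cball (0 :: 'n cmat) r \<inter> - ball 0 \<eta>)" by (intro compact_Int_closed compact_cball) auto
  ultimately have "compact ({X : \<pp>. \<psi> (mexp X) <= R} \<inter> (cball 0 r \<inter> - ball 0 \<eta>))" by (rule closed_Int_compact)
  moreover have "S = {X : \<pp>. \<psi> (mexp X) <= R} \<inter> (cball 0 r \<inter> - ball 0 \<eta>)" by (auto simp: S_def)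
  ultimately have compS: "compact S" by simp
  have X1\<eta>: "\<not> norm X1 <= \<eta>" using small_Q[OF X1(1)] by auto
  have X1S: "X1 : S" using X1 X1\<eta> by (simp add: S_def)
  have Sp: "X : \<pp>" "norm X <= r" "X ~= 0" "\<psi> (mexp X) <= R" if "X : S" for X
   using that \<eta>(1) by (auto simp: S_def)
  have contf: "continuous_on S (%X. f (mexp X))" by (rule continuous_on_compose2[OF smooth_continuous[OF sm]]) (auto intro!: continuous_intros expG Sp)
  have contQ: "continuous_on S (%X. Q (mexp X))" unfolding Q_def using \<psi>pos Sp
   by (intro continuous_on_divide continuous_intros contf continuous_on_subset[OF cont\<psi>]) (auto simp: less_imp_neq[symmetric])
  from continuous_attains_sup[OF compS _ contQ]
  obtain X0 where X0: "X0 : S" "!!X. X : S ==> Q (mexp X) <= Q (mexp X0)" using X1S by blast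
  have max: "Q (mexp X) <= Q (mexp X0)" if "X : \<pp>" "norm X <= r" "\<psi> (mexp X) <= R" for X
  proof (cases "norm X <= \<eta>")
   case True
   then show ?thesis using small_Q[OF that(1) True] X0(2)[OF X1S] by simp
  next
   case False
   then show ?thesis using that by (intro X0(2)) (simp add: S_def)
  qed
  define g where "g = mexp X0"
  define Y where "Y = J (orbP g)"
  have X0': "X0 : \<pp>" "norm X0 <= r" "X0 ~= 0" "\<psi> g <= R" using Sp[OF X0(1)] by (auto simp: g_def)
  have g: "g : G" unfolding g_def by (rule expG[OF X0'(1)])
  have Y: "Y : \<gg>" unfolding Y_def by (rule p_mem[OF J_mem[OF orb_parts(2)[OF g]]])
  define \<gamma> where "\<gamma> t = g ** mexp (t *\<^sub>R Y)" for t
  have \<gamma>G: "\<gamma> t : G" for t using g Y by (auto simp: \<gamma>_def)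
  have \<gamma>0: "\<gamma> 0 = g" by (simp add: \<gamma>_def)
  have \<psi>g: "\<psi> g > 0" using \<psi>pos[OF X0'(1-3)] by (simp add: g_def)
  have Qg: "Q g > 0" using Q1 X0(2)[OF X1S] by (simp add: g_def)
  then have hg: "norm (f g)^2 > 0" using \<psi>g by (simp add: Q_def zero_less_divide_iff zero_less_power)
  define \<psi>' where "\<psi>' = 2 * \<kappa> (bracket (orbK g) (J (orbP g))) (orbP g)"
  have \<psi>': "\<psi>' <= - \<psi> g" using dec[OF X0'(1,2)] by (simp add: \<psi>'_def g_def)
  have d\<psi>: "((%t. \<psi> (\<gamma> t)) has_real_derivative \<psi>') (at 0)" using \<psi>_derivative[OF g] unfolding \<gamma>_def Y_def \<psi>'_def
   by (simp add: has_real_derivative_iff_has_vector_derivative)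
  define h' where "h' = 2 * (f g \<bullet> right_deriv Y f g)"
  have dh: "((%t. norm (f (\<gamma> t))^2) has_real_derivative h') (at 0)" proof -
   have d: "((%t. f (\<gamma> t)) has_vector_derivative right_deriv Y f g) (at 0)" unfolding \<gamma>_def by (rule right_deriv_at_0[OF sm Y g])
   have "((%t. f (\<gamma> t) \<bullet> f (\<gamma> t)) has_vector_derivative f (\<gamma> 0) \<bullet> right_deriv Y f g + right_deriv Y f g \<bullet> f (\<gamma> 0)) (at 0)"
    by (rule bounded_bilinear.has_vector_derivative[OF bounded_bilinear_inner d d])
   then show ?thesis
    by (simp add: has_real_derivative_iff_has_vector_derivative dot_square_norm h'_def \<gamma>0 inner_commute)
  qed
  have h': "h' \<ge> - 2 * M * norm (f g)^2" proof -
   have "\<bar>f g \<bullet> right_deriv Y f g\<bar> <= norm (f g) * norm (right_deriv Y f g)" by (rule Cauchy_Schwarz_ineq2)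
   also have "\<dots> <= norm (f g) * (M * norm (f g))" using M(2)[OF g] nK[OF X0'(1,2)] unfolding Y_def g_def[symmetric] by (intro mult_left_mono) auto
   finally show ?thesis by (simp add: h'_def power2_eq_square mult_ac)
  qed
  define Q' where "Q' = (h' * \<psi> g ^ N - norm (f g)^2 * (real N * \<psi>' * \<psi> g ^ (N - 1))) / (\<psi> g ^ N * \<psi> g ^ N)"
  have dQ: "((%t. Q (\<gamma> t)) has_real_derivative Q') (at 0)" proof -
   have dpow: "((%t. \<psi> (\<gamma> t) ^ N) has_real_derivative (real N * \<psi>' * \<psi> g ^ (N - 1))) (at 0)"
    using DERIV_power[OF d\<psi>, of N] by (simp add: \<gamma>0 mult_ac)
   have "\<psi> (\<gamma> 0) ^ N ~= 0" using \<psi>g by (simp add: \<gamma>0)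
   from DERIV_divide[OF dh dpow this] show ?thesis by (simp add: Q_def Q'_def \<gamma>0)
  qed
  have Npos: "N > 0" using N M(1) by (cases N) auto
  have "Q' > 0" proof -
   have "\<psi> g ^ N = \<psi> g * \<psi> g ^ (N - 1)" using Npos by (simp add: power_eq_if)
   then have "h' * \<psi> g ^ N - norm (f g)^2 * (real N * \<psi>' * \<psi> g ^ (N - 1)) =
     (h' * \<psi> g - norm (f g)^2 * (real N * \<psi>')) * \<psi> g ^ (N - 1)" by (simp add: algebra_simps)
   also have "\<dots> > 0" proof (intro mult_pos_pos)
    have "h' * \<psi> g \<ge> (- 2 * M * norm (f g)^2) * \<psi> g" using h' \<psi>g by (intro mult_right_mono) auto
    moreover have "norm (f g)^2 * (real N * \<psi>') <= norm (f g)^2 * (real N * (- \<psi> g))" using \<psi>' by (intro mult_left_mono) auto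
    moreover have "norm (f g)^2 * \<psi> g * (2 * M) < norm (f g)^2 * \<psi> g * real N" using N hg \<psi>g by (intro mult_strict_left_mono mult_pos_pos)
    ultimately show "h' * \<psi> g - norm (f g)^2 * (real N * \<psi>') > 0" by (simp add: algebra_simps)
   qed (use \<psi>g in simp)
   finally show ?thesis using \<psi>g by (simp add: Q'_def)
  qed
  then obtain t1 where t1: "t1 > 0" "!!t. 0 < t ==> t < t1 ==> Q g < Q (\<gamma> t)" using has_vector_derivative_imp_increasing[of "%t. Q (\<gamma> t)" Q'] dQ
   by (auto simp: has_real_derivative_iff_has_vector_derivative \<gamma>0)
  have "((%t. - \<psi> (\<gamma> t)) has_real_derivative - \<psi>') (at 0)" using d\<psi> by (rule DERIV_minus)
  moreover have "- \<psi>' > 0" using \<psi>' \<psi>g by simp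
  ultimately obtain t2 where t2: "t2 > 0" "!!t. 0 < t ==> t < t2 ==> \<psi> (\<gamma> t) < \<psi> g"
   using has_vector_derivative_imp_increasing[of "%t. - \<psi> (\<gamma> t)" "- \<psi>'"] by (auto simp: has_real_derivative_iff_has_vector_derivative \<gamma>0)
  have ng: "norm (g - mat 1) < eps1" proof -
   have "norm X0 <= r'" using small[OF X0'(1,2)] X0'(4) by (simp add: g_def)
   then show ?thesis using r1(2)[of X0] r'(3,4) by (simp add: g_def)
  qed
  obtain t3 where t3: "t3 > 0" "!!p s. norm (p - g) < t3 ==> \<bar>s\<bar> < t3 ==>
    norm (p ** mexp (s *\<^sub>R Y) - g) < eps1 - norm (g - mat 1)" by (rule curve_near[of "eps1 - norm (g - mat 1)" g Y]) (use ng in simp, rule that)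
  define t where "t = min t1 (min t2 t3) / 2"
  have t: "0 < t" "t < t1" "t < t2" "\<bar>t\<bar> < t3" using t1(1) t2(1) t3(1) by (auto simp: t_def)
  have "norm (\<gamma> t - g) < eps1 - norm (g - mat 1)" using t3(2)[of g t] t(4) t3(1) by (simp add: \<gamma>_def)
  then have n1: "norm (\<gamma> t - mat 1) < eps1" using norm_triangle_ineq[of "\<gamma> t - g" "g - mat 1"] by simp
  have "norm (\<gamma> t - mat 1) < eps0" using n1 eps1(2) by simp
  from coord[OF \<gamma>G this] obtain X V where XV: "X : \<pp>" "V : \<kk>" "norm X <= C * norm (\<gamma> t - mat 1)"
   "\<gamma> t = mexp X ** mexp V" by blast
  have k: "mexp V : K" using exp_k_mem[OF XV(2), of 1] by simp
  have nX: "norm X <= r" proof -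
   have "C * norm (\<gamma> t - mat 1) <= C * (r / C)" using n1 eps1(3) eps0(2) by (intro mult_left_mono) auto
   then show ?thesis using XV(3) eps0(2) by simp
  qed
  have \<psi>X: "\<psi> (\<gamma> t) = \<psi> (mexp X)" unfolding XV(4) by (rule orb_K[OF expG[OF XV(1)] k])
  have "norm (f (\<gamma> t)) = norm (f (mexp X))" unfolding XV(4) by (rule norm_hol_K[OF \<tau> f expG[OF XV(1)] k])
  then have "Q (\<gamma> t) = Q (mexp X)" by (simp add: Q_def \<psi>X)
  moreover have "Q (mexp X) <= Q g" unfolding g_def
   using max[OF XV(1) nX] t2(2)[OF t(1,3)] X0'(4) \<psi>X by simp
  ultimately show False using t1(2)[OF t(1,2)] by simp
 qed
 define eps where "eps = min eps0 (\<rho> / C)"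
 show ?thesis
 proof (rule that[of eps])
  show "eps > 0" using eps0 \<rho> by (simp add: eps_def)
  fix \<tau> :: "'n cmat => complex^'w^'w" and f \<beta> g
  assume \<tau>: "unitary_rep K \<tau>" and f: "f : hol_functions \<tau>" and flat: "flat_at_one f"
   and rotation: "!!s x. \<bar>s\<bar> < 1 ==> x : G ==> f (rot s ** x) = cis (\<beta> * s) *s f x"
   and g: "g : G" "norm (g - mat 1) < eps"
  have "norm (g - mat 1) < eps0" using g(2) by (simp add: eps_def)
  from coord[OF g(1) this] obtain X V where XV: "X : \<pp>" "V : \<kk>" "norm X <= C * norm (g - mat 1)"
   "g = mexp X ** mexp V" by blast
  have k: "mexp V : K" using exp_k_mem[OF XV(2), of 1] by simp
  have "C * norm (g - mat 1) <= C * (\<rho> / C)" using g(2) eps0(2) by (intro mult_left_mono) (auto simp: eps_def)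
  then have nX: "norm X <= \<rho>" using XV(3) eps0(2) by simp
  have "f (mexp X) = 0" proof (rule main[OF \<tau> f flat rotation XV(1)])
   show "norm X <= r" using nX by (simp add: \<rho>_def)
   show "\<psi> (mexp X) <= R" by (rule inR[OF XV(1) nX])
  qed
  then show "f g = 0" using hol_functionsD(3)[OF f exp_mem[OF p_mem[OF XV(1)]] k] XV(4) by simp
 qed
qed

end

section \<open>Unique continuation\<close>

lemma periodic_integral_shift:
 fixes u :: "real => 'a::euclidean_space"
 assumes u: "continuous_on UNIV u" and per: "!!t. u (t + p) = u t" and p: "p > 0" and s: "\<bar>s\<bar> <= 4"
 shows "integral {0..p} (%t. u (t + s)) = integral {0..p} u" proof -
 have cont: "continuous_on S u" for S by (rule continuous_on_subset[OF u]) simp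
 define F where "F y = integral {-5..y} u" for y
 have F: "(F has_vector_derivative u y) (at y)" if "y : {-5<..<p + 5}" for y
 proof -
  have "(F has_vector_derivative u y) (at y within {-5..p + 5})" unfolding F_def using that by (intro integral_has_vector_derivative cont) auto
  then have "(F has_vector_derivative u y) (at y within {-5<..<p + 5})" by (rule has_vector_derivative_within_subset) auto
  then show ?thesis using at_within_open[of y "{-5<..<p + 5}"] that by simp
 qed
 have split: "F v - F w = integral {w..v} u" if "-5 <= w" "w <= v" for w v
  using Henstock_Kurzweil_Integration.integral_combine[of "-5" w v u] that
   integrable_continuous_real[OF cont] unfolding F_def by (simp add: algebra_simps)
 have "((%s. F (s + p) - F s) has_vector_derivative 0) (at s within {-4..4})" if s: "s : {-4..4}" for s
 proof -
  have 1: "((%s. s + p) has_vector_derivative 1) (at s)" by (auto intro!: derivative_eq_intros)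
  have 2: "(F has_vector_derivative u (s + p)) (at ((%s. s + p) s))" using F[of "s + p"] s p by simp
  have "((%s. F (s + p)) has_vector_derivative u (s + p)) (at s)" using vector_diff_chain_at[OF 1 2] by (simp add: o_def)
  moreover have "(F has_vector_derivative u s) (at s)" using F[of s] s p by simp
  ultimately have "((%s. F (s + p) - F s) has_vector_derivative u (s + p) - u s) (at s)" by (rule has_vector_derivative_diff)
  then show ?thesis by (simp add: per has_vector_derivative_at_within)
 qed
 then obtain k where k: "!!s. s : {-4..4} ==> F (s + p) - F s = k"
  using has_vector_derivative_zero_constant[OF convex_real_interval(5), of "-4" 4 "%s. F (s + p) - F s"] by blast
 have "integral {0..p} (%t. u (t + s)) = integral {0 + s..p + s} u" using integral_shift[OF cont, where a=0 and b=p and c=s] by (simp add: o_def)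
 also have "\<dots> = F (s + p) - F s" using split[of s "s + p"] s p by (simp add: add.commute)
 also have "\<dots> = F (0 + p) - F 0" using k[of s] k[of 0] s by (simp add: abs_le_iff)
 also have "\<dots> = integral {0..p} u" using split[of 0 p] p by simp
 finally show ?thesis .
qed

text \<open>The powers of \<open>(1 - cos t) / 2\<close> are trigonometric polynomials that concentrate at \<open>\<pi>\<close>.\<close>

lemma fourier_coefficients_zero:
 fixes v :: "real => complex^'w"
 assumes v: "continuous_on UNIV v"
  and coeff: "!!m :: int. integral {0..2 * pi} (%t. cis (of_int m * t) *s v t) = 0"
 shows "v pi = 0" proof (rule ccontr)
 assume nz: "v pi ~= 0"
 define k where "k t = (1 - cos t) / 2" for t :: real
 have contv: "continuous_on S v" for S by (rule continuous_on_subset[OF v]) simp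
 have H: "((%t. cis (of_int m * t) *s (k t ^ N *\<^sub>R v t)) has_integral 0) {0..2 * pi}" for N and m :: int
 proof (induction N arbitrary: m)
  case 0
  have "continuous_on {0..2 * pi} (%t. cis (of_int m * t) *s v t)" by (intro continuous_intros contv)
  then have "((%t. cis (of_int m * t) *s v t) has_integral integral {0..2 * pi} (%t. cis (of_int m * t) *s v t)) {0..2 * pi}"
   by (intro integrable_integral integrable_continuous_real)
  then show ?case by (simp add: coeff)
 next
  case (Suc N)
  let ?w = "%m t. cis (of_int m * t) *s (k t ^ N *\<^sub>R v t)"
  have "((%t. (1/2) *\<^sub>R ?w m t - (1/4) *\<^sub>R ?w (m + 1) t - (1/4) *\<^sub>R ?w (m - 1) t) has_integral
    (1/2) *\<^sub>R 0 - (1/4) *\<^sub>R 0 - (1/4) *\<^sub>R 0) {0..2 * pi}" by (intro has_integral_diff has_integral_cmul Suc.IH)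
  moreover have "(1/2) *\<^sub>R ?w m t - (1/4) *\<^sub>R ?w (m + 1) t - (1/4) *\<^sub>R ?w (m - 1) t =
    cis (of_int m * t) *s (k t ^ Suc N *\<^sub>R v t)" for t
  proof -
   have s: "cis (of_int (m + 1) * t) = cis (of_int m * t) * cis t" "cis (of_int (m - 1) * t) = cis (of_int m * t) * cis (- t)" by (simp_all add: cis_mult algebra_simps)
   have kc: "complex_of_real (k t) = 1/2 - (cis t + cis (- t)) / 4" by (simp add: k_def complex_eq_iff)
   have "(1/2) *\<^sub>R (c *s x) - (1/4) *\<^sub>R ((c * cis t) *s x) - (1/4) *\<^sub>R ((c * cis (- t)) *s x) = c *s (k t *\<^sub>R x)"
    for c and x :: "complex^'w" proof -
    have e: "(1/2) *\<^sub>R (c * z) - (1/4) *\<^sub>R ((c * cis t) * z) - (1/4) *\<^sub>R ((c * cis (- t)) * z) = c * (k t *\<^sub>R z)" for z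
     unfolding scaleR_conv_of_real kc by (simp add: field_simps)
    show ?thesis
     unfolding vec_eq_iff vector_minus_component vector_scaleR_component vector_smult_component
     using e by blast
   qed
   then show ?thesis unfolding s by simp
  qed
  ultimately show ?case by simp
 qed
 define \<phi> where "\<phi> t = v t \<bullet> v pi" for t
 have K0: "((%t. k t ^ N * \<phi> t) has_integral 0) {0..2 * pi}" for N
  using has_integral_linear[OF H[of 0 N] bounded_linear_inner_left[of "v pi"]] by (simp add: o_def \<phi>_def)
 have cont\<phi>: "continuous_on S \<phi>" for S unfolding \<phi>_def by (intro continuous_intros contv)
 have \<phi>pi: "\<phi> pi > 0" using nz by (simp add: \<phi>_def)
 define \<delta> where "\<delta> = \<phi> pi / 2"
 have \<delta>: "\<delta> > 0" using \<phi>pi by (simp add: \<delta>_def)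
 from cont\<phi>[of UNIV, unfolded continuous_on_iff, rule_format, of pi \<delta>] \<delta>
 obtain d where d: "d > 0" "!!t. dist t pi < d ==> dist (\<phi> t) (\<phi> pi) < \<delta>" by auto
 define \<eta> where "\<eta> = min (d / 2) 1"
 have \<eta>: "\<eta> > 0" "\<eta> < d" "\<eta> <= 1" using d(1) by (auto simp: \<eta>_def)
 have near: "\<phi> t \<ge> \<delta>" if "\<bar>t - pi\<bar> <= \<eta>" for t
 proof -
  have "\<bar>\<phi> t - \<phi> pi\<bar> < \<phi> pi / 2" using d(2)[of t] that \<eta>(2) by (simp add: dist_real_def \<delta>_def)
  then show ?thesis unfolding \<delta>_def by linarith
 qed
 have "compact (\<phi> ` {0..2 * pi})" by (intro compact_continuous_image cont\<phi>) simp
 from compact_imp_bounded[OF this, THEN iffD1[OF bounded_pos]]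
 obtain M where M0: "M > 0" "\<forall>x\<in>\<phi> ` {0..2 * pi}. norm x <= M" by (elim exE conjE)
 have M: "M > 0" "t : {0..2 * pi} ==> \<bar>\<phi> t\<bar> <= M" for t
  using M0(2)[rule_format, OF imageI[of t "{0..2 * pi}" \<phi>]] by (simp_all add: M0(1))
 define q1 where "q1 = (1 + cos (\<eta> / 2)) / 2"
 define q2 where "q2 = (1 + cos \<eta>) / 2"
 have kpi: "k t = (1 + cos \<bar>t - pi\<bar>) / 2" for t by (simp add: k_def cos_diff)
 have pi3: "pi > 3" by (rule pi_gt3)
 have q: "q2 \<ge> 0" "q2 < q1" "q1 > 0" proof -
  have "cos \<eta> < cos (\<eta> / 2)" using \<eta> pi3 by (intro cos_monotone_0_pi) auto
  then show "q2 < q1" by (simp add: q1_def q2_def)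
  show "q2 \<ge> 0" using add_left_mono[OF cos_ge_minus_one[of \<eta>], of 1] by (simp add: q2_def)
  then show "q1 > 0" using \<open>q2 < q1\<close> by simp
 qed
 have k01: "0 <= k t" for t using cos_le_one[of t] by (simp add: k_def)
 have kin: "k t \<ge> q1" if "\<bar>t - pi\<bar> <= \<eta> / 2" for t
 proof -
  have "cos (\<eta> / 2) <= cos \<bar>t - pi\<bar>" using that \<eta> pi3 by (intro cos_monotone_0_pi_le) auto
  then show ?thesis by (simp add: kpi q1_def)
 qed
 have kout: "k t <= q2" if "\<bar>t - pi\<bar> \<ge> \<eta>" "t : {0..2 * pi}" for t
 proof -
  have "cos \<bar>t - pi\<bar> <= cos \<eta>" using that \<eta> by (intro cos_monotone_0_pi_le) (auto simp: abs_le_iff)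
  then show ?thesis by (simp add: kpi q2_def)
 qed
 have est: "q1 ^ N * \<delta> * \<eta> <= M * q2 ^ N * (2 * pi)" for N
 proof -
  let ?I = "{pi - \<eta> / 2..pi + \<eta> / 2}"
  have sub: "?I <= {0..2 * pi}" using \<eta> pi3 by auto
  have "((%t. q1 ^ N * \<delta>) has_integral (q1 ^ N * \<delta>) * \<eta>) ?I"
   using has_integral_const_real[of "q1 ^ N * \<delta>" "pi - \<eta> / 2" "pi + \<eta> / 2"] \<eta>(1) by (simp add: mult.commute)
  then have I1: "((%t. if t : ?I then q1 ^ N * \<delta> else 0) has_integral (q1 ^ N * \<delta>) * \<eta>) {0..2 * pi}" by (subst has_integral_restrict[OF sub])
  have I2: "((%t. M * q2 ^ N) has_integral (M * q2 ^ N) * (2 * pi)) {0..2 * pi}" using has_integral_const_real[of "M * q2 ^ N" 0 "2 * pi"] by (simp add: mult.commute)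
  have "(q1 ^ N * \<delta>) * \<eta> - (M * q2 ^ N) * (2 * pi) <= 0" proof (rule has_integral_le[OF has_integral_diff[OF I1 I2] K0[of N]])
   fix t assume t: "t : {0..2 * pi}"
   have Mq: "M * q2 ^ N \<ge> 0" using M(1) q(1) by simp
   consider "t : ?I" | "t \<notin> ?I" "\<bar>t - pi\<bar> <= \<eta>" | "t \<notin> ?I" "\<bar>t - pi\<bar> > \<eta>" by linarith
   then show "(if t : ?I then q1 ^ N * \<delta> else 0) - M * q2 ^ N <= k t ^ N * \<phi> t" proof cases
    case 1
    then have a: "\<bar>t - pi\<bar> <= \<eta> / 2" by (intro abs_leI) auto
    have "q1 ^ N * \<delta> <= k t ^ N * \<phi> t" using kin[OF a] near[of t] a \<eta>(1) q(3) \<delta> k01[of t] by (intro mult_mono power_mono) auto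
    then show ?thesis using 1 Mq by simp
   next
    case 2
    have "0 <= k t ^ N * \<phi> t" using near[OF 2(2)] \<delta> k01[of t] by (intro mult_nonneg_nonneg zero_le_power) auto
    then show ?thesis unfolding if_not_P[OF 2(1)] using Mq by linarith
   next
    case 3
    have "k t ^ N * \<bar>\<phi> t\<bar> <= q2 ^ N * M" using kout[of t] 3 t M k01[of t] q(1) by (intro mult_mono power_mono) auto
    then have "- (M * q2 ^ N) <= k t ^ N * \<phi> t"
     using abs_mult[of "k t ^ N" "\<phi> t"] abs_of_nonneg[OF zero_le_power[OF k01[of t], of N]] abs_ge_minus_self[of "k t ^ N * \<phi> t"]
     unfolding mult.commute[of M] by linarith
    then show ?thesis unfolding if_not_P[OF 3(1)] by linarith
   qed
  qed
  then show ?thesis by simp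
 qed
 have "(%N. (q2 / q1) ^ N) \<longlonglongrightarrow> 0" using q by (intro LIMSEQ_realpow_zero) auto
 then have "\<forall>\<^sub>F N in sequentially. (q2 / q1) ^ N < \<delta> * \<eta> / (M * (2 * pi))" using \<delta> \<eta>(1) M(1) by (intro order_tendstoD(2)) auto
 then obtain N where N: "(q2 / q1) ^ N < \<delta> * \<eta> / (M * (2 * pi))" by (auto simp: eventually_sequentially)
 have "q2 ^ N * (M * (2 * pi)) < q1 ^ N * (\<delta> * \<eta>)" using N q M(1) by (simp add: power_divide field_simps)
 then show False using est[of N] by (simp add: mult_ac)
qed

context hermitian_group
begin

lemma continuous_rot: "continuous_on UNIV (%t. rot t)" by (intro continuous_intros)

lemma rot_add: "rot (s + t) = rot s ** rot t" by (rule matrix_exp_scaleR_add)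

lemma continuous_cis_mult: "continuous_on UNIV (%t. cis (a * t))" by (intro continuous_intros)

lemma p_minus_gC: "y : p_minus \<pp> J ==> y : \<gg>\<^sub>C" using p_mem by (auto simp: p_minus_def)

lemma smult_norm: "norm (a *s v) = norm a * norm v" for a and v :: "complex^'w" by (simp add: norm_vec_def norm_mult L2_set_right_distrib)

lemma cis_smult_cancel: "cis a *s v = w \<longleftrightarrow> v = cis (- a) *s w" for v w :: "complex^'w" proof -
 have "cis (- a) *s (cis a *s v) = v" "cis a *s (cis (- a) *s w) = w" by (simp_all add: vec_eq_iff mult.assoc[symmetric] cis_mult)
 then show ?thesis by metis
qed

abbreviation circle_average :: "real => ('n cmat => complex^'w) => 'n cmat => complex^'w" where
 "circle_average b f \<equiv> average 0 (2 * pi) (%t. cis (b * t)) (%t. rot t) f"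

lemmas circle_average_simps = average_mem[OF continuous_cis_mult continuous_rot rot_mem(2)]
 right_derivC_average[OF continuous_cis_mult continuous_rot rot_mem(2)]
 right_deriv_word_average[OF continuous_cis_mult continuous_rot rot_mem(2)]
 continuous_on_averaged_fixed[OF continuous_cis_mult continuous_rot rot_mem(2)]

lemma circle_average_hol:
 assumes f: "f : hol_functions \<tau>"
 shows "circle_average b f : hol_functions \<tau>" proof -
 note fS = hol_functionsD(1)[OF f]
 have "circle_average b f (g ** k) = matrix_inv (\<tau> k) *v circle_average b f g" if g: "g : G" and k: "k : K" for g k
 proof -
  let ?L = "%v. matrix_inv (\<tau> k) *v v"
  have int: "(%t. cis (b * t) *s f (rot t ** g)) integrable_on {0..2 * pi}"
   by (rule integrable_continuous_real[OF circle_average_simps(4)[OF smooth_continuous[OF hol_functionsD(2)[OF f]] g]])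
  have "circle_average b f (g ** k) = integral {0..2 * pi} (?L \<circ> (%t. cis (b * t) *s f (rot t ** g)))" unfolding average_def
  proof (rule arg_cong[where f="integral {0..2 * pi}"], rule ext)
   fix t
   have "f (rot t ** (g ** k)) = ?L (f (rot t ** g))" using hol_functionsD(3)[OF f mult_mem[OF rot_mem(2) g] k, of t] by (simp add: matrix_mul_assoc)
   then show "cis (b * t) *s f (rot t ** (g ** k)) = (?L \<circ> (%t. cis (b * t) *s f (rot t ** g))) t" by (simp add: vector_smult_matrix_vector)
  qed
  also have "\<dots> = ?L (integral {0..2 * pi} (%t. cis (b * t) *s f (rot t ** g)))" by (rule integral_linear[OF int bounded_linear_matrix_vector_mult])
  finally show ?thesis by (simp add: average_def)
 qed
 moreover have "right_derivC y (circle_average b f) g = 0" if y: "y : p_minus \<pp> J" and g: "g : G" for y g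
 proof -
  have "right_derivC y f (rot t ** g) = 0" for t by (rule hol_functionsD(4)[OF f y mult_mem[OF rot_mem(2) g]])
  then show ?thesis unfolding circle_average_simps(2)[OF fS p_minus_gC[OF y]] average_def by simp
 qed
 ultimately show ?thesis using circle_average_simps(1)[OF fS] by (simp add: hol_functions_def)
qed

text \<open>The twist by a character that makes the integrand \<open>2 \<pi>\<close>-periodic: \<open>rot (2 * pi)\<close> is central, and
 moved to the right it acts through \<open>\<tau>\<close>.\<close>

lemma twisted_periodic:
 fixes m :: int
 assumes f: "f : hol_functions \<tau>" and scalar: "!!t v. \<tau> (rot t) *v v = cis (\<alpha> * t) *s v"
  and \<tau>: "unitary_rep K \<tau>" and g: "g : G"
 shows "cis ((\<alpha> + of_int m) * (t + 2 * pi)) *s f (rot (t + 2 * pi) ** g) = cis ((\<alpha> + of_int m) * t) *s f (rot t ** g)" proof -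
 let ?c = "rot (2 * pi)"
 have "rot (t + 2 * pi) ** g = rot t ** g ** ?c" unfolding rot_add using rot_period_central[OF g] by (metis matrix_mul_assoc)
 then have "f (rot (t + 2 * pi) ** g) = matrix_inv (\<tau> ?c) *v f (rot t ** g)" using hol_functionsD(3)[OF f mult_mem[OF rot_mem(2) g] rot_mem(1)] by simp
 moreover have "matrix_inv (\<tau> (rot s)) *v v = cis (- \<alpha> * s) *s v" for s v
 proof -
  have hom: "!!k l. k : K ==> l : K ==> \<tau> (k ** l) = \<tau> k ** \<tau> l" "\<tau> (mat 1) = mat 1" using \<tau> by (auto simp: unitary_rep_def)
  have "matrix_inv (\<tau> (rot s)) = \<tau> (rot (- s))" using hom(1)[OF rot_mem(1) rot_mem(1), of s "- s"] hom(1)[OF rot_mem(1) rot_mem(1), of "- s" s] hom(2)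
   by (intro matrix_inv_eqI) (simp_all add: rot_add[symmetric])
  then show ?thesis using scalar[of "- s" v] by simp
 qed
 ultimately have "cis ((\<alpha> + of_int m) * (t + 2 * pi)) *s f (rot (t + 2 * pi) ** g)
   = (cis ((\<alpha> + of_int m) * (t + 2 * pi)) * cis (- \<alpha> * (2 * pi))) *s f (rot t ** g)" by (simp add: vec_eq_iff)
 also have "cis ((\<alpha> + of_int m) * (t + 2 * pi)) * cis (- \<alpha> * (2 * pi)) = cis ((\<alpha> + of_int m) * t) * cis (2 * pi * of_int m)"
  by (simp add: cis_mult algebra_simps)
 also have "cis (2 * pi * of_int m) = 1" by (rule cis_multiple_2pi) simp
 finally show ?thesis by simp
qed

lemma circle_average_rotation:
 fixes m :: int
 assumes f: "f : hol_functions \<tau>" and scalar: "!!t v. \<tau> (rot t) *v v = cis (\<alpha> * t) *s v"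
  and \<tau>: "unitary_rep K \<tau>" and g: "g : G" and s: "\<bar>s\<bar> <= 4"
 shows "circle_average (\<alpha> + of_int m) f (rot s ** g) = cis (- (\<alpha> + of_int m) * s) *s circle_average (\<alpha> + of_int m) f g" proof -
 let ?u = "%t. cis ((\<alpha> + of_int m) * t) *s f (rot t ** g)"
 have cont: "continuous_on S ?u" for S
  by (rule circle_average_simps(4)[OF smooth_continuous[OF hol_functionsD(2)[OF f]] g])
 have "integral {0..2 * pi} (%t. ?u (t + s)) = integral {0..2 * pi} ?u" by (rule periodic_integral_shift[OF cont twisted_periodic[OF f scalar \<tau> g] _ s]) simp
 moreover have "(%t. ?u (t + s)) = (%v. cis ((\<alpha> + of_int m) * s) *s v) \<circ> (%t. cis ((\<alpha> + of_int m) * t) *s f (rot t ** (rot s ** g)))" proof (rule ext)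
  fix t
  have "cis ((\<alpha> + of_int m) * (t + s)) = cis ((\<alpha> + of_int m) * s) * cis ((\<alpha> + of_int m) * t)" by (simp add: cis_mult algebra_simps)
  then show "?u (t + s) = ((%v. cis ((\<alpha> + of_int m) * s) *s v) \<circ> (%t. cis ((\<alpha> + of_int m) * t) *s f (rot t ** (rot s ** g)))) t"
   by (simp add: rot_add matrix_mul_assoc vec_eq_iff)
 qed
 moreover have "integral {0..2 * pi} ((%v. cis ((\<alpha> + of_int m) * s) *s v) \<circ> (%t. cis ((\<alpha> + of_int m) * t) *s f (rot t ** (rot s ** g))))
   = cis ((\<alpha> + of_int m) * s) *s integral {0..2 * pi} (%t. cis ((\<alpha> + of_int m) * t) *s f (rot t ** (rot s ** g)))"
  by (rule integral_linear[OF integrable_continuous_real[OF circle_average_simps(4)[OF smooth_continuous[OF hol_functionsD(2)[OF f]] mult_mem[OF rot_mem(2) g]]]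
    bounded_linear_vector_smult])
 ultimately have "cis ((\<alpha> + of_int m) * s) *s circle_average (\<alpha> + of_int m) f (rot s ** g) = circle_average (\<alpha> + of_int m) f g"
  by (simp add: average_def)
 then show ?thesis unfolding cis_smult_cancel by (simp add: algebra_simps)
qed

text \<open>A section that vanishes to infinite order at the identity is the sum of its Fourier components
 under the rotations, which are homogeneous and also vanish to infinite order. Left translation
 carries the vanishing near the identity to all of \<open>G\<close>.\<close>

theorem unique_continuation:
 fixes \<tau> :: "'n cmat => complex^'w^'w"
 assumes \<tau>: "unitary_rep K \<tau>" and irr: "irreducible_rep K \<tau>" and f: "f : hol_functions \<tau>" and flat: "flat_at_one f"
 shows "f g = 0" proof -
 obtain \<alpha> where \<alpha>: "!!t v. \<tau> (rot t) *v v = cis (\<alpha> * t) *s v" by (rule central_one_parameter_scalar[OF \<tau> irr continuous_rot rot_mem(1)])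
    (auto simp: rot_add rot_commute)
 obtain eps where eps: "eps > 0" and near: "!!(\<tau> :: 'n cmat => complex^'w^'w) f \<beta> g. unitary_rep K \<tau> ==> f : hol_functions \<tau> ==> flat_at_one f ==>
   (!!s x. \<bar>s\<bar> < 1 ==> x : G ==> f (rot s ** x) = cis (\<beta> * s) *s f x) ==>
   g : G ==> norm (g - mat 1) < eps ==> f g = 0" proof (rule flat_homogeneous_vanishes[where 'w='w])
  fix eps :: real
  assume pos: "eps > 0" and N: "!!(\<tau> :: 'n cmat => complex^'w^'w) f \<beta> g. unitary_rep K \<tau> ==> f : hol_functions \<tau> ==> flat_at_one f ==>
   (!!s x. \<bar>s\<bar> < 1 ==> x : G ==> f (rot s ** x) = cis (\<beta> * s) *s f x) ==>
   g : G ==> norm (g - mat 1) < eps ==> f g = 0"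
  show thesis
  proof (rule that[OF pos])
   fix \<tau> :: "'n cmat => complex^'w^'w" and f \<beta> g
   assume "unitary_rep K \<tau>" "f : hol_functions \<tau>" "flat_at_one f"
    "!!s x. \<bar>s\<bar> < 1 ==> x : G ==> f (rot s ** x) = cis (\<beta> * s) *s f x" "g : G" "norm (g - mat 1) < eps"
   then show "f g = 0" by (rule N)
  qed
 qed
 have local: "f x = 0" if f: "f : hol_functions \<tau>" and flat: "flat_at_one f" and x: "x : G" "norm (x - mat 1) < eps" for f x
 proof -
  note fS = hol_functionsD(1)[OF f] and contf = smooth_continuous[OF hol_functionsD(2)[OF f]]
  have avg0: "circle_average (\<alpha> + of_int m) f x = 0" for m :: int
  proof (rule near[OF \<tau> circle_average_hol[OF f] _ _ x])
   have "right_deriv_word xs (circle_average (\<alpha> + of_int m) f) (mat 1) = 0" if xs: "set xs <= \<gg>\<^sub>C" for xs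
   proof -
    have "right_deriv_word xs f (rot t ** mat 1) = 0" for t
    proof -
     have xs': "set (map (AdC (rot t)) xs) <= \<gg>\<^sub>C" unfolding set_map using xs by (intro image_subsetI AdC_mem[OF rot_mem(2)]) blast
     have "right_deriv_word xs f (mat 1 ** rot t) = matrix_inv (\<tau> (rot t)) *v right_deriv_word (map (AdC (rot t)) xs) f (mat 1)"
      by (rule right_deriv_word_right_translate[OF fS rot_mem(2) hol_functionsD(3)[OF f _ rot_mem(1)] xs one_mem])
     then show ?thesis using flat xs' by (simp add: flat_at_one_def)
    qed
    then show ?thesis unfolding circle_average_simps(3)[OF fS xs] average_def by simp
   qed
   then show "flat_at_one (circle_average (\<alpha> + of_int m) f)" using circle_average_simps(1)[OF fS] by (simp add: flat_at_one_def)
   show "circle_average (\<alpha> + of_int m) f (rot s ** x) = cis (- (\<alpha> + of_int m) * s) *s circle_average (\<alpha> + of_int m) f x"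
    if "\<bar>s\<bar> < 1" "x : G" for s x
    by (rule circle_average_rotation[OF f \<alpha> \<tau> that(2)]) (use that(1) in simp)
  qed
  define v where "v t = cis (\<alpha> * (t - pi)) *s f (rot (t - pi) ** x)" for t
  have "v pi = 0" proof (rule fourier_coefficients_zero)
   have "continuous_on UNIV (%t. (%t. cis (\<alpha> * t) *s f (rot t ** x)) (t - pi))"
    by (rule continuous_on_compose2[OF circle_average_simps(4)[OF contf x(1), of UNIV \<alpha>]]) (auto intro!: continuous_intros)
   then show "continuous_on UNIV v" by (simp add: v_def[abs_def])
   fix m :: int
   let ?u = "%t. cis ((\<alpha> + of_int m) * t) *s f (rot t ** x)"
   have cont: "continuous_on S ?u" for S by (rule circle_average_simps(4)[OF contf x(1)])
   have shift: "integral {0..2 * pi} (%t. ?u (t + (- pi))) = integral {0..2 * pi} ?u"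
    by (rule periodic_integral_shift[OF cont twisted_periodic[OF f \<alpha> \<tau> x(1)]]) (use pi_less_4 in auto)
   have "(%t. cis (of_int m * t) *s v t) = (%v. cis (of_int m * pi) *s v) \<circ> (%t. ?u (t + (- pi)))" proof (rule ext)
    fix t
    have "cis (of_int m * t) * cis (\<alpha> * (t - pi)) = cis (of_int m * pi) * cis ((\<alpha> + of_int m) * (t + - pi))" by (simp add: cis_mult algebra_simps)
    then have e: "(cis (of_int m * t) * cis (\<alpha> * (t - pi))) *s w = (cis (of_int m * pi) * cis ((\<alpha> + of_int m) * (t + - pi))) *s w"
     for w :: "complex^'w" by simp
    show "cis (of_int m * t) *s v t = ((%v. cis (of_int m * pi) *s v) \<circ> (%t. ?u (t + (- pi)))) t" using e[of "f (rot (t - pi) ** x)"] by (simp add: v_def)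
   qed
   have "(%t. ?u (t + (- pi))) integrable_on {0..2 * pi}"
    by (rule integrable_continuous_real, rule continuous_on_compose2[OF cont[of UNIV]]) (auto intro!: continuous_intros)
   then have "integral {0..2 * pi} (%t. cis (of_int m * t) *s v t) = cis (of_int m * pi) *s integral {0..2 * pi} (%t. ?u (t + (- pi)))"
    unfolding \<open>(%t. cis (of_int m * t) *s v t) = _\<close> by (rule integral_linear[OF _ bounded_linear_vector_smult])
   also have "\<dots> = 0" unfolding shift using avg0[of m] by (simp add: average_def)
   finally show "integral {0..2 * pi} (%t. cis (of_int m * t) *s v t) = 0" .
  qed
  then show "f x = 0" by (simp add: v_def)
 qed
 note fS = hol_functionsD(1)[OF f]
 define A where "A = {a : G. \<forall>xs. set xs <= \<gg>\<^sub>C --> right_deriv_word xs f a = 0}"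
 have "A = G" proof (rule connected_group_induct[OF conn _ _ eps])
  show "A <= G" by (auto simp: A_def)
  show "mat 1 : A" using flat by (auto simp: A_def flat_at_one_def)
  fix a u assume a: "a : A" and u: "u : G" "norm (u - mat 1) < eps"
  have aG: "a : G" using a by (simp add: A_def)
  define h where "h x = f (a ** x)" for x
  have hS: "h : smooth_functions G" unfolding h_def by (rule left_translate_mem[OF fS aG])
  have hw: "right_deriv_word xs h x = right_deriv_word xs f (a ** x)" for xs x
   unfolding h_def right_deriv_word_left_translate ..
  have hol: "h : hol_functions \<tau>" proof -
   have "h (x ** k) = matrix_inv (\<tau> k) *v h x" if "x : G" "k : K" for x k
    using hol_functionsD(3)[OF f mult_mem[OF aG that(1)] that(2)] by (simp add: h_def matrix_mul_assoc)
   moreover have "right_derivC y h x = 0" if "y : p_minus \<pp> J" "x : G" for y x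
    using hw[of "[y]" x] hol_functionsD(4)[OF f that(1) mult_mem[OF aG that(2)]] by simp
   ultimately show ?thesis using hS by (simp add: hol_functions_def)
  qed
  have "flat_at_one h" using a hS by (simp add: flat_at_one_def hw A_def)
  then have h0: "h x = 0" if "x : G" "x : ball (mat 1) eps" for x
   using local[OF hol _ that(1)] that(2) by (simp add: dist_norm norm_minus_commute)
  have "right_deriv_word xs h u = 0" if xs: "set xs <= \<gg>\<^sub>C" for xs
   by (rule right_deriv_word_local[OF hS open_ball h0 xs u(1)]) (use u(2) in \<open>auto simp: dist_norm norm_minus_commute\<close>)
  then show "a ** u : A" using aG u(1) by (auto simp: A_def hw)
 qed
 then have "f g = 0" if "g : G" using that by (auto simp: A_def dest!: spec[of _ "[]"])
 then show ?thesis using smooth_functionsD(2)[OF fS] by blast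
qed

end

section \<open>Homogeneous components and jets\<close>

lemma integral_cis_zero:
 fixes k :: int
 assumes "k ~= 0"
 shows "integral {0..2 * pi} (%t. cis (of_int k * t)) = 0" proof -
 let ?u = "%t :: real. cis (of_int k * t)"
 have cont: "continuous_on UNIV ?u" by (intro continuous_intros)
 have per: "?u (t + 2 * pi) = ?u t" for t
 proof -
  have "?u (t + 2 * pi) = ?u t * cis (2 * pi * of_int k)" by (simp add: cis_mult algebra_simps)
  also have "cis (2 * pi * of_int k) = 1" by (rule cis_multiple_2pi) simp
  finally show ?thesis by simp
 qed
 have small: "\<bar>pi / of_int k\<bar> <= 4" proof -
  have "1 <= \<bar>real_of_int k\<bar>" using assms by linarith
  then have "\<bar>pi / of_int k\<bar> <= pi / 1" unfolding abs_divide by (intro frac_le) auto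
  then show ?thesis using pi_less_4 by simp
 qed
 have "integral {0..2 * pi} (%t. ?u (t + pi / of_int k)) = integral {0..2 * pi} ?u" by (rule periodic_integral_shift[OF cont per _ small]) simp
 moreover have "(%t. ?u (t + pi / of_int k)) = (%t. - ?u t)" proof (rule ext)
  fix t :: real
  have e: "of_int k * (t + pi / of_int k) = of_int k * t + pi" using assms by (simp add: field_simps)
  have "?u (t + pi / of_int k) = ?u t * cis pi" unfolding e cis_mult ..
  then show "?u (t + pi / of_int k) = - ?u t" by simp
 qed
 ultimately show ?thesis by simp
qed

context hermitian_group
begin

lemma AdC_rot:
 assumes x: "x : p_plus \<pp> J"
 shows "AdC (rot t) x = cos t *\<^sub>R x + sin t *\<^sub>R scaleI x" proof -
 have X: "fst x : \<pp>" "snd x = - J (fst x)" using p_plusD[OF x] by auto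
 have "snd x : \<pp>" using X by (simp add: J_mem subspace_neg[OF subspace_p])
 then show ?thesis
  using X by (simp add: AdC_def Ad_rot_p prod_eq_iff scaleI_def J_mem J_minus J_J)
qed

lemma p_plus_gC: "p_plus \<pp> J <= \<gg>\<^sub>C" using p_mem by (auto simp: p_plus_def)

lemma right_deriv_word_rot:
 assumes f: "f : smooth_functions G"
 shows "set xs <= p_plus \<pp> J ==>
  right_deriv_word (map (AdC (rot t)) xs) f = (%g. cis (of_nat (length xs) * t) *s right_deriv_word xs f g)" proof (induction xs)
 case (Cons x xs)
 let ?c = "cis (of_nat (length xs) * t)" and ?h = "right_deriv_word xs f"
 have x: "x : p_plus \<pp> J" "x : \<gg>\<^sub>C" and xs: "set xs <= \<gg>\<^sub>C" using Cons.prems p_plus_gC by auto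
 have hS: "?h : smooth_functions G" by (rule right_deriv_word_mem[OF f xs])
 have sx: "scaleI x : \<gg>\<^sub>C" using x(2) by (auto simp: mem_Times_iff scaleI_def subspace_neg[OF subspace_lie_algebra])
 have s: "c *\<^sub>R z : \<gg>\<^sub>C" if "z : \<gg>\<^sub>C" for c z using that by (auto simp: mem_Times_iff lie_algebra_scaleR)
 have Ax: "AdC (rot t) x : \<gg>\<^sub>C" by (rule AdC_mem[OF rot_mem(2) x(2)])
 have "right_derivC (AdC (rot t) x) (%g. ?c *s ?h g) = (%g. ?c *s right_derivC (AdC (rot t) x) ?h g)"
  by (rule right_derivC_linear[OF hS Ax bounded_linear_vector_smult]) (simp add: mult.commute)
 moreover have "right_derivC (AdC (rot t) x) ?h = (%g. cis t *s right_derivC x ?h g)"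
  unfolding AdC_rot[OF x(1)] right_derivC_add[OF hS s[OF x(2)] s[OF sx]] right_derivC_scaleR[OF hS x(2)]
   right_derivC_scaleR[OF hS sx] right_derivC_scaleI[OF hS x(2)] by (rule ext) (simp add: vec_eq_iff complex_eq_iff algebra_simps)
 ultimately show ?case
  using Cons by (simp add: cis_mult algebra_simps)
qed simp

lemma isotropy_derivative:
 assumes \<tau>: "unitary_rep K \<tau>" and Y: "Y : \<kk>"
 obtains B where "!!f g. f : hol_functions \<tau> ==> right_deriv Y f g = B *v f g" proof -
 have eK: "mexp (t *\<^sub>R Y) : K" for t by (rule exp_k_mem[OF Y])
 have "continuous_on UNIV (%t. \<tau> (mexp (t *\<^sub>R Y)))"
  by (rule continuous_on_compose2[of K \<tau>]) (use \<tau> eK in \<open>auto simp: unitary_rep_def intro!: continuous_intros\<close>)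
 then obtain B where B: "!!t. \<tau> (mexp (t *\<^sub>R Y)) = mexp (t *\<^sub>R B)"
  using \<tau> eK by (rule_tac continuous_one_parameter_group[of "%t. \<tau> (mexp (t *\<^sub>R Y))"])
   (auto simp: unitary_rep_def matrix_exp_scaleR_add)
 have "right_deriv Y f g = (- B) *v f g" if f: "f : hol_functions \<tau>" for f g
 proof (cases "g : G")
  case True
  have "f (g ** mexp (t *\<^sub>R Y)) = mexp (t *\<^sub>R (- B)) *v f g" for t
   using hol_functionsD(3)[OF f True eK] by (simp add: B)
  moreover have "((%t. mexp (t *\<^sub>R (- B)) *v f g) has_vector_derivative (- B) *v f g) (at 0)"
   by (rule bounded_linear.has_vector_derivative[OF bounded_bilinear.bounded_linear_left[OF bounded_bilinear_matrix_vector_mult] matrix_exp_derivative_at_0])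
  ultimately show ?thesis by (intro right_deriv_eqI) simp
 next
  case False
  then show ?thesis
   using smooth_functionsD(2)[OF right_deriv_mem[OF hol_functionsD(1)[OF f] k_mem[OF Y]] False]
    smooth_functionsD(2)[OF hol_functionsD(1)[OF f] False] by simp
 qed
 then show ?thesis by (rule that)
qed

lemma bracketC_mem: "x : \<gg>\<^sub>C ==> y : \<gg>\<^sub>C ==> bracketC x y : \<gg>\<^sub>C"
 by (auto simp: bracketC_def mem_Times_iff intro!: subspace_add[OF subspace_lie_algebra]
   subspace_diff[OF subspace_lie_algebra] lie_algebra_bracket)

lemma triangular_decomposition:
 assumes x: "x : \<gg>\<^sub>C"
 obtains a b c where "x = a + b + c" "a : \<kk> \<times> \<kk>" "b : p_plus \<pp> J" "c : p_minus \<pp> J" proof -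
 obtain X Y where xy: "x = (X, Y)" "X : \<gg>" "Y : \<gg>" using x by auto
 define P where "P = p_part X"
 define Q where "Q = p_part Y"
 have PQ: "P : \<pp>" "Q : \<pp>" using parts xy by (auto simp: P_def Q_def)
 define U where "U = (1/2) *\<^sub>R (P + J Q)"
 define V where "V = (1/2) *\<^sub>R (P - J Q)"
 have UV: "U : \<pp>" "V : \<pp>" unfolding U_def V_def
  using PQ by (auto intro!: subspace_scale[OF subspace_p] subspace_add[OF subspace_p] subspace_diff[OF subspace_p] J_mem)
 have JU: "J U = (1/2) *\<^sub>R (J P - Q)" unfolding U_def using PQ by (simp add: J_scaleR J_add J_mem J_J subspace_add[OF subspace_p])
 have JV: "J V = (1/2) *\<^sub>R (J P + Q)" proof -
  have "J V = (1/2) *\<^sub>R J (P + - J Q)" unfolding V_def using PQ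
   by (simp add: J_scaleR J_mem subspace_diff[OF subspace_p])
  also have "J (P + - J Q) = J P + Q" using PQ by (simp only: J_add J_mem J_minus J_J subspace_neg[OF subspace_p] minus_minus)
  finally show ?thesis .
 qed
 show ?thesis
 proof (rule that[of "(k_part X, k_part Y)" "(U, - J U)" "(V, J V)"])
  have s1: "U + V = P" unfolding U_def V_def by (simp flip: scaleR_add_right scaleR_2)
  have s2: "- J U + J V = Q" unfolding JU JV by (simp add: algebra_simps flip: scaleR_add_left)
  show "x = (k_part X, k_part Y) + (U, - J U) + (V, J V)" unfolding xy(1) add_Pair prod.inject add.assoc s1 s2 P_def Q_def parts(3)[OF xy(2)] parts(3)[OF xy(3)] by blast
 qed (use UV parts(1)[OF xy(2)] parts(1)[OF xy(3)] p_plus_mem p_minus_mem in auto)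
qed

text \<open>Every word in the complexified Lie algebra is, up to shorter words, a sum of words whose
 letters come from the three summands. A letter outside \<open>\<pp>\<^sup>+\<close> can be moved to the right end, where
 the section absorbs it. Hence the jet of a section is determined by its \<open>\<pp>\<^sup>+\<close>-derivatives.\<close>

lemma flat_if_p_plus_flat:
 assumes \<tau>: "unitary_rep K \<tau>" and f: "f : hol_functions \<tau>"
  and jets: "!!xs. set xs <= p_plus \<pp> J ==> right_deriv_word xs f (mat 1) = 0"
 shows "flat_at_one f" proof -
 note fS = hol_functionsD(1)[OF f]
 have main: "length xs = n ==> set xs <= \<gg>\<^sub>C ==> right_deriv_word xs f (mat 1) = 0" for xs n
 proof (induction n arbitrary: xs rule: less_induct)
  case (less n)
  have short: "right_deriv_word ys f (mat 1) = 0" if "length ys < n" "set ys <= \<gg>\<^sub>C" for ys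
   using less.IH[OF that(1) refl that(2)] .
  have move: "right_deriv_word (us @ y # vs) f (mat 1) = right_deriv_word (us @ vs @ [y]) f (mat 1)"
   if "set (us @ y # vs) <= \<gg>\<^sub>C" "length (us @ y # vs) = n" for us y vs
   using that
  proof (induction vs arbitrary: us)
   case (Cons v vs)
   have mem: "set us <= \<gg>\<^sub>C" "y : \<gg>\<^sub>C" "v : \<gg>\<^sub>C" "set vs <= \<gg>\<^sub>C" using Cons.prems(1) by auto
   let ?h = "right_deriv_word vs f"
   have hS: "?h : smooth_functions G" by (rule right_deriv_word_mem[OF fS mem(4)])
   note d = right_derivC_mem[OF right_derivC_mem[OF hS mem(2)] mem(3)] right_derivC_mem[OF hS bracketC_mem[OF mem(2,3)]]
   have "right_derivC y (right_derivC v ?h) = (%g. right_derivC v (right_derivC y ?h) g + right_derivC (bracketC y v) ?h g)"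
    by (rule smooth_functions_eqI[OF right_derivC_mem[OF right_derivC_mem[OF hS mem(3)] mem(2)] add_mem[OF d]])
     (rule right_derivC_commutator[OF hS mem(2,3)])
   then have "right_deriv_word (us @ y # v # vs) f (mat 1) =
     right_deriv_word us (%g. right_derivC v (right_derivC y ?h) g + right_derivC (bracketC y v) ?h g) (mat 1)" by (simp add: right_deriv_word_append)
   also have "\<dots> = right_deriv_word (us @ v # y # vs) f (mat 1) + right_deriv_word (us @ bracketC y v # vs) f (mat 1)"
    unfolding right_deriv_word_fun_add[OF d mem(1)] by (simp add: right_deriv_word_append)
   also have "right_deriv_word (us @ bracketC y v # vs) f (mat 1) = 0" using Cons.prems(2) mem bracketC_mem[OF mem(2,3)] by (intro short) auto
   also have "right_deriv_word (us @ v # y # vs) f (mat 1) = right_deriv_word ((us @ [v]) @ y # vs) f (mat 1)" by simp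
   also have "\<dots> = right_deriv_word ((us @ [v]) @ vs @ [y]) f (mat 1)" using Cons.prems by (intro Cons.IH) auto
   finally show ?case by simp
  qed simp
  have last_k: "right_deriv_word (xs @ [y]) f (mat 1) = 0"
   if xs: "set xs <= \<gg>\<^sub>C" "length (xs @ [y]) = n" and y: "y : \<kk> \<times> \<kk>" for xs y
  proof -
   have y12: "fst y : \<kk>" "snd y : \<kk>" using y by auto
   obtain B1 where B1: "!!f g. f : hol_functions \<tau> ==> right_deriv (fst y) f g = B1 *v f g" by (rule isotropy_derivative[OF \<tau> y12(1)]) (rule that)
   obtain B2 where B2: "!!f g. f : hol_functions \<tau> ==> right_deriv (snd y) f g = B2 *v f g" by (rule isotropy_derivative[OF \<tau> y12(2)]) (rule that)
   let ?T = "%v. B1 *v v + \<i> *s (B2 *v v)"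
   have T: "bounded_linear ?T" by (intro bounded_linear_add bounded_linear_matrix_vector_mult
      bounded_linear_compose[OF bounded_linear_vector_smult bounded_linear_matrix_vector_mult])
   have Ti: "?T (\<i> *s v) = \<i> *s ?T v" for v by (simp add: vector_smult_matrix_vector vector_add_ldistrib)
   have "right_derivC y f = (%g. ?T (f g))" using B1[OF f] B2[OF f] by (simp add: right_derivC_def fun_eq_iff)
   then have "right_deriv_word (xs @ [y]) f (mat 1) = ?T (right_deriv_word xs f (mat 1))" by (simp add: right_deriv_word_append right_deriv_word_linear[OF fS T Ti xs(1)])
   also have "right_deriv_word xs f (mat 1) = 0" using xs by (intro short) auto
   finally show ?thesis by simp
  qed
  have last_minus: "right_deriv_word (xs @ [y]) f (mat 1) = 0"
   if xs: "set xs <= \<gg>\<^sub>C" and y: "y : p_minus \<pp> J" for xs y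
  proof -
   have "right_derivC y f g = 0" for g
    using hol_functionsD(4)[OF f y, of g] smooth_functionsD(2)[OF right_derivC_mem[OF fS p_minus_gC[OF y]], of g] by blast
   then have "right_derivC y f = (%g. 0)" by (rule ext)
   then show ?thesis by (simp add: right_deriv_word_append right_deriv_word_zero[OF xs])
  qed
  let ?pure = "\<kk> \<times> \<kk> \<union> p_plus \<pp> J \<union> p_minus \<pp> J"
  have pure_gC: "?pure <= \<gg>\<^sub>C" using k_mem p_plus_gC p_minus_gC by auto
  have pure: "right_deriv_word vs f (mat 1) = 0" if vs: "set vs <= ?pure" "length vs = n" for vs
  proof (cases "set vs <= p_plus \<pp> J")
   case True
   then show ?thesis by (rule jets)
  next
   case False
   then obtain y where y: "y : set vs" "y \<notin> p_plus \<pp> J" by auto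
   obtain as bs where ab: "vs = as @ y # bs" using split_list[OF y(1)] by blast
   have g: "set vs <= \<gg>\<^sub>C" using vs(1) pure_gC by blast
   have e: "right_deriv_word vs f (mat 1) = right_deriv_word ((as @ bs) @ [y]) f (mat 1)" using move[of as y bs] g vs(2) by (simp add: ab)
   have g': "set (as @ bs) <= \<gg>\<^sub>C" "length ((as @ bs) @ [y]) = n" using g vs(2) by (auto simp: ab)
   have "y : \<kk> \<times> \<kk> \<or> y : p_minus \<pp> J" using y vs(1) by blast
   then show ?thesis unfolding e using last_k[OF g'] last_minus[OF g'(1)] by blast
  qed
  have mixed: "right_deriv_word (us @ vs) f (mat 1) = 0"
   if "set us <= \<gg>\<^sub>C" "set vs <= ?pure" "length (us @ vs) = n" for us vs
   using that
  proof (induction us arbitrary: vs rule: rev_induct)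
   case Nil
   then show ?case using pure[of vs] by simp
  next
   case (snoc x us)
   have x: "x : \<gg>\<^sub>C" and us: "set us <= \<gg>\<^sub>C" using snoc.prems(1) by auto
   have vs: "set vs <= \<gg>\<^sub>C" by (rule subset_trans[OF snoc.prems(2) pure_gC])
   obtain a b c where abc: "x = a + b + c" "a : \<kk> \<times> \<kk>" "b : p_plus \<pp> J" "c : p_minus \<pp> J" by (rule triangular_decomposition[OF x]) (rule that)
   have m: "a : \<gg>\<^sub>C" "b : \<gg>\<^sub>C" "c : \<gg>\<^sub>C" using abc pure_gC by auto
   have m': "a + b : \<gg>\<^sub>C" using m by (auto simp: mem_Times_iff subspace_add[OF subspace_lie_algebra])
   let ?h = "right_deriv_word vs f"
   have hS: "?h : smooth_functions G" by (rule right_deriv_word_mem[OF fS vs])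
   have eq: "right_derivC x ?h = (%g. (%g. right_derivC a ?h g + right_derivC b ?h g) g + right_derivC c ?h g)"
    unfolding abc(1) right_derivC_add[OF hS m' m(3)] right_derivC_add[OF hS m(1,2)] ..
   have "right_deriv_word ((us @ [x]) @ vs) f (mat 1) = right_deriv_word us (right_derivC x ?h) (mat 1)" by (simp add: right_deriv_word_append)
   also have "\<dots> = right_deriv_word (us @ a # vs) f (mat 1) + right_deriv_word (us @ b # vs) f (mat 1) + right_deriv_word (us @ c # vs) f (mat 1)"
    unfolding eq right_deriv_word_fun_add[OF add_mem[OF right_derivC_mem[OF hS m(1)] right_derivC_mem[OF hS m(2)]] right_derivC_mem[OF hS m(3)] us]
     right_deriv_word_fun_add[OF right_derivC_mem[OF hS m(1)] right_derivC_mem[OF hS m(2)] us] by (simp add: right_deriv_word_append)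
   also have "right_deriv_word (us @ a # vs) f (mat 1) = 0" using snoc.prems us abc(2) by (intro snoc.IH) auto
   also have "right_deriv_word (us @ b # vs) f (mat 1) = 0" using snoc.prems us abc(3) by (intro snoc.IH) auto
   also have "right_deriv_word (us @ c # vs) f (mat 1) = 0" using snoc.prems us abc(4) by (intro snoc.IH) auto
   finally show ?case by simp
  qed
  show ?case using mixed[of xs "[]"] less.prems by simp
 qed
 then show ?thesis using fS by (auto simp: flat_at_one_def)
qed

lemma matrix_inv_scalar:
 assumes \<tau>: "unitary_rep K \<tau>" and scalar: "!!t v. \<tau> (rot t) *v v = cis (\<alpha> * t) *s v"
 shows "matrix_inv (\<tau> (rot t)) *v v = cis (- \<alpha> * t) *s v" proof -
 have hom: "!!k l. k : K ==> l : K ==> \<tau> (k ** l) = \<tau> k ** \<tau> l" "\<tau> (mat 1) = mat 1" using \<tau> by (auto simp: unitary_rep_def)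
 have "matrix_inv (\<tau> (rot s)) = \<tau> (rot (- s))" for s
  using hom(1)[OF rot_mem(1) rot_mem(1), of s "- s"] hom(1)[OF rot_mem(1) rot_mem(1), of "- s" s] hom(2) by (intro matrix_inv_eqI) (simp_all add: rot_add[symmetric])
 then have "matrix_inv (\<tau> (rot t)) *v v = \<tau> (rot (- t)) *v v" by (rule arg_cong)
 then show ?thesis unfolding scalar[of "- t"] by simp
qed

text \<open>Averaging against the character of weight \<open>\<alpha> + m\<close> keeps from the jet of a section the
 derivatives of degree \<open>- m\<close> only.\<close>

lemma circle_average_vanishes:
 fixes m :: int and \<tau> :: "'n cmat => complex^'w^'w"
 assumes \<tau>: "unitary_rep K \<tau>" and irr: "irreducible_rep K \<tau>" and f: "f : hol_functions \<tau>"
  and scalar: "!!t v. \<tau> (rot t) *v v = cis (\<alpha> * t) *s v"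
  and jets: "!!xs. set xs <= p_plus \<pp> J ==> int (length xs) = - m ==> right_deriv_word xs f (mat 1) = 0"
 shows "circle_average (\<alpha> + of_int m) f g = 0"
proof (rule unique_continuation[OF \<tau> irr circle_average_hol[OF f]], rule flat_if_p_plus_flat[OF \<tau> circle_average_hol[OF f]])
 note fS = hol_functionsD(1)[OF f]
 fix xs assume xs: "set xs <= p_plus \<pp> J"
 have xs': "set xs <= \<gg>\<^sub>C" using xs p_plus_gC by blast
 let ?d = "right_deriv_word xs f (mat 1)"
 have w: "right_deriv_word xs f (rot t ** mat 1) = cis ((of_nat (length xs) - \<alpha>) * t) *s ?d" for t
 proof -
  have "right_deriv_word xs f (mat 1 ** rot t) = matrix_inv (\<tau> (rot t)) *v right_deriv_word (map (AdC (rot t)) xs) f (mat 1)"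
   by (rule right_deriv_word_right_translate[OF fS rot_mem(2) hol_functionsD(3)[OF f _ rot_mem(1)] xs' one_mem])
  then show ?thesis
   by (simp add: right_deriv_word_rot[OF fS xs] matrix_inv_scalar[OF \<tau> scalar] cis_mult algebra_simps)
 qed
 have "right_deriv_word xs (circle_average (\<alpha> + of_int m) f) (mat 1) =
   integral {0..2 * pi} (%t. cis ((\<alpha> + of_int m) * t) *s (cis ((of_nat (length xs) - \<alpha>) * t) *s ?d))"
  unfolding circle_average_simps(3)[OF fS xs'] average_def w ..
 also have "(%t. cis ((\<alpha> + of_int m) * t) *s (cis ((of_nat (length xs) - \<alpha>) * t) *s ?d)) =
   (%c. c *s ?d) \<circ> (%t. cis (of_int (m + int (length xs)) * t))" by (rule ext) (simp add: cis_mult algebra_simps)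
 also have "integral {0..2 * pi} \<dots> = integral {0..2 * pi} (%t. cis (of_int (m + int (length xs)) * t)) *s ?d"
  by (rule integral_linear[OF integrable_continuous_real bounded_bilinear.bounded_linear_left[OF bounded_bilinear_vector_smult]])
   (intro continuous_intros)
 also have "\<dots> = 0" using jets[OF xs] integral_cis_zero[of "m + int (length xs)"] by (cases "m + int (length xs) = 0") auto
 finally show "right_deriv_word xs (circle_average (\<alpha> + of_int m) f) (mat 1) = 0" .
qed

end

section \<open>Averages of square integrable functions\<close>

lemma riemann_sums:
 fixes u :: "real => 'a::euclidean_space"
 assumes u: "continuous_on UNIV u" and p: "p > 0"
 shows "(%N. (1 / real N) *\<^sub>R (\<Sum>j<N. u (real j * p / real N))) \<longlonglongrightarrow> (1 / p) *\<^sub>R integral {0..p} u" proof (rule LIMSEQ_I)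
 fix r :: real assume r: "r > 0"
 have cont: "continuous_on A u" for A by (rule continuous_on_subset[OF u]) simp
 have int: "u integrable_on {s..t}" for s t by (rule integrable_continuous_real[OF cont])
 have "uniformly_continuous_on {0..p} u" by (intro compact_uniformly_continuous cont) simp
 from this[unfolded uniformly_continuous_on_def, rule_format, of "r / 2"] r
 obtain d where d: "d > 0" "!!s t. s : {0..p} ==> t : {0..p} ==> dist t s < d ==> dist (u t) (u s) < r / 2" by (metis half_gt_zero)
 obtain N0 :: nat where N0: "p / d < real N0" using reals_Archimedean2 by blast
 show "\<exists>N0. \<forall>N\<ge>N0. norm ((1 / real N) *\<^sub>R (\<Sum>j<N. u (real j * p / real N)) - (1 / p) *\<^sub>R integral {0..p} u) < r"
 proof (intro exI[of _ N0] allI impI)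
  fix N assume N: "N0 <= N"
  have pd: "0 < p / d" using p d(1) by simp
  have Npd: "p / d < real N" using N0 N by linarith
  have Npos: "real N > 0" using pd Npd by linarith
  define h where "h = p / real N"
  have h: "h > 0" "h < d" "real N * h = p" using Npos p d(1) Npd by (auto simp: h_def field_simps)
  have est: "norm (integral {0..real M * h} u - h *\<^sub>R (\<Sum>j<M. u (real j * h))) <= real M * (h * (r / 2))" if "M <= N" for M
   using that
  proof (induction M)
   case (Suc M)
   let ?s = "real M * h" and ?t = "real (Suc M) * h"
   have tp: "?t <= p" using mult_right_mono[of "real (Suc M)" "real N" h] Suc.prems h by simp
   have s0: "0 <= ?s" using h by simp
   have ts: "?t = ?s + h" by (simp add: algebra_simps)
   have split: "integral {0..?t} u = integral {0..?s} u + integral {?s..?t} u"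
    by (rule Henstock_Kurzweil_Integration.integral_combine[symmetric]) (use s0 h int ts in auto)
   have "integral {?s..?t} u - h *\<^sub>R u ?s = integral {?s..?t} (%x. u x - u ?s)"
    using Henstock_Kurzweil_Integration.integral_diff[OF int[of ?s ?t] integrable_continuous_real[OF continuous_on_const[of _ "u ?s"]]]
     ts h by simp
   moreover have "norm (integral {?s..?t} (%x. u x - u ?s)) <= (r / 2) * (?t - ?s)" proof (rule integral_bound)
    show "?s <= ?t" using ts h by simp
    show "continuous_on {?s..?t} (%x. u x - u ?s)" by (intro continuous_intros cont)
    fix x assume x: "x : {?s..?t}"
    have "dist (u x) (u ?s) < r / 2" proof (rule d(2))
     have "?s <= p" using ts tp h(1) by linarith
     then show "?s : {0..p}" using s0 by auto
     have "0 <= x" by (rule order_trans[OF s0]) (use x in auto)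
     moreover have "x <= p" by (rule order_trans[OF _ tp]) (use x in auto)
     ultimately show "x : {0..p}" by simp
     show "dist x ?s < d" using x ts h(2) by (auto simp: dist_real_def)
    qed
    then show "norm (u x - u ?s) <= r / 2" by (simp add: dist_norm)
   qed
   ultimately have b: "norm (integral {?s..?t} u - h *\<^sub>R u ?s) <= h * (r / 2)" using ts by (simp add: mult.commute)
   have "integral {0..?t} u - h *\<^sub>R (\<Sum>j<Suc M. u (real j * h)) =
     (integral {0..?s} u - h *\<^sub>R (\<Sum>j<M. u (real j * h))) + (integral {?s..?t} u - h *\<^sub>R u ?s)" unfolding split by (simp add: algebra_simps)
   then have "norm (integral {0..?t} u - h *\<^sub>R (\<Sum>j<Suc M. u (real j * h))) <= real M * (h * (r / 2)) + h * (r / 2)"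
    using norm_triangle_mono[OF Suc.IH b] Suc.prems by simp
   then show ?case by (simp add: algebra_simps)
  qed simp
  have e: "(1 / real N) *\<^sub>R (\<Sum>j<N. u (real j * p / real N)) = (1 / p) *\<^sub>R (h *\<^sub>R (\<Sum>j<N. u (real j * h)))" using p by (simp add: h_def)
  have "norm ((1 / real N) *\<^sub>R (\<Sum>j<N. u (real j * p / real N)) - (1 / p) *\<^sub>R integral {0..p} u)
    = (1 / p) * norm (integral {0..p} u - h *\<^sub>R (\<Sum>j<N. u (real j * h)))" unfolding e scaleR_diff_right[symmetric] using p by (simp add: norm_minus_commute)
  also have "\<dots> <= (1 / p) * (p * (r / 2))" using est[of N] p by (intro mult_left_mono) (auto simp: h(3)[symmetric] mult.assoc)
  also have "\<dots> < r" using p r by simp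
  finally show "norm ((1 / real N) *\<^sub>R (\<Sum>j<N. u (real j * p / real N)) - (1 / p) *\<^sub>R integral {0..p} u) < r" .
 qed
qed

lemma variance_identity:
 fixes a :: "nat => 'a::real_inner"
 assumes "real N *\<^sub>R m = (\<Sum>j<N. a j)"
 shows "(\<Sum>j<N. (norm (a j - m))\<^sup>2) = (\<Sum>j<N. (norm (a j))\<^sup>2) - real N * (norm m)\<^sup>2" proof -
 have "(norm (a j - m))\<^sup>2 = (norm (a j))\<^sup>2 + (norm m)\<^sup>2 - 2 * (a j \<bullet> m)" for j
  by (simp add: power2_norm_eq_inner inner_diff_left inner_diff_right inner_commute)
 then have "(\<Sum>j<N. (norm (a j - m))\<^sup>2) = (\<Sum>j<N. (norm (a j))\<^sup>2) + real N * (norm m)\<^sup>2 - 2 * ((\<Sum>j<N. a j) \<bullet> m)"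
  by (simp add: sum.distrib sum_subtractf sum_distrib_left inner_sum_left)
 then show ?thesis unfolding assms[symmetric] by (simp add: power2_norm_eq_inner)
qed

lemma periodic_sum_shift:
 fixes v :: "nat => 'a::ab_group_add"
 assumes "!!j. v (j + N) = v j"
 shows "(\<Sum>j<N. v (j + k)) = (\<Sum>j<N. v j)" proof (induction k)
 case (Suc k)
 have "(\<Sum>j<Suc N. v (j + k)) = v (0 + k) + (\<Sum>j<N. v (Suc j + k))" by (rule sum.lessThan_Suc_shift)
 then show ?case using Suc assms[of k] by (simp add: add.commute)
qed simp

text \<open>The averages of a function over \<open>N\<close> equidistant points of a closed one-parameter group, twisted
 by a character. They are orthogonal projections in \<open>L\<^sup>2\<close>.\<close>

definition cyclic_mean :: "real => (real => 'n::finite cmat) => nat => ('n cmat => complex^'w::finite) => 'n cmat => complex^'w" where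
 "cyclic_mean b c N f x =
   (1 / real N) *\<^sub>R (\<Sum>j<N. cis (b * (real j * (2 * pi) / real N)) *s f (c (real j * (2 * pi) / real N) ** x))"

lemma haar_translation:
 fixes H :: "'n::finite cmat set"
 assumes haar: "haar_measure H \<nu>" and sub: "matrix_subgroup H" and a: "a : H"
 shows "space \<nu> = H" "(%x. a ** x) : measurable \<nu> \<nu>" "distr \<nu> \<nu> (%x. a ** x) = \<nu>" proof -
 have sets: "sets \<nu> = sets (restrict_space borel H)" using haar by (simp add: haar_measure_def)
 show sp: "space \<nu> = H" using sets_eq_imp_space_eq[OF sets] by (simp add: space_restrict_space)
 have mul: "a ** x : H" "matrix_inv a ** x : H" "a ** (matrix_inv a ** x) = x" "matrix_inv a ** (a ** x) = x" if "x : H" for x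
  using sub a that by (auto simp: matrix_subgroup_def matrix_mul_assoc matrix_inv_cancel)
 have meas: "(%x. c ** x) : measurable \<nu> \<nu>" if c: "!!x. x : H ==> c ** x : H" for c
 proof -
  have "(%x. c ** x) : borel_measurable (restrict_space borel H)" by (rule borel_measurable_continuous_on_restrict) (intro continuous_intros)
  then have "(%x. c ** x) : measurable (restrict_space borel H) (restrict_space borel H)"
   by (rule measurable_restrict_space2[rotated]) (use c in \<open>auto simp: space_restrict_space\<close>)
  then show ?thesis by (simp only: measurable_cong_sets[OF sets sets])
 qed
 show m: "(%x. a ** x) : measurable \<nu> \<nu>" by (rule meas[OF mul(1)])
 have m': "(%x. matrix_inv a ** x) : measurable \<nu> \<nu>" by (rule meas[OF mul(2)])
 show "distr \<nu> \<nu> (%x. a ** x) = \<nu>" proof (rule measure_eqI)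
  fix A assume "A : sets (distr \<nu> \<nu> (%x. a ** x))"
  then have A: "A : sets \<nu>" by simp
  have AH: "A <= H" using sets.sets_into_space[OF A] sp by simp
  let ?B = "(%x. a ** x) -` A \<inter> space \<nu>"
  have B: "?B : sets \<nu>" by (rule measurable_sets[OF m A])
  have img: "(%x. a ** x) ` ?B = A" proof (intro equalityI subsetI)
   fix y assume y: "y : A"
   then have "y : H" using AH by blast
   then show "y : (%x. a ** x) ` ?B" using mul(2,3)[of y] y sp by (intro image_eqI[of _ _ "matrix_inv a ** y"]) auto
  qed auto
  have "emeasure (distr \<nu> \<nu> (%x. a ** x)) A = emeasure \<nu> ?B" by (rule emeasure_distr[OF m A])
  also have "\<dots> = emeasure \<nu> ((%x. a ** x) ` ?B)" using haar a B by (simp add: haar_measure_def)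
  finally show "emeasure (distr \<nu> \<nu> (%x. a ** x)) A = emeasure \<nu> A" by (simp only: img)
 qed simp
qed

locale circle_action =
 fixes H :: "'n::finite cmat set" and \<nu> :: "'n cmat measure" and c :: "real => 'n cmat" and b :: real
 assumes subgroup: "matrix_subgroup H" and haar: "haar_measure H \<nu>"
  and c_mem: "!!t. c t : H" and c_add: "!!s t. c (s + t) = c s ** c t" and c_zero: "c 0 = mat 1" and c_cont: "continuous_on UNIV c"
begin

lemma space_haar: "space \<nu> = H" by (rule haar_translation(1)[OF haar subgroup c_mem])

lemma continuous_measurable: "continuous_on H g ==> g : borel_measurable \<nu>"
 for g :: "'n cmat => 'b::topological_space" using haar borel_measurable_continuous_on_restrict[of H g] by (simp add: haar_measure_def cong: measurable_cong_sets)

lemma translate_integral: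
 fixes g :: "'n cmat => real"
 assumes g: "continuous_on H g" and a: "a : H"
 shows "integral\<^sup>L \<nu> (%x. g (a ** x)) = integral\<^sup>L \<nu> g" "integrable \<nu> g ==> integrable \<nu> (%x. g (a ** x))"
 using integral_distr[OF haar_translation(2)[OF haar subgroup a] continuous_measurable[OF g]]
  integrable_distr_eq[OF haar_translation(2)[OF haar subgroup a] continuous_measurable[OF g]] unfolding haar_translation(3)[OF haar subgroup a] by auto

lemma mult_H: "a : H ==> x : H ==> a ** x : H" using subgroup by (simp add: matrix_subgroup_def)

lemma translate_continuous:
 fixes g :: "'n cmat => 'b::topological_space"
 assumes "continuous_on H g" "a : H" shows "continuous_on H (%x. g (a ** x))"
 by (rule continuous_on_compose2[OF assms(1)]) (use mult_H[OF assms(2)] in \<open>auto intro!: continuous_intros\<close>)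

abbreviation "mean N f \<equiv> cyclic_mean b c N f"
abbreviation "twist f t x \<equiv> cis (b * t) *s f (c t ** x)"

context
 fixes f :: "'n cmat => complex^'w::finite"
 assumes f: "continuous_on H f" and L2: "integrable \<nu> (%x. (norm (f x))\<^sup>2)"
  and periodic: "!!t x. x : H ==> twist f (t + 2 * pi) x = twist f t x"
begin

lemma norm_cis_smult: "norm (cis s *s v) = norm v" for v :: "complex^'w" by (simp add: norm_vec_def norm_mult)

lemma mean_continuous: "continuous_on H (mean N f)" unfolding cyclic_mean_def by (intro continuous_intros translate_continuous[OF f c_mem])

lemma mean_sum: "N > 0 ==> real N *\<^sub>R mean N f x = (\<Sum>j<N. twist f (real j * (2 * pi) / real N) x)" by (simp add: cyclic_mean_def)

lemma mean_invariant:
 assumes N: "N > 0" and x: "x : H"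
 shows "cis (b * (real k * (2 * pi) / real N)) *s mean N f (c (real k * (2 * pi) / real N) ** x) = mean N f x" proof -
 let ?t = "%j. real j * (2 * pi) / real N"
 have step: "cis (b * ?t k) *s twist f (?t j) (c (?t k) ** x) = twist f (?t (j + k)) x" for j
 proof -
  have e: "?t (j + k) = ?t j + ?t k" by (simp add: add_divide_distrib algebra_simps)
  have e1: "cis (b * ?t k) * cis (b * ?t j) = cis (b * ?t (j + k))" unfolding e by (simp add: cis_mult algebra_simps)
  have e2: "c (?t j) ** (c (?t k) ** x) = c (?t (j + k)) ** x" unfolding e c_add by (rule matrix_mul_assoc)
  show ?thesis by (simp only: vector_smult_assoc e1 e2)
 qed
 have lin: "linear (%v :: complex^'w. z *s v)" for z by (rule bounded_linear.linear[OF bounded_linear_vector_smult])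
 have "cis (b * ?t k) *s mean N f (c (?t k) ** x) = (1 / real N) *\<^sub>R (\<Sum>j<N. cis (b * ?t k) *s twist f (?t j) (c (?t k) ** x))" unfolding cyclic_mean_def
  by (simp only: linear_scale[OF lin] linear_sum[OF lin])
 also have "\<dots> = (1 / real N) *\<^sub>R (\<Sum>j<N. twist f (?t (j + k)) x)" unfolding step ..
 also have "(\<Sum>j<N. twist f (?t (j + k)) x) = (\<Sum>j<N. twist f (?t j) x)" proof (rule periodic_sum_shift)
  fix j
  have "?t (j + N) = ?t j + 2 * pi" using N by (simp add: field_simps)
  then show "twist f (?t (j + N)) x = twist f (?t j) x" using periodic[OF x, of "?t j"] by simp
 qed
 finally show ?thesis by (simp add: cyclic_mean_def)
qed

lemma twist_integrable: "integrable \<nu> (%x. (norm (twist f t x))\<^sup>2)"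
 "integral\<^sup>L \<nu> (%x. (norm (twist f t x))\<^sup>2) = integral\<^sup>L \<nu> (%x. (norm (f x))\<^sup>2)"
 unfolding norm_cis_smult using translate_integral[OF continuous_on_power[OF continuous_on_norm[OF f]] c_mem] L2 by auto

lemma mean_L2: "integrable \<nu> (%x. (norm (mean N f x))\<^sup>2)" proof (cases "N > 0")
 case True
 let ?t = "%j. real j * (2 * pi) / real N"
 show ?thesis
 proof (rule Bochner_Integration.integrable_bound)
  show "integrable \<nu> (%x. (\<Sum>j<N. (norm (twist f (?t j) x))\<^sup>2) / real N)"
   by (intro Bochner_Integration.integrable_divide Bochner_Integration.integrable_sum twist_integrable)
  show "(%x. (norm (mean N f x))\<^sup>2) : borel_measurable \<nu>" by (intro continuous_measurable continuous_intros mean_continuous)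
  have "(norm (mean N f x))\<^sup>2 <= (\<Sum>j<N. (norm (twist f (?t j) x))\<^sup>2) / real N" for x
   using variance_identity[OF mean_sum[OF True, of x]] sum_nonneg[of "{..<N}" "%j. (norm (twist f (?t j) x - mean N f x))\<^sup>2"] True
   by (simp add: field_simps)
  then show "AE x in \<nu>. norm ((norm (mean N f x))\<^sup>2) <= norm ((\<Sum>j<N. (norm (twist f (?t j) x))\<^sup>2) / real N)"
   by (intro always_eventually allI) (simp add: sum_nonneg)
 qed
qed (simp add: cyclic_mean_def)

lemma diff_L2: "integrable \<nu> (%x. (norm (f x - mean N f x))\<^sup>2)" proof (rule Bochner_Integration.integrable_bound)
 show "integrable \<nu> (%x. 2 * (norm (f x))\<^sup>2 + 2 * (norm (mean N f x))\<^sup>2)" using L2 mean_L2[of N] by simp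
 show "(%x. (norm (f x - mean N f x))\<^sup>2) : borel_measurable \<nu>" by (intro continuous_measurable continuous_intros f mean_continuous)
 have "(norm (u - v))\<^sup>2 <= 2 * (norm u)\<^sup>2 + 2 * (norm v)\<^sup>2" for u v :: "complex^'w" proof -
  have "(norm (u - v))\<^sup>2 + (norm (u + v))\<^sup>2 = 2 * (norm u)\<^sup>2 + 2 * (norm v)\<^sup>2"
   by (simp add: power2_norm_eq_inner inner_add_left inner_add_right inner_diff_left inner_diff_right)
  then show ?thesis using zero_le_power2[of "norm (u + v)"] by linarith
 qed
 then show "AE x in \<nu>. norm ((norm (f x - mean N f x))\<^sup>2) <= norm (2 * (norm (f x))\<^sup>2 + 2 * (norm (mean N f x))\<^sup>2)"
  by (intro always_eventually allI) simp
qed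

text \<open>Pythagoras for the projection: by invariance the distance of \<open>f\<close> to its mean is also the distance
 of every translate to the mean, and the average of these is a variance.\<close>

lemma mean_pythagoras:
 assumes N: "N > 0"
 shows "integral\<^sup>L \<nu> (%x. (norm (f x - mean N f x))\<^sup>2) = integral\<^sup>L \<nu> (%x. (norm (f x))\<^sup>2) - integral\<^sup>L \<nu> (%x. (norm (mean N f x))\<^sup>2)"
proof -
 let ?t = "%j. real j * (2 * pi) / real N"
 let ?d = "%x. (norm (f x - mean N f x))\<^sup>2"
 have cd: "continuous_on H ?d" by (intro continuous_intros f mean_continuous)
 have eq: "?d (c (?t j) ** x) = (norm (twist f (?t j) x - mean N f x))\<^sup>2" if x: "x : H" for j x
 proof -
  have "twist f (?t j) x - mean N f x = cis (b * ?t j) *s (f (c (?t j) ** x) - mean N f (c (?t j) ** x))"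
   by (subst mean_invariant[OF N x, of j, symmetric]) (simp add: vec_eq_iff algebra_simps)
  then show ?thesis by (simp only: norm_cis_smult)
 qed
 have one: "integrable \<nu> (%x. (norm (twist f (?t j) x - mean N f x))\<^sup>2)"
  "integral\<^sup>L \<nu> (%x. (norm (twist f (?t j) x - mean N f x))\<^sup>2) = integral\<^sup>L \<nu> ?d" for j
 proof -
  have "integrable \<nu> (%x. ?d (c (?t j) ** x)) = integrable \<nu> (%x. (norm (twist f (?t j) x - mean N f x))\<^sup>2)"
   by (rule Bochner_Integration.integrable_cong[OF refl]) (rule eq, simp add: space_haar)
  moreover have "integral\<^sup>L \<nu> (%x. ?d (c (?t j) ** x)) = integral\<^sup>L \<nu> (%x. (norm (twist f (?t j) x - mean N f x))\<^sup>2)"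
   by (rule Bochner_Integration.integral_cong[OF refl]) (rule eq, simp add: space_haar)
  ultimately show "integrable \<nu> (%x. (norm (twist f (?t j) x - mean N f x))\<^sup>2)"
   "integral\<^sup>L \<nu> (%x. (norm (twist f (?t j) x - mean N f x))\<^sup>2) = integral\<^sup>L \<nu> ?d"
   using translate_integral[OF cd c_mem, of "?t j"] diff_L2[of N] by auto
 qed
 have "real N * integral\<^sup>L \<nu> ?d = (\<Sum>j<N. integral\<^sup>L \<nu> (%x. (norm (twist f (?t j) x - mean N f x))\<^sup>2))" unfolding one(2) by simp
 also have "\<dots> = integral\<^sup>L \<nu> (%x. \<Sum>j<N. (norm (twist f (?t j) x - mean N f x))\<^sup>2)"
  by (rule Bochner_Integration.integral_sum[symmetric]) (rule one(1))
 also have "\<dots> = integral\<^sup>L \<nu> (%x. (\<Sum>j<N. (norm (twist f (?t j) x))\<^sup>2) - real N * (norm (mean N f x))\<^sup>2)"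
  unfolding variance_identity[OF mean_sum[OF N]] ..
 also have "\<dots> = integral\<^sup>L \<nu> (%x. \<Sum>j<N. (norm (twist f (?t j) x))\<^sup>2) - integral\<^sup>L \<nu> (%x. real N * (norm (mean N f x))\<^sup>2)"
  by (intro Bochner_Integration.integral_diff Bochner_Integration.integrable_sum twist_integrable(1)
    Bochner_Integration.integrable_mult_right mean_L2)
 also have "integral\<^sup>L \<nu> (%x. \<Sum>j<N. (norm (twist f (?t j) x))\<^sup>2) = (\<Sum>j<N. integral\<^sup>L \<nu> (%x. (norm (twist f (?t j) x))\<^sup>2))"
  by (rule Bochner_Integration.integral_sum) (rule twist_integrable(1))
 also have "integral\<^sup>L \<nu> (%x. real N * (norm (mean N f x))\<^sup>2) = real N * integral\<^sup>L \<nu> (%x. (norm (mean N f x))\<^sup>2)"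
  by (rule integral_mult_right_zero)
 also have "(\<Sum>j<N. integral\<^sup>L \<nu> (%x. (norm (twist f (?t j) x))\<^sup>2)) - real N * integral\<^sup>L \<nu> (%x. (norm (mean N f x))\<^sup>2)
   = real N * (integral\<^sup>L \<nu> (%x. (norm (f x))\<^sup>2) - integral\<^sup>L \<nu> (%x. (norm (mean N f x))\<^sup>2))"
  unfolding twist_integrable(2) by (simp add: algebra_simps)
 finally show ?thesis using N by simp
qed

text \<open>By Fatou's lemma the norm of \<open>f\<close> is at most the limit inferior of its distances to the means.\<close>

lemma mean_vanishes_in_L2:
 assumes zero: "!!x. x : H ==> integral {0..2 * pi} (%t. twist f t x) = 0"
 shows "(%N. integral\<^sup>L \<nu> (%x. (norm (mean N f x))\<^sup>2)) \<longlonglongrightarrow> 0" proof -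
 let ?A = "integral\<^sup>L \<nu> (%x. (norm (f x))\<^sup>2)" and ?p = "%N. integral\<^sup>L \<nu> (%x. (norm (mean N f x))\<^sup>2)"
 have p0: "0 <= ?p N" for N by simp
 have pA: "?p N <= ?A" if "N > 0" for N
 proof -
  have "0 <= integral\<^sup>L \<nu> (%x. (norm (f x - mean N f x))\<^sup>2)" by simp
  then show ?thesis unfolding mean_pythagoras[OF that] by linarith
 qed
 have point: "(%N. mean N f x) \<longlonglongrightarrow> 0" if x: "x : H" for x
 proof -
  have "continuous_on UNIV (%t. twist f t x)" by (intro continuous_intros continuous_on_compose2[OF f] c_cont) (use mult_H[OF c_mem x] in auto)
  from riemann_sums[OF this, of "2 * pi"] show ?thesis by (simp add: zero[OF x] cyclic_mean_def)
 qed
 have fatou: "ennreal ?A <= liminf (%N. ennreal (integral\<^sup>L \<nu> (%x. (norm (f x - mean N f x))\<^sup>2)))" proof -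
  have m: "(%x. (norm (f x - mean N f x))\<^sup>2) : borel_measurable \<nu>" for N
   by (rule borel_measurable_integrable[OF diff_L2])
  have nn: "(\<integral>\<^sup>+x. ennreal ((norm (f x - mean N f x))\<^sup>2) \<partial>\<nu>) = ennreal (integral\<^sup>L \<nu> (%x. (norm (f x - mean N f x))\<^sup>2))" for N
   by (rule nn_integral_eq_integral[OF diff_L2]) simp
  have "ennreal ?A = (\<integral>\<^sup>+x. ennreal ((norm (f x))\<^sup>2) \<partial>\<nu>)" by (rule nn_integral_eq_integral[OF L2, symmetric]) simp
  also have "\<dots> = (\<integral>\<^sup>+x. liminf (%N. ennreal ((norm (f x - mean N f x))\<^sup>2)) \<partial>\<nu>)" proof (rule nn_integral_cong)
   fix x assume "x : space \<nu>"
   then have x: "x : H" by (simp add: space_haar)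
   have "(%N. ennreal ((norm (f x - mean N f x))\<^sup>2)) \<longlonglongrightarrow> ennreal ((norm (f x - 0))\<^sup>2)"
    by (intro tendsto_ennrealI tendsto_intros point[OF x])
   from lim_imp_Liminf[OF sequentially_bot this]
   show "ennreal ((norm (f x))\<^sup>2) = liminf (%N. ennreal ((norm (f x - mean N f x))\<^sup>2))" by simp
  qed
  also have "\<dots> <= liminf (%N. \<integral>\<^sup>+x. ennreal ((norm (f x - mean N f x))\<^sup>2) \<partial>\<nu>)"
   by (rule nn_integral_liminf) (rule measurable_compose[OF m measurable_ennreal])
  also have "\<dots> = liminf (%N. ennreal (integral\<^sup>L \<nu> (%x. (norm (f x - mean N f x))\<^sup>2)))" unfolding nn ..
  finally show ?thesis .
 qed
 show ?thesis
 proof (rule LIMSEQ_I)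
  fix e :: real assume e: "e > 0"
  have "\<forall>\<^sub>F N in sequentially. ?p N < e" proof (cases "?A < e")
   case True
   show ?thesis using eventually_gt_at_top[of 0] by eventually_elim (rule le_less_trans[OF pA True])
  next
   case False
   then have "ennreal (?A - e) < ennreal ?A" using e by (intro ennreal_lessI) auto
   then have "\<forall>\<^sub>F N in sequentially. ennreal (?A - e) < ennreal (integral\<^sup>L \<nu> (%x. (norm (f x - mean N f x))\<^sup>2))"
    by (rule fatou[unfolded le_Liminf_iff, rule_format])
   then show ?thesis using eventually_gt_at_top[of 0] proof eventually_elim
    case (elim N)
    then have "?A - e < integral\<^sup>L \<nu> (%x. (norm (f x - mean N f x))\<^sup>2)" using False by (simp add: ennreal_less_iff)
    then show ?case unfolding mean_pythagoras[OF elim(2)] by linarith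
   qed
  qed
  then show "\<exists>no. \<forall>N\<ge>no. norm (?p N - 0) < e" using p0 by (simp add: eventually_sequentially)
 qed
qed

text \<open>The means keep the value at the identity and are equicontinuous there.\<close>

lemma mean_vanishes_at_one:
 assumes lim: "(%N. integral\<^sup>L \<nu> (%x. (norm (mean N f x))\<^sup>2)) \<longlonglongrightarrow> 0"
  and eqv: "!!t. twist f t (mat 1) = f (mat 1)"
 shows "f (mat 1) = 0" proof (rule ccontr)
 assume nz: "f (mat 1) ~= 0"
 define e where "e = norm (f (mat 1)) / 2"
 have e: "e > 0" using nz by (simp add: e_def)
 have one: "mat 1 : H" using subgroup by (simp add: matrix_subgroup_def)
 have "continuous_on (H \<times> {0..2 * pi}) (%z. twist f (snd z) (fst z))"
  by (intro continuous_intros continuous_on_compose2[OF f] continuous_on_compose2[OF c_cont]) (use mult_H[OF c_mem] in auto)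
 from continuous_on_prod_compactE[OF this compact_Icc one e]
 obtain U where U: "mat 1 : U" "open U" "\<forall>x\<in>U \<inter> H. \<forall>t\<in>{0..2 * pi}. dist (twist f t x) (twist f t (mat 1)) <= e" by auto
 have low: "e <= norm (mean N f x)" if x: "x : U" "x : H" and N: "N > 0" for x N
 proof -
  let ?t = "%j. real j * (2 * pi) / real N"
  have t: "?t j : {0..2 * pi}" if "j < N" for j
   using that N mult_right_mono[of "real j" "real N" "2 * pi"] by (auto simp: field_simps)
  have d: "norm (twist f (?t j) x - f (mat 1)) <= e" if "j < N" for j
   using U(3)[rule_format, OF IntI[OF x] t[OF that]] unfolding eqv dist_norm .
  have "real N *\<^sub>R (mean N f x - f (mat 1)) = (\<Sum>j<N. twist f (?t j) x - f (mat 1))"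
   unfolding scaleR_diff_right mean_sum[OF N] by (simp add: sum_subtractf scaleR_conv_of_real)
  from arg_cong[OF this, of norm]
  have "real N * norm (mean N f x - f (mat 1)) = norm (\<Sum>j<N. twist f (?t j) x - f (mat 1))" unfolding norm_scaleR abs_of_nat .
  also have "\<dots> <= (\<Sum>j<N. e)" using d by (intro sum_norm_le) auto
  finally have "norm (mean N f x - f (mat 1)) <= e" using N by simp
  then show ?thesis using norm_triangle_sub[of "f (mat 1)" "mean N f x"] by (simp add: e_def norm_minus_commute)
 qed
 let ?U = "U \<inter> H"
 have "openin (top_of_set H) ?U" using U(2) by (auto simp: openin_open)
 then have pos: "emeasure \<nu> ?U > 0" using haar U(1) one by (auto simp: haar_measure_def)
 have Us: "?U : sets \<nu>" using haar U(2) by (auto simp: haar_measure_def sets_restrict_space)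
 have bound: "ennreal (e\<^sup>2) * emeasure \<nu> ?U <= ennreal (integral\<^sup>L \<nu> (%x. (norm (mean N f x))\<^sup>2))" if N: "N > 0" for N
 proof -
  have "ennreal (e\<^sup>2) * emeasure \<nu> ?U = (\<integral>\<^sup>+x. ennreal (e\<^sup>2) * indicator ?U x \<partial>\<nu>)"
   by (rule nn_integral_cmult_indicator[OF Us, symmetric])
  also have "\<dots> <= (\<integral>\<^sup>+x. ennreal ((norm (mean N f x))\<^sup>2) \<partial>\<nu>)" proof (rule nn_integral_mono)
   fix x
   show "ennreal (e\<^sup>2) * indicator ?U x <= ennreal ((norm (mean N f x))\<^sup>2)" proof (cases "x : ?U")
    case True
    then show ?thesis using low[of x N] N e by (auto intro!: ennreal_leI power_mono)
   qed simp
  qed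
  also have "\<dots> = ennreal (integral\<^sup>L \<nu> (%x. (norm (mean N f x))\<^sup>2))" by (rule nn_integral_eq_integral[OF mean_L2]) simp
  finally show ?thesis .
 qed
 have "(%N. ennreal (integral\<^sup>L \<nu> (%x. (norm (mean N f x))\<^sup>2))) \<longlonglongrightarrow> ennreal 0" by (rule tendsto_ennrealI[OF lim])
 then have "ennreal (e\<^sup>2) * emeasure \<nu> ?U <= ennreal 0" by (rule LIMSEQ_le_const) (use bound in \<open>auto intro!: exI[of _ 1]\<close>)
 then show False using pos e by simp
qed

end

end

section \<open>Functionals on a space of sections\<close>

definition hin :: "complex^'w => complex^'w => complex" where
 "hin u v = (\<Sum>a\<in>UNIV. cnj (u $ a) * v $ a)"

lemma hin_inner: "hin u v = complex_of_real (u \<bullet> v) + \<i> * complex_of_real ((\<i> *s u) \<bullet> v)"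
 by (simp add: hin_def inner_vec_def inner_complex_def complex_eq_iff sum.distrib sum_subtractf algebra_simps
   flip: sum_negf)

lemma hin_simps:
 "hin (u + u') v = hin u v + hin u' v" "hin u (v + v') = hin u v + hin u v'"
 "hin (a *s u) v = cnj a * hin u v" "hin u (a *s v) = a * hin u v"
 "hin u 0 = 0" "hin 0 v = 0" by (simp_all add: hin_def sum.distrib sum_distrib_left algebra_simps)

lemma hin_scaleR: "hin (r *\<^sub>R u) v = complex_of_real r * hin u v"
 unfolding hin_def vector_scaleR_component by (simp add: scaleR_conv_of_real sum_distrib_left algebra_simps)

lemma hin_sum_left: "hin (\<Sum>i\<in>F. u i) v = (\<Sum>i\<in>F. hin (u i) v)" by (induction F rule: infinite_finite_induct) (simp_all add: hin_simps)

lemma hin_isometry: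
 fixes A :: "complex^'w^'w"
 assumes "!!v. norm (A *v v) = norm v"
 shows "hin (A *v u) (A *v v) = hin u v" proof -
 have i: "(A *v u) \<bullet> (A *v v) = u \<bullet> v" for u v
 proof -
  have "(norm (A *v u + A *v v))\<^sup>2 = (norm (u + v))\<^sup>2" by (simp add: assms flip: matrix_vector_right_distrib)
  then show ?thesis
   using assms[of u] assms[of v] by (simp add: dot_norm)
 qed
 show ?thesis unfolding hin_inner vector_smult_matrix_vector[symmetric] i
  by (simp add: i flip: vector_smult_matrix_vector)
qed

lemma hin_self: "hin u u = complex_of_real ((norm u)\<^sup>2)" proof -
 have "(\<i> *s u) \<bullet> u = 0" by (simp add: inner_vec_def inner_complex_def)
 then show ?thesis by (simp add: hin_inner power2_norm_eq_inner)
qed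

text \<open>Bessel's inequality for the coordinate vectors bounds the size of an orthonormal family.\<close>

lemma orthonormal_card_le:
 fixes y :: "nat => 'i => complex"
 assumes I: "finite I"
  and orth: "!!j k. j < r ==> k < r ==> (\<Sum>i\<in>I. cnj (y j i) * y k i) = (if j = k then 1 else 0)"
 shows "r <= card I" proof -
 define s where "s i = (\<Sum>j<r. (cmod (y j i))\<^sup>2)" for i
 have s1: "s i <= 1" if i: "i : I" for i
 proof -
  define P where "P i' = (\<Sum>j<r. cnj (y j i) * y j i')" for i'
  let ?\<delta> = "%i'. if i' = i then 1 else 0 :: complex"
  have sc: "complex_of_real (s i) = (\<Sum>j<r. y j i * cnj (y j i))" unfolding s_def of_real_sum complex_norm_square ..
  have Pi: "P i = complex_of_real (s i)" unfolding sc P_def by (simp add: mult.commute)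
  have "(\<Sum>i'\<in>I. cnj (P i') * P i') = (\<Sum>i'\<in>I. \<Sum>j<r. \<Sum>k<r. (y j i * cnj (y k i)) * (cnj (y j i') * y k i'))"
   unfolding P_def cnj_sum sum_product by (intro sum.cong refl) (simp add: mult_ac)
  also have "\<dots> = (\<Sum>j<r. \<Sum>k<r. (y j i * cnj (y k i)) * (\<Sum>i'\<in>I. cnj (y j i') * y k i'))"
   unfolding sum_distrib_left by (subst sum.swap, rule sum.cong[OF refl], rule sum.swap)
  also have "\<dots> = (\<Sum>j<r. \<Sum>k<r. if j = k then y j i * cnj (y k i) else 0)" by (intro sum.cong refl) (simp add: orth)
  also have "\<dots> = (\<Sum>j<r. y j i * cnj (y j i))" by (simp add: sum.delta)
  also have "\<dots> = complex_of_real (s i)" by (rule sc[symmetric])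
  finally have PP: "(\<Sum>i'\<in>I. cnj (P i') * P i') = complex_of_real (s i)" .
  have "complex_of_real (\<Sum>i'\<in>I. (cmod (?\<delta> i' - P i'))\<^sup>2) = (\<Sum>i'\<in>I. cnj (?\<delta> i' - P i') * (?\<delta> i' - P i'))"
   unfolding of_real_sum complex_norm_square by (intro sum.cong refl mult.commute)
  also have "\<dots> = (\<Sum>i'\<in>I. (if i' = i then 1 - P i' - cnj (P i') else 0) + cnj (P i') * P i')" by (intro sum.cong refl) (simp add: algebra_simps)
  also have "\<dots> = 1 - P i - cnj (P i) + complex_of_real (s i)" using I i by (simp add: sum.distrib PP)
  also have "\<dots> = complex_of_real (1 - s i)" by (simp add: Pi)
  finally have "(\<Sum>i'\<in>I. (cmod (?\<delta> i' - P i'))\<^sup>2) = 1 - s i" by (simp only: of_real_eq_iff)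
  moreover have "0 <= (\<Sum>i'\<in>I. (cmod (?\<delta> i' - P i'))\<^sup>2)" by (intro sum_nonneg) simp
  ultimately show ?thesis by linarith
 qed
 have "real r = (\<Sum>j<r. \<Sum>i\<in>I. (cmod (y j i))\<^sup>2)" proof -
  have "(\<Sum>i\<in>I. (cmod (y j i))\<^sup>2) = 1" if "j < r" for j
  proof -
   have "complex_of_real (\<Sum>i\<in>I. (cmod (y j i))\<^sup>2) = (\<Sum>i\<in>I. cnj (y j i) * y j i)"
    unfolding of_real_sum complex_norm_square by (intro sum.cong refl mult.commute)
   also have "\<dots> = complex_of_real 1" using orth[OF that that] by simp
   finally show ?thesis by (simp only: of_real_eq_iff)
  qed
  then show ?thesis by simp
 qed
 also have "\<dots> = (\<Sum>i\<in>I. s i)" unfolding s_def by (rule sum.swap)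
 also have "\<dots> <= (\<Sum>i\<in>I. 1)" by (rule sum_mono[OF s1])
 finally show ?thesis by simp
qed

locale section_space =
 fixes V :: "('x => complex^'w) set"
 assumes nonempty: "V ~= {}" and V_add: "!!f g. f : V ==> g : V ==> (%x. f x + g x) : V"
  and V_scale: "!!c f. f : V ==> (%x. c *s f x) : V"
begin

lemma V_zero: "(%x. 0) : V" proof -
 obtain f where "f : V" using nonempty by blast
 from V_scale[OF this, of 0] show ?thesis by simp
qed

definition functional :: "(('x => complex^'w) => complex) => bool" where
 "functional \<phi> \<longleftrightarrow> (\<forall>f\<in>V. \<forall>g\<in>V. \<phi> (%x. f x + g x) = \<phi> f + \<phi> g) \<and> (\<forall>c. \<forall>f\<in>V. \<phi> (%x. c *s f x) = c * \<phi> f)"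

lemma combination:
 assumes F: "finite F" and u: "!!i. i : F ==> u i : V"
 shows "(%x. \<Sum>i\<in>F. a i *s u i x) : V \<and>
  (\<forall>\<phi>. functional \<phi> --> \<phi> (%x. \<Sum>i\<in>F. a i *s u i x) = (\<Sum>i\<in>F. a i * \<phi> (u i)))" using F u
proof (induction F)
 case empty
 have "\<phi> (%x. 0) = 0" if "functional \<phi>" for \<phi> using that[unfolded functional_def, THEN conjunct2, rule_format, of "%x. 0" 0] V_zero by simp
 then show ?case using V_zero by simp
next
 case (insert i F)
 have m: "(%x. a i *s u i x) : V" "u i : V" using V_scale insert.prems by auto
 have n: "(%x. \<Sum>i\<in>F. a i *s u i x) : V" using insert by auto
 have "\<phi> (%x. a i *s u i x + (\<Sum>i\<in>F. a i *s u i x)) = a i * \<phi> (u i) + (\<Sum>i\<in>F. a i * \<phi> (u i))" if "functional \<phi>" for \<phi>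
  using that insert.IH insert.prems m n unfolding functional_def by simp
 then show ?case using V_add[OF m(1) n] insert.hyps by simp
qed

text \<open>A functional that only depends on finitely many others is represented by a vector for the
 Hermitian form that these define. A maximal orthonormal family provides it.\<close>

lemma riesz_representation:
 assumes I: "finite I" and \<phi>: "!!i. i : I ==> functional (\<phi> i)" and \<Phi>: "functional \<Phi>"
  and ker: "!!f. f : V ==> (!!i. i : I ==> \<phi> i f = 0) ==> \<Phi> f = 0"
 obtains q where "q : V" "!!f. f : V ==> \<Phi> f = (\<Sum>i\<in>I. cnj (\<phi> i q) * \<phi> i f)" proof -
 define B where "B f g = (\<Sum>i\<in>I. cnj (\<phi> i f) * \<phi> i g)" for f g
 have Bf: "functional (B f)" for f
  using \<phi> by (auto simp: functional_def B_def sum.distrib sum_distrib_left algebra_simps intro!: sum.cong)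
 have Bc: "B f g = cnj (B g f)" for f g by (simp add: B_def mult.commute)
 define R where "R r \<longleftrightarrow> (\<exists>u. (\<forall>j<r. u j : V) \<and> (\<forall>j<r. \<forall>k<r. B (u j) (u k) = (if j = k then 1 else 0)))" for r :: nat
 have "R r ==> r <= card I" for r
  unfolding R_def B_def using orthonormal_card_le[OF I, of r "%j i. \<phi> i (u j)" for u] by blast
 then have "\<not> R (Suc (card I))" by fastforce
 moreover have "R 0" by (simp add: R_def)
 ultimately obtain r where r: "R r" "\<not> R (Suc r)" by (metis nat_induct)
 then obtain u where u: "!!j. j < r ==> u j : V" "!!j k. j < r ==> k < r ==> B (u j) (u k) = (if j = k then 1 else 0)" unfolding R_def by blast
 have main: "\<Phi> f = (\<Sum>j<r. B (u j) f * \<Phi> (u j))" if f: "f : V" for f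
 proof -
  define p where "p = (%x. \<Sum>j<r. (- B (u j) f) *s u j x)"
  have p: "p : V" "!!\<psi>. functional \<psi> ==> \<psi> p = (\<Sum>j<r. - B (u j) f * \<psi> (u j))"
   unfolding p_def using combination[of "{..<r}" u "%j. - B (u j) f"] u(1) by auto
  define h where "h = (%x. f x + p x)"
  have h: "h : V" unfolding h_def by (rule V_add[OF f p(1)])
  have ev: "\<psi> h = \<psi> f - (\<Sum>j<r. B (u j) f * \<psi> (u j))" if "functional \<psi>" for \<psi>
   using that f p(1) p(2)[OF that] unfolding h_def functional_def by (simp add: sum_negf)
  have Bh: "B (u k) h = 0" if k: "k < r" for k
  proof -
   have "(\<Sum>j<r. B (u j) f * B (u k) (u j)) = (\<Sum>j<r. if k = j then B (u j) f else 0)" by (intro sum.cong refl) (simp add: u(2)[OF k])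
   then show ?thesis unfolding ev[OF Bf] using k by simp
  qed
  have "\<phi> i h = 0" if i: "i : I" for i
  proof (rule ccontr)
   assume nz: "\<phi> i h ~= 0"
   define s where "s = (\<Sum>i\<in>I. (cmod (\<phi> i h))\<^sup>2)"
   have "s > 0" unfolding s_def using nz i by (intro sum_pos2[OF I i]) auto
   have Bhh: "B h h = complex_of_real s" unfolding s_def B_def of_real_sum complex_norm_square by (intro sum.cong refl mult.commute)
   define w where "w = (%x. complex_of_real (1 / sqrt s) *s h x)"
   have w: "w : V" unfolding w_def by (rule V_scale[OF h])
   have Bw: "B g w = complex_of_real (1 / sqrt s) * B g h" for g
    using Bf[of g] h unfolding w_def functional_def by blast
   have ww: "B w w = 1" proof -
    have "B w w = complex_of_real (1 / sqrt s) * cnj (B h w)" unfolding Bw[of w] by (simp only: Bc[of w h])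
    also have "\<dots> = complex_of_real ((1 / sqrt s) * (1 / sqrt s) * s)" unfolding Bw Bhh
     by (simp only: complex_cnj_mult complex_cnj_complex_of_real of_real_mult mult.assoc)
    also have "(1 / sqrt s) * (1 / sqrt s) * s = 1" using \<open>s > 0\<close> by simp
    finally show ?thesis by simp
   qed
   have uw: "B (u k) w = 0" "B w (u k) = 0" if "k < r" for k
   proof -
    show 1: "B (u k) w = 0" unfolding Bw Bh[OF that] by simp
    show "B w (u k) = 0" unfolding Bc[of w] 1 by simp
   qed
   have "R (Suc r)" unfolding R_def
   proof (intro exI[of _ "u(r := w)"] conjI allI impI)
    fix j k assume "j < Suc r" "k < Suc r"
    then show "B ((u(r := w)) j) ((u(r := w)) k) = (if j = k then 1 else 0)" using u(2) uw ww by (auto simp: less_Suc_eq)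
   qed (use u(1) w in \<open>auto simp: less_Suc_eq\<close>)
   then show False using r(2) by blast
  qed
  then have "\<Phi> h = 0" by (rule ker[OF h])
  then show ?thesis using ev[OF \<Phi>] by simp
 qed
 define q where "q = (%x. \<Sum>j<r. cnj (\<Phi> (u j)) *s u j x)"
 have q: "q : V" "!!\<psi>. functional \<psi> ==> \<psi> q = (\<Sum>j<r. cnj (\<Phi> (u j)) * \<psi> (u j))"
  unfolding q_def using combination[of "{..<r}" u "%j. cnj (\<Phi> (u j))"] u(1) by auto
 show ?thesis
 proof (rule that[OF q(1)])
  fix f assume f: "f : V"
  have "B q f = cnj (B f q)" by (rule Bc)
  also have "\<dots> = (\<Sum>j<r. \<Phi> (u j) * cnj (B f (u j)))" unfolding q(2)[OF Bf] by simp
  also have "\<dots> = (\<Sum>j<r. B (u j) f * \<Phi> (u j))" unfolding Bc[of f, symmetric] Bc[of _ f] by (simp add: mult.commute)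
  also have "\<dots> = \<Phi> f" by (rule main[OF f, symmetric])
  finally show "\<Phi> f = (\<Sum>i\<in>I. cnj (\<phi> i q) * \<phi> i f)" by (simp add: B_def)
 qed
qed

end

section \<open>Equivariant symbols\<close>

context hermitian_group
begin

lemma killing_sum_left:
 assumes "finite F" and "!!b. b : F ==> b : \<gg>" and X: "X : \<gg>"
 shows "(\<Sum>b\<in>F. u b *\<^sub>R b) : \<gg> \<and> \<kappa> (\<Sum>b\<in>F. u b *\<^sub>R b) X = (\<Sum>b\<in>F. u b * \<kappa> b X)" using assms(1,2)
proof (induction F)
 case empty
 have "\<kappa> 0 X = 0" using killing_scale_left[OF X X, of 0] by simp
 then show ?case using subspace_0[OF subspace_lie_algebra] by simp
next
 case (insert b F)
 have b: "b : \<gg>" "u b *\<^sub>R b : \<gg>" using insert.prems lie_algebra_scaleR by auto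
 have F: "(\<Sum>b\<in>F. u b *\<^sub>R b) : \<gg>" using insert by auto
 show ?case
  using insert killing_add_left[OF b(2) F X] killing_scale_left[OF b(1) X, of "u b"]
   subspace_add[OF subspace_lie_algebra b(2) F] by simp
qed

text \<open>The Killing form is positive on \<open>\<pp>\<close>.\<close>

lemma killing_orthonormal_basis:
 obtains E where "finite E" "E <= \<pp>" "!!X. X : \<pp> ==> X = (\<Sum>b\<in>E. \<kappa> X b *\<^sub>R b)" proof -
 define R where "R r \<longleftrightarrow> (\<exists>E. finite E \<and> card E = r \<and> E <= \<pp> \<and> (\<forall>b\<in>E. \<forall>b'\<in>E. \<kappa> b b' = (if b = b' then 1 else 0)))" for r
 have bound: "r <= DIM('n cmat)" if "R r" for r
 proof -
  from that[unfolded R_def]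
  obtain E where E: "finite E" "card E = r" "E <= \<pp>" and orth: "\<forall>b\<in>E. \<forall>b'\<in>E. \<kappa> b b' = (if b = b' then 1 else 0)" by (elim exE conjE)
  have "u b = 0" if z: "(\<Sum>b\<in>E. u b *\<^sub>R b) = 0" and b: "b : E" for u b
  proof -
   have bg: "b : \<gg>" using E(3) b p_mem by blast
   have "\<kappa> (\<Sum>b\<in>E. u b *\<^sub>R b) b = (\<Sum>b'\<in>E. u b' * \<kappa> b' b)"
    by (rule killing_sum_left[OF E(1) p_mem[OF subsetD[OF E(3)]] bg, THEN conjunct2])
   also have "\<dots> = (\<Sum>b'\<in>E. if b' = b then u b' else 0)" by (intro sum.cong refl) (simp add: orth b)
   also have "\<dots> = u b" using E(1) b by simp
   finally show ?thesis using killing_scale_left[OF bg bg, of 0] by (simp add: z)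
  qed
  then have "independent E" unfolding independent_explicit by (intro conjI E(1) allI impI ballI)
  then show ?thesis using independent_bound[of E] E(2) by simp
 qed
 have "\<not> R (Suc DIM('n cmat))" using bound by fastforce
 moreover have "R 0" unfolding R_def by (intro exI[of _ "{}"]) simp
 ultimately obtain r where r: "R r" "\<not> R (Suc r)" by (metis nat_induct)
 from r(1)[unfolded R_def]
 obtain E where E: "finite E" "card E = r" "E <= \<pp>" and orth: "!!b b'. b : E ==> b' : E ==> \<kappa> b b' = (if b = b' then 1 else 0)" proof (elim exE conjE)
  fix E assume *: "finite E" "card E = r" "E <= \<pp>" "\<forall>b\<in>E. \<forall>b'\<in>E. \<kappa> b b' = (if b = b' then 1 else 0)"
  show thesis by (rule that[OF *(1-3)]) (rule *(4)[rule_format])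
 qed
 have Eg: "b : \<gg>" if "b : E" for b using E(3) that p_mem by blast
 show ?thesis
 proof (rule that[OF E(1,3)])
  fix X assume X: "X : \<pp>"
  note Xg = p_mem[OF X]
  define W where "W = (\<Sum>b\<in>E. \<kappa> X b *\<^sub>R b)"
  define Y where "Y = X - W"
  have Wp: "W : \<pp>" unfolding W_def using E(3) by (intro subspace_sum[OF subspace_p] subspace_scale[OF subspace_p]) auto
  have Y: "Y : \<pp>" unfolding Y_def by (rule subspace_diff[OF subspace_p X Wp])
  have Yb: "\<kappa> Y b = 0" if b: "b : E" for b
  proof -
   have "\<kappa> W b = (\<Sum>b'\<in>E. \<kappa> X b' * \<kappa> b' b)" unfolding W_def by (rule killing_sum_left[OF E(1) Eg Eg[OF b], THEN conjunct2])
   also have "\<dots> = (\<Sum>b'\<in>E. if b' = b then \<kappa> X b' else 0)" by (intro sum.cong refl) (simp add: orth b)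
   also have "\<dots> = \<kappa> X b" using E(1) b by simp
   finally have W: "\<kappa> W b = \<kappa> X b" .
   have "\<kappa> X b = \<kappa> (Y + W) b" by (simp add: Y_def)
   also have "\<dots> = \<kappa> Y b + \<kappa> W b" by (rule killing_add_left[OF p_mem[OF Y] p_mem[OF Wp] Eg[OF b]])
   finally show ?thesis using W by simp
  qed
  have "Y = 0" proof (rule ccontr)
   assume "Y ~= 0"
   then have s: "\<kappa> Y Y > 0" by (rule killing_positive[OF Y])
   define n where "n = (1 / sqrt (\<kappa> Y Y)) *\<^sub>R Y"
   have n: "n : \<pp>" unfolding n_def by (rule subspace_scale[OF subspace_p Y])
   have nb: "\<kappa> n b = 0" "\<kappa> b n = 0" if "b : E" for b
   proof -
    show 1: "\<kappa> n b = 0" unfolding n_def killing_scale_left[OF p_mem[OF Y] Eg[OF that]] Yb[OF that] by simp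
    show "\<kappa> b n = 0" using killing_sym[OF p_mem[OF n] Eg[OF that]] 1 by simp
   qed
   have nn: "\<kappa> n n = 1" using s unfolding n_def killing_scale_left[OF p_mem[OF Y] p_mem[OF n, unfolded n_def]] killing_scale_right[OF p_mem[OF Y] p_mem[OF Y]]
    by simp
   have nE: "n \<notin> E" using nb(1)[of n] nn by auto
   have "R (Suc r)" unfolding R_def
   proof (intro exI[of _ "insert n E"] conjI ballI)
    show "card (insert n E) = Suc r" using E(1,2) nE by simp
    fix b b' assume "b : insert n E" "b' : insert n E"
    then show "\<kappa> b b' = (if b = b' then 1 else 0)" using nb[of b] nb[of b'] nn orth[of b b'] nE by (elim insertE) auto
   qed (use E n in auto)
   then show False using r(2) by blast
  qed
  then show "X = (\<Sum>b\<in>E. \<kappa> X b *\<^sub>R b)" by (simp add: Y_def W_def)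
 qed
qed

definition e_plus :: "'n cmat => 'n cmatC" where "e_plus X = (X, - J X)"

lemma e_plus_mem: "X : \<pp> ==> e_plus X : p_plus \<pp> J" unfolding e_plus_def by (rule p_plus_mem)

lemma AdC_e_plus: "k : K ==> X : \<pp> ==> AdC k (e_plus X) = e_plus (Ad k X)" by (simp add: AdC_def e_plus_def J_Ad Ad_simps)

lemma e_plus_sum:
 assumes "finite E" "E <= \<pp>"
 shows "(\<Sum>b\<in>E. a b *\<^sub>R b) : \<pp> \<and> e_plus (\<Sum>b\<in>E. a b *\<^sub>R b) = (\<Sum>b\<in>E. a b *\<^sub>R e_plus b)" using assms
proof (induction E)
 case empty
 have "J 0 = 0" using J_scaleR[OF subspace_0[OF subspace_p], of 0] by simp
 then show ?case using subspace_0[OF subspace_p] by (simp add: e_plus_def zero_prod_def)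
next
 case (insert b E)
 have b: "b : \<pp>" "a b *\<^sub>R b : \<pp>" using insert.prems subspace_scale[OF subspace_p] by auto
 have s: "(\<Sum>b\<in>E. a b *\<^sub>R b) : \<pp>" "e_plus (\<Sum>b\<in>E. a b *\<^sub>R b) = (\<Sum>b\<in>E. a b *\<^sub>R e_plus b)" using insert by auto
 have "e_plus (a b *\<^sub>R b + (\<Sum>b\<in>E. a b *\<^sub>R b)) = a b *\<^sub>R e_plus b + e_plus (\<Sum>b\<in>E. a b *\<^sub>R b)"
  using b s(1) by (simp add: e_plus_def J_add J_scaleR)
 then show ?case using insert.hyps s subspace_add[OF subspace_p b(2) s(1)] by simp
qed

lemma right_derivC_sum_letters:
 assumes h: "h : smooth_functions G" and "finite F" "!!b. b : F ==> z b : \<gg>\<^sub>C"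
 shows "(\<Sum>b\<in>F. a b *\<^sub>R z b) : \<gg>\<^sub>C \<and> right_derivC (\<Sum>b\<in>F. a b *\<^sub>R z b) h = (%g. \<Sum>b\<in>F. a b *\<^sub>R right_derivC (z b) h g)"
 using assms(2,3) proof (induction F)
 case empty
 have z: "(0 :: 'n cmatC) : \<gg>\<^sub>C" using subspace_0[OF subspace_lie_algebra] by (simp add: zero_prod_def)
 have "right_derivC (0 *\<^sub>R 0) h = (%g. 0 *\<^sub>R right_derivC 0 h g)" by (rule right_derivC_scaleR[OF h z])
 then show ?case using z by simp
next
 case (insert b F)
 have b: "z b : \<gg>\<^sub>C" using insert.prems by auto
 then have ab: "a b *\<^sub>R z b : \<gg>\<^sub>C" by (auto simp: mem_Times_iff lie_algebra_scaleR)
 have s: "(\<Sum>b\<in>F. a b *\<^sub>R z b) : \<gg>\<^sub>C" "right_derivC (\<Sum>b\<in>F. a b *\<^sub>R z b) h = (%g. \<Sum>b\<in>F. a b *\<^sub>R right_derivC (z b) h g)"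
  using insert by auto
 have "a b *\<^sub>R z b + (\<Sum>b\<in>F. a b *\<^sub>R z b) : \<gg>\<^sub>C" using ab s(1) by (auto simp: mem_Times_iff subspace_add[OF subspace_lie_algebra])
 then show ?case
  using insert.hyps by (simp add: right_derivC_add[OF h ab s(1)] right_derivC_scaleR[OF h b] s(2))
qed

lemma zero_smooth: "(%g. 0 :: complex^'w) : smooth_functions G" proof -
 have "Ck_on_group G k (%g. 0 :: complex^'w)" for k
 proof (induction k)
  case (Suc k)
  have "right_deriv X (%g. 0 :: complex^'w) = (%g. 0)" for X :: "'n cmat" by (simp add: right_deriv_def fun_eq_iff)
  then show ?case using Suc by simp
 qed simp
 then show ?thesis by (simp add: smooth_functions_def smooth_on_group_def)
qed

lemma right_derivC_fun_sum:
 fixes h :: "'i => 'n cmat => complex^'w"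
 assumes x: "x : \<gg>\<^sub>C" and "finite F" "!!i. i : F ==> h i : smooth_functions G"
 shows "(%g. \<Sum>i\<in>F. (a i :: real) *\<^sub>R h i g) : smooth_functions G \<and>
  right_derivC x (%g. \<Sum>i\<in>F. a i *\<^sub>R h i g) = (%g. \<Sum>i\<in>F. a i *\<^sub>R right_derivC x (h i) g)" using assms(2,3) proof (induction F)
 case empty
 have x': "set [x] <= \<gg>\<^sub>C" using x by simp
 have "(%g. 0 :: complex^'w) : smooth_functions G" by (rule zero_smooth)
 then show ?case using right_deriv_word_zero[OF x'] by simp
next
 case (insert i F)
 have hi: "h i : smooth_functions G" using insert.prems by auto
 have bl: "bounded_linear (%v :: complex^'w. a i *\<^sub>R v)" by (rule bounded_linear_scaleR_right)
 have hi': "(%g. a i *\<^sub>R h i g) : smooth_functions G" by (rule bounded_linear_mem[OF hi bl])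
 have d: "right_derivC x (%g. a i *\<^sub>R h i g) = (%g. a i *\<^sub>R right_derivC x (h i) g)" by (rule right_derivC_linear[OF hi x bl]) (simp add: vec_eq_iff)
 have s: "(%g. \<Sum>i\<in>F. a i *\<^sub>R h i g) : smooth_functions G"
  "right_derivC x (%g. \<Sum>i\<in>F. a i *\<^sub>R h i g) = (%g. \<Sum>i\<in>F. a i *\<^sub>R right_derivC x (h i) g)" using insert by auto
 show ?case
  using insert.hyps add_mem[OF hi' s(1)] by (simp add: right_derivC_fun_add[OF hi' s(1) x] d s(2))
qed

context
 fixes E :: "'n cmat set"
 assumes E: "finite E" "E <= \<pp>" and expand: "!!X. X : \<pp> ==> X = (\<Sum>b\<in>E. \<kappa> X b *\<^sub>R b)"
begin

definition basis_words :: "nat => 'n cmat list set" where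
 "basis_words k = {ys. set ys <= E \<and> length ys = k}"

text \<open>The coordinates of a tensor power.\<close>

fun weight :: "'n cmat list => 'n cmat list => real" where
 "weight (y # ys) (X # Xs) = \<kappa> X y * weight ys Xs"
| "weight ys Xs = 1"

lemma finite_basis_words: "finite (basis_words k)" unfolding basis_words_def by (rule finite_lists_length_eq[OF E(1)])

lemma sum_basis_words_Suc:
 fixes F :: "'n cmat list => 'c::comm_monoid_add"
 shows "(\<Sum>ys\<in>basis_words (Suc k). F ys) = (\<Sum>b\<in>E. \<Sum>ys\<in>basis_words k. F (b # ys))" proof -
 have "basis_words (Suc k) = (%z. fst z # snd z) ` (E \<times> basis_words k)" proof (intro equalityI subsetI)
  fix ys assume "ys : basis_words (Suc k)"
  then show "ys : (%z. fst z # snd z) ` (E \<times> basis_words k)" by (cases ys) (auto simp: basis_words_def image_iff)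
 qed (auto simp: basis_words_def)
 moreover have "inj_on (%z. fst z # snd z) (E \<times> basis_words k)" by (simp add: inj_on_def prod_eq_iff)
 ultimately show ?thesis by (simp add: sum.reindex sum.cartesian_product case_prod_beta)
qed

lemma e_plus_expand: "X : \<pp> ==> e_plus X = (\<Sum>b\<in>E. \<kappa> X b *\<^sub>R e_plus b)" using e_plus_sum[OF E, of "\<kappa> X"] expand[of X] by simp

lemma e_plus_gC: "set Xs <= \<pp> ==> set (map e_plus Xs) <= \<gg>\<^sub>C" unfolding set_map
proof (rule image_subsetI)
 fix x assume "set Xs <= \<pp>" "x : set Xs"
 then have "x : \<pp>" by blast
 then show "e_plus x : \<gg>\<^sub>C" by (rule subsetD[OF p_plus_gC e_plus_mem])
qed

lemma right_deriv_word_expand: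
 assumes h: "h : smooth_functions G"
 shows "set Xs <= \<pp> ==> right_deriv_word (map e_plus Xs) h =
  (%g. \<Sum>ys\<in>basis_words (length Xs). weight ys Xs *\<^sub>R right_deriv_word (map e_plus ys) h g)" proof (induction Xs)
 case Nil
 have "basis_words 0 = {[]}" by (auto simp: basis_words_def)
 then show ?case by simp
next
 case (Cons X Xs)
 have X: "X : \<pp>" "set Xs <= \<pp>" using Cons.prems by auto
 let ?k = "length Xs"
 let ?u = "%ys. right_deriv_word (map e_plus ys) h"
 have u: "?u ys : smooth_functions G" if "ys : basis_words ?k" for ys
  using that E(2) by (intro right_deriv_word_mem[OF h] e_plus_gC) (auto simp: basis_words_def)
 have uX: "?u Xs : smooth_functions G" by (rule right_deriv_word_mem[OF h e_plus_gC[OF X(2)]])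
 have Eg: "e_plus b : \<gg>\<^sub>C" if "b : E" for b using that E(2) e_plus_mem p_plus_gC by blast
 have 1: "right_derivC (e_plus X) (?u Xs) g = (\<Sum>b\<in>E. \<kappa> X b *\<^sub>R right_derivC (e_plus b) (?u Xs) g)" for g
  using right_derivC_sum_letters[where z=e_plus and a="\<kappa> X", OF uX E(1) Eg, THEN conjunct2] unfolding e_plus_expand[OF X(1), symmetric] by (rule fun_cong)
 have 2: "(\<Sum>b\<in>E. \<kappa> X b *\<^sub>R right_derivC (e_plus b) (?u Xs) g)
   = (\<Sum>b\<in>E. \<Sum>ys\<in>basis_words ?k. (\<kappa> X b * weight ys Xs) *\<^sub>R ?u (b # ys) g)" for g
 proof (rule sum.cong[OF refl])
  fix b assume b: "b : E"
  have "right_derivC (e_plus b) (?u Xs) g = (\<Sum>ys\<in>basis_words ?k. weight ys Xs *\<^sub>R right_derivC (e_plus b) (?u ys) g)" unfolding Cons.IH[OF X(2)]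
   using right_derivC_fun_sum[OF Eg[OF b] finite_basis_words u, where a="%ys. weight ys Xs"] by simp
  then show "\<kappa> X b *\<^sub>R right_derivC (e_plus b) (?u Xs) g = (\<Sum>ys\<in>basis_words ?k. (\<kappa> X b * weight ys Xs) *\<^sub>R ?u (b # ys) g)"
   by (simp add: scaleR_sum_right)
 qed
 have "right_derivC (e_plus X) (?u Xs) g = (\<Sum>ys\<in>basis_words (Suc ?k). weight ys (X # Xs) *\<^sub>R ?u ys g)" for g
  unfolding 1 2 sum_basis_words_Suc weight.simps ..
 then show ?case by (simp add: fun_eq_iff)
qed

lemma product_expand:
 assumes \<xi>: "complex_functional \<xi>"
 shows "set Xs <= \<pp> ==> (\<Prod>x\<leftarrow>map e_plus Xs. \<xi> x) =
  (\<Sum>ys\<in>basis_words (length Xs). of_real (weight ys Xs) * (\<Prod>x\<leftarrow>map e_plus ys. \<xi> x))" proof (induction Xs)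
 case Nil
 have "basis_words 0 = {[]}" by (auto simp: basis_words_def)
 then show ?case by simp
next
 case (Cons X Xs)
 have X: "X : \<pp>" "set Xs <= \<pp>" using Cons.prems by auto
 have lin: "linear \<xi>" using \<xi> by (simp add: complex_functional_def)
 have "\<xi> (e_plus X) = (\<Sum>b\<in>E. of_real (\<kappa> X b) * \<xi> (e_plus b))"
  by (subst e_plus_expand[OF X(1)]) (simp add: linear_sum[OF lin] linear_scale[OF lin] scaleR_conv_of_real)
 then show ?case
  using Cons.IH[OF X(2)] by (simp add: sum_basis_words_Suc sum_product mult_ac)
qed

lemma weight_adjoint:
 assumes k: "k : K"
 shows "set ys <= \<pp> ==> set xs <= \<pp> ==> length ys = length xs ==>
  weight xs (map (Ad (matrix_inv k)) ys) = weight ys (map (Ad k) xs)" proof (induction ys arbitrary: xs)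
 case (Cons y ys)
 then obtain x xs' where xs: "xs = x # xs'" by (cases xs) auto
 have m: "y : \<gg>" "x : \<gg>" using Cons.prems p_mem by (auto simp: xs)
 have kG: "k : G" by (rule K_group(4)[OF k])
 have "\<kappa> (Ad k (Ad (matrix_inv k) y)) (Ad k x) = \<kappa> (Ad (matrix_inv k) y) x" using m by (intro killing_Ad[OF kG] lie_algebra_Ad inv_mem kG)
 moreover have "Ad k (Ad (matrix_inv k) y) = y" using Ad_mult[OF invertible_mem[OF kG] invertible_mem[OF inv_mem[OF kG]], of y] inv_cancel(1)[OF kG] by simp
 ultimately have "\<kappa> (Ad (matrix_inv k) y) x = \<kappa> (Ad k x) y" using killing_sym[OF m(1) lie_algebra_Ad[OF kG m(2)]] by simp
 then show ?case using Cons by (simp add: xs)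
qed simp

text \<open>The coefficients are chosen as the representing vectors of the components of \<open>\<Phi>\<close>. These are
 unique, because they are jets of sections themselves; so the coefficients are equivariant.\<close>

lemma equivariant_symbol:
 fixes \<tau> :: "'n cmat => complex^'w^'w" and \<sigma> :: "'n cmat => complex^'z^'z"
  and \<Phi> :: "('n cmat => complex^'w) => complex^'z"
 assumes \<tau>: "unitary_rep K \<tau>" and V: "section_space V" and hol: "V <= hol_functions \<tau>"
  and L: "!!l. l : L ==> l : K" "!!l. l : L ==> matrix_inv l : L"
  and trans: "!!l f. l : L ==> f : V ==> (%x. f (l ** x)) : V"
  and \<Phi>_add: "!!f g. f : V ==> g : V ==> \<Phi> (%x. f x + g x) = \<Phi> f + \<Phi> g"
  and \<Phi>_scale: "!!c f. f : V ==> \<Phi> (%x. c *s f x) = c *s \<Phi> f"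
  and eqv: "!!l f. l : L ==> f : V ==> \<sigma> l *v \<Phi> (%x. f (l ** x)) = \<Phi> f"
  and ker: "!!f. f : V ==> (!!xs. set xs <= p_plus \<pp> J ==> length xs = k ==> right_deriv_word xs f (mat 1) = 0) ==> \<Phi> f = 0"
 shows "\<exists>D. (\<forall>(c, xs)\<in>set D. length xs = k \<and> set xs <= p_plus \<pp> J) \<and>
   (\<forall>l\<in>L. same_tensor (transform_op \<tau> \<sigma> l D) D) \<and>
   (\<forall>f\<in>V. \<Phi> f = (\<Sum>(c, xs)\<leftarrow>D. c *v right_deriv_word xs f (mat 1)))" proof -
 interpret section_space V by (rule V)
 let ?W = "basis_words k"
 define \<rho> where "\<rho> ys f = right_deriv_word (map e_plus ys) f (mat 1)" for ys and f :: "'n cmat => complex^'w"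
 have Vs: "f : smooth_functions G" if "f : V" for f by (rule hol_functionsD(1)[OF subsetD[OF hol that]])
 have W: "set ys <= \<pp>" "length ys = k" if "ys : ?W" for ys
  using that E(2) by (auto simp: basis_words_def)
 have \<rho>_add: "\<rho> ys (%x. f x + g x) = \<rho> ys f + \<rho> ys g" if "ys : ?W" "f : V" "g : V" for ys f g
  unfolding \<rho>_def right_deriv_word_fun_add[OF Vs[OF that(2)] Vs[OF that(3)] e_plus_gC[OF W(1)[OF that(1)]]] ..
 have \<rho>_scale: "\<rho> ys (%x. c *s f x) = c *s \<rho> ys f" if "ys : ?W" "f : V" for ys c f
  unfolding \<rho>_def
  by (subst right_deriv_word_linear[OF Vs[OF that(2)] bounded_linear_vector_smult _ e_plus_gC[OF W(1)[OF that(1)]]])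
   (simp_all add: mult.commute)
 have \<rho>_functional: "functional (%f. \<rho> ys f $ a)" if "ys : ?W" for ys a
  unfolding functional_def using \<rho>_add[OF that] \<rho>_scale[OF that] by simp
 have ker': "\<Phi> f = 0" if f: "f : V" and z: "!!ys. ys : ?W ==> \<rho> ys f = 0" for f
 proof (rule ker[OF f])
  fix xs assume xs: "set xs <= p_plus \<pp> J" "length xs = k"
  have e: "e_plus (fst x) = x" if "x : set xs" for x
   using p_plusD[OF subsetD[OF xs(1) that]] by (simp add: e_plus_def prod_eq_iff)
  have fp: "set (map fst xs) <= \<pp>" unfolding set_map by (rule image_subsetI) (use p_plusD xs(1) in blast)
  have "right_deriv_word (map e_plus (map fst xs)) f (mat 1) = (\<Sum>ys\<in>?W. weight ys (map fst xs) *\<^sub>R \<rho> ys f)"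
   unfolding right_deriv_word_expand[OF Vs[OF f] fp] \<rho>_def using xs(2) by simp
  moreover have "map e_plus (map fst xs) = xs" unfolding map_map by (rule map_idI) (simp add: e)
  ultimately show "right_deriv_word xs f (mat 1) = 0" by (simp add: z)
 qed
 have ex: "\<exists>q. q : V \<and> (\<forall>f\<in>V. \<Phi> f $ r = (\<Sum>ys\<in>?W. hin (\<rho> ys q) (\<rho> ys f)))" for r
 proof -
  have fin: "finite (?W \<times> (UNIV :: 'w set))" using finite_basis_words by simp
  have fun1: "functional ((%(ys, a) f. \<rho> ys f $ a) i)" if "i : ?W \<times> (UNIV :: 'w set)" for i
   using that \<rho>_functional by auto
  have fun2: "functional (%f. \<Phi> f $ r)" unfolding functional_def using \<Phi>_add \<Phi>_scale by simp
  obtain q where q: "q : V" "!!f. f : V ==> \<Phi> f $ r = (\<Sum>i\<in>?W \<times> (UNIV :: 'w set).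
    cnj ((%(ys, a) f. \<rho> ys f $ a) i q) * (%(ys, a) f. \<rho> ys f $ a) i f)" proof (rule riesz_representation[OF fin fun1 fun2])
   fix f assume f: "f : V" and z: "!!i. i : ?W \<times> (UNIV :: 'w set) ==> (%(ys, a) f. \<rho> ys f $ a) i f = 0"
   have "\<rho> ys f = 0" if "ys : ?W" for ys
    using z[of "(ys, a)" for a] that by (simp add: vec_eq_iff)
   then have "\<Phi> f = 0" by (rule ker'[OF f])
   then show "\<Phi> f $ r = 0" by simp
  next
   fix i :: "'n cmat list \<times> 'w" assume "i : ?W \<times> UNIV"
   then show "i : ?W \<times> UNIV" .
  next
   fix q assume qq: "q : V" "!!f. f : V ==> \<Phi> f $ r = (\<Sum>i\<in>?W \<times> (UNIV :: 'w set).
    cnj ((%(ys, a) f. \<rho> ys f $ a) i q) * (%(ys, a) f. \<rho> ys f $ a) i f)"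
   show thesis by (rule that[OF qq])
  qed
  have "\<forall>f\<in>V. \<Phi> f $ r = (\<Sum>ys\<in>?W. hin (\<rho> ys q) (\<rho> ys f))" using q(2) by (simp add: hin_def sum.cartesian_product case_prod_beta)
  then show ?thesis using q(1) by blast
 qed
 from choice[OF allI[OF ex]] obtain q where q: "\<forall>r. q r : V \<and> (\<forall>f\<in>V. \<Phi> f $ r = (\<Sum>ys\<in>?W. hin (\<rho> ys (q r)) (\<rho> ys f)))" ..
 have qV: "q r : V" and q\<Phi>: "f : V ==> \<Phi> f $ r = (\<Sum>ys\<in>?W. hin (\<rho> ys (q r)) (\<rho> ys f))" for r f
  using q by blast+
 define C :: "'n cmat list => complex^'w^'z" where "C ys = (\<chi> r a. cnj (\<rho> ys (q r) $ a))" for ys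
 have Cv: "(C ys *v w) $ r = hin (\<rho> ys (q r)) w" for ys w r
  by (simp add: C_def matrix_vector_mult_def hin_def)
 have rep: "\<Phi> f = (\<Sum>ys\<in>?W. C ys *v \<rho> ys f)" if "f : V" for f
  by (simp add: vec_eq_iff q\<Phi>[OF that] Cv)
 have AdL: "map (AdC l) (map e_plus xs) = map e_plus (map (Ad l) xs)" "set (map (Ad l) xs) <= \<pp>"
  if "l : K" "set xs <= \<pp>" for l xs
 proof -
  have "AdC l (e_plus x) = e_plus (Ad l x)" "Ad l x : \<pp>" if "x : set xs" for x
   using AdC_e_plus[OF \<open>l : K\<close>, of x] Ad_K(2)[OF \<open>l : K\<close>, of x] \<open>set xs <= \<pp>\<close> that by blast+
  then show "map (AdC l) (map e_plus xs) = map e_plus (map (Ad l) xs)" "set (map (Ad l) xs) <= \<pp>" by auto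
 qed
 have \<rho>_translate: "\<rho> xs (%x. f (l ** x)) = matrix_inv (\<tau> l) *v (\<Sum>ys\<in>?W. weight ys (map (Ad l) xs) *\<^sub>R \<rho> ys f)"
  if l: "l : K" and f: "f : V" and xs: "xs : ?W" for l f xs
 proof -
  have lG: "l : G" by (rule K_group(4)[OF l])
  have "\<rho> xs (%x. f (l ** x)) = right_deriv_word (map e_plus xs) f (mat 1 ** l)" unfolding \<rho>_def right_deriv_word_left_translate by simp
  also have "\<dots> = matrix_inv (\<tau> l) *v right_deriv_word (map (AdC l) (map e_plus xs)) f (mat 1)"
   by (rule right_deriv_word_right_translate[OF Vs[OF f] lG hol_functionsD(3)[OF subsetD[OF hol f] _ l] e_plus_gC[OF W(1)[OF xs]] one_mem])
  also have "right_deriv_word (map (AdC l) (map e_plus xs)) f (mat 1) = (\<Sum>ys\<in>?W. weight ys (map (Ad l) xs) *\<^sub>R \<rho> ys f)"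
   unfolding AdL(1)[OF l W(1)[OF xs]] right_deriv_word_expand[OF Vs[OF f] AdL(2)[OF l W(1)[OF xs]]] \<rho>_def
   using W(2)[OF xs] by simp
  finally show ?thesis .
 qed
 have lin: "linear (%v. A *v v)" for A :: "complex^'a::finite^'b::finite" by (rule bounded_linear.linear[OF bounded_linear_matrix_vector_mult])
 have inv: "(\<Sum>xs\<in>?W. weight ys (map (Ad l) xs) *\<^sub>R (\<sigma> l *v (C xs *v (matrix_inv (\<tau> l) *v w)))) = C ys *v w"
  if l: "l : L" and ys: "ys : ?W" for l ys w
 proof -
  let ?wt = "%ys xs. weight ys (map (Ad l) xs)"
  define Cp where "Cp ys w = (\<Sum>xs\<in>?W. ?wt ys xs *\<^sub>R (\<sigma> l *v (C xs *v (matrix_inv (\<tau> l) *v w))))" for ys w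
  have lK: "l : K" by (rule L(1)[OF l])
  have liK: "matrix_inv l : K" by (rule K_group(3)[OF lK])
  have lG: "l : G" by (rule K_group(4)[OF lK])
  have hom: "!!k l. k : K ==> l : K ==> \<tau> (k ** l) = \<tau> k ** \<tau> l" "\<tau> (mat 1) = mat 1" "!!v. norm (\<tau> l *v v) = norm v"
   using \<tau> lK by (auto simp: unitary_rep_def)
  have \<tau>\<tau>: "\<tau> l ** \<tau> (matrix_inv l) = mat 1" "\<tau> (matrix_inv l) ** \<tau> l = mat 1"
   using hom(1)[OF lK liK] hom(1)[OF liK lK] hom(2) inv_cancel(1,2)[OF lG] by simp_all
  have \<tau>i: "matrix_inv (\<tau> (matrix_inv l)) = \<tau> l" "matrix_inv (\<tau> l) = \<tau> (matrix_inv l)" using \<tau>\<tau> by (auto intro!: matrix_inv_eqI)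
  have adj: "hin (\<tau> l *v u) w = hin u (matrix_inv (\<tau> l) *v w)" for u w
  proof -
   have "\<tau> l *v (matrix_inv (\<tau> l) *v w) = w" by (simp add: \<tau>i(2) matrix_vector_mul_assoc \<tau>\<tau>)
   then show ?thesis using hin_isometry[OF hom(3), of u "matrix_inv (\<tau> l) *v w"] by simp
  qed
  define q' where "q' r = (%x. \<Sum>r'\<in>UNIV. cnj (\<sigma> l $ r $ r') *s q r' (matrix_inv l ** x))" for r
  have tV: "(%x. q r' (matrix_inv l ** x)) : V" for r' by (rule trans[OF L(2)[OF l] qV])
  have q'V: "q' r : V" and q'f: "functional \<psi> ==> \<psi> (q' r) = (\<Sum>r'\<in>UNIV. cnj (\<sigma> l $ r $ r') * \<psi> (%x. q r' (matrix_inv l ** x)))" for r \<psi>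
   unfolding q'_def
   using combination[of UNIV "%r' x. q r' (matrix_inv l ** x)" "%r'. cnj (\<sigma> l $ r $ r')"] tV by auto
  have \<rho>q': "\<rho> ys (q' r) = (\<Sum>r'\<in>UNIV. cnj (\<sigma> l $ r $ r') *s (\<tau> l *v (\<Sum>xs\<in>?W. ?wt ys xs *\<^sub>R \<rho> xs (q r'))))" if ys: "ys : ?W" for ys r
  proof -
   have "\<rho> ys (%x. q r' (matrix_inv l ** x)) = \<tau> l *v (\<Sum>xs\<in>?W. ?wt ys xs *\<^sub>R \<rho> xs (q r'))" for r'
    unfolding \<rho>_translate[OF liK qV ys] \<tau>i(1) by (intro arg_cong[where f="%v. \<tau> l *v v"] sum.cong refl arg_cong[where f="%c. c *\<^sub>R _"])
     (rule weight_adjoint[OF lK W(1)[OF ys] W(1)], simp_all add: W(2)[OF ys] W(2))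
   then show ?thesis using q'f[OF \<rho>_functional[OF ys]] by (simp add: vec_eq_iff)
  qed
  have star: "hin (\<rho> ys (q' r)) w = Cp ys w $ r" if ys: "ys : ?W" for ys r w
  proof -
   let ?w = "matrix_inv (\<tau> l) *v w"
   have "hin (\<rho> ys (q' r)) w = (\<Sum>r'\<in>UNIV. \<sigma> l $ r $ r' * (\<Sum>xs\<in>?W. of_real (?wt ys xs) * hin (\<rho> xs (q r')) ?w))"
    unfolding \<rho>q'[OF ys] hin_sum_left hin_simps adj hin_scaleR by simp
   also have "\<dots> = (\<Sum>xs\<in>?W. of_real (?wt ys xs) * (\<Sum>r'\<in>UNIV. \<sigma> l $ r $ r' * hin (\<rho> xs (q r')) ?w))"
    unfolding sum_distrib_left by (subst sum.swap) (simp add: mult_ac)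
   also have "\<dots> = (\<Sum>xs\<in>?W. of_real (?wt ys xs) * (\<sigma> l *v (C xs *v ?w)) $ r)" by (simp add: matrix_vector_mult_def[of "\<sigma> l"] Cv)
   also have "\<dots> = Cp ys w $ r" unfolding Cp_def sum_component vector_scaleR_component by (simp add: scaleR_conv_of_real)
   finally show ?thesis .
  qed
  have Cp\<Phi>: "(\<Sum>ys\<in>?W. Cp ys (\<rho> ys f)) = \<Phi> f" if f: "f : V" for f
  proof -
   have "(\<Sum>ys\<in>?W. Cp ys (\<rho> ys f)) = (\<Sum>xs\<in>?W. \<Sum>ys\<in>?W. ?wt ys xs *\<^sub>R (\<sigma> l *v (C xs *v (matrix_inv (\<tau> l) *v \<rho> ys f))))"
    unfolding Cp_def by (rule sum.swap)
   also have "\<dots> = (\<Sum>xs\<in>?W. \<sigma> l *v (C xs *v (matrix_inv (\<tau> l) *v (\<Sum>ys\<in>?W. ?wt ys xs *\<^sub>R \<rho> ys f))))"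
    by (simp only: linear_sum[OF lin] linear_scale[OF lin])
   also have "\<dots> = (\<Sum>xs\<in>?W. \<sigma> l *v (C xs *v \<rho> xs (%x. f (l ** x))))" by (intro sum.cong refl) (simp add: \<rho>_translate[OF lK f])
   also have "\<dots> = \<sigma> l *v \<Phi> (%x. f (l ** x))" unfolding rep[OF trans[OF l f]] by (simp only: linear_sum[OF lin])
   finally show ?thesis using eqv[OF l f] by simp
  qed
  have same: "\<rho> ys (q' r) = \<rho> ys (q r)" if ys: "ys : ?W" for ys r
  proof -
   define u where "u = (%x. q' r x + (- 1) *s q r x)"
   have m: "(%x. (- 1) *s q r x) : V" by (rule V_scale[OF qV])
   have uV: "u : V" unfolding u_def by (rule V_add[OF q'V m])
   have \<rho>u: "\<rho> ys u = \<rho> ys (q' r) + (- 1) *s \<rho> ys (q r)" if "ys : ?W" for ys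
    unfolding u_def \<rho>_add[OF that q'V m] \<rho>_scale[OF that qV] ..
   have "(\<Sum>ys\<in>?W. hin (\<rho> ys u) (\<rho> ys u)) = (\<Sum>ys\<in>?W. hin (\<rho> ys (q' r)) (\<rho> ys u) - hin (\<rho> ys (q r)) (\<rho> ys u))"
   proof (rule sum.cong[OF refl])
    fix ys assume "ys : ?W"
    then show "hin (\<rho> ys u) (\<rho> ys u) = hin (\<rho> ys (q' r)) (\<rho> ys u) - hin (\<rho> ys (q r)) (\<rho> ys u)"
     by (subst (1) \<rho>u) (simp_all only: hin_simps, simp)
   qed
   also have "\<dots> = (\<Sum>ys\<in>?W. Cp ys (\<rho> ys u) $ r) - \<Phi> u $ r" unfolding sum_subtractf q\<Phi>[OF uV] using star by simp
   also have "\<dots> = 0" unfolding Cp\<Phi>[OF uV, symmetric] by simp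
   finally have "complex_of_real (\<Sum>ys\<in>?W. (norm (\<rho> ys u))\<^sup>2) = 0" by (simp add: hin_self)
   then have "(\<Sum>ys\<in>?W. (norm (\<rho> ys u))\<^sup>2) = 0" by (simp only: of_real_eq_0_iff)
   then have "\<rho> ys u = 0" using ys finite_basis_words by (simp add: sum_nonneg_eq_0_iff)
   then show ?thesis unfolding \<rho>u[OF ys] by simp
  qed
  have "Cp ys w = C ys *v w" by (simp add: vec_eq_iff star[OF ys, symmetric] same[OF ys] Cv)
  then show ?thesis by (simp only: Cp_def)
 qed
 obtain ws where ws: "set ws = ?W" "distinct ws" using finite_distinct_list[OF finite_basis_words] by blast
 define D where "D = map (%ys. (C ys, map e_plus ys)) ws"
 have sumD: "(\<Sum>(c, xs)\<leftarrow>D. F c xs) = (\<Sum>ys\<in>?W. F (C ys) (map e_plus ys))" for F :: "complex^'w^'z => 'n cmatC list => complex^'z"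
  unfolding D_def map_map o_def prod.case using sum_list_distinct_conv_sum_set[OF ws(2)] ws(1) by simp
 have "same_tensor (transform_op \<tau> \<sigma> l D) D" if l: "l : L" for l
  unfolding same_tensor_def
 proof (intro allI impI)
  fix \<xi> w assume \<xi>: "complex_functional (\<xi> :: 'n cmatC => complex)"
  let ?P = "%ys. \<Prod>x\<leftarrow>map e_plus ys. \<xi> x"
  let ?v = "%xs. \<sigma> l *v (C xs *v (matrix_inv (\<tau> l) *v w))"
  have "symbol (transform_op \<tau> \<sigma> l D) \<xi> w = (\<Sum>(c, xs)\<leftarrow>D. (\<Prod>x\<leftarrow>map (AdC l) xs. \<xi> x) *s ((\<sigma> l ** c ** matrix_inv (\<tau> l)) *v w))"
   by (simp add: symbol_def transform_op_def o_def case_prod_unfold)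
  also have "\<dots> = (\<Sum>xs\<in>?W. (\<Prod>x\<leftarrow>map (AdC l) (map e_plus xs). \<xi> x) *s ?v xs)"
   unfolding sumD by (simp only: matrix_vector_mul_assoc matrix_mul_assoc)
  also have "\<dots> = (\<Sum>xs\<in>?W. \<Sum>ys\<in>?W. ?P ys *s (weight ys (map (Ad l) xs) *\<^sub>R ?v xs))" proof (rule sum.cong[OF refl])
   fix xs assume xs: "xs : ?W"
   have gen: "(\<Sum>ys\<in>?W. of_real (r ys) * p ys) *s v = (\<Sum>ys\<in>?W. p ys *s (r ys *\<^sub>R v))"
    for r p and v :: "complex^'z" by (simp add: vec_eq_iff sum_distrib_left sum_distrib_right scaleR_conv_of_real[where 'a=complex] mult_ac)
   have "(\<Prod>x\<leftarrow>map (AdC l) (map e_plus xs). \<xi> x) = (\<Sum>ys\<in>?W. of_real (weight ys (map (Ad l) xs)) * ?P ys)"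
    unfolding AdL(1)[OF L(1)[OF l] W(1)[OF xs]] product_expand[OF \<xi> AdL(2)[OF L(1)[OF l] W(1)[OF xs]]] using W(2)[OF xs] by simp
   then show "(\<Prod>x\<leftarrow>map (AdC l) (map e_plus xs). \<xi> x) *s ?v xs = (\<Sum>ys\<in>?W. ?P ys *s (weight ys (map (Ad l) xs) *\<^sub>R ?v xs))"
    by (simp only: gen)
  qed
  also have "\<dots> = (\<Sum>ys\<in>?W. ?P ys *s (\<Sum>xs\<in>?W. weight ys (map (Ad l) xs) *\<^sub>R ?v xs))"
   by (subst sum.swap) (simp add: vec_eq_iff sum_distrib_left)
  also have "\<dots> = (\<Sum>ys\<in>?W. ?P ys *s (C ys *v w))" by (intro sum.cong refl) (simp only: inv[OF l])
  also have "\<dots> = symbol D \<xi> w" unfolding symbol_def using sumD[of "%c xs. (\<Prod>x\<leftarrow>xs. \<xi> x) *s (c *v w)"] by simp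
  finally show "symbol (transform_op \<tau> \<sigma> l D) \<xi> w = symbol D \<xi> w" .
 qed
 moreover have "\<Phi> f = (\<Sum>(c, xs)\<leftarrow>D. c *v right_deriv_word xs f (mat 1))" if "f : V" for f
  using rep[OF that] sumD[of "%c xs. c *v right_deriv_word xs f (mat 1)"] by (simp add: \<rho>_def)
 moreover have Dp: "length xs = k \<and> set xs <= p_plus \<pp> J" if cx: "(c, xs) : set D" for c xs
 proof -
  obtain ys where ys: "ys : ?W" "xs = map e_plus ys" using cx ws(1) by (auto simp: D_def)
  then show ?thesis using W[OF ys(1)] e_plus_mem by auto
 qed
 moreover have "\<forall>(c, xs)\<in>set D. length xs = k \<and> set xs <= p_plus \<pp> J" by (rule ballI) (auto dest: Dp)
 ultimately show ?thesis by (intro exI[of _ D] conjI ballI) (assumption | blast)+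
qed

end

end

section \<open>Symmetry breaking operators\<close>

context hermitian_group
begin

lemma rot_zero: "rot 0 = mat 1" by simp

lemma circle_action_rot:
 assumes "matrix_subgroup H" "haar_measure H \<nu>" "!!t. rot t : H"
 shows "circle_action H \<nu> (%t. rot t)" by (rule circle_action.intro[OF assms rot_add rot_zero continuous_rot])

lemma matrix_subgroup_G: "matrix_subgroup G" using lie_group by (simp add: matrix_lie_group_def)

lemma hol_sections_hol_functions: "hol_sections G K \<pp> J \<mu> \<tau> <= hol_functions \<tau>" by (auto simp: hol_sections_def hol_functions_def smooth_functions_def)

lemma hol_sections_iff:
 "f : hol_sections G K \<pp> J \<mu> \<tau> \<longleftrightarrow> f : hol_functions \<tau> \<and> integrable \<mu> (%x. (norm (f x))\<^sup>2)"
 by (auto simp: hol_sections_def hol_functions_def smooth_functions_def)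

lemma section_space_hol_sections:
 fixes \<tau> :: "'n cmat => complex^'w^'w"
 assumes haar: "haar_measure G \<mu>"
 shows "section_space (hol_sections G K \<pp> J \<mu> \<tau>)" proof
 interpret circle_action G \<mu> "%t. rot t" 0 by (rule circle_action_rot[OF matrix_subgroup_G haar rot_mem(2)])
 have "right_derivC y (%g. 0 :: complex^'w) = (%g. 0)" if "y : p_minus \<pp> J" for y
  using right_deriv_word_zero[of "[y]"] p_minus_gC[OF that] by simp
 then have "(%g. 0) : hol_sections G K \<pp> J \<mu> \<tau>" using zero_smooth by (simp add: hol_sections_iff hol_functions_def)
 then show "hol_sections G K \<pp> J \<mu> \<tau> ~= {}" by blast
 have cont: "continuous_on G f" if "f : hol_functions \<tau>" for f :: "'n cmat => complex^'w" by (rule smooth_continuous[OF hol_functionsD(2)[OF that]])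
 fix f g :: "'n cmat => complex^'w" and c
 assume f: "f : hol_sections G K \<pp> J \<mu> \<tau>"
 then have fh: "f : hol_functions \<tau>" and fL: "integrable \<mu> (%x. (norm (f x))\<^sup>2)" by (simp_all add: hol_sections_iff)
 have "(%x. c *s f x) : hol_functions \<tau>" proof -
  have "(%x. c *s f x) : smooth_functions G" by (rule bounded_linear_mem[OF hol_functionsD(1)[OF fh] bounded_linear_vector_smult])
  moreover have "right_derivC y (%x. c *s f x) a = 0" if "y : p_minus \<pp> J" "a : G" for y a
   by (subst right_derivC_linear[OF hol_functionsD(1)[OF fh] p_minus_gC[OF that(1)] bounded_linear_vector_smult])
    (simp_all add: mult.commute hol_functionsD(4)[OF fh that])
  ultimately show ?thesis using hol_functionsD(3)[OF fh] by (simp add: hol_functions_def vector_smult_matrix_vector)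
 qed
 moreover have "integrable \<mu> (%x. (norm (c *s f x))\<^sup>2)" using fL by (simp add: smult_norm power_mult_distrib)
 ultimately show "(%x. c *s f x) : hol_sections G K \<pp> J \<mu> \<tau>" by (simp add: hol_sections_iff)
 assume g: "g : hol_sections G K \<pp> J \<mu> \<tau>"
 then have gh: "g : hol_functions \<tau>" and gL: "integrable \<mu> (%x. (norm (g x))\<^sup>2)" by (simp_all add: hol_sections_iff)
 have "(%x. f x + g x) : hol_functions \<tau>" proof -
  have "(%x. f x + g x) : smooth_functions G" by (rule add_mem[OF hol_functionsD(1)[OF fh] hol_functionsD(1)[OF gh]])
  moreover have "right_derivC y (%x. f x + g x) a = 0" if "y : p_minus \<pp> J" "a : G" for y a
   unfolding right_derivC_fun_add[OF hol_functionsD(1)[OF fh] hol_functionsD(1)[OF gh] p_minus_gC[OF that(1)]]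
   using hol_functionsD(4)[OF fh that] hol_functionsD(4)[OF gh that] by simp
  ultimately show ?thesis using hol_functionsD(3)[OF fh] hol_functionsD(3)[OF gh] by (simp add: hol_functions_def matrix_vector_right_distrib)
 qed
 moreover have "integrable \<mu> (%x. (norm (f x + g x))\<^sup>2)" proof (rule Bochner_Integration.integrable_bound)
  show "integrable \<mu> (%x. 2 * (norm (f x))\<^sup>2 + 2 * (norm (g x))\<^sup>2)" using fL gL by simp
  show "(%x. (norm (f x + g x))\<^sup>2) : borel_measurable \<mu>" by (intro continuous_measurable continuous_intros cont fh gh)
  have "(norm (u + v))\<^sup>2 <= 2 * (norm u)\<^sup>2 + 2 * (norm v)\<^sup>2" for u v :: "complex^'w" proof -
   have "(norm (u - v))\<^sup>2 + (norm (u + v))\<^sup>2 = 2 * (norm u)\<^sup>2 + 2 * (norm v)\<^sup>2"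
    by (simp add: power2_norm_eq_inner inner_add_left inner_add_right inner_diff_left inner_diff_right)
   then show ?thesis using zero_le_power2[of "norm (u - v)"] by linarith
  qed
  then show "AE x in \<mu>. norm ((norm (f x + g x))\<^sup>2) <= norm (2 * (norm (f x))\<^sup>2 + 2 * (norm (g x))\<^sup>2)" by (intro always_eventually allI) simp
 qed
 ultimately show "(%x. f x + g x) : hol_sections G K \<pp> J \<mu> \<tau>" by (simp add: hol_sections_iff)
qed

lemma hol_sections_translate:
 fixes \<tau> :: "'n cmat => complex^'w^'w"
 assumes haar: "haar_measure G \<mu>" and f: "f : hol_sections G K \<pp> J \<mu> \<tau>" and a: "a : G"
 shows "(%x. f (a ** x)) : hol_sections G K \<pp> J \<mu> \<tau>" proof -
 interpret circle_action G \<mu> "%t. rot t" 0 by (rule circle_action_rot[OF matrix_subgroup_G haar rot_mem(2)])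
 have fh: "f : hol_functions \<tau>" and fL: "integrable \<mu> (%x. (norm (f x))\<^sup>2)" using f by (simp_all add: hol_sections_iff)
 have "f (a ** (g ** k)) = matrix_inv (\<tau> k) *v f (a ** g)" if "g : G" "k : K" for g k
  using hol_functionsD(3)[OF fh mult_mem[OF a that(1)] that(2)] by (simp add: matrix_mul_assoc)
 moreover have "right_derivC y (%x. f (a ** x)) g = 0" if "y : p_minus \<pp> J" "g : G" for y g
  using hol_functionsD(4)[OF fh that(1) mult_mem[OF a that(2)]] by (simp add: right_derivC_left_translate)
 moreover have "integrable \<mu> (%x. (norm (f (a ** x)))\<^sup>2)"
  by (rule translate_integral(2)[OF continuous_on_power[OF continuous_on_norm[OF smooth_continuous[OF hol_functionsD(2)[OF fh]]]] a fL])
 ultimately show ?thesis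
  using left_translate_mem[OF hol_functionsD(1)[OF fh] a] by (simp add: hol_sections_iff hol_functions_def)
qed

lemma rot_fixed:
 assumes inv: "involutive_group G \<iota>" and comm: "!!g. g : G ==> \<iota> (\<theta> g) = \<theta> (\<iota> g)" and neq: "\<exists>g\<in>G. \<iota> g ~= \<theta> g"
  and H: "H = identity_component (fixed_group G \<iota>)"
  and JH: "invariant_complex_structure L (cartan_p H \<theta>) J\<^sub>H"
  and incl: "holomorphic_inclusion (cartan_p H \<theta>) J\<^sub>H \<pp> J"
 shows "rot t : H" proof -
 interpret I: involutive_group G \<iota> by (rule inv)
 note FH = identity_component_group(1)[OF fixed_group_closed[OF inv], folded H]
 have memH: "X : lie_algebra H" if "X : \<gg>" "hom_differential \<iota> X = X" for X
  unfolding lie_algebra_def H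
 proof (intro CollectI allI exp_identity_component)
  show "mexp (t *\<^sub>R X) : fixed_group G \<iota>" for t
   using I.hom_exp_curve[OF that(1)] that by (auto simp: fixed_group_def)
 qed
 have "hom_differential \<iota> Z = Z" proof (rule complex_structure_fixed[OF inv comm neq])
  fix X assume X: "X : \<pp>" "hom_differential \<iota> X = X"
  have XH: "X : cartan_p H \<theta>" using memH[OF p_mem[OF X(1)] X(2)] X(1) by (simp add: cartan_p_def)
  have JX: "J X = J\<^sub>H X" using incl XH by (simp add: holomorphic_inclusion_def)
  have "J\<^sub>H X : cartan_p H \<theta>" using JH XH by (simp add: invariant_complex_structure_def)
  then have "J X : lie_algebra H" by (simp add: JX cartan_p_def)
  then have "mexp (t *\<^sub>R J X) : fixed_group G \<iota>" for t using FH by (auto simp: lie_algebra_def)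
  then have "\<iota> (mexp (t *\<^sub>R J X)) = mexp (t *\<^sub>R J X)" for t by (simp add: fixed_group_def)
  then show "hom_differential \<iota> (J X) = J X" by (rule I.differential_eqI)
 qed
 from memH[OF Z_g this] show ?thesis by (simp add: lie_algebra_def)
qed

theorem symmetry_breaking_homogeneous:
 fixes \<tau> :: "'n cmat => complex^'w^'w" and \<sigma> :: "'n cmat => complex^'z^'z"
  and S :: "('n cmat => complex^'w) => ('n cmat => complex^'z)"
 assumes H: "matrix_subgroup H" "H <= G" and rotH: "!!t. rot t : H" and L: "L = K \<inter> H"
  and haar: "haar_measure G \<mu>" "haar_measure H \<nu>"
  and \<tau>: "unitary_rep K \<tau>" "irreducible_rep K \<tau>" and \<sigma>: "unitary_rep L \<sigma>" "irreducible_rep L \<sigma>"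
  and sbo: "symmetry_breaking_operator H \<mu> (hol_sections G K \<pp> J \<mu> \<tau>) \<nu> (hol_sections H L \<pp>\<^sub>H J\<^sub>H \<nu> \<sigma>) S"
 shows "\<exists>k. represented_homogeneous H L (p_plus \<pp> J) \<tau> \<sigma> (hol_sections G K \<pp> J \<mu> \<tau>) k S" proof -
 let ?V = "hol_sections G K \<pp> J \<mu> \<tau>"
 interpret section_space ?V by (rule section_space_hol_sections[OF haar(1)])
 have rotL: "rot t : L" for t using rotH rot_mem(1) L by blast
 have Hgrp: "mat 1 : H" "!!g h. g : H ==> h : H ==> g ** h : H" "!!g. g : H ==> matrix_inv g : H" using H(1) by (auto simp: matrix_subgroup_def)
 have Lgrp: "!!l. l : L ==> l : K" "!!l. l : L ==> matrix_inv l : L" "!!l. l : L ==> l : H" using Hgrp(3) K_group(3) L by auto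
 have SV: "S f : hol_sections H L \<pp>\<^sub>H J\<^sub>H \<nu> \<sigma>" if "f : ?V" for f
  using sbo that by (simp add: symmetry_breaking_operator_def)
 have S_add: "S (%x. f x + g x) = (%x. S f x + S g x)" if "f : ?V" "g : ?V" for f g
  using sbo that by (simp add: symmetry_breaking_operator_def)
 have S_scale: "S (%x. c *s f x) = (%x. c *s S f x)" if "f : ?V" for f c
  using sbo that by (simp add: symmetry_breaking_operator_def)
 obtain C where C: "!!f. f : ?V ==> L2_norm \<nu> (S f) <= C * L2_norm \<mu> f" using sbo unfolding symmetry_breaking_operator_def by blast
 have trans: "(%x. f (h ** x)) : ?V" if "h : H" "f : ?V" for h f
  by (rule hol_sections_translate[OF haar(1) that(2) subsetD[OF H(2) that(1)]])
 have S_trans: "S (%x. f (h ** x)) = (%x. S f (h ** x))" if h: "h : H" and f: "f : ?V" for h f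
 proof -
  have hi: "matrix_inv (matrix_inv h) = h" using matrix_inv_inv[OF invertible_mem[OF subsetD[OF H(2) h]]] .
  have "S (left_translate (matrix_inv h) f) = left_translate (matrix_inv h) (S f)" using sbo Hgrp(3)[OF h] f by (simp add: symmetry_breaking_operator_def)
  then show ?thesis by (simp add: left_translate_def[abs_def] hi)
 qed
 define \<Phi> where "\<Phi> f = S f (mat 1)" for f
 have S\<Phi>: "S f h = \<Phi> (%x. f (h ** x))" if "h : H" "f : ?V" for h f
  unfolding \<Phi>_def S_trans[OF that] by simp
 have S_eqv: "S f (h ** l) = matrix_inv (\<sigma> l) *v S f h" if "f : ?V" "h : H" "l : L" for f h l
  using SV[OF that(1)] that(2,3) by (simp add: hol_sections_def)
 have \<sigma>_inv: "\<sigma> l *v (matrix_inv (\<sigma> l) *v v) = v" if l: "l : L" for l v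
 proof -
  have "\<sigma> l ** \<sigma> (matrix_inv l) = mat 1" "\<sigma> (matrix_inv l) ** \<sigma> l = mat 1"
   using \<sigma>(1) l Lgrp(2)[OF l] inv_cancel(1,2)[OF subsetD[OF H(2) Lgrp(3)[OF l]]] unfolding unitary_rep_def by metis+
  then have "invertible (\<sigma> l)" unfolding invertible_def by blast
  then show ?thesis by (simp add: matrix_vector_mul_assoc matrix_inv_cancel)
 qed
 obtain \<alpha> where \<alpha>: "!!t v. \<tau> (rot t) *v v = cis (\<alpha> * t) *s v"
  by (rule central_one_parameter_scalar[OF \<tau> continuous_rot rot_mem(1) rot_zero rot_add rot_commute]) (assumption, rule that)
 obtain \<beta> where \<beta>: "!!t v. \<sigma> (rot t) *v v = cis (\<beta> * t) *s v"
  by (rule central_one_parameter_scalar[OF \<sigma> continuous_rot rotL rot_zero rot_add rot_commute[OF Lgrp(1)]]) (assumption, rule that)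
 have \<beta>i: "matrix_inv (\<sigma> (rot t)) *v v = cis (- (\<beta> * t)) *s v" for t v
  using \<sigma>_inv[OF rotL, of t v] unfolding \<beta> cis_smult_cancel .
 show ?thesis
 proof (cases "\<forall>f\<in>?V. \<Phi> f = 0")
  case True
  have "represented_homogeneous H L (p_plus \<pp> J) \<tau> \<sigma> ?V 0 S" unfolding represented_homogeneous_def
  proof (intro exI[of _ "[]"] conjI ballI)
   fix f h assume fh: "f : ?V" "h : H"
   have "S f h = 0" unfolding S\<Phi>[OF fh(2,1)] by (rule True[rule_format, OF trans[OF fh(2,1)]])
   then show "S f h = (\<Sum>(c, xs)\<leftarrow>[]. c *v right_deriv_word xs f h)" by simp
  qed (simp_all add: same_tensor_def transform_op_def)
  then show ?thesis by blast
 next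
  case False
  then obtain f0 where f0: "f0 : ?V" "\<Phi> f0 ~= 0" by blast
  \<comment> \<open>\<open>rot (2 * pi)\<close> is central, so both \<open>\<tau>\<close> and \<open>\<sigma>\<close> must give it the same scalar.\<close>
  obtain m :: int where m: "\<beta> = \<alpha> + of_int m" proof -
   have fh: "f0 : hol_functions \<tau>" using f0(1) hol_sections_hol_functions by blast
   have "f0 (rot (2 * pi) ** x) = cis (- (\<alpha> * (2 * pi))) *s f0 x" for x
   proof (cases "x : G")
    case True
    then show ?thesis
     using hol_functionsD(3)[OF fh True rot_mem(1), of "2 * pi"] matrix_inv_scalar[OF \<tau>(1) \<alpha>, of "2 * pi"] by (simp add: rot_period_central)
   next
    case False
    then have "rot (2 * pi) ** x \<notin> G" using mult_mem[OF rot_mem(2), of "rot (2 * pi) ** x" "- (2 * pi)"] by (metis inv_cancel(4) inv_mem mult_mem rot_mem(2))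
    then show ?thesis using False smooth_functionsD(2)[OF hol_functionsD(1)[OF fh]] by simp
   qed
   then have "S (%x. f0 (rot (2 * pi) ** x)) (mat 1) = cis (- (\<alpha> * (2 * pi))) *s \<Phi> f0" unfolding \<Phi>_def by (simp only: S_scale[OF f0(1)])
   moreover have "S (%x. f0 (rot (2 * pi) ** x)) (mat 1) = cis (- (\<beta> * (2 * pi))) *s \<Phi> f0"
    unfolding S_trans[OF rotH f0(1)] using S_eqv[OF f0(1) Hgrp(1) rotL, of "2 * pi"] unfolding \<beta>i \<Phi>_def by simp
   ultimately have "cis (- (\<alpha> * (2 * pi))) *s \<Phi> f0 = cis (- (\<beta> * (2 * pi))) *s \<Phi> f0" by (rule HOL.trans[OF sym])
   then have "cis (- (\<alpha> * (2 * pi))) = cis (- (\<beta> * (2 * pi)))" using f0(2) vector_mul_rcancel by blast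
   then have "sin (- (\<alpha> * (2 * pi))) = sin (- (\<beta> * (2 * pi))) \<and> cos (- (\<alpha> * (2 * pi))) = cos (- (\<beta> * (2 * pi)))"
    by (simp only: complex_eq_iff cis.sel)
   then obtain n :: int where "- (\<alpha> * (2 * pi)) = - (\<beta> * (2 * pi)) + 2 * pi * of_int n" unfolding sin_cos_eq_iff by blast
   then have "2 * pi * (\<beta> - (\<alpha> + of_int n)) = 0" by (simp add: algebra_simps)
   then show thesis using that[of n] by simp
  qed
  have key: "\<Phi> f = 0"
   if f: "f : ?V" and jets: "!!xs. set xs <= p_plus \<pp> J ==> int (length xs) = - m ==> right_deriv_word xs f (mat 1) = 0" for f
  proof -
   interpret CG: circle_action G \<mu> "%t. rot t" \<beta> by (rule circle_action_rot[OF matrix_subgroup_G haar(1) rot_mem(2)])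
   interpret CH: circle_action H \<nu> "%t. rot t" \<beta> by (rule circle_action_rot[OF H(1) haar(2) rotH])
   have fh: "f : hol_functions \<tau>" and fL: "integrable \<mu> (%x. (norm (f x))\<^sup>2)" using f by (simp_all add: hol_sections_iff)
   have fc: "continuous_on G f" by (rule smooth_continuous[OF hol_functionsD(2)[OF fh]])
   have Fc: "continuous_on H (S f)" and FL: "integrable \<nu> (%x. (norm (S f x))\<^sup>2)"
    using SV[OF f] spec[of "%k. Ck_on_group H k (S f)" 0] by (auto simp: hol_sections_def smooth_on_group_def)
   have perG: "cis (\<beta> * (t + 2 * pi)) *s f (rot (t + 2 * pi) ** x) = cis (\<beta> * t) *s f (rot t ** x)" if "x : G" for t x
    unfolding m by (rule twisted_periodic[OF fh \<alpha> \<tau>(1) that])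
   have perH: "cis (\<beta> * (t + 2 * pi)) *s S f (rot (t + 2 * pi) ** x) = cis (\<beta> * t) *s S f (rot t ** x)" if x: "x : H" for t x
   proof -
    have "rot (t + 2 * pi) ** x = (rot t ** x) ** rot (2 * pi)" unfolding rot_add using rot_period_central[OF subsetD[OF H(2) x]] by (metis matrix_mul_assoc)
    then have "S f (rot (t + 2 * pi) ** x) = cis (- (\<beta> * (2 * pi))) *s S f (rot t ** x)" using S_eqv[OF f Hgrp(2)[OF rotH x] rotL] by (simp only: \<beta>i)
    then show ?thesis by (simp add: cis_mult algebra_simps)
   qed
   have zero: "integral {0..2 * pi} (%t. cis (\<beta> * t) *s f (rot t ** x)) = 0" for x
   proof -
    have "circle_average \<beta> f x = 0" unfolding m by (rule circle_average_vanishes[OF \<tau> fh \<alpha> jets])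
    then show ?thesis unfolding average_def .
   qed
   have limG: "(%N. integral\<^sup>L \<mu> (%x. (norm (CG.mean N f x))\<^sup>2)) \<longlonglongrightarrow> 0" by (rule CG.mean_vanishes_in_L2[OF fc fL perG zero])
   have commute: "CG.mean N f : ?V" "S (CG.mean N f) h = CH.mean N (S f) h" if h: "h : H" for N h
   proof -
    let ?t = "%j. real j * (2 * pi) / real N"
    let ?a = "%j. complex_of_real (1 / real N) * cis (\<beta> * ?t j)"
    have sc: "(1 / real N) *\<^sub>R v = complex_of_real (1 / real N) *s v" for v :: "complex^'b" by (simp add: vec_eq_iff scaleR_conv_of_real[where 'a=complex])
    have gen: "z *s (\<Sum>j<N. w j *s v j) = (\<Sum>j<N. (z * w j) *s v j)" for z w and v :: "nat => complex^'b" by (simp add: vec_eq_iff sum_distrib_left mult.assoc)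
    have mean: "cyclic_mean \<beta> (%t. rot t) N u x = (\<Sum>j<N. ?a j *s u (rot (?t j) ** x))" for u :: "'n cmat => complex^'b" and x
     unfolding cyclic_mean_def sc gen ..
    have mf: "CG.mean N f = (%x. \<Sum>j<N. ?a j *s f (rot (?t j) ** x))" by (rule ext) (rule mean)
    note comb = combination[of "{..<N}" "%j x. f (rot (?t j) ** x)" ?a, OF finite_lessThan trans[OF rotH f]]
    show "CG.mean N f : ?V" unfolding mf by (rule comb[THEN conjunct1])
    have "functional (%u. S u h $ r)" for r
     unfolding functional_def using S_add S_scale by simp
    from comb[THEN conjunct2, rule_format, OF this]
    have "S (CG.mean N f) h $ r = CH.mean N (S f) h $ r" for r
     unfolding mf mean[of "S f"] S_trans[OF rotH f] sum_component vector_smult_component .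
    then show "S (CG.mean N f) h = CH.mean N (S f) h" unfolding vec_eq_iff by blast
   qed
   have bound: "integral\<^sup>L \<nu> (%x. (norm (CH.mean N (S f) x))\<^sup>2) <= C\<^sup>2 * integral\<^sup>L \<mu> (%x. (norm (CG.mean N f x))\<^sup>2)" for N
   proof -
    let ?p = "integral\<^sup>L \<nu> (%x. (norm (CH.mean N (S f) x))\<^sup>2)" and ?q = "integral\<^sup>L \<mu> (%x. (norm (CG.mean N f x))\<^sup>2)"
    have "integral\<^sup>L \<nu> (%x. (norm (S (CG.mean N f) x))\<^sup>2) = ?p" by (rule Bochner_Integration.integral_cong[OF refl]) (simp add: CH.space_haar commute(2))
    then have "sqrt ?p <= C * sqrt ?q" using C[OF commute(1)[OF Hgrp(1), of N]] by (simp only: L2_norm_def)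
    then have "(sqrt ?p)\<^sup>2 <= (C * sqrt ?q)\<^sup>2" by (rule power_mono) simp
    then show ?thesis by (simp add: power_mult_distrib)
   qed
   have limH: "(%N. integral\<^sup>L \<nu> (%x. (norm (CH.mean N (S f) x))\<^sup>2)) \<longlonglongrightarrow> 0" proof (rule tendsto_sandwich)
    show "\<forall>\<^sub>F N in sequentially. (0 :: real) <= integral\<^sup>L \<nu> (%x. (norm (CH.mean N (S f) x))\<^sup>2)" by (intro always_eventually allI) simp
    show "\<forall>\<^sub>F N in sequentially. integral\<^sup>L \<nu> (%x. (norm (CH.mean N (S f) x))\<^sup>2) <= C\<^sup>2 * integral\<^sup>L \<mu> (%x. (norm (CG.mean N f x))\<^sup>2)"
     by (intro always_eventually allI bound)
    show "(%N. 0 :: real) \<longlonglongrightarrow> 0" by (rule tendsto_const)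
    show "(%N. C\<^sup>2 * integral\<^sup>L \<mu> (%x. (norm (CG.mean N f x))\<^sup>2)) \<longlonglongrightarrow> 0"
     using tendsto_mult_left[OF limG, of "C\<^sup>2"] by simp
   qed
   have "S f (mat 1) = 0" proof (rule CH.mean_vanishes_at_one[OF Fc FL perH limH])
    fix t
    have "S f (mat 1 ** rot t) = cis (- (\<beta> * t)) *s S f (mat 1)" using S_eqv[OF f Hgrp(1) rotL] by (simp only: \<beta>i)
    then show "cis (\<beta> * t) *s S f (rot t ** mat 1) = S f (mat 1)" by (simp add: cis_mult)
   qed
   then show ?thesis by (simp add: \<Phi>_def)
  qed
  have m0: "m <= 0" proof (rule ccontr)
   assume "\<not> m <= 0"
   then have "\<Phi> f0 = 0" by (intro key[OF f0(1)]) auto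
   then show False using f0(2) by blast
  qed
  define k where "k = nat (- m)"
  have k: "int n = - m \<longleftrightarrow> n = k" for n using m0 by (auto simp: k_def)
  obtain E where E: "finite E" "E <= \<pp>" "!!X. X : \<pp> ==> X = (\<Sum>b\<in>E. \<kappa> X b *\<^sub>R b)" by (rule killing_orthonormal_basis) (rule that)
  have "\<exists>D. (\<forall>(c, xs)\<in>set D. length xs = k \<and> set xs <= p_plus \<pp> J) \<and>
    (\<forall>l\<in>L. same_tensor (transform_op \<tau> \<sigma> l D) D) \<and>
    (\<forall>f\<in>?V. \<Phi> f = (\<Sum>(c, xs)\<leftarrow>D. c *v right_deriv_word xs f (mat 1)))"
  proof (rule equivariant_symbol[OF E \<tau>(1) section_space_axioms hol_sections_hol_functions])
   show "\<Phi> (%x. f x + g x) = \<Phi> f + \<Phi> g" if "f : ?V" "g : ?V" for f g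
    by (simp add: \<Phi>_def S_add[OF that])
   show "\<Phi> (%x. c *s f x) = c *s \<Phi> f" if "f : ?V" for c f
    by (simp add: \<Phi>_def S_scale[OF that])
   show "\<sigma> l *v \<Phi> (%x. f (l ** x)) = \<Phi> f" if "l : L" "f : ?V" for l f
    using S_eqv[OF that(2) Hgrp(1) that(1)] \<sigma>_inv[OF that(1)] by (simp add: \<Phi>_def S_trans[OF Lgrp(3)[OF that(1)] that(2)])
   show "\<Phi> f = 0" if "f : ?V" "!!xs. set xs <= p_plus \<pp> J ==> length xs = k ==> right_deriv_word xs f (mat 1) = 0" for f
   proof (rule key[OF that(1)])
    fix xs assume a: "set xs <= p_plus \<pp> J" "int (length xs) = - m"
    show "right_deriv_word xs f (mat 1) = 0" by (rule that(2)[OF a(1) k[THEN iffD1, OF a(2)]])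
   qed
   show "l : K" "matrix_inv l : L" if "l : L" for l using Lgrp(1,2)[OF that] .
   show "(%x. f (l ** x)) : ?V" if "l : L" "f : ?V" for l f by (rule trans[OF Lgrp(3)[OF that(1)] that(2)])
  qed
  then obtain D where D: "\<forall>(c, xs)\<in>set D. length xs = k \<and> set xs <= p_plus \<pp> J"
   "\<forall>l\<in>L. same_tensor (transform_op \<tau> \<sigma> l D) D"
   "\<forall>f\<in>?V. \<Phi> f = (\<Sum>(c, xs)\<leftarrow>D. c *v right_deriv_word xs f (mat 1))" by (elim exE conjE)
  have "S f h = (\<Sum>(c, xs)\<leftarrow>D. c *v right_deriv_word xs f h)" if fh: "f : ?V" "h : H" for f h
  proof -
   have "S f h = (\<Sum>(c, xs)\<leftarrow>D. c *v right_deriv_word xs (%x. f (h ** x)) (mat 1))"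
    unfolding S\<Phi>[OF fh(2,1)] by (rule D(3)[rule_format, OF trans[OF fh(2,1)]])
   then show ?thesis by (simp add: right_deriv_word_left_translate)
  qed
  then have C: "\<forall>f\<in>?V. \<forall>h\<in>H. S f h = (\<Sum>(c, xs)\<leftarrow>D. c *v right_deriv_word xs f h)" by blast
  have "represented_homogeneous H L (p_plus \<pp> J) \<tau> \<sigma> ?V k S"
   unfolding represented_homogeneous_def by (rule exI[of _ D], rule conjI[OF D(1) conjI[OF D(2) C]])
  then show ?thesis by blast
 qed
qed

end

theorem proposition3p8:
  fixes G K H L :: "(complex^'n^'n) set"
    and \<theta> \<iota> J J\<^sub>H :: "complex^'n^'n \<Rightarrow> complex^'n^'n"
    and \<mu> \<nu> :: "(complex^'n^'n) measure"
    and \<tau> :: "complex^'n^'n \<Rightarrow> complex^'w^'w"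
    and \<sigma> :: "complex^'n^'n \<Rightarrow> complex^'z^'z"
    and S :: "(complex^'n^'n \<Rightarrow> complex^'w) \<Rightarrow> (complex^'n^'n \<Rightarrow> complex^'z)"
  assumes "matrix_lie_group G" and "connected G" and "\<not> compact G"
    and "simple_lie_algebra (lie_algebra G)"
    and "cartan_involution G \<theta>"
    and "K = fixed_group G \<theta>" and "maximal_compact_subgroup G K"
    and "invariant_complex_structure K (cartan_p G \<theta>) J"
    and "abelian_subset (p_plus (cartan_p G \<theta>) J)"
    and "abelian_subset (p_minus (cartan_p G \<theta>) J)"
    and "group_involution G \<iota>"
    and "\<forall>g\<in>G. \<iota> (\<theta> g) = \<theta> (\<iota> g)"
    and "\<exists>g\<in>G. \<iota> g \<noteq> g" and "\<exists>g\<in>G. \<iota> g \<noteq> \<theta> g"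
    and "H = identity_component (fixed_group G \<iota>)" and "L = K \<inter> H"
    and "invariant_complex_structure L (cartan_p H \<theta>) J\<^sub>H"
    and "holomorphic_inclusion (cartan_p H \<theta>) J\<^sub>H (cartan_p G \<theta>) J"
    and "haar_measure G \<mu>" and "haar_measure H \<nu>"
    and "holomorphic_discrete_series G K (cartan_p G \<theta>) J \<mu> \<tau>"
    and "holomorphic_discrete_series H L (cartan_p H \<theta>) J\<^sub>H \<nu> \<sigma>"
    and "symmetry_breaking_operator H
           \<mu> (hol_sections G K (cartan_p G \<theta>) J \<mu> \<tau>)
           \<nu> (hol_sections H L (cartan_p H \<theta>) J\<^sub>H \<nu> \<sigma>) S"
  shows "\<exists>k. represented_homogeneous H L (p_plus (cartan_p G \<theta>) J) \<tau> \<sigma>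
               (hol_sections G K (cartan_p G \<theta>) J \<mu> \<tau>) k S"
proof -
 note lie = assms(1) and K = assms(6) and HL = assms(15,16)
 have \<theta>inv: "group_involution G \<theta>"
  and pos: "!!X. X : lie_algebra G ==> X ~= 0 ==> - killing_form (lie_algebra G) X (hom_differential \<theta> X) > 0"
  using assms(5) unfolding cartan_involution_def lie_differential_eq by blast+
 have \<iota>: "involutive_group G \<iota>" by (rule group_involution_imp_involutive_group[OF lie assms(11)])
 have "hermitian_group G \<theta> J" proof (rule hermitian_group.intro[OF group_involution_imp_involutive_group[OF lie \<theta>inv]], rule hermitian_group_axioms.intro)
  show "compact (fixed_group G \<theta>)" using assms(7) by (simp add: maximal_compact_subgroup_def K)
  show "invariant_complex_structure (fixed_group G \<theta>) (cartan_p G \<theta>) J" using assms(8) by (simp only: K)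
 qed (fact assms(2-4) assms(9) pos)+
 then interpret hermitian_group G \<theta> J .
 note Hc = identity_component_group[OF fixed_group_closed[OF \<iota>], folded HL(1)]
 have HG: "H <= G" using Hc(1) fixed_group_closed(1)[OF \<iota>] by blast
 have Hsub: "matrix_subgroup H" unfolding matrix_subgroup_def using Hc(2-4) HG invertible_mem by blast
 have rotH: "rot t : H" for t
  by (rule rot_fixed[OF \<iota> _ assms(14) HL(1) assms(17,18)]) (use assms(12) in blast)
 show ?thesis
  using assms(21,22,23) unfolding K holomorphic_discrete_series_def
  by (intro symmetry_breaking_homogeneous[OF Hsub HG rotH HL(2)[unfolded K] assms(19,20)]) auto
qed

end
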